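(* Let $A\in\mathbb{R}^{m\times n}$ and $B\in\mathbb{R}^{d\times n}$ with $m\ge n$, $d\ge n$, both of full column rank. Let $k$ (the target rank) and $p$ (the oversampling parameter) be positive integers with $k<n$ and $k+p\le m$, and let $(\hat A,\hat B)$ be the rank-$k$ GCUR decomposition of $(A,B)$ computed by the randomized DEIM-based GCUR algorithm described in the context. Put $$\Theta_k=\left(1+6\sqrt{(k+p)p\log p}\right)\sigma_{k+1}(A)+3\sqrt{k+p}\sqrt{\sum_{j>k}\sigma_j^2(A)},\qquad \eta_k=\sqrt{\tfrac{nk}{3}}\,2^k+\sqrt{\tfrac{mk}{3}}\,2^k .$$ Let $(\gamma_i,\beta_i)_{i=1}^n$ be the generalized singular value pairs of $(A,B)$, ordered so that both $\gamma_i/\beta_i$ and $1/\beta_i$ are non-increasing in $i$. Then, with probability not less than $1-3p^{-p}$ (over the random matrix used by the algorithm), $$\|\hat A-A\|\le \eta_k\left[\Theta_k+\left(\|A\|+\|B\|\right)\left(\frac{\gamma_{k+1}}{\beta_{k+1}}+\frac{\Theta_k}{\beta_{k+1}}\left\|\begin{pmatrix}A\\ B\end{pmatrix}^{\dagger}\right\|\right)\right].$$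
   Context: Notation: $\|\cdot\|$ is the matrix/vector 2-norm, $X^\dagger$ the Moore–Penrose pseudoinverse, $\sigma_j(X)$ the $j$th largest singular value of $X$, and $\log$ the natural logarithm. MATLAB indexing: $X(\mathbf q,:)$ and $X(:,\mathbf p)$ are the submatrices of rows indexed by $\mathbf q$ and of columns indexed by $\mathbf p$. GSVD (Van Loan form): for $A\in\mathbb{R}^{m\times n}$, $B\in\mathbb{R}^{d\times n}$ with $m,d\ge n$ there are orthogonal $U_0\in\mathbb{R}^{m\times m}$, $V_0\in\mathbb{R}^{d\times d}$ and a nonsingular $Y_0\in\mathbb{R}^{n\times n}$ with $A=U_0\Gamma_0Y_0^{\mathrm T}$, $B=V_0\Sigma_0Y_0^{\mathrm T}$, where $\Gamma_0=\operatorname{diag}(\gamma_1,\dots,\gamma_n)$, $\Sigma_0=\operatorname{diag}(\beta_1,\dots,\beta_n)$ (rectangular diagonal), $\gamma_i,\beta_i\in[0,1]$, $\gamma_i^2+\beta_i^2=1$, and the ratios $\gamma_i/\beta_i$ are non-increasing. The pairs $(\gamma_i,\beta_i)$ are the generalized singular values of $(A,B)$. DEIM index selection: given a matrix $X$ with $k$ linearly independent columns $x_1,\dots,x_k$, choose $p_1$ as an index of a largest-magnitude entry of $x_1$ and set $\mathbf p=[p_1]$; for $j=2,\dots,k$ form the residual $r=x_j-X(:,1{:}j-1)\,X(\mathbf p,1{:}j-1)^{-1}x_j(\mathbf p)$, choose $p_j$ as an index of a largest-magnitude entry of $r$, and append $p_j$ to $\mathbf p$. The output is $\mathbf p$ (with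 $k$ distinct entries). Randomized DEIM-based GCUR algorithm (inputs $A,B,k,p$): 1. Generate an $n\times(k+p)$ Gaussian random matrix $\Omega$ (i.i.d. standard normal entries). 2. Form $K=A\Omega$ and compute a QR factorization $K=QR$ with $Q\in\mathbb{R}^{m\times(k+p)}$ having orthonormal columns. 3. Compute a GSVD of the pair $(Q^{\mathrm T}A,B)$: $Q^{\mathrm T}A=W\Gamma Y^{\mathrm T}$, $B=V\Sigma Y^{\mathrm T}$, with $W\in\mathbb{R}^{(k+p)\times(k+p)}$ and $V\in\mathbb{R}^{d\times d}$ orthogonal, $Y\in\mathbb{R}^{n\times n}$ nonsingular, $\Gamma,\Sigma$ rectangular diagonal with nonnegative diagonal entries $\tilde\gamma_i,\tilde\beta_i$ ($i=1,\dots,n$, with $\tilde\gamma_i=0$ for $i>k+p$), $\tilde\gamma_i^2+\tilde\beta_i^2=1$ and $\tilde\gamma_i/\tilde\beta_i$ non-increasing. 4. Set $U=QW\in\mathbb{R}^{m\times(k+p)}$. 5. Apply DEIM to the first $k$ columns of $Y$, $U$, $V$ respectively to obtain index vectors $\mathbf p$, $\mathbf s_A$, $\mathbf s_B$ of length $k$. 6. Set $C_A=A(:,\mathbf p)$, $R_A=A(\mathbf s_A,:)$, $C_B=B(:,\mathbf p)$, $R_B=B(\mathbf s_B,:)$, $M_A=C_A^\dagger AR_A^\dagger$, $M_B=C_B^\dagger BR_B^\dagger$, and output $\hat A=C_AM_AR_A$, $\hat B=C_BM_BR_B$. *)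

theory Defs
  imports
    "HOL-Probability.Probability"
    "Jordan_Normal_Form.Char_Poly"
    "Jordan_Normal_Form.DL_Rank"
    "Jordan_Normal_Form.Gauss_Jordan_Elimination"
begin

(* HOL-Analysis has its own vec, mat, row and $; below these always mean the ones of
   Jordan_Normal_Form, whose dimensions are values, so that k + p can be a dimension. *)
unbundle no vec_syntax
hide_const (open) Finite_Cartesian_Product.vec Finite_Cartesian_Product.mat
  Finite_Cartesian_Product.row Finite_Cartesian_Product.transpose Finite_Cartesian_Product.rows
hide_type (open) Finite_Cartesian_Product.vec

text \<open>Matrix entries, vector entries and list positions count from 0; singular values
  and generalized singular values count from 1.\<close>

definition vec_norm2 :: "real vec \<Rightarrow> real" where
  "vec_norm2 v = sqrt (scalar_prod v v)"

definition mat_norm2 :: "real mat \<Rightarrow> real" where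
  "mat_norm2 A = (SUP v \<in> {v \<in> carrier_vec (dim_col A). vec_norm2 v \<le> 1}. vec_norm2 (A *\<^sub>v v))"

text \<open>The list consists of the square roots of the eigenvalues of \<open>A\<^sup>T A\<close>, repeated according
  to multiplicity. It has \<open>dim_col A\<close> entries, so for a wide matrix the usual
  \<open>dim_row A\<close> singular values are followed by zeros.\<close>

definition sing_vals :: "real mat \<Rightarrow> real list" where
  "sing_vals A =
     rev (sorted_list_of_multiset (image_mset sqrt (proots (char_poly (transpose_mat A * A)))))"

definition sing_val :: "real mat \<Rightarrow> nat \<Rightarrow> real" where
  "sing_val A j = sing_vals A ! (j - 1)"

definition is_pinv :: "real mat \<Rightarrow> real mat \<Rightarrow> bool" where
  "is_pinv A X \<longleftrightarrow> X \<in> carrier_mat (dim_col A) (dim_row A) \<and>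
     A * X * A = A \<and> X * A * X = X \<and>
     transpose_mat (A * X) = A * X \<and> transpose_mat (X * A) = X * A"

definition pinv :: "real mat \<Rightarrow> real mat" where
  "pinv A = (THE X. is_pinv A X)"

definition orthonormal_cols :: "real mat \<Rightarrow> bool" where
  "orthonormal_cols Q \<longleftrightarrow> transpose_mat Q * Q = 1\<^sub>m (dim_col Q)"

text \<open>This is \<open>orthogonal_matrix\<close> of HOL-Analysis for matrices with explicit dimensions;
  \<open>orthogonal_mat\<close> of Jordan_Normal_Form only asks for pairwise orthogonal nonzero columns.\<close>

definition real_orthogonal :: "nat \<Rightarrow> real mat \<Rightarrow> bool" where
  "real_orthogonal n U \<longleftrightarrow> U \<in> carrier_mat n n \<and> orthonormal_cols U"

definition full_column_rank :: "real mat \<Rightarrow> bool" where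
  "full_column_rank A \<longleftrightarrow> vec_space.rank (dim_row A) A = dim_col A"

definition select_rows :: "real mat \<Rightarrow> nat list \<Rightarrow> real mat" where
  "select_rows A q = mat_of_rows (dim_col A) (map (row A) q)"

definition select_cols :: "real mat \<Rightarrow> nat list \<Rightarrow> real mat" where
  "select_cols A q = mat_of_cols (dim_row A) (map (col A) q)"

definition first_cols :: "nat \<Rightarrow> real mat \<Rightarrow> real mat" where
  "first_cols k A = mat_of_cols (dim_row A) (take k (cols A))"

definition rect_diag :: "nat \<Rightarrow> nat \<Rightarrow> (nat \<Rightarrow> real) \<Rightarrow> real mat" where
  "rect_diag r c f = mat r c (\<lambda>(i, j). if i = j then f (i + 1) else 0)"

text \<open>\<open>A\<close> may have fewer rows than columns; then \<open>\<gamma> i\<close> is 0 for every \<open>i\<close> that has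
  no diagonal position. The ratios are meaningful because the predicate is only used with a
  second matrix of full column rank, for which every \<open>\<beta> i\<close> with \<open>1 \<le> i \<le> n\<close> is positive.\<close>

definition is_gsvd ::
  "real mat \<Rightarrow> real mat \<Rightarrow> real mat \<Rightarrow> real mat \<Rightarrow> real mat \<Rightarrow>
   (nat \<Rightarrow> real) \<Rightarrow> (nat \<Rightarrow> real) \<Rightarrow> bool" where
  "is_gsvd A B U V Y \<gamma> \<beta> \<longleftrightarrow> (let n = dim_col A in
     dim_col B = n \<and>
     real_orthogonal (dim_row A) U \<and> real_orthogonal (dim_row B) V \<and>
     Y \<in> carrier_mat n n \<and> invertible_mat Y \<and>
     A = U * rect_diag (dim_row A) n \<gamma> * transpose_mat Y \<and>
     B = V * rect_diag (dim_row B) n \<beta> * transpose_mat Y \<and>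
     (\<forall>i\<in>{1..n}. 0 \<le> \<gamma> i \<and> 0 \<le> \<beta> i \<and> (\<gamma> i)\<^sup>2 + (\<beta> i)\<^sup>2 = 1) \<and>
     (\<forall>i\<in>{1..n}. dim_row A < i \<longrightarrow> \<gamma> i = 0) \<and>
     (\<forall>i\<in>{1..n}. \<forall>j\<in>{1..n}. i \<le> j \<longrightarrow> \<gamma> j / \<beta> j \<le> \<gamma> i / \<beta> i))"

definition gen_sing_vals :: "real mat \<Rightarrow> real mat \<Rightarrow> (nat \<Rightarrow> real) \<Rightarrow> (nat \<Rightarrow> real) \<Rightarrow> bool" where
  "gen_sing_vals A B \<gamma> \<beta> \<longleftrightarrow> (\<exists>U V Y. is_gsvd A B U V Y \<gamma> \<beta>)"

text \<open>Only the first \<open>j\<close> entries of the index list enter the residual of column \<open>j\<close>.\<close>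

definition deim_residual :: "real mat \<Rightarrow> nat list \<Rightarrow> nat \<Rightarrow> real vec" where
  "deim_residual X q j =
     (if j = 0 then col X 0
      else (let q' = take j q; X' = first_cols j X in
        col X j - X' *\<^sub>v (the (mat_inverse (select_rows X' q')) *\<^sub>v vec j (\<lambda>i. col X j $ (q' ! i)))))"

text \<open>A relation rather than a function, because a largest-magnitude entry need not be unique.\<close>

definition is_deim :: "real mat \<Rightarrow> nat list \<Rightarrow> bool" where
  "is_deim X q \<longleftrightarrow> length q = dim_col X \<and>
     (\<forall>j < dim_col X. q ! j < dim_row X \<and>
        (\<forall>i < dim_row X. \<bar>deim_residual X q j $ i\<bar> \<le> \<bar>deim_residual X q j $ (q ! j)\<bar>))"

definition gaussian_matrix :: "'w measure \<Rightarrow> nat \<Rightarrow> nat \<Rightarrow> ('w \<Rightarrow> real mat) \<Rightarrow> bool" where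
  "gaussian_matrix M n l \<Omega> \<longleftrightarrow>
     (\<forall>\<omega>\<in>space M. \<Omega> \<omega> \<in> carrier_mat n l) \<and>
     (\<forall>i<n. \<forall>j<l. distributed M lborel (\<lambda>\<omega>. \<Omega> \<omega> $$ (i, j)) std_normal_density) \<and>
     prob_space.indep_vars M (\<lambda>_. borel) (\<lambda>ij \<omega>. \<Omega> \<omega> $$ ij) ({..<n} \<times> {..<l})"

definition cur_approx :: "real mat \<Rightarrow> nat list \<Rightarrow> nat list \<Rightarrow> real mat" where
  "cur_approx A q s = (let C = select_cols A q; R = select_rows A s in
     C * (pinv C * A * pinv R) * R)"

text \<open>\<open>rand_gcur A B k p \<Omega> Ahat Bhat\<close>: started with the test matrix \<open>\<Omega>\<close>, the algorithm can
  return \<open>(Ahat, Bhat)\<close>. The QR factorization, the GSVD and the DEIM indices are not unique;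
  every admissible choice is an admissible run.\<close>

definition rand_gcur ::
  "real mat \<Rightarrow> real mat \<Rightarrow> nat \<Rightarrow> nat \<Rightarrow> real mat \<Rightarrow> real mat \<Rightarrow> real mat \<Rightarrow> bool" where
  "rand_gcur A B k p \<Omega> Ahat Bhat \<longleftrightarrow>
     (\<exists>Q T W V Y \<gamma> \<beta> q s\<^sub>A s\<^sub>B.
        Q \<in> carrier_mat (dim_row A) (k + p) \<and> orthonormal_cols Q \<and>
        T \<in> carrier_mat (k + p) (k + p) \<and> upper_triangular T \<and> A * \<Omega> = Q * T \<and>
        is_gsvd (transpose_mat Q * A) B W V Y \<gamma> \<beta> \<and>
        is_deim (first_cols k Y) q \<and>
        is_deim (first_cols k (Q * W)) s\<^sub>A \<and>
        is_deim (first_cols k V) s\<^sub>B \<and>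
        Ahat = cur_approx A q s\<^sub>A \<and> Bhat = cur_approx B q s\<^sub>B)"

definition \<Theta> :: "real mat \<Rightarrow> nat \<Rightarrow> nat \<Rightarrow> real" where
  "\<Theta> A k p =
     (1 + 6 * sqrt (real (k + p) * real p * ln (real p))) * sing_val A (k + 1) +
     3 * sqrt (real (k + p)) * sqrt (\<Sum>j\<in>{k+1..dim_col A}. (sing_val A j)\<^sup>2)"

definition \<eta> :: "nat \<Rightarrow> nat \<Rightarrow> nat \<Rightarrow> real" where
  "\<eta> m n k = sqrt (real n * real k / 3) * 2 ^ k + sqrt (real m * real k / 3) * 2 ^ k"

end

theory Submission
  imports Defs "Jordan_Normal_Form.Spectral_Radius"
begin

text \<open>Fix a run and write \<open>A' = Q\<^sup>T A\<close>. For a vector \<open>v\<close> put \<open>p = R\<^sub>A\<^sup>\<dagger> R\<^sub>A v\<close> and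
\<open>z = v - p\<close>, and let \<open>w\<close> be the residual of \<open>A p\<close> after projection on the column space of
\<open>C\<^sub>A\<close>. The error of the approximation at \<open>v\<close> is \<open>- (A z + w)\<close>. The vector \<open>A z\<close> vanishes at the
row indices, and \<open>A\<^sup>T w\<close> vanishes at the column indices.

The DEIM indices of a matrix \<open>X\<close> with \<open>k\<close> independent columns have the following property
(\<open>deim_error_bound\<close>): if \<open>X c + w'\<close> vanishes at them, its length is at most
\<open>sqrt (N k / 3) * 2 ^ k\<close> times that of \<open>w'\<close>, where \<open>N\<close> is the number of rows. Each new index is
a position at which the residual of the next column is largest, so every step at most doubles the error
made so far. The GSVD of \<open>(A', B)\<close> writes \<open>A z\<close> as a combination of the first \<open>k\<close> columns of \<open>Q W\<close>
plus a remainder, and \<open>A\<^sup>T w\<close> as a combination of the first \<open>k\<close> columns of \<open>Y\<close> plus a remainder.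
Both remainders consist of the tail of the GSVD and of a contribution of \<open>A - Q Q\<^sup>T A\<close>.
The tail is controlled by two observations. Since \<open>Y Y\<^sup>T = A'\<^sup>T A' + B\<^sup>T B\<close>, the norm of \<open>Y\<close> is at most
\<open>\<parallel>A\<parallel> + \<parallel>B\<parallel>\<close>. And the generalized singular values are min-max values of
\<open>|A x| / |B x|\<close>, so replacing \<open>A\<close> by \<open>A'\<close> can only decrease them; a count of dimensions suffices for
this (\<open>gsvd_ratio_mono\<close>). Hence \<open>\<parallel>A - Q Q\<^sup>T A\<parallel> \<le> \<Theta>\<close> implies the error bound
\<open>\<eta> * (\<Theta> + (\<parallel>A\<parallel> + \<parallel>B\<parallel>) * (\<gamma> / \<beta>))\<close> with the ratio of index \<open>k + 1\<close>
(\<open>gcur_error_bound\<close>), and this is at most the claimed bound.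

It remains to show that the range finder achieves \<open>\<Theta>\<close> with the claimed probability. Rotate the test
matrix into the basis of right singular vectors of \<open>A\<close>; the result \<open>G\<close> is again Gaussian. If \<open>F\<close> is a
right inverse of the first \<open>k\<close> rows of \<open>G\<close>, then a vector in the range of the test matrix can be
subtracted from \<open>x\<close> so that the first \<open>k\<close> coordinates cancel, and
\<open>\<parallel>A - Q Q\<^sup>T A\<parallel> \<le> \<sigma>\<^sub>k\<^sub>+\<^sub>1 + \<parallel>S H F\<parallel>\<close>, where \<open>H\<close> consists of the other rows of \<open>G\<close> and
\<open>S\<close> is the diagonal matrix of the remaining singular values (\<open>range_finder_bound\<close>).
The norm of \<open>S H F\<close> is bounded (\<open>gaussian_sketch\<close>) on the intersection of three events, each of which fails with probability
at most \<open>p powr - p\<close>. Two of them bound the Frobenius norm and the operator norm of \<open>F\<close>; they come from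
the \<open>p\<close>-th negative moment of the length of a Gaussian vector in dimension \<open>p + 1\<close> and Markov's
inequality. The third one bounds the bilinear form \<open>\<langle>S g, H F h\<rangle>\<close> simultaneously in all directions: an exponential
average of this form over independent Gaussian \<open>g\<close> and \<open>h\<close> has mean one, so it is at most \<open>p ^ p\<close> with
probability at least \<open>1 - p powr - p\<close>, and by the Gibbs variational inequality it dominates the exponential of the form
at every fixed pair of directions, up to explicit error terms. Optimizing
the free scales gives exactly the constants of \<open>\<Theta>\<close>. For \<open>p = 1\<close> the claimed probability is negative.\<close>


section \<open>Gaussian product measures and orthogonal maps\<close>

abbreviation std_normal :: "real measure" where
  "std_normal \<equiv> density lborel (\<lambda>x. ennreal (std_normal_density x))"

definition gauss :: "'i set \<Rightarrow> ('i \<Rightarrow> real) measure" where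
  "gauss I = (\<Pi>\<^sub>M i\<in>I. std_normal)"

interpretation std_normal: prob_space std_normal
  by (rule prob_space_normal_density) simp

interpretation std_normals: product_sigma_finite "\<lambda>_. std_normal"
  by standard

lemma sets_gauss [measurable_cong, simp]: "sets (gauss I) = sets (Pi\<^sub>M I (\<lambda>_. borel))"
  unfolding gauss_def by (intro sets_PiM_cong) simp_all

lemma space_gauss: "space (gauss I) = PiE I (\<lambda>_. UNIV)"
  by (simp add: gauss_def space_PiM)

lemma prob_space_gauss: "prob_space (gauss I)"
  unfolding gauss_def by (rule prob_space_PiM) (rule std_normal.prob_space_axioms)

lemma emeasure_gauss_space: "emeasure (gauss I) (space (gauss I)) = 1"
  by (rule prob_space.emeasure_space_1[OF prob_space_gauss])

lemma nn_integral_std_normal: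
  "f \<in> borel_measurable borel \<Longrightarrow>
   (\<integral>\<^sup>+x. f x \<partial>std_normal) = (\<integral>\<^sup>+x. ennreal (std_normal_density x) * f x \<partial>lborel)"
  by (subst nn_integral_density) simp_all

lemma nn_integral_gauss_insert:
  assumes "finite I" "i \<notin> I" "f \<in> borel_measurable (Pi\<^sub>M (insert i I) (\<lambda>_. borel))"
  shows "(\<integral>\<^sup>+g. f g \<partial>gauss (insert i I)) = (\<integral>\<^sup>+g. (\<integral>\<^sup>+x. f (g(i := x)) \<partial>std_normal) \<partial>gauss I)"
  using assms sets_gauss[of "insert i I"] unfolding gauss_def
  by (intro std_normals.product_nn_integral_insert) (auto simp: gauss_def cong: measurable_cong_sets)

text \<open>The joint density depends on \<open>x\<^sup>2 + y\<^sup>2\<close> only. For \<open>c \<noteq> 0\<close> the rotation is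
composed of affine substitutions in one variable at a time; for \<open>c = 0\<close> it is an exchange of the two variables up to sign.\<close>

lemma rotation_std_normal:
  fixes c s :: real and f :: "real \<Rightarrow> real \<Rightarrow> ennreal"
  assumes cs: "c\<^sup>2 + s\<^sup>2 = 1" and [measurable]: "case_prod f \<in> borel_measurable (borel \<Otimes>\<^sub>M borel)"
  shows "(\<integral>\<^sup>+x. \<integral>\<^sup>+y. f (c * x + s * y) (c * y - s * x) \<partial>std_normal \<partial>std_normal)
       = (\<integral>\<^sup>+x. \<integral>\<^sup>+y. f x y \<partial>std_normal \<partial>std_normal)"
proof -
  define \<psi> where "\<psi> x y = ennreal (std_normal_density x * std_normal_density y)" for x y
  have psi_meas[measurable]: "case_prod \<psi> \<in> borel_measurable (borel \<Otimes>\<^sub>M borel)"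
    unfolding \<psi>_def by measurable
  have psi_eq: "\<psi> x y = \<psi> x' y'" if "x\<^sup>2 + y\<^sup>2 = x'\<^sup>2 + y'\<^sup>2" for x y x' y'
  proof -
    have "std_normal_density x * std_normal_density y = std_normal_density x' * std_normal_density y'"
      unfolding std_normal_density_def
      using that by (simp add: exp_add[symmetric] divide_simps)
    then show ?thesis by (simp add: \<psi>_def)
  qed
  have eq: "(\<integral>\<^sup>+x. \<integral>\<^sup>+y. h x y \<partial>std_normal \<partial>std_normal) = (\<integral>\<^sup>+x. \<integral>\<^sup>+y. \<psi> x y * h x y \<partial>lborel \<partial>lborel)"
    if [measurable]: "case_prod h \<in> borel_measurable (borel \<Otimes>\<^sub>M borel)" for h :: "real \<Rightarrow> real \<Rightarrow> ennreal"
    by (simp add: nn_integral_std_normal nn_integral_cmult[symmetric] \<psi>_def ennreal_mult' mult.assoc)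
  have swap: "(\<integral>\<^sup>+x. \<integral>\<^sup>+y. h x y \<partial>lborel \<partial>lborel) = (\<integral>\<^sup>+y. \<integral>\<^sup>+x. h x y \<partial>lborel \<partial>lborel)"
    if [measurable]: "case_prod h \<in> borel_measurable (borel \<Otimes>\<^sub>M borel)" for h :: "real \<Rightarrow> real \<Rightarrow> ennreal"
    by (rule lborel_pair.Fubini') simp
  define F where "F u v = \<psi> u v * f u v" for u v
  have F[measurable]: "case_prod F \<in> borel_measurable (borel \<Otimes>\<^sub>M borel)"
    unfolding F_def by measurable
  have "(\<integral>\<^sup>+x. \<integral>\<^sup>+y. f (c * x + s * y) (c * y - s * x) \<partial>std_normal \<partial>std_normal)
      = (\<integral>\<^sup>+x. \<integral>\<^sup>+y. F (c * x + s * y) (c * y - s * x) \<partial>lborel \<partial>lborel)"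
  proof (subst eq)
    have "\<psi> x y = \<psi> (c * x + s * y) (c * y - s * x)" for x y
    proof (rule psi_eq)
      have "(c * x + s * y)\<^sup>2 + (c * y - s * x)\<^sup>2 = (c\<^sup>2 + s\<^sup>2) * (x\<^sup>2 + y\<^sup>2)"
        by (simp add: power2_eq_square algebra_simps)
      then show "x\<^sup>2 + y\<^sup>2 = (c * x + s * y)\<^sup>2 + (c * y - s * x)\<^sup>2" using cs by simp
    qed
    then show "(\<integral>\<^sup>+x. \<integral>\<^sup>+y. \<psi> x y * f (c * x + s * y) (c * y - s * x) \<partial>lborel \<partial>lborel) =
          (\<integral>\<^sup>+x. \<integral>\<^sup>+y. F (c * x + s * y) (c * y - s * x) \<partial>lborel \<partial>lborel)"
      by (simp add: F_def)
  qed measurable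
  also have "\<dots> = (\<integral>\<^sup>+u. \<integral>\<^sup>+v. F u v \<partial>lborel \<partial>lborel)"
  proof (cases "c = 0")
    case True
    then have s: "s = 1 \<or> s = -1" using cs by (simp add: power2_eq_1_iff)
    then have [simp]: "s \<noteq> 0" "\<bar>s\<bar> = 1" by auto
    have "(\<integral>\<^sup>+x. \<integral>\<^sup>+y. F (c * x + s * y) (c * y - s * x) \<partial>lborel \<partial>lborel)
        = (\<integral>\<^sup>+x. \<integral>\<^sup>+y. F (s * y) (- s * x) \<partial>lborel \<partial>lborel)" using True by simp
    also have "\<dots> = (\<integral>\<^sup>+x. \<integral>\<^sup>+y. F y (- s * x) \<partial>lborel \<partial>lborel)"
    proof (rule nn_integral_cong)
      fix x :: real
      show "(\<integral>\<^sup>+y. F (s * y) (- s * x) \<partial>lborel) = (\<integral>\<^sup>+y. F y (- s * x) \<partial>lborel)"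
        by (subst nn_integral_real_affine[of "\<lambda>y. F y (- s * x)" s 0]) simp_all
    qed
    also have "\<dots> = (\<integral>\<^sup>+y. \<integral>\<^sup>+x. F y (- s * x) \<partial>lborel \<partial>lborel)" by (rule swap) measurable
    also have "\<dots> = (\<integral>\<^sup>+y. \<integral>\<^sup>+x. F y x \<partial>lborel \<partial>lborel)"
    proof (rule nn_integral_cong)
      fix y :: real
      show "(\<integral>\<^sup>+x. F y (- s * x) \<partial>lborel) = (\<integral>\<^sup>+x. F y x \<partial>lborel)"
        by (subst nn_integral_real_affine[of "\<lambda>x. F y x" "-s" 0]) simp_all
    qed
    finally show ?thesis .
  next
    case False
    have "(\<integral>\<^sup>+u. \<integral>\<^sup>+v. F u v \<partial>lborel \<partial>lborel)
        = (\<integral>\<^sup>+u. \<bar>1/c\<bar> * (\<integral>\<^sup>+y. F u ((- s * u) / c + 1/c * y) \<partial>lborel) \<partial>lborel)"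
    proof (rule nn_integral_cong)
      fix u :: real
      show "(\<integral>\<^sup>+v. F u v \<partial>lborel) = \<bar>1/c\<bar> * (\<integral>\<^sup>+y. F u ((- s * u) / c + 1/c * y) \<partial>lborel)"
        using False by (subst nn_integral_real_affine[of "\<lambda>v. F u v" "1/c" "(- s * u) / c"]) simp_all
    qed
    also have "\<dots> = \<bar>1/c\<bar> * (\<integral>\<^sup>+y. \<integral>\<^sup>+u. F u ((- s * u) / c + 1/c * y) \<partial>lborel \<partial>lborel)"
      by (subst nn_integral_cmult, measurable, subst swap) simp_all
    also have "(\<integral>\<^sup>+y. \<integral>\<^sup>+u. F u ((- s * u) / c + 1/c * y) \<partial>lborel \<partial>lborel)
        = (\<integral>\<^sup>+y. \<bar>c\<bar> * (\<integral>\<^sup>+x. F (s * y + c * x) (c * y - s * x) \<partial>lborel) \<partial>lborel)"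
    proof (rule nn_integral_cong)
      fix y :: real
      have e: "(- s * (s * y + c * x)) / c + 1/c * y = c * y - s * x" for x
      proof -
        have "(- s * (s * y + c * x)) + y = (1 - s\<^sup>2) * y - s * c * x"
          by (simp add: power2_eq_square algebra_simps)
        also have "1 - s\<^sup>2 = c * c" using cs by (simp add: power2_eq_square)
        finally show ?thesis using False by (simp add: field_simps)
      qed
      show "(\<integral>\<^sup>+u. F u ((- s * u) / c + 1/c * y) \<partial>lborel)
         = \<bar>c\<bar> * (\<integral>\<^sup>+x. F (s * y + c * x) (c * y - s * x) \<partial>lborel)"
        using False by (subst nn_integral_real_affine[of _ c "s * y"]) (simp_all only: e, measurable)
    qed
    also have "\<dots> = \<bar>c\<bar> * (\<integral>\<^sup>+x. \<integral>\<^sup>+y. F (s * y + c * x) (c * y - s * x) \<partial>lborel \<partial>lborel)"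
      by (subst nn_integral_cmult, measurable, subst swap) simp_all
    finally show ?thesis using False
      by (simp add: mult.assoc[symmetric] ennreal_mult[symmetric] abs_mult[symmetric] add.commute)
  qed
  also have "\<dots> = (\<integral>\<^sup>+x. \<integral>\<^sup>+y. f x y \<partial>std_normal \<partial>std_normal)"
    by (subst eq) (simp_all add: F_def[abs_def])
  finally show ?thesis .
qed


lemma nn_integral_gauss_rotate:
  fixes f :: "('i \<Rightarrow> real) \<Rightarrow> ennreal"
  assumes I: "finite I" "a \<in> I" "b \<in> I" "a \<noteq> b" and cs: "c\<^sup>2 + s\<^sup>2 = 1"
    and f: "f \<in> borel_measurable (Pi\<^sub>M I (\<lambda>_. borel))"
  shows "(\<integral>\<^sup>+g. f (g(a := c * g a + s * g b, b := c * g b - s * g a)) \<partial>gauss I) = (\<integral>\<^sup>+g. f g \<partial>gauss I)"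
proof -
  define J where "J = I - {a, b}"
  have I_eq: "I = insert a (insert b J)" and J: "finite J" "a \<notin> insert b J" "b \<notin> J"
    using I by (auto simp: J_def)
  note f' [measurable] = f[unfolded I_eq]
  have "(\<integral>\<^sup>+g. h g \<partial>gauss I) = (\<integral>\<^sup>+g. \<integral>\<^sup>+y. \<integral>\<^sup>+x. h (g(b := y, a := x)) \<partial>std_normal \<partial>std_normal \<partial>gauss J)"
    if [measurable]: "h \<in> borel_measurable (Pi\<^sub>M (insert a (insert b J)) (\<lambda>_. borel))" for h :: "('i \<Rightarrow> real) \<Rightarrow> ennreal"
    unfolding I_eq using J by (simp add: nn_integral_gauss_insert)
  note eq = this
  have [measurable]: "(\<lambda>g. g(a := c * g a + s * g b, b := c * g b - s * g a))
      \<in> measurable (Pi\<^sub>M (insert a (insert b J)) (\<lambda>_. borel)) (Pi\<^sub>M (insert a (insert b J)) (\<lambda>_. borel :: real measure))"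
    by (rule measurable_fun_upd[where J="insert a (insert b J)"], blast,
        rule measurable_fun_upd[where J="insert a (insert b J)"], blast) simp_all
  have 1: "(\<integral>\<^sup>+g. f (g(a := c * g a + s * g b, b := c * g b - s * g a)) \<partial>gauss I)
    = (\<integral>\<^sup>+g. \<integral>\<^sup>+y. \<integral>\<^sup>+x. f (g(b := c * y - s * x, a := c * x + s * y)) \<partial>std_normal \<partial>std_normal \<partial>gauss J)"
    using I(4) by (subst eq) (simp_all add: fun_upd_twist)
  also have "\<dots> = (\<integral>\<^sup>+g. \<integral>\<^sup>+y. \<integral>\<^sup>+x. f (g(b := y, a := x)) \<partial>std_normal \<partial>std_normal \<partial>gauss J)"
  proof (rule nn_integral_cong)
    fix g assume g: "g \<in> space (gauss J)"
    then have [measurable]: "(\<lambda>z. g(b := fst z, a := snd z)) \<in> measurable (borel \<Otimes>\<^sub>M borel) (Pi\<^sub>M (insert a (insert b J)) (\<lambda>_. borel))"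
      by (intro measurable_fun_upd[where J="insert b J"] measurable_fun_upd[where J=J] measurable_const)
        (auto simp: space_gauss space_PiM)
    have m: "(\<lambda>(y, x). f (g(b := y, a := x))) \<in> borel_measurable (borel \<Otimes>\<^sub>M borel)"
      unfolding split_beta' by measurable
    have "(\<integral>\<^sup>+y. \<integral>\<^sup>+x. f (g(b := c * y + (- s) * x, a := c * x - (- s) * y)) \<partial>std_normal \<partial>std_normal)
        = (\<integral>\<^sup>+y. \<integral>\<^sup>+x. f (g(b := y, a := x)) \<partial>std_normal \<partial>std_normal)"
      by (rule rotation_std_normal[OF _ m]) (use cs in simp)
    then show "(\<integral>\<^sup>+y. \<integral>\<^sup>+x. f (g(b := c * y - s * x, a := c * x + s * y)) \<partial>std_normal \<partial>std_normal)
       = (\<integral>\<^sup>+y. \<integral>\<^sup>+x. f (g(b := y, a := x)) \<partial>std_normal \<partial>std_normal)" by simp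
  qed
  also have "\<dots> = (\<integral>\<^sup>+g. f g \<partial>gauss I)" by (rule eq[symmetric]) (rule f')
  finally show ?thesis .
qed

lemma nn_integral_std_normal_uminus:
  assumes [measurable]: "f \<in> borel_measurable borel"
  shows "(\<integral>\<^sup>+x. f (- x) \<partial>std_normal) = (\<integral>\<^sup>+x. f x \<partial>std_normal)"
  by (simp add: nn_integral_std_normal)
     (subst (2) nn_integral_real_affine[of _ "-1" 0], simp_all add: std_normal_density_def)

lemma nn_integral_gauss_reflect:
  fixes f :: "('i \<Rightarrow> real) \<Rightarrow> ennreal"
  assumes I: "finite I" "a \<in> I" and f: "f \<in> borel_measurable (Pi\<^sub>M I (\<lambda>_. borel))"
  shows "(\<integral>\<^sup>+g. f (g(a := - g a)) \<partial>gauss I) = (\<integral>\<^sup>+g. f g \<partial>gauss I)"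
proof -
  define J where "J = I - {a}"
  have I_eq: "I = insert a J" and J: "finite J" "a \<notin> J" using I by (auto simp: J_def)
  note f' [measurable] = f[unfolded I_eq]
  have [measurable]: "(\<lambda>g. g(a := - g a)) \<in> measurable (Pi\<^sub>M (insert a J) (\<lambda>_. borel)) (Pi\<^sub>M (insert a J) (\<lambda>_. borel :: real measure))"
    by (rule measurable_fun_upd[where J="insert a J"]) auto
  have m: "(\<lambda>x. g(a := x)) \<in> measurable borel (Pi\<^sub>M (insert a J) (\<lambda>_. borel))" if "g \<in> space (gauss J)" for g
    using that by (intro measurable_fun_upd[where J=J] measurable_const) (auto simp: space_gauss space_PiM)
  show ?thesis
    unfolding I_eq using J
    by (simp add: nn_integral_gauss_insert)
      (intro nn_integral_cong nn_integral_std_normal_uminus measurable_compose[OF m f'])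
qed

definition orthonormal_on :: "'i set \<Rightarrow> ('i \<Rightarrow> 'i \<Rightarrow> real) \<Rightarrow> bool" where
  "orthonormal_on I U \<longleftrightarrow> (\<forall>i\<in>I. \<forall>j\<in>I. (\<Sum>x\<in>I. U i x * U j x) = (if i = j then 1 else 0))"

text \<open>The Givens rotation in the coordinates \<open>a\<close> and \<open>b\<close>.\<close>

definition plane_rot :: "'i \<Rightarrow> 'i \<Rightarrow> real \<Rightarrow> real \<Rightarrow> ('i \<Rightarrow> real) \<Rightarrow> 'i \<Rightarrow> real" where
  "plane_rot a b c s v = v(a := c * v a + s * v b, b := c * v b - s * v a)"

lemma sum_plane_rot:
  assumes "finite I" "a \<in> I" "b \<in> I" "a \<noteq> b" "c\<^sup>2 + s\<^sup>2 = 1"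
  shows "(\<Sum>x\<in>I. plane_rot a b c s v x * plane_rot a b c s w x) = (\<Sum>x\<in>I. v x * w x)"
proof -
  define J where "J = I - {a, b}"
  have I_eq: "I = insert a (insert b J)" and J: "finite J" "a \<notin> insert b J" "b \<notin> J"
    using assms by (auto simp: J_def)
  have "(\<Sum>x\<in>J. plane_rot a b c s v x * plane_rot a b c s w x) = (\<Sum>x\<in>J. v x * w x)"
    using J by (intro sum.cong) (auto simp: plane_rot_def)
  moreover have "plane_rot a b c s v a * plane_rot a b c s w a + plane_rot a b c s v b * plane_rot a b c s w b
     = (c\<^sup>2 + s\<^sup>2) * (v a * w a + v b * w b)"
    using assms(4) by (simp add: plane_rot_def power2_eq_square algebra_simps)
  ultimately show ?thesis using J assms(5) by (simp add: I_eq)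
qed

text \<open>Every orthogonal matrix is reduced to the identity by Givens rotations and reflections of single coordinates, and
the measure is invariant under each of these. The outer induction is over the rows that are not yet unit
vectors, the inner one over the entries of one such row that still have to be cleared.\<close>

lemma gauss_orthogonal:
  fixes U :: "'i \<Rightarrow> 'i \<Rightarrow> real"
  assumes I: "finite I" and U: "orthonormal_on I U" and f: "f \<in> borel_measurable (Pi\<^sub>M I (\<lambda>_. borel))"
  shows "(\<integral>\<^sup>+g. f (\<lambda>i\<in>I. \<Sum>x\<in>I. U i x * g x) \<partial>gauss I) = (\<integral>\<^sup>+g. f g \<partial>gauss I)"
proof -
  define Q where "Q U \<longleftrightarrow> (\<integral>\<^sup>+g. f (\<lambda>i\<in>I. \<Sum>x\<in>I. U i x * g x) \<partial>gauss I) = (\<integral>\<^sup>+g. f g \<partial>gauss I)" for U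
  have meas: "(\<lambda>g. f (\<lambda>i\<in>I. \<Sum>x\<in>I. U i x * g x)) \<in> borel_measurable (Pi\<^sub>M I (\<lambda>_. borel))" for U :: "'i \<Rightarrow> 'i \<Rightarrow> real"
    by (rule measurable_compose[OF _ f]) measurable
  have rot: "Q U" if "Q (\<lambda>i. plane_rot a b c s (U i))" and "a \<in> I" "b \<in> I" "a \<noteq> b" "c\<^sup>2 + s\<^sup>2 = 1" for U a b c s
  proof -
    have "(\<integral>\<^sup>+g. f (\<lambda>i\<in>I. \<Sum>x\<in>I. plane_rot a b c s (U i) x * g x) \<partial>gauss I)
        = (\<integral>\<^sup>+g. f (\<lambda>i\<in>I. \<Sum>x\<in>I. plane_rot a b c s (U i) x * plane_rot a b c s g x) \<partial>gauss I)"
      unfolding plane_rot_def[of a b c s g for g] using nn_integral_gauss_rotate[OF I that(2-5) meas] by metis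
    then show ?thesis using that(1) sum_plane_rot[OF I that(2-5)] by (simp add: Q_def)
  qed
  have reflect: "Q U" if "Q (\<lambda>i. (U i)(a := - U i a))" and "a \<in> I" for U a
  proof -
    have *: "(\<Sum>x\<in>I. ((U i)(a := - U i a)) x * (g(a := - g a)) x) = (\<Sum>x\<in>I. U i x * g x)" for i g
      by (intro sum.cong) auto
    have "(\<integral>\<^sup>+g. f (\<lambda>i\<in>I. \<Sum>x\<in>I. ((U i)(a := - U i a)) x * g x) \<partial>gauss I)
        = (\<integral>\<^sup>+g. f (\<lambda>i\<in>I. \<Sum>x\<in>I. ((U i)(a := - U i a)) x * (g(a := - g a)) x) \<partial>gauss I)"
      by (rule nn_integral_gauss_reflect[OF I that(2) meas, symmetric])
    then show ?thesis using that(1) unfolding Q_def * by simp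
  qed
  define P where "P J U \<longleftrightarrow> orthonormal_on I U \<and> (\<forall>r\<in>I - J. \<forall>x\<in>I. U r x = (if x = r then 1 else 0))" for J U
  have main: "Q U" if "finite J" "J \<subseteq> I" "P J U" for J U
    using that
  proof (induction J arbitrary: U rule: finite_induct)
    case empty
    have "f (\<lambda>i\<in>I. \<Sum>x\<in>I. U i x * g x) = f g" if "g \<in> space (gauss I)" for g
    proof -
      have "(\<Sum>x\<in>I. U i x * g x) = g i" if "i \<in> I" for i
      proof -
        have "(\<Sum>x\<in>I. U i x * g x) = (\<Sum>x\<in>I. if x = i then g x else 0)"
          using empty that by (intro sum.cong) (auto simp: P_def)
        then show ?thesis using I that by simp
      qed
      then have "(\<lambda>i\<in>I. \<Sum>x\<in>I. U i x * g x) = g"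
        using that by (auto simp: fun_eq_iff space_gauss PiE_def extensional_def)
      then show ?thesis by simp
    qed
    then show ?case unfolding Q_def by (intro nn_integral_cong)
  next
    case (insert a J)
    have aI: "a \<in> I" and JI: "J \<subseteq> I" using insert.prems by auto
    have inner: "Q U" if "finite K" "K \<subseteq> J" "P (insert a J) U" "\<forall>x\<in>I - insert a K. U a x = 0" for K U
      using that
    proof (induction K arbitrary: U rule: finite_induct)
      case empty
      have "(\<Sum>x\<in>I. U a x * U a x) = 1" using empty.prems aI by (auto simp: P_def orthonormal_on_def)
      also have "(\<Sum>x\<in>I. U a x * U a x) = (\<Sum>x\<in>I. if x = a then U a a * U a a else 0)"
        using empty.prems by (intro sum.cong) auto
      finally have "U a a * U a a = 1" using aI I by simp
      then have cases: "U a a = 1 \<or> U a a = - 1" by (simp add: square_eq_1_iff)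
      show ?case
      proof (cases "U a a = 1")
        case True
        have "P J U" unfolding P_def
        proof (intro conjI ballI)
          fix r x assume r: "r \<in> I - J" and x: "x \<in> I"
          show "U r x = (if x = r then 1 else 0)"
            using empty.prems r x True by (cases "r = a") (auto simp: P_def)
        qed (use empty.prems in \<open>simp add: P_def\<close>)
        then show ?thesis using insert.IH JI by blast
      next
        case False
        then have m1: "U a a = - 1" using cases by simp
        let ?V = "\<lambda>i. (U i)(a := - U i a)"
        have "P J ?V" unfolding P_def orthonormal_on_def
        proof (intro conjI ballI)
          fix i j assume ij: "i \<in> I" "j \<in> I"
          have "(\<Sum>x\<in>I. ?V i x * ?V j x) = (\<Sum>x\<in>I. U i x * U j x)" by (intro sum.cong) auto
          then show "(\<Sum>x\<in>I. ?V i x * ?V j x) = (if i = j then 1 else 0)"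
            using empty.prems ij by (auto simp: P_def orthonormal_on_def)
        next
          fix r x assume r: "r \<in> I - J" and x: "x \<in> I"
          show "?V r x = (if x = r then 1 else 0)"
            using empty.prems r x m1 aI by (cases "r = a") (auto simp: P_def)
        qed
        then have "Q ?V" using insert.IH JI by blast
        then show ?thesis by (rule reflect) (rule aI)
      qed
    next
      case (insert b K)
      have b: "b \<in> I" "a \<noteq> b" "b \<in> J" using insert.prems insert.hyps JI \<open>a \<notin> J\<close> by auto
      define \<rho> where "\<rho> = sqrt ((U a a)\<^sup>2 + (U a b)\<^sup>2)"
      define c where "c = (if \<rho> = 0 then 1 else U a a / \<rho>)"
      define s where "s = (if \<rho> = 0 then 0 else U a b / \<rho>)"
      have rho2: "\<rho>\<^sup>2 = (U a a)\<^sup>2 + (U a b)\<^sup>2" by (simp add: \<rho>_def)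
      have rho0: "U a a = 0 \<and> U a b = 0" if "\<rho> = 0"
        using rho2 that by (simp add: sum_power2_eq_zero_iff)
      have cs: "c\<^sup>2 + s\<^sup>2 = 1"
        using rho2 by (auto simp: c_def s_def power_divide add_divide_distrib[symmetric])
      have zero: "c * U a b - s * U a a = 0"
        using rho0 by (auto simp: c_def s_def)
      let ?V = "\<lambda>i. plane_rot a b c s (U i)"
      have V1: "P (insert a J) ?V" unfolding P_def orthonormal_on_def
      proof (intro conjI ballI)
        fix i j assume ij: "i \<in> I" "j \<in> I"
        show "(\<Sum>x\<in>I. ?V i x * ?V j x) = (if i = j then 1 else 0)"
          using insert.prems(2) ij by (auto simp: sum_plane_rot[OF I aI b(1,2) cs] P_def orthonormal_on_def)
      next
        fix r x assume r: "r \<in> I - insert a J" and x: "x \<in> I"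
        then have "U r x = (if x = r then 1 else 0)" "U r a = 0" "U r b = 0"
          using insert.prems(2) aI b by (auto simp: P_def)
        then show "?V r x = (if x = r then 1 else 0)"
          using r b by (auto simp: plane_rot_def)
      qed
      have V2: "\<forall>x\<in>I - insert a K. ?V a x = 0"
        using insert.prems(3) zero by (auto simp: plane_rot_def)
      have "Q ?V" using insert.IH V1 V2 insert.prems by blast
      then show ?case by (rule rot[OF _ aI b(1,2) cs])
    qed
    \<comment> \<open>Rows outside \<open>insert a J\<close> are unit vectors, so orthogonality clears their positions in row \<open>a\<close>.\<close>
    have "U a x = 0" if x: "x \<in> I - insert a J" for x
    proof -
      have "(\<Sum>y\<in>I. U x y * U a y) = (\<Sum>y\<in>I. if y = x then U a y else 0)"
        using insert.prems x by (intro sum.cong) (auto simp: P_def)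
      then have "(\<Sum>y\<in>I. U x y * U a y) = U a x" using x I by simp
      moreover have "(\<Sum>y\<in>I. U x y * U a y) = 0"
        using insert.prems x aI by (auto simp: P_def orthonormal_on_def)
      ultimately show ?thesis by simp
    qed
    then show ?case using inner[of J U] insert by blast
  qed
  have "P I U" using U by (auto simp: P_def)
  then have "Q U" using main[of I U] I by blast
  then show ?thesis by (simp add: Q_def)
qed

section \<open>Gaussian integrals and the Gibbs variational bound\<close>

lemma nn_integral_normal_density:
  "0 < \<sigma> \<Longrightarrow> (\<integral>\<^sup>+x. ennreal (normal_density \<mu> \<sigma> x) \<partial>lborel) = 1"
  using prob_space.emeasure_space_1[OF prob_space_normal_density, of \<sigma> \<mu>]
  by (simp add: emeasure_density)

lemma nn_integral_exp_square:
  assumes "c < 1 / 2"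
  shows "(\<integral>\<^sup>+x. ennreal (exp (c * x\<^sup>2)) \<partial>std_normal) = ennreal (1 / sqrt (1 - 2 * c))"
proof -
  define \<sigma> where "\<sigma> = 1 / sqrt (1 - 2 * c)"
  have pos: "0 < \<sigma>" using assms by (simp add: \<sigma>_def)
  have s2: "\<sigma>\<^sup>2 = 1 / (1 - 2 * c)" using assms by (simp add: \<sigma>_def power_divide)
  have "std_normal_density x * exp (c * x\<^sup>2) = \<sigma> * normal_density 0 \<sigma> x" for x
    using assms pos by (simp add: normal_density_def s2 exp_add[symmetric] real_sqrt_mult real_sqrt_divide)
      (simp add: \<sigma>_def field_simps)
  then have "(\<integral>\<^sup>+x. ennreal (exp (c * x\<^sup>2)) \<partial>std_normal) = (\<integral>\<^sup>+x. ennreal \<sigma> * ennreal (normal_density 0 \<sigma> x) \<partial>lborel)"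
    using pos by (simp add: nn_integral_std_normal ennreal_mult'[symmetric])
  also have "\<dots> = \<sigma>" using pos by (simp add: nn_integral_cmult nn_integral_normal_density)
  finally show ?thesis by (simp add: \<sigma>_def)
qed

lemma nn_integral_exp_linear:
  "(\<integral>\<^sup>+x. ennreal (exp (b * x)) \<partial>std_normal) = ennreal (exp (b\<^sup>2 / 2))"
proof -
  have "std_normal_density x * exp (b * x) = exp (b\<^sup>2 / 2) * normal_density b 1 x" for x
    by (simp add: normal_density_def exp_add[symmetric] power2_eq_square field_simps)
  then have "(\<integral>\<^sup>+x. ennreal (exp (b * x)) \<partial>std_normal) = (\<integral>\<^sup>+x. ennreal (exp (b\<^sup>2 / 2)) * ennreal (normal_density b 1 x) \<partial>lborel)"
    by (simp add: nn_integral_std_normal ennreal_mult'[symmetric])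
  also have "\<dots> = ennreal (exp (b\<^sup>2 / 2))" by (simp add: nn_integral_cmult nn_integral_normal_density)
  finally show ?thesis .
qed

lemma nn_integral_gauss_prod:
  assumes "finite I" "\<And>i. i \<in> I \<Longrightarrow> f i \<in> borel_measurable borel"
  shows "(\<integral>\<^sup>+g. (\<Prod>i\<in>I. f i (g i)) \<partial>gauss I) = (\<Prod>i\<in>I. \<integral>\<^sup>+x. f i x \<partial>std_normal)"
  unfolding gauss_def using assms by (intro std_normals.product_nn_integral_prod) auto

lemma nn_integral_gauss_exp_linear:
  assumes "finite I"
  shows "(\<integral>\<^sup>+g. ennreal (exp (\<Sum>i\<in>I. b i * g i)) \<partial>gauss I) = ennreal (exp ((\<Sum>i\<in>I. (b i)\<^sup>2) / 2))"
  using assms nn_integral_gauss_prod[of I "\<lambda>i x. ennreal (exp (b i * x))"]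
  by (simp add: exp_sum nn_integral_exp_linear prod_ennreal sum_divide_distrib)

lemma nn_integral_gauss_exp_square:
  assumes "finite I" "c < 1 / 2"
  shows "(\<integral>\<^sup>+g. ennreal (exp (c * (\<Sum>i\<in>I. (g i)\<^sup>2))) \<partial>gauss I) = ennreal ((1 / sqrt (1 - 2 * c)) ^ card I)"
  using assms nn_integral_gauss_prod[of I "\<lambda>i x. ennreal (exp (c * x\<^sup>2))"]
  by (simp add: exp_sum sum_distrib_left nn_integral_exp_square prod_ennreal ennreal_power)

lemma nn_integral_std_normal_shift:
  assumes [measurable]: "f \<in> borel_measurable borel"
  shows "(\<integral>\<^sup>+x. f x \<partial>std_normal) = (\<integral>\<^sup>+x. f (x + w) * ennreal (exp (- (w * x) - w\<^sup>2 / 2)) \<partial>std_normal)"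
proof -
  have "std_normal_density (w + x) = std_normal_density x * exp (- (w * x) - w\<^sup>2 / 2)" for x
    by (simp add: std_normal_density_def exp_add[symmetric] power2_eq_square field_simps)
  then show ?thesis
    by (simp add: nn_integral_std_normal)
      (subst nn_integral_real_affine[of _ 1 w], simp_all add: ennreal_mult' ac_simps)
qed

lemma borel_measurable_gauss_fiber:
  assumes "f \<in> borel_measurable (Pi\<^sub>M (insert i I) (\<lambda>_. borel))" "g \<in> space (gauss I)"
  shows "(\<lambda>x. f (g(i := x))) \<in> borel_measurable borel"
  using assms(2) by (intro measurable_compose[OF _ assms(1)] measurable_fun_upd[where J=I] measurable_const)
      (auto simp: space_gauss space_PiM)

text \<open>The Cameron-Martin formula for translations, one coordinate at a time.\<close>

lemma nn_integral_gauss_shift: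
  assumes "finite I" "f \<in> borel_measurable (Pi\<^sub>M I (\<lambda>_. borel))"
  shows "(\<integral>\<^sup>+g. f g \<partial>gauss I) =
    (\<integral>\<^sup>+g. f (\<lambda>i\<in>I. g i + w i) * ennreal (exp (- (\<Sum>i\<in>I. w i * g i) - (\<Sum>i\<in>I. (w i)\<^sup>2) / 2)) \<partial>gauss I)"
  using assms
proof (induction I arbitrary: f rule: finite_induct)
  case empty
  show ?case
  proof (rule nn_integral_cong)
    fix g :: "'a \<Rightarrow> real" assume "g \<in> space (gauss {})"
    then have "(\<lambda>i\<in>{}. g i + w i) = g" by (simp add: space_gauss restrict_def)
    then show "f g = f (\<lambda>i\<in>{}. g i + w i) * ennreal (exp (- (\<Sum>i\<in>{}. w i * g i) - (\<Sum>i\<in>{}. (w i)\<^sup>2) / 2))"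
      by simp
  qed
next
  case (insert i I)
  note [measurable] = insert.prems
  note [simp] = insert.hyps
  have m[measurable]: "(\<lambda>g. \<lambda>j\<in>insert i I. g j + w j) \<in> measurable (Pi\<^sub>M (insert i I) (\<lambda>_. borel)) (Pi\<^sub>M (insert i I) (\<lambda>_. borel))"
    by measurable
  define E where "E g = ennreal (exp (- (\<Sum>i\<in>I. w i * g i) - (\<Sum>i\<in>I. (w i)\<^sup>2) / 2))" for g
  have [measurable]: "E \<in> borel_measurable (Pi\<^sub>M I (\<lambda>_. borel))" unfolding E_def by measurable
  have upd[measurable]: "(\<lambda>(g, x). g(i := x)) \<in> measurable (Pi\<^sub>M I (\<lambda>_. borel) \<Otimes>\<^sub>M borel) (Pi\<^sub>M (insert i I) (\<lambda>_. borel :: real measure))"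
    by (rule measurable_add_dim)
  define F where "F g = (\<integral>\<^sup>+x. f (g(i := x)) \<partial>std_normal)" for g
  have "(\<lambda>g. F g) \<in> borel_measurable (Pi\<^sub>M I (\<lambda>_. borel))"
    unfolding F_def
    by (rule std_normal.borel_measurable_nn_integral) (use measurable_compose[OF upd insert.prems] in \<open>simp add: split_beta' cong: measurable_cong_sets\<close>)
  then have IH: "(\<integral>\<^sup>+g. F g \<partial>gauss I) = (\<integral>\<^sup>+g. F (\<lambda>j\<in>I. g j + w j) * E g \<partial>gauss I)"
    unfolding E_def by (rule insert.IH)
  have "(\<integral>\<^sup>+g. f (\<lambda>j\<in>insert i I. g j + w j) * ennreal (exp (- (\<Sum>j\<in>insert i I. w j * g j) - (\<Sum>j\<in>insert i I. (w j)\<^sup>2) / 2)) \<partial>gauss (insert i I))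
     = (\<integral>\<^sup>+g. (\<integral>\<^sup>+x. f (\<lambda>j\<in>insert i I. (g(i := x)) j + w j) * ennreal (exp (- (\<Sum>j\<in>insert i I. w j * (g(i := x)) j) - (\<Sum>j\<in>insert i I. (w j)\<^sup>2) / 2)) \<partial>std_normal) \<partial>gauss I)"
    by (subst nn_integral_gauss_insert) (simp_all del: sum.insert)
  also have "\<dots> = (\<integral>\<^sup>+g. F (\<lambda>j\<in>I. g j + w j) * E g \<partial>gauss I)"
  proof (rule nn_integral_cong)
    fix g assume g: "g \<in> space (gauss I)"
    have g': "(\<lambda>j\<in>I. g j + w j) \<in> space (gauss I)" by (simp add: space_gauss)
    note mf = borel_measurable_gauss_fiber[OF insert.prems g', measurable]
    have s: "(\<Sum>j\<in>I. w j * (if j = i then x else g j)) = (\<Sum>j\<in>I. w j * g j)" for x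
      by (rule sum.cong) auto
    have a: "(\<lambda>j\<in>insert i I. (g(i := x)) j + w j) = (\<lambda>j\<in>I. g j + w j)(i := x + w i)" for x
      by (auto simp: fun_eq_iff)
    have b: "ennreal (exp (- (\<Sum>j\<in>insert i I. w j * (g(i := x)) j) - (\<Sum>j\<in>insert i I. (w j)\<^sup>2) / 2))
       = ennreal (exp (- (w i * x) - (w i)\<^sup>2 / 2)) * E g" for x
      unfolding E_def
      by (subst ennreal_mult'[symmetric]) (simp_all add: s exp_add[symmetric] add_divide_distrib algebra_simps)
    have F_eq: "F (\<lambda>j\<in>I. g j + w j) = (\<integral>\<^sup>+x. f ((\<lambda>j\<in>I. g j + w j)(i := x + w i)) * ennreal (exp (- (w i * x) - (w i)\<^sup>2 / 2)) \<partial>std_normal)"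
      unfolding F_def by (rule nn_integral_std_normal_shift) measurable
    show "(\<integral>\<^sup>+x. f (\<lambda>j\<in>insert i I. (g(i := x)) j + w j) * ennreal (exp (- (\<Sum>j\<in>insert i I. w j * (g(i := x)) j) - (\<Sum>j\<in>insert i I. (w j)\<^sup>2) / 2)) \<partial>std_normal)
      = F (\<lambda>j\<in>I. g j + w j) * E g"
      unfolding a b mult.assoc[symmetric] F_eq by (rule nn_integral_multc) measurable
  qed
  also have "\<dots> = (\<integral>\<^sup>+g. F g \<partial>gauss I)" by (rule IH[symmetric])
  also have "\<dots> = (\<integral>\<^sup>+g. f g \<partial>gauss (insert i I))"
    unfolding F_def by (rule nn_integral_gauss_insert[symmetric]) (simp_all add: insert.prems)
  finally show ?case by (rule sym)
qed

lemma nn_integral_gauss_uminus: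
  fixes f :: "('i \<Rightarrow> real) \<Rightarrow> ennreal"
  assumes "finite I" "f \<in> borel_measurable (Pi\<^sub>M I (\<lambda>_. borel))"
  shows "(\<integral>\<^sup>+g. f (\<lambda>i\<in>I. - g i) \<partial>gauss I) = (\<integral>\<^sup>+g. f g \<partial>gauss I)"
proof -
  define U :: "'i \<Rightarrow> 'i \<Rightarrow> real" where "U = (\<lambda>i x. if x = i then - 1 else 0)"
  have "orthonormal_on I U"
    unfolding orthonormal_on_def U_def using assms(1) by (auto simp: if_distrib[of "\<lambda>z. z * _"] cong: if_cong)
  moreover have "(\<lambda>i\<in>I. \<Sum>x\<in>I. U i x * g x) = (\<lambda>i\<in>I. - g i)" for g
    unfolding U_def using assms(1) by (auto simp: fun_eq_iff if_distrib[of "\<lambda>z. z * _"] cong: if_cong)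
  ultimately show ?thesis using gauss_orthogonal[OF assms(1) _ assms(2), of U] by simp
qed

lemma nn_integral_std_normal_square: "(\<integral>\<^sup>+x. ennreal (x\<^sup>2) \<partial>std_normal) = 1"
proof -
  have "has_bochner_integral lborel (\<lambda>x. std_normal_density x * x ^ 2) 1"
    using std_normal_moment_even[of 1] by (simp add: fact_2)
  then have "(\<integral>\<^sup>+x. ennreal (std_normal_density x * x\<^sup>2) \<partial>lborel) = 1"
    by (subst nn_integral_eq_integral) (auto simp: has_bochner_integral_iff)
  then show ?thesis by (simp add: nn_integral_std_normal ennreal_mult')
qed

lemma nn_integral_std_normal_affine_square:
  "(\<integral>\<^sup>+x. ennreal ((a + b * x)\<^sup>2) \<partial>std_normal) = ennreal (a\<^sup>2 + b\<^sup>2)"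
proof -
  let ?I = "\<integral>\<^sup>+x. ennreal ((a + b * x)\<^sup>2) \<partial>std_normal"
  have "?I = (\<integral>\<^sup>+x. ennreal ((a + b * (- x))\<^sup>2) \<partial>std_normal)"
    by (rule nn_integral_std_normal_uminus[symmetric]) measurable
  then have "2 * ?I = ?I + (\<integral>\<^sup>+x. ennreal ((a + b * (- x))\<^sup>2) \<partial>std_normal)" by (simp add: mult_2)
  also have "\<dots> = (\<integral>\<^sup>+x. ennreal ((a + b * x)\<^sup>2) + ennreal ((a + b * (- x))\<^sup>2) \<partial>std_normal)"
    by (rule nn_integral_add[symmetric]) measurable
  also have "\<dots> = (\<integral>\<^sup>+x. ennreal (2 * a\<^sup>2) + ennreal (2 * b\<^sup>2) * ennreal (x\<^sup>2) \<partial>std_normal)"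
  proof (rule nn_integral_cong)
    fix x :: real
    have "(a + b * x)\<^sup>2 + (a + b * (- x))\<^sup>2 = 2 * a\<^sup>2 + (2 * b\<^sup>2) * x\<^sup>2"
      by (simp add: power2_eq_square algebra_simps)
    then show "ennreal ((a + b * x)\<^sup>2) + ennreal ((a + b * (- x))\<^sup>2) = ennreal (2 * a\<^sup>2) + ennreal (2 * b\<^sup>2) * ennreal (x\<^sup>2)"
      by (simp only: ennreal_plus[symmetric] ennreal_mult'[symmetric] zero_le_power2 mult_nonneg_nonneg zero_le_numeral)
  qed
  also have "\<dots> = ennreal (2 * a\<^sup>2) + ennreal (2 * b\<^sup>2)"
    by (simp add: nn_integral_add nn_integral_cmult nn_integral_std_normal_square std_normal.emeasure_space_1[simplified])
  also have "\<dots> = 2 * ennreal (a\<^sup>2 + b\<^sup>2)"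
    by (simp add: ennreal_plus[symmetric] ennreal_mult'[symmetric] ennreal_numeral[symmetric] del: ennreal_plus ennreal_numeral)
  finally show ?thesis by (simp add: ennreal_mult_cancel_left del: ennreal_plus)
qed

lemma nn_integral_gauss_affine_square:
  assumes "finite I"
  shows "(\<integral>\<^sup>+g. ennreal ((c + (\<Sum>i\<in>I. b i * g i))\<^sup>2) \<partial>gauss I) = ennreal (c\<^sup>2 + (\<Sum>i\<in>I. (b i)\<^sup>2))"
  using assms
proof (induction I arbitrary: c rule: finite_induct)
  case empty
  then show ?case by (simp add: emeasure_gauss_space)
next
  case (insert i I)
  have s: "(\<Sum>j\<in>I. b j * (if j = i then x else g j)) = (\<Sum>j\<in>I. b j * g j)" for x g
    using insert.hyps by (intro sum.cong) auto
  have "(\<integral>\<^sup>+g. ennreal ((c + (\<Sum>j\<in>insert i I. b j * g j))\<^sup>2) \<partial>gauss (insert i I))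
    = (\<integral>\<^sup>+g. (\<integral>\<^sup>+x. ennreal (((c + (\<Sum>j\<in>I. b j * g j)) + b i * x)\<^sup>2) \<partial>std_normal) \<partial>gauss I)"
    using insert.hyps by (subst nn_integral_gauss_insert) (simp_all add: s ac_simps)
  also have "\<dots> = (\<integral>\<^sup>+g. ennreal ((c + (\<Sum>j\<in>I. b j * g j))\<^sup>2) + ennreal ((b i)\<^sup>2) \<partial>gauss I)"
    by (simp add: nn_integral_std_normal_affine_square)
  also have "\<dots> = ennreal (c\<^sup>2 + (\<Sum>j\<in>I. (b j)\<^sup>2)) + ennreal ((b i)\<^sup>2)"
    by (subst nn_integral_add) (simp_all add: insert.IH emeasure_gauss_space)
  also have "\<dots> = ennreal (c\<^sup>2 + (\<Sum>j\<in>insert i I. (b j)\<^sup>2))"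
    using insert.hyps by (simp add: ennreal_plus[symmetric] sum_nonneg ac_simps del: ennreal_plus)
  finally show ?case .
qed


text \<open>The Gibbs variational inequality for a quadratic exponent: the prior \<open>gauss I\<close> is compared
  with its translate by \<open>w\<close>, whose relative entropy is half the squared length of \<open>w\<close>. The odd
  part of the translated exponent cancels under \<open>g \<mapsto> - g\<close>, so Jensen's inequality is only needed
  for the quadratic part, in its tangent-line form.\<close>

lemma gauss_gibbs_lower_bound:
  fixes b w :: "'i \<Rightarrow> real" and F :: "'r \<Rightarrow> 'i \<Rightarrow> real"
  assumes I: "finite I" and R: "finite R" and c: "0 \<le> c"
  shows "ennreal (exp ((\<Sum>i\<in>I. b i * w i)
      - c * ((\<Sum>r\<in>R. (\<Sum>i\<in>I. F r i * w i)\<^sup>2) + (\<Sum>r\<in>R. \<Sum>i\<in>I. (F r i)\<^sup>2)) - (\<Sum>i\<in>I. (w i)\<^sup>2) / 2))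
    \<le> (\<integral>\<^sup>+g. ennreal (exp ((\<Sum>i\<in>I. b i * g i) - c * (\<Sum>r\<in>R. (\<Sum>i\<in>I. F r i * g i)\<^sup>2))) \<partial>gauss I)"
    (is "?L \<le> ?Z")
proof -
  define q where "q g = (\<Sum>r\<in>R. (\<Sum>i\<in>I. F r i * g i)\<^sup>2)" for g :: "'i \<Rightarrow> real"
  define K where "K = (\<Sum>i\<in>I. b i * w i) - c * q w - (\<Sum>i\<in>I. (w i)\<^sup>2) / 2"
  define t0 where "t0 = c * (\<Sum>r\<in>R. \<Sum>i\<in>I. (F r i)\<^sup>2)"
  define J where "J g = (\<Sum>i\<in>I. b i * (g i + w i)) - c * q (\<lambda>i. g i + w i) - (\<Sum>i\<in>I. w i * g i) - (\<Sum>i\<in>I. (w i)\<^sup>2) / 2" for g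
  have [measurable]: "q \<in> borel_measurable (Pi\<^sub>M I (\<lambda>_. borel))" unfolding q_def by measurable
  have [measurable]: "J \<in> borel_measurable (Pi\<^sub>M I (\<lambda>_. borel))" unfolding J_def q_def by measurable
  have q0: "0 \<le> q g" for g by (simp add: q_def sum_nonneg)
  have t0: "0 \<le> t0" using c by (simp add: t0_def sum_nonneg)
  have Z: "?Z = (\<integral>\<^sup>+g. ennreal (exp (J g)) \<partial>gauss I)"
  proof -
    have eq1: "(\<Sum>i\<in>I. b i * (\<lambda>i\<in>I. g i + w i) i) = (\<Sum>i\<in>I. b i * (g i + w i))" for g
      by (rule sum.cong) auto
    have eq2: "q (\<lambda>i\<in>I. g i + w i) = q (\<lambda>i. g i + w i)" for g
      by (simp add: q_def)
    have "?Z = (\<integral>\<^sup>+g. ennreal (exp ((\<Sum>i\<in>I. b i * (\<lambda>i\<in>I. g i + w i) i) - c * q (\<lambda>i\<in>I. g i + w i)))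
        * ennreal (exp (- (\<Sum>i\<in>I. w i * g i) - (\<Sum>i\<in>I. (w i)\<^sup>2) / 2)) \<partial>gauss I)"
      unfolding q_def[symmetric] by (rule nn_integral_gauss_shift[OF I]) measurable
    also have "\<dots> = (\<integral>\<^sup>+g. ennreal (exp (J g)) \<partial>gauss I)"
      unfolding eq1 eq2 J_def
      by (simp add: ennreal_mult'[symmetric] exp_add[symmetric] algebra_simps)
    finally show ?thesis .
  qed
  have qT: "(\<integral>\<^sup>+g. ennreal (c * q g) \<partial>gauss I) = ennreal t0"
  proof -
    have "(\<integral>\<^sup>+g. ennreal (c * q g) \<partial>gauss I) = ennreal c * (\<Sum>r\<in>R. \<integral>\<^sup>+g. ennreal ((\<Sum>i\<in>I. F r i * g i)\<^sup>2) \<partial>gauss I)"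
      using c by (simp add: q_def ennreal_mult' sum_ennreal[symmetric] nn_integral_cmult nn_integral_sum del: sum_ennreal)
    also have "\<dots> = ennreal c * (\<Sum>r\<in>R. ennreal (\<Sum>i\<in>I. (F r i)\<^sup>2))"
      using nn_integral_gauss_affine_square[OF I, of 0] by simp
    finally show ?thesis using c by (simp add: t0_def ennreal_mult' sum_nonneg)
  qed
  \<comment> \<open>The tangent of \<open>exp\<close> at \<open>- t0\<close>, where \<open>t0\<close> is the mean of \<open>c * q\<close>, after averaging over \<open>g\<close> and \<open>- g\<close>. All terms are kept nonnegative.\<close>
  have point: "2 * ennreal (exp (K - t0)) * (1 + ennreal t0)
      \<le> (ennreal (exp (J g)) + ennreal (exp (J (\<lambda>i\<in>I. - g i)))) + 2 * ennreal (exp (K - t0)) * ennreal (c * q g)" for g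
  proof -
    define S where "S r u = (\<Sum>i\<in>I. F r i * u i)" for r and u :: "'i \<Rightarrow> real"
    have qpar: "q (\<lambda>i. g i + w i) + q (\<lambda>i. w i - g i) = 2 * (q g + q w)"
    proof -
      have "q (\<lambda>i. g i + w i) + q (\<lambda>i. w i - g i) = (\<Sum>r\<in>R. (S r (\<lambda>i. g i + w i))\<^sup>2 + (S r (\<lambda>i. w i - g i))\<^sup>2)"
        by (simp only: q_def S_def sum.distrib)
      also have "\<dots> = (\<Sum>r\<in>R. 2 * ((S r g)\<^sup>2 + (S r w)\<^sup>2))"
      proof (rule sum.cong)
        fix r
        have e: "S r (\<lambda>i. g i + w i) = S r g + S r w" "S r (\<lambda>i. w i - g i) = S r w - S r g"
          by (simp_all add: S_def algebra_simps sum.distrib sum_subtractf)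
        show "(S r (\<lambda>i. g i + w i))\<^sup>2 + (S r (\<lambda>i. w i - g i))\<^sup>2 = 2 * ((S r g)\<^sup>2 + (S r w)\<^sup>2)"
          unfolding e by (simp add: power2_eq_square algebra_simps)
      qed simp
      also have "\<dots> = 2 * (q g + q w)"
        by (simp only: q_def S_def sum.distrib sum_distrib_left[symmetric])
      finally show ?thesis .
    qed
    have neg: "q (\<lambda>i. (\<lambda>i\<in>I. - g i) i + w i) = q (\<lambda>i. w i - g i)"
      by (simp add: q_def)
    have avg: "J g + J (\<lambda>i\<in>I. - g i) = 2 * (K - c * q g)"
    proof -
      have q: "c * q (\<lambda>i. g i + w i) + c * q (\<lambda>i. w i - g i) = 2 * (c * q g) + 2 * (c * q w)"
        using arg_cong[OF qpar, of "\<lambda>x. c * x"] by (simp only: distrib_left mult.left_commute)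
      have "(\<Sum>i\<in>I. b i * ((\<lambda>i\<in>I. - g i) i + w i)) = (\<Sum>i\<in>I. b i * w i) - (\<Sum>i\<in>I. b i * g i)"
        by (simp add: algebra_simps sum_subtractf)
      moreover have "(\<Sum>i\<in>I. w i * (\<lambda>i\<in>I. - g i) i) = - (\<Sum>i\<in>I. w i * g i)"
        by (simp add: sum_negf)
      ultimately have "J (\<lambda>i\<in>I. - g i) = (\<Sum>i\<in>I. b i * w i) - (\<Sum>i\<in>I. b i * g i) - c * q (\<lambda>i. w i - g i)
          + (\<Sum>i\<in>I. w i * g i) - (\<Sum>i\<in>I. (w i)\<^sup>2) / 2"
        unfolding J_def neg by (simp only:)
      moreover have "(\<Sum>i\<in>I. b i * (g i + w i)) = (\<Sum>i\<in>I. b i * w i) + (\<Sum>i\<in>I. b i * g i)"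
        by (simp only: distrib_left sum.distrib add.commute)
      moreover have "S - Q1 - V - W / 2 + J1 = 2 * (A - Qw - W / 2 - Qg)"
        if "J1 = A - B - Q2 + V - W / 2" "S = A + B" "Q1 + Q2 = 2 * Qg + 2 * Qw" for S Q1 V W J1 A Qw Qg B Q2 :: real
        using that by (simp add: field_simps)
      ultimately show ?thesis unfolding J_def[of g] K_def using q by blast
    qed
    have "2 * exp (K - c * q g) \<le> exp (J g) + exp (J (\<lambda>i\<in>I. - g i))"
    proof -
      define u v where "u = exp (J g / 2)" and "v = exp (J (\<lambda>i\<in>I. - g i) / 2)"
      have "exp (J g) = u * u" "exp (J (\<lambda>i\<in>I. - g i)) = v * v" by (simp_all add: u_def v_def exp_add[symmetric])
      moreover have "exp (K - c * q g) = u * v" using avg by (simp add: u_def v_def exp_add[symmetric] add_divide_distrib[symmetric])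
      moreover have "0 \<le> (u - v) * (u - v)" by simp
      ultimately show ?thesis by (simp add: algebra_simps)
    qed
    moreover have "exp (K - t0) * (1 + t0) \<le> exp (K - c * q g) + exp (K - t0) * (c * q g)"
    proof -
      have "1 + (t0 - c * q g) \<le> exp (t0 - c * q g)" by (rule exp_ge_add_one_self)
      then have "exp (K - t0) * (1 + (t0 - c * q g)) \<le> exp (K - t0) * exp (t0 - c * q g)" by simp
      also have "\<dots> = exp (K - c * q g)" by (simp add: exp_add[symmetric])
      finally show ?thesis by (simp add: algebra_simps)
    qed
    ultimately have "2 * exp (K - t0) * (1 + t0) \<le> (exp (J g) + exp (J (\<lambda>i\<in>I. - g i))) + 2 * exp (K - t0) * (c * q g)"
      by (simp add: algebra_simps)
    then have "ennreal (2 * exp (K - t0) * (1 + t0)) \<le> ennreal ((exp (J g) + exp (J (\<lambda>i\<in>I. - g i))) + 2 * exp (K - t0) * (c * q g))"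
      by (rule ennreal_leI)
    then show ?thesis using c q0 t0 by (simp add: ennreal_mult')
  qed
  have half: "(\<integral>\<^sup>+g. ennreal (exp (J (\<lambda>i\<in>I. - g i))) \<partial>gauss I) = ?Z"
    unfolding Z by (rule nn_integral_gauss_uminus[OF I]) measurable
  have "2 * ennreal (exp (K - t0)) * (1 + ennreal t0) = (\<integral>\<^sup>+g. 2 * ennreal (exp (K - t0)) * (1 + ennreal t0) \<partial>gauss I)"
    by (simp add: emeasure_gauss_space)
  also have "\<dots> \<le> (\<integral>\<^sup>+g. (ennreal (exp (J g)) + ennreal (exp (J (\<lambda>i\<in>I. - g i)))) + 2 * ennreal (exp (K - t0)) * ennreal (c * q g) \<partial>gauss I)"
    by (rule nn_integral_mono) (rule point)
  also have "\<dots> = (?Z + ?Z) + 2 * ennreal (exp (K - t0)) * ennreal t0"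
    by (simp add: nn_integral_add nn_integral_cmult half Z[symmetric] qT)
  finally have le: "2 * ennreal (exp (K - t0)) * (1 + ennreal t0) \<le> (?Z + ?Z) + 2 * ennreal (exp (K - t0)) * ennreal t0" .
  have "X * t + X \<le> X * t + 2 * z" if "X * (1 + t) \<le> (z + z) + X * t" for X t z :: ennreal
    using that by (simp only: distrib_left mult_1_right mult_2 add.commute)
  from this[OF le] have "2 * ennreal (exp (K - t0)) * ennreal t0 + 2 * ennreal (exp (K - t0))
      \<le> 2 * ennreal (exp (K - t0)) * ennreal t0 + 2 * ?Z" .
  moreover have "2 * ennreal (exp (K - t0)) * ennreal t0 \<noteq> \<infinity>"
    by (simp add: ennreal_mult_eq_top_iff)
  ultimately have "2 * ennreal (exp (K - t0)) \<le> 2 * ?Z"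
    by (simp add: ennreal_add_left_cancel_le)
  then have "ennreal (exp (K - t0)) \<le> ?Z" by (simp add: ennreal_mult_le_mult_iff)
  then show ?thesis by (simp add: K_def t0_def q_def algebra_simps)
qed

section \<open>Moments of the length of a Gaussian vector\<close>

text \<open>The integrand of the Gamma integral, extended by zero so that it can be integrated over the whole line.\<close>

definition pos_powr :: "real \<Rightarrow> real \<Rightarrow> real" where
  "pos_powr a t = (if 0 < t then t powr (a - 1) else 0)"

lemma pos_powr_nonneg [simp]: "0 \<le> pos_powr a t"
  by (simp add: pos_powr_def)

lemma borel_measurable_pos_powr [measurable]: "pos_powr a \<in> borel_measurable borel"
  unfolding pos_powr_def[abs_def] by measurable

lemma nn_integral_Gamma:
  assumes a: "0 < a" and c: "0 < c"
  shows "(\<integral>\<^sup>+t. ennreal (pos_powr a t * exp (- (c * t))) \<partial>lborel) = ennreal (Gamma a / c powr a)"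
proof -
  have 1: "(\<integral>\<^sup>+t. ennreal (pos_powr a t * exp (- t)) \<partial>lborel) = ennreal (Gamma a)"
  proof -
    have "(\<integral>\<^sup>+t. ennreal (pos_powr a t * exp (- t)) \<partial>lborel)
        = (\<integral>\<^sup>+t. ennreal (indicator {0..} t * (t powr (a - 1) / exp t)) \<partial>lborel)"
      by (intro nn_integral_cong) (auto simp: pos_powr_def exp_minus field_simps indicator_def)
    also have "\<dots> = ennreal (Gamma a)"
      using nn_integral_has_integral_lebesgue[OF _ Gamma_integral_real[OF a]] by simp
    finally show ?thesis .
  qed
  have "pos_powr a (c * t) * exp (- (c * t)) = c powr (a - 1) * (pos_powr a t * exp (- (c * t)))" for t
    using c by (auto simp: pos_powr_def powr_mult zero_less_mult_iff)
  then have "ennreal (Gamma a) = ennreal c * (\<integral>\<^sup>+t. ennreal (c powr (a - 1)) * ennreal (pos_powr a t * exp (- (c * t))) \<partial>lborel)"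
    using c unfolding 1[symmetric]
    by (subst nn_integral_real_affine[of _ c 0]) (simp_all add: ennreal_mult'[symmetric] mult.assoc)
  also have "\<dots> = ennreal c * (ennreal (c powr (a - 1)) * (\<integral>\<^sup>+t. ennreal (pos_powr a t * exp (- (c * t))) \<partial>lborel))"
    by (subst nn_integral_cmult) simp_all
  also have "\<dots> = ennreal (c * c powr (a - 1)) * (\<integral>\<^sup>+t. ennreal (pos_powr a t * exp (- (c * t))) \<partial>lborel)"
    using c by (simp only: mult.assoc[symmetric] ennreal_mult')
  also have "c * c powr (a - 1) = c powr a" using c powr_mult_base[of c "a - 1"] by simp
  finally have e: "ennreal (c powr a) * (\<integral>\<^sup>+t. ennreal (pos_powr a t * exp (- (c * t))) \<partial>lborel) = ennreal (Gamma a)" by simp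
  have "ennreal (c powr a) * ennreal (Gamma a / c powr a) = ennreal (Gamma a)"
    using c a Gamma_real_pos[OF a] by (simp add: ennreal_mult'[symmetric])
  then have "ennreal (c powr a) * (\<integral>\<^sup>+t. ennreal (pos_powr a t * exp (- (c * t))) \<partial>lborel)
      = ennreal (c powr a) * ennreal (Gamma a / c powr a)" using e by (simp only:)
  then show ?thesis using c by (subst (asm) ennreal_mult_cancel_left) auto
qed

text \<open>The \<open>p\<close>-th negative moment of the length of a standard Gaussian vector in dimension \<open>p + 1\<close>; for
the one-dimensional standard normal distribution it is the reciprocal of the \<open>p\<close>-th absolute moment.\<close>

definition inv_chi_moment :: "nat \<Rightarrow> real" where
  "inv_chi_moment p = sqrt pi / (2 powr (real p / 2) * Gamma ((real p + 1) / 2))"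

text \<open>For \<open>r > 0\<close> this is an equation, the Gamma integral with exponent \<open>p / 2\<close> and rate \<open>r\<^sup>2\<close>. At
\<open>r = 0\<close> both sides are infinite.\<close>

lemma inverse_power_le_Laplace:
  assumes r: "0 \<le> r" and p: "0 < p"
  shows "ennreal (Gamma (real p / 2)) * inverse (ennreal r) ^ p
     \<le> (\<integral>\<^sup>+t. ennreal (pos_powr (real p / 2) t * exp (- (r\<^sup>2 * t))) \<partial>lborel)"
proof (cases "r = 0")
  case False
  then have r: "0 < r" using r by simp
  have "(r\<^sup>2) powr (real p / 2) = (r powr 2) powr (real p / 2)" using r by simp
  also have "\<dots> = r powr real p" by (simp add: powr_powr)
  also have "\<dots> = r ^ p" using r by (simp add: powr_realpow)
  finally have rp: "(r\<^sup>2) powr (real p / 2) = r ^ p" .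
  have G: "0 < Gamma (real p / 2)" using p by (simp add: Gamma_real_pos)
  have "inverse (ennreal r) ^ p = ennreal (inverse r) ^ p"
    using r by (simp add: inverse_ennreal)
  also have "\<dots> = ennreal (inverse r ^ p)"
    by (rule ennreal_power) (use r in simp)
  finally have e: "inverse (ennreal r) ^ p = ennreal (inverse r ^ p)" .
  have "ennreal (Gamma (real p / 2)) * inverse (ennreal r) ^ p = ennreal (Gamma (real p / 2) / r ^ p)"
  proof -
    have "Gamma (real p / 2) / r ^ p = Gamma (real p / 2) * inverse r ^ p"
      by (simp only: divide_inverse power_inverse)
    then show ?thesis using G by (simp only: e ennreal_mult' less_imp_le)
  qed
  moreover have "(\<integral>\<^sup>+t. ennreal (pos_powr (real p / 2) t * exp (- (r\<^sup>2 * t))) \<partial>lborel) = ennreal (Gamma (real p / 2) / r ^ p)"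
    unfolding rp[symmetric] by (rule nn_integral_Gamma) (use r p in simp_all)
  ultimately show ?thesis by simp
next
  case True
  let ?a = "real p / 2"
  have G: "0 < Gamma ?a" using p by (simp add: Gamma_real_pos)
  have "(\<integral>\<^sup>+t. ennreal (pos_powr ?a t) \<partial>lborel) = \<infinity>"
  proof (rule ccontr)
    assume "\<not> ?thesis"
    then obtain x where x: "(\<integral>\<^sup>+t. ennreal (pos_powr ?a t) \<partial>lborel) = ennreal x" "0 \<le> x"
      by (cases "\<integral>\<^sup>+t. ennreal (pos_powr ?a t) \<partial>lborel" rule: ennreal_cases) auto
    obtain N :: nat where N: "x < real N * Gamma ?a" "0 < N"
    proof -
      obtain N0 where "x / Gamma ?a < real N0" using reals_Archimedean2 by blast
      then have "x < real (Suc N0) * Gamma ?a" using G by (simp add: field_simps)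
      then show ?thesis using that by blast
    qed
    define c where "c = (1 / real N) powr (1 / ?a)"
    have c: "0 < c" using N by (simp add: c_def)
    have ca: "c powr ?a = 1 / real N" using p N by (simp add: c_def powr_powr)
    have "ennreal (Gamma ?a / c powr ?a) = (\<integral>\<^sup>+t. ennreal (pos_powr ?a t * exp (- (c * t))) \<partial>lborel)"
      using p c by (simp add: nn_integral_Gamma)
    also have "\<dots> \<le> (\<integral>\<^sup>+t. ennreal (pos_powr ?a t) \<partial>lborel)"
    proof (intro nn_integral_mono ennreal_leI)
      fix t show "pos_powr ?a t * exp (- (c * t)) \<le> pos_powr ?a t"
        using c by (cases "0 < t") (auto simp: pos_powr_def)
    qed
    finally have "Gamma ?a / c powr ?a \<le> x" using x by (simp add: ennreal_le_iff)
    then show False using N ca by (simp add: mult.commute)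
  qed
  then show ?thesis using True by simp
qed

text \<open>With the inverse power written as a Laplace integral, the Gaussian integral becomes a power of
\<open>1 + 2 t\<close>. Writing this power as a Gamma integral too and exchanging the order of integration leaves a
third Gamma integral, with exponent \<open>1 / 2\<close>.\<close>

lemma gauss_inverse_moment:
  assumes I: "finite I" "J \<subseteq> I" "card J = p + 1" and p: "0 < p"
  shows "(\<integral>\<^sup>+g. inverse (ennreal (sqrt (\<Sum>i\<in>J. (g i)\<^sup>2))) ^ p \<partial>gauss I) \<le> ennreal (inv_chi_moment p)"
proof -
  define a b where "a = real p / 2" and "b = (real p + 1) / 2"
  have ab: "0 < a" "0 < b" "b - a = 1 / 2" using p by (auto simp: a_def b_def field_simps)
  have Ga: "0 < Gamma a" and Gb: "0 < Gamma b" using ab by (simp_all add: Gamma_real_pos)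
  have finJ: "finite J" using I finite_subset by blast
  define q where "q g = (\<Sum>i\<in>J. (g i)\<^sup>2)" for g :: "'a \<Rightarrow> real"
  have q0: "0 \<le> q g" for g by (simp add: q_def sum_nonneg)
  have "(\<lambda>g. g i) \<in> borel_measurable (Pi\<^sub>M I (\<lambda>_. borel :: real measure))" if "i \<in> J" for i
    using that I by auto
  then have [measurable]: "q \<in> borel_measurable (Pi\<^sub>M I (\<lambda>_. borel))"
    unfolding q_def by (intro borel_measurable_sum borel_measurable_power)
  interpret gI: prob_space "gauss I" by (rule prob_space_gauss)
  interpret P: pair_sigma_finite lborel "gauss I" ..
  have mgf: "(\<integral>\<^sup>+g. ennreal (exp (- (q g * t))) \<partial>gauss I) = ennreal ((1 + 2 * t) powr (- b))" if t: "0 < t" for t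
  proof -
    have "(\<integral>\<^sup>+g. ennreal (exp (- (q g * t))) \<partial>gauss I)
       = (\<integral>\<^sup>+g. (\<Prod>i\<in>I. (if i \<in> J then ennreal (exp (- t * (g i)\<^sup>2)) else 1)) \<partial>gauss I)"
    proof (rule nn_integral_cong)
      fix g
      have "- (q g * t) = (\<Sum>i\<in>J. - t * (g i)\<^sup>2)" by (simp add: q_def sum_distrib_left sum_negf mult.commute)
      then show "ennreal (exp (- (q g * t))) = (\<Prod>i\<in>I. (if i \<in> J then ennreal (exp (- t * (g i)\<^sup>2)) else 1))"
        using I finJ by (simp add: exp_sum prod_ennreal prod.If_cases Int_absorb1)
    qed
    also have "\<dots> = (\<Prod>i\<in>I. \<integral>\<^sup>+x. (if i \<in> J then ennreal (exp (- t * x\<^sup>2)) else 1) \<partial>std_normal)"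
      by (rule nn_integral_gauss_prod) (use I in auto)
    also have "\<dots> = (\<Prod>i\<in>I. if i \<in> J then ennreal (1 / sqrt (1 + 2 * t)) else 1)"
      using nn_integral_exp_square[of "-t"] t std_normal.emeasure_space_1
      by (intro prod.cong) auto
    also have "\<dots> = ennreal (1 / sqrt (1 + 2 * t)) ^ (p + 1)"
      using I by (simp add: prod.If_cases Int_absorb1)
    also have "\<dots> = ennreal ((1 / sqrt (1 + 2 * t)) ^ (p + 1))"
      by (rule ennreal_power) (use t in simp)
    also have "(1 / sqrt (1 + 2 * t)) ^ (p + 1) = (1 + 2 * t) powr (- b)"
    proof -
      have "1 / sqrt (1 + 2 * t) = (1 + 2 * t) powr (- 1 / 2)"
        using t by (simp add: powr_half_sqrt[symmetric] powr_minus_divide[symmetric])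
      then have "(1 / sqrt (1 + 2 * t)) ^ (p + 1) = ((1 + 2 * t) powr (- 1 / 2)) powr (real (p + 1))"
        using t by (simp only: powr_realpow powr_gt_zero)
      also have "\<dots> = (1 + 2 * t) powr (- b)" unfolding powr_powr by (simp add: b_def field_simps)
      finally show ?thesis .
    qed
    finally show ?thesis .
  qed
  have "ennreal (Gamma a) * (\<integral>\<^sup>+g. inverse (ennreal (sqrt (q g))) ^ p \<partial>gauss I)
      = (\<integral>\<^sup>+g. ennreal (Gamma a) * inverse (ennreal (sqrt (q g))) ^ p \<partial>gauss I)"
    by (rule nn_integral_cmult[symmetric]) measurable
  also have "\<dots> \<le> (\<integral>\<^sup>+g. \<integral>\<^sup>+t. ennreal (pos_powr a t * exp (- (q g * t))) \<partial>lborel \<partial>gauss I)"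
    using inverse_power_le_Laplace[OF _ p, of "sqrt (q g)" for g] q0
    by (intro nn_integral_mono) (simp add: a_def)
  also have "\<dots> = (\<integral>\<^sup>+t. \<integral>\<^sup>+g. ennreal (pos_powr a t * exp (- (q g * t))) \<partial>gauss I \<partial>lborel)"
    by (rule P.Fubini') measurable
  also have "\<dots> = (\<integral>\<^sup>+t. ennreal (pos_powr a t * (1 + 2 * t) powr (- b)) \<partial>lborel)"
  proof (rule nn_integral_cong)
    fix t :: real
    show "(\<integral>\<^sup>+g. ennreal (pos_powr a t * exp (- (q g * t))) \<partial>gauss I) = ennreal (pos_powr a t * (1 + 2 * t) powr (- b))"
      by (cases "0 < t") (simp_all add: ennreal_mult' nn_integral_cmult mgf, simp_all add: pos_powr_def)
  qed
  finally have 1: "ennreal (Gamma a) * (\<integral>\<^sup>+g. inverse (ennreal (sqrt (q g))) ^ p \<partial>gauss I)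
      \<le> (\<integral>\<^sup>+t. ennreal (pos_powr a t * (1 + 2 * t) powr (- b)) \<partial>lborel)" .
  have "ennreal (Gamma b) * (\<integral>\<^sup>+t. ennreal (pos_powr a t * (1 + 2 * t) powr (- b)) \<partial>lborel)
     = (\<integral>\<^sup>+t. ennreal (Gamma b) * ennreal (pos_powr a t * (1 + 2 * t) powr (- b)) \<partial>lborel)"
    by (rule nn_integral_cmult[symmetric]) measurable
  also have "\<dots> = (\<integral>\<^sup>+t. \<integral>\<^sup>+u. ennreal (pos_powr a t * pos_powr b u * exp (- u) * exp (- (2 * u * t))) \<partial>lborel \<partial>lborel)"
  proof (rule nn_integral_cong)
    fix t :: real
    show "ennreal (Gamma b) * ennreal (pos_powr a t * (1 + 2 * t) powr (- b))
      = (\<integral>\<^sup>+u. ennreal (pos_powr a t * pos_powr b u * exp (- u) * exp (- (2 * u * t))) \<partial>lborel)"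
    proof (cases "0 < t")
      case True
      have "(\<integral>\<^sup>+u. ennreal (pos_powr a t * pos_powr b u * exp (- u) * exp (- (2 * u * t))) \<partial>lborel)
         = (\<integral>\<^sup>+u. ennreal (pos_powr a t) * ennreal (pos_powr b u * exp (- ((1 + 2 * t) * u))) \<partial>lborel)"
        by (intro nn_integral_cong) (simp add: ennreal_mult'[symmetric] mult.assoc exp_add[symmetric] algebra_simps)
      also have "\<dots> = ennreal (pos_powr a t) * ennreal (Gamma b / (1 + 2 * t) powr b)"
        using True ab by (simp add: nn_integral_cmult nn_integral_Gamma)
      finally show ?thesis using Gb by (simp add: ennreal_mult'[symmetric] powr_minus_divide mult.commute)
    qed (simp add: pos_powr_def)
  qed
  also have "\<dots> = (\<integral>\<^sup>+u. \<integral>\<^sup>+t. ennreal (pos_powr a t * pos_powr b u * exp (- u) * exp (- (2 * u * t))) \<partial>lborel \<partial>lborel)"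
    by (rule lborel_pair.Fubini') measurable
  also have "\<dots> = (\<integral>\<^sup>+u. ennreal (Gamma a / 2 powr a) * ennreal (pos_powr (1 / 2) u * exp (- (1 * u))) \<partial>lborel)"
  proof (rule nn_integral_cong)
    fix u :: real
    show "(\<integral>\<^sup>+t. ennreal (pos_powr a t * pos_powr b u * exp (- u) * exp (- (2 * u * t))) \<partial>lborel)
      = ennreal (Gamma a / 2 powr a) * ennreal (pos_powr (1 / 2) u * exp (- (1 * u)))"
    proof (cases "0 < u")
      case True
      have "(\<integral>\<^sup>+t. ennreal (pos_powr a t * pos_powr b u * exp (- u) * exp (- (2 * u * t))) \<partial>lborel)
         = (\<integral>\<^sup>+t. ennreal (pos_powr b u * exp (- u)) * ennreal (pos_powr a t * exp (- ((2 * u) * t))) \<partial>lborel)"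
        by (intro nn_integral_cong) (simp add: ennreal_mult'[symmetric] ac_simps)
      also have "\<dots> = ennreal (pos_powr b u * exp (- u)) * ennreal (Gamma a / (2 * u) powr a)"
        using True ab by (simp add: nn_integral_cmult nn_integral_Gamma)
      also have "\<dots> = ennreal (pos_powr b u * exp (- u) * (Gamma a / (2 * u) powr a))"
        by (simp add: ennreal_mult'[symmetric])
      also have "pos_powr b u * exp (- u) * (Gamma a / (2 * u) powr a)
         = (Gamma a / 2 powr a) * (pos_powr (1 / 2) u * exp (- (1 * u)))"
      proof -
        have "u powr (b - 1) / u powr a = u powr (1 / 2 - 1)"
        proof -
          have "b - 1 - a = 1 / 2 - 1" using ab(3) by linarith
          then show ?thesis by (simp only: powr_diff[symmetric])
        qed
        then show ?thesis using True by (simp add: pos_powr_def powr_mult field_simps)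
      qed
      also have "ennreal ((Gamma a / 2 powr a) * (pos_powr (1 / 2) u * exp (- (1 * u))))
          = ennreal (Gamma a / 2 powr a) * ennreal (pos_powr (1 / 2) u * exp (- (1 * u)))"
        by (rule ennreal_mult') (use Ga in simp)
      finally show ?thesis .
    qed (simp add: pos_powr_def)
  qed
  also have "\<dots> = ennreal (Gamma a / 2 powr a) * (\<integral>\<^sup>+u. ennreal (pos_powr (1 / 2) u * exp (- (1 * u))) \<partial>lborel)"
    by (rule nn_integral_cmult) measurable
  also have "\<dots> = ennreal (Gamma a / 2 powr a) * ennreal (Gamma (1 / 2) / 1 powr (1 / 2))"
    by (subst nn_integral_Gamma) simp_all
  finally have 2: "ennreal (Gamma b) * (\<integral>\<^sup>+t. ennreal (pos_powr a t * (1 + 2 * t) powr (- b)) \<partial>lborel)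
      = ennreal (Gamma a * sqrt pi / 2 powr a)"
    using Ga by (simp add: ennreal_mult'[symmetric] Gamma_one_half_real)
  have "ennreal (Gamma b * Gamma a) * (\<integral>\<^sup>+g. inverse (ennreal (sqrt (q g))) ^ p \<partial>gauss I)
      \<le> ennreal (Gamma a * sqrt pi / 2 powr a)"
    using mult_left_mono[OF 1, of "ennreal (Gamma b)"] 2 Ga Gb by (simp add: ennreal_mult' mult.assoc)
  also have "\<dots> = ennreal (Gamma b * Gamma a) * ennreal (inv_chi_moment p)"
    using Ga Gb by (simp add: ennreal_mult'[symmetric] inv_chi_moment_def a_def[symmetric] b_def[symmetric])
  finally show ?thesis
    using Ga Gb unfolding q_def by (subst (asm) ennreal_mult_le_mult_iff) simp_all
qed


lemma inv_chi_moment_pos: "0 < inv_chi_moment p"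
  by (simp add: inv_chi_moment_def Gamma_real_pos add_nonneg_pos)

lemma inv_chi_moment_add2: "inv_chi_moment (p + 2) = inv_chi_moment p / (real p + 1)"
proof -
  have G: "Gamma ((real p + 1) / 2 + 1) = (real p + 1) / 2 * Gamma ((real p + 1) / 2)"
    by (rule Gamma_plus1) (auto simp: nonpos_Ints_def)
  have A: "(real (p + 2) + 1) / 2 = (real p + 1) / 2 + 1" by (simp add: field_simps)
  have P: "(2::real) powr (real (p + 2) / 2) = 2 * 2 powr (real p / 2)"
    by (simp add: add_divide_distrib powr_add)
  show ?thesis unfolding inv_chi_moment_def A P G by simp
qed

lemma inv_chi_moment_0: "inv_chi_moment 0 = 1"
  by (simp add: inv_chi_moment_def Gamma_one_half_real)

lemma inv_chi_moment_1: "inv_chi_moment 1 = sqrt (pi / 2)"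
  by (simp add: inv_chi_moment_def powr_half_sqrt real_sqrt_divide)

lemma nn_integral_std_normal_abs_power:
  "(\<integral>\<^sup>+x. ennreal (\<bar>x\<bar> ^ p) \<partial>std_normal) = ennreal (1 / inv_chi_moment p)"
proof -
  have *: "(\<integral>\<^sup>+x. ennreal (\<bar>x\<bar> ^ p) \<partial>std_normal) = ennreal m"
    if "has_bochner_integral lborel (\<lambda>x. std_normal_density x * \<bar>x\<bar> ^ p) m" for m
  proof -
    have "(\<integral>\<^sup>+x. ennreal (std_normal_density x * \<bar>x\<bar> ^ p) \<partial>lborel) = ennreal m"
      using that by (subst nn_integral_eq_integral) (auto simp: has_bochner_integral_iff)
    then show ?thesis by (simp add: nn_integral_std_normal ennreal_mult')
  qed
  show ?thesis
  proof (cases "even p")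
    case True
    then obtain k where k: "p = 2 * k" by (elim evenE)
    have "fact (2 * k) / (2 ^ k * fact k) = 1 / inv_chi_moment (2 * k)" for k :: nat
    proof (induction k)
      case 0
      then show ?case by (simp add: inv_chi_moment_0)
    next
      case (Suc k)
      have "1 / inv_chi_moment (2 * Suc k) = (2 * real k + 1) * (1 / inv_chi_moment (2 * k))"
        using inv_chi_moment_add2[of "2 * k"] by simp
      also have "1 / inv_chi_moment (2 * k) = fact (2 * k) / (2 ^ k * fact k)" by (rule Suc.IH[symmetric])
      also have "(2 * real k + 1) * (fact (2 * k) / (2 ^ k * fact k)) = fact (2 * Suc k) / (2 ^ Suc k * fact (Suc k))"
        by (simp add: divide_simps)
      finally show ?case by (rule sym)
    qed
    moreover have "has_bochner_integral lborel (\<lambda>x. std_normal_density x * \<bar>x\<bar> ^ p) (fact (2 * k) / (2 ^ k * fact k))"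
      using std_normal_moment_even[of k] by (simp add: k power_mult)
    ultimately show ?thesis using * k by metis
  next
    case False
    then obtain k where k: "p = 2 * k + 1" by (elim oddE)
    have "sqrt (2 / pi) * 2 ^ k * fact k = 1 / inv_chi_moment (2 * k + 1)" for k :: nat
    proof (induction k)
      case 0
      then show ?case by (simp add: inv_chi_moment_1[simplified] real_sqrt_divide)
    next
      case (Suc k)
      have "1 / inv_chi_moment (2 * Suc k + 1) = (2 * real k + 2) * (1 / inv_chi_moment (2 * k + 1))"
        using inv_chi_moment_add2[of "2 * k + 1"] by simp
      also have "1 / inv_chi_moment (2 * k + 1) = sqrt (2 / pi) * 2 ^ k * fact k" by (rule Suc.IH[symmetric])
      also have "(2 * real k + 2) * (sqrt (2 / pi) * 2 ^ k * fact k) = sqrt (2 / pi) * 2 ^ Suc k * fact (Suc k)"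
        by (simp add: algebra_simps)
      finally show ?case by (rule sym)
    qed
    then show ?thesis using * std_normal_moment_abs_odd[of k] k by metis
  qed
qed

lemma sqrt_exp_half: "sqrt (exp x) = exp (x / 2)"
  by (rule real_sqrt_unique) (auto simp: power2_eq_square exp_add[symmetric])

text \<open>The bound comes from \<open>y \<le> exp (y - 1)\<close> at \<open>y = |g|\<^sup>2 / (card I + p)\<close>; this choice of scale makes
  the resulting Gaussian integral at most \<open>(card I + p)\<^bsup>p/2\<^esup>\<close>.\<close>

lemma gauss_norm_moment:
  assumes I: "finite I" "0 < card I" and p: "0 < p"
  shows "(\<integral>\<^sup>+g. ennreal (sqrt (\<Sum>i\<in>I. (g i)\<^sup>2) ^ p) \<partial>gauss I) \<le> ennreal (sqrt (real (card I + p)) ^ p)"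
proof -
  define k l where "k = real (card I)" and "l = real (card I + p)"
  have kl: "0 < k" "0 < l" "l = k + p" "k < l" using I p by (auto simp: k_def l_def)
  define c where "c = real p / (2 * l)"
  have c: "c < 1 / 2" using kl by (simp add: c_def field_simps)
  have 1: "1 - 2 * c = k / l" using kl by (simp add: c_def field_simps)
  have point: "sqrt z ^ p \<le> sqrt l ^ p * exp (- real p / 2) * exp (c * z)" if z: "0 \<le> z" for z
  proof -
    have "z / l \<le> exp (z / l - 1)" using exp_ge_add_one_self[of "z / l - 1"] by simp
    then have "z \<le> l * exp (z / l - 1)" using kl by (simp add: field_simps)
    then have "sqrt z \<le> sqrt (l * exp (z / l - 1))" by simp
    also have "\<dots> = sqrt l * exp ((z / l - 1) / 2)"
      by (simp add: real_sqrt_mult sqrt_exp_half) 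
    finally have "sqrt z ^ p \<le> (sqrt l * exp ((z / l - 1) / 2)) ^ p"
      using z by (intro power_mono) auto
    also have "\<dots> = sqrt l ^ p * exp (real p * ((z / l - 1) / 2))"
      by (simp only: power_mult_distrib exp_of_nat_mult)
    also have "real p * ((z / l - 1) / 2) = - real p / 2 + c * z" using kl by (simp add: c_def field_simps)
    finally show ?thesis by (simp only: exp_add mult.assoc)
  qed
  have "(\<integral>\<^sup>+g. ennreal (sqrt (\<Sum>i\<in>I. (g i)\<^sup>2) ^ p) \<partial>gauss I)
     \<le> (\<integral>\<^sup>+g. ennreal (sqrt l ^ p * exp (- real p / 2)) * ennreal (exp (c * (\<Sum>i\<in>I. (g i)\<^sup>2))) \<partial>gauss I)"
    using point kl by (intro nn_integral_mono) (simp add: ennreal_mult'[symmetric] sum_nonneg)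
  also have "\<dots> = ennreal (sqrt l ^ p * exp (- real p / 2)) * ennreal ((1 / sqrt (1 - 2 * c)) ^ card I)"
    using I by (subst nn_integral_cmult) (simp_all add: nn_integral_gauss_exp_square[OF _ c])
  also have "\<dots> = ennreal (sqrt l ^ p * exp (- real p / 2) * (1 / sqrt (1 - 2 * c)) ^ card I)"
    using kl by (simp add: ennreal_mult'[symmetric])
  also have "\<dots> \<le> ennreal (sqrt l ^ p)"
  proof (rule ennreal_leI)
    have "1 / sqrt (1 - 2 * c) = sqrt (l / k)" using kl by (simp add: 1 real_sqrt_divide)
    also have "\<dots> \<le> sqrt (exp (real p / k))"
      using kl exp_ge_add_one_self[of "real p / k"] by (simp add: add_divide_distrib)
    also have "\<dots> = exp (real p / k / 2)" by (simp add: sqrt_exp_half)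
    finally have "(1 / sqrt (1 - 2 * c)) ^ card I \<le> exp (real p / k / 2) ^ card I"
      using c by (intro power_mono) auto
    also have "\<dots> = exp (real p / 2)" using kl by (simp add: exp_of_nat_mult[symmetric] k_def)
    finally have "exp (- real p / 2) * (1 / sqrt (1 - 2 * c)) ^ card I \<le> exp (- real p / 2) * exp (real p / 2)"
      by (rule mult_left_mono) simp
    also have "\<dots> = 1" by (simp add: exp_add[symmetric])
    finally show "sqrt l ^ p * exp (- real p / 2) * (1 / sqrt (1 - 2 * c)) ^ card I \<le> sqrt l ^ p"
      using kl by (simp add: mult.assoc mult_left_le)
  qed
  finally show ?thesis by (simp add: l_def)
qed

text \<open>The difference of the two sides has derivative \<open>ln (1 - w\<^sup>2) \<le> 0\<close> and vanishes at \<open>0\<close>.\<close>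

lemma entropy_gap:
  fixes w :: real
  assumes "0 \<le> w" "w < 1"
  shows "(1 + w) * ln (1 + w) - (1 - w) * ln (1 - w) \<le> 2 * w"
proof -
  define f where "f w = (1 + w) * ln (1 + w) - (1 - w) * ln (1 - w) - 2 * w" for w :: real
  have "f w \<le> f 0"
  proof (rule DERIV_nonpos_imp_nonincreasing[OF assms(1)])
    fix x assume x: "0 \<le> x" "x \<le> w"
    have "(f has_real_derivative (ln (1 + x) + ln (1 - x))) (at x)"
    proof -
      have d1: "((\<lambda>w. (1 + w) * ln (1 + w)) has_real_derivative (ln (1 + x) + 1)) (at x)"
        using x by (auto intro!: derivative_eq_intros)
      have d2: "((\<lambda>w. (1 - w) * ln (1 - w)) has_real_derivative (- ln (1 - x) - 1)) (at x)"
        using x assms by (auto intro!: derivative_eq_intros)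
      have d3: "((\<lambda>w. 2 * w) has_real_derivative 2) (at x)"
        by (auto intro!: derivative_eq_intros)
      show ?thesis using DERIV_diff[OF DERIV_diff[OF d1 d2] d3] by (simp add: f_def[abs_def])
    qed
    moreover have "ln (1 + x) + ln (1 - x) \<le> 0"
    proof -
      have "ln (1 + x) + ln (1 - x) = ln ((1 + x) * (1 - x))" using x assms by (simp add: ln_mult)
      also have "\<dots> \<le> 0"
      proof -
        have "0 < (1 + x) * (1 - x)" using x assms by (intro mult_pos_pos) auto
        moreover have "(1 + x) * (1 - x) \<le> 1" by (simp add: algebra_simps)
        ultimately show ?thesis by (simp only: ln_le_zero_iff)
      qed
      finally show ?thesis .
    qed
    ultimately show "\<exists>y. (f has_real_derivative y) (at x) \<and> y \<le> 0" by blast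
  qed
  then show ?thesis by (simp add: f_def)
qed

lemma nat_step2_induct [consumes 1, case_names 2 3 step]:
  assumes "2 \<le> p" "P 2" "P 3" "\<And>q. 2 \<le> q \<Longrightarrow> P q \<Longrightarrow> P (q + 2)"
  shows "P (p :: nat)"
  using assms(1)
proof (induction p rule: less_induct)
  case (less p)
  consider "p = 2" | "p = 3" | "4 \<le> p" using less.prems by linarith
  then show ?case
  proof cases
    case 3
    then have "P ((p - 2) + 2)" by (intro assms(4) less.IH) auto
    moreover have "p - 2 + 2 = p" using 3 by simp
    ultimately show ?thesis by (simp only:)
  qed (use assms in auto)
qed

lemma exp_2_le: "exp 2 \<le> (7.4 :: real)"
proof -
  have "exp (2::real) = exp 1 * exp 1" by (simp add: exp_add[symmetric])
  also have "\<dots> \<le> (272 / 100) * (272 / 100)" using e_less_272 by (intro mult_mono) auto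
  finally show ?thesis by simp
qed

text \<open>Take logarithms and apply the previous entropy estimate at \<open>w = 1 / (q + 1)\<close>; the constant bounds
\<open>exp 2\<close>.\<close>

lemma power_add2_le:
  assumes q: "0 < q"
  shows "real (q + 2) ^ (q + 2) \<le> 7.4 * real q ^ q * real (q + 1) ^ 2"
proof -
  define w where "w = 1 / real (q + 1)"
  have w: "0 \<le> w" "w < 1" using q by (auto simp: w_def)
  have 1: "1 + w = real (q + 2) / real (q + 1)" "1 - w = real q / real (q + 1)"
    using q by (auto simp: w_def field_simps)
  have "real (q + 1) * ((1 + w) * ln (1 + w) - (1 - w) * ln (1 - w)) \<le> real (q + 1) * (2 * w)"
    using entropy_gap[OF w] by (intro mult_left_mono) auto
  moreover have "real (q + 1) * (1 + w) = real (q + 2)" "real (q + 1) * (1 - w) = real q" "real (q + 1) * (2 * w) = 2"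
    using q by (auto simp: w_def field_simps)
  ultimately have "real (q + 2) * ln (1 + w) - real q * ln (1 - w) \<le> 2"
    by (simp only: right_diff_distrib mult.assoc[symmetric])
  moreover have "ln (1 + w) = ln (real (q + 2)) - ln (real (q + 1))" "ln (1 - w) = ln (real q) - ln (real (q + 1))"
    unfolding 1 using q by (simp_all only: ln_div of_nat_0_less_iff) (auto simp: ln_div)
  ultimately have "real (q + 2) * ln (real (q + 2)) \<le> 2 + real q * ln (real q) + 2 * ln (real (q + 1))"
    by (simp add: algebra_simps)
  then have "exp (real (q + 2) * ln (real (q + 2))) \<le> exp (2 + real q * ln (real q) + real 2 * ln (real (q + 1)))"
    by simp
  also have "\<dots> = exp 2 * real q ^ q * real (q + 1) ^ 2"
    using q by (simp only: exp_add exp_of_nat_mult) simp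
  also have "exp (real (q + 2) * ln (real (q + 2))) = real (q + 2) ^ (q + 2)"
    by (simp only: exp_of_nat_mult) simp
  also have "exp 2 * real q ^ q * real (q + 1) ^ 2 \<le> 7.4 * real q ^ q * real (q + 1) ^ 2"
    using exp_2_le by (intro mult_right_mono) auto
  finally show ?thesis .
qed

text \<open>The quotient of successive terms of the same parity is at most \<open>7.4\<close> on the left-hand side, by the recursion
of the moments and \<open>power_add2_le\<close>, and equal to \<open>7.4\<close> on the right-hand side.\<close>

lemma inv_chi_moment_square_le:
  assumes "2 \<le> p"
  shows "(inv_chi_moment p)\<^sup>2 * real p ^ p \<le> sqrt 7.4 ^ p"
  using assms
proof (induction p rule: nat_step2_induct)
  case 2
  have "inv_chi_moment 2 = 1" using inv_chi_moment_add2[of 0] by (simp add: inv_chi_moment_0 numeral_2_eq_2)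
  then show ?case by simp
next
  case 3
  have "inv_chi_moment 3 = sqrt (pi / 2) / 2"
    using inv_chi_moment_add2[of 1] by (simp add: inv_chi_moment_1[simplified] numeral_3_eq_3)
  then have "(inv_chi_moment 3)\<^sup>2 = (sqrt (pi / 2) / 2)\<^sup>2" by (simp only:)
  also have "\<dots> = pi / 8" by (simp add: power_divide)
  finally have "(inv_chi_moment 3)\<^sup>2 * 3 ^ 3 = 27 * pi / 8" by simp
  also have "\<dots> \<le> 7.4 * 2.7" using pi_less_4 by simp
  also have "\<dots> \<le> 7.4 * sqrt 7.4" by (intro mult_left_mono real_le_rsqrt) (auto simp: power2_eq_square)
  also have "\<dots> = sqrt 7.4 ^ 3" by (simp add: power3_eq_cube)
  finally show ?case by simp
next
  case (step q)
  have "(inv_chi_moment (q + 2))\<^sup>2 * real (q + 2) ^ (q + 2) = (inv_chi_moment q)\<^sup>2 / real (q + 1) ^ 2 * real (q + 2) ^ (q + 2)"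
    by (simp only: inv_chi_moment_add2) (simp add: power_divide add.commute)
  also have "\<dots> \<le> (inv_chi_moment q)\<^sup>2 / real (q + 1) ^ 2 * (7.4 * real q ^ q * real (q + 1) ^ 2)"
    using power_add2_le[of q] step by (intro mult_left_mono) auto
  also have "\<dots> = 7.4 * ((inv_chi_moment q)\<^sup>2 * real q ^ q)" by simp
  also have "\<dots> \<le> 7.4 * sqrt 7.4 ^ q" using step.IH by (rule mult_left_mono) simp
  also have "\<dots> = sqrt 7.4 ^ (q + 2)" by (simp only: power_add) (simp add: power2_eq_square)
  finally show ?case .
qed


text \<open>From \<open>q\<close> to \<open>q + 2\<close> the left-hand side grows by a factor of at most \<open>exp 1 * (q + 2) / (q + 1)\<close>, which is below
\<open>3.2 * ln (q + 2)\<close>; the right-hand side grows by at least this factor.\<close>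

lemma inv_chi_moment_le:
  assumes "2 \<le> p"
  shows "inv_chi_moment p * sqrt (real p) ^ p \<le> sqrt (3.2 * ln (real p)) ^ p"
  using assms
proof (induction p rule: nat_step2_induct)
  case 2
  have "inv_chi_moment 2 = 1" using inv_chi_moment_add2[of 0] by (simp add: inv_chi_moment_0 numeral_2_eq_2)
  then show ?case using ln2_ge_two_thirds by simp
next
  case 3
  have "inv_chi_moment 3 = sqrt (pi / 2) / 2"
    using inv_chi_moment_add2[of 1] by (simp add: inv_chi_moment_1[simplified] numeral_3_eq_3)
  also have "\<dots> \<le> sqrt 4 / 2" using pi_less_4 by (intro divide_right_mono real_sqrt_le_mono) auto
  finally have 1: "inv_chi_moment 3 \<le> 1" by simp
  have "1 = ln (exp (1::real))" by simp
  also have "\<dots> \<le> ln 3" using exp_le by (intro ln_mono) auto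
  finally have "sqrt 3 \<le> sqrt (3.2 * ln 3)" by (intro real_sqrt_le_mono) auto
  then have "sqrt 3 ^ 3 \<le> sqrt (3.2 * ln 3) ^ 3" by (intro power_mono) auto
  moreover have "inv_chi_moment 3 * sqrt 3 ^ 3 \<le> 1 * sqrt 3 ^ 3" using 1 by (intro mult_right_mono) auto
  ultimately have "inv_chi_moment 3 * sqrt 3 ^ 3 \<le> sqrt (3.2 * ln 3) ^ 3" by linarith
  then show ?case by (simp only: of_nat_numeral)
next
  case (step q)
  have q: "0 < real q" using step by simp
  have "sqrt (real (q + 2)) ^ q \<le> exp 1 * sqrt (real q) ^ q"
  proof -
    have "real (q + 2) = real q * (1 + 2 / real q)" using q by (simp add: field_simps)
    also have "\<dots> \<le> real q * exp (2 / real q)" using q by (intro mult_left_mono exp_ge_add_one_self) auto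
    finally have "sqrt (real (q + 2)) \<le> sqrt (real q * exp (2 / real q))" by (rule real_sqrt_le_mono)
    also have "\<dots> = sqrt (real q) * exp (1 / real q)" by (simp add: real_sqrt_mult sqrt_exp_half)
    finally have "sqrt (real (q + 2)) ^ q \<le> (sqrt (real q) * exp (1 / real q)) ^ q"
      by (intro power_mono) auto
    also have "\<dots> = sqrt (real q) ^ q * exp (real q * (1 / real q))"
      by (simp only: power_mult_distrib exp_of_nat_mult)
    finally show ?thesis using q by (simp add: mult.commute)
  qed
  then have "inv_chi_moment (q + 2) * sqrt (real (q + 2)) ^ (q + 2)
      \<le> inv_chi_moment q / (real q + 1) * ((exp 1 * sqrt (real q) ^ q) * real (q + 2))"
    unfolding inv_chi_moment_add2 power_add using inv_chi_moment_pos[of q]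
    by (intro mult_left_mono mult_mono) (auto simp: less_imp_le)
  also have "\<dots> = (inv_chi_moment q * sqrt (real q) ^ q) * (exp 1 * (real (q + 2) / (real q + 1)))"
    by simp
  also have "\<dots> \<le> sqrt (3.2 * ln (real (q + 2))) ^ q * (3.2 * ln (real (q + 2)))"
  proof (rule mult_mono)
    have "sqrt (3.2 * ln (real q)) ^ q \<le> sqrt (3.2 * ln (real (q + 2))) ^ q"
      using q step by (intro power_mono) auto
    then show "inv_chi_moment q * sqrt (real q) ^ q \<le> sqrt (3.2 * ln (real (q + 2))) ^ q"
      using step.IH by linarith
    have "4 / 3 \<le> ln (2 * 2 :: real)" using ln2_ge_two_thirds by (subst ln_mult) auto
    also have "\<dots> \<le> ln (real (q + 2))" using step by (intro ln_mono) auto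
    finally have l: "4 / 3 \<le> ln (real (q + 2))" .
    have "real (q + 2) / (real q + 1) \<le> 4 / 3" using step q by (simp add: field_simps)
    then have "exp 1 * (real (q + 2) / (real q + 1)) \<le> (272 / 100) * (4 / 3)"
      using e_less_272 by (intro mult_mono) auto
    also have "\<dots> \<le> 3.2 * ln (real (q + 2))" using l by simp
    finally show "exp 1 * (real (q + 2) / (real q + 1)) \<le> 3.2 * ln (real (q + 2))" .
  qed (use q step in auto)
  also have "\<dots> = sqrt (3.2 * ln (real (q + 2))) ^ (q + 2)"
  proof -
    have "0 \<le> 3.2 * ln (real (q + 2))" using step by simp
    then show ?thesis by (simp only: power_add real_sqrt_pow2)
  qed
  finally show ?case .
qed

section \<open>Orthonormal systems and the real spectral theorem\<close>

definition ip :: "nat \<Rightarrow> (nat \<Rightarrow> real) \<Rightarrow> (nat \<Rightarrow> real) \<Rightarrow> real" where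
  "ip n u v = (\<Sum>c<n. u c * v c)"

definition orthonormal_rows :: "nat \<Rightarrow> nat \<Rightarrow> (nat \<Rightarrow> nat \<Rightarrow> real) \<Rightarrow> bool" where
  "orthonormal_rows r n U \<longleftrightarrow> (\<forall>i<r. \<forall>j<r. ip n (U i) (U j) = (if i = j then 1 else 0))"

lemma ip_commute: "ip n u v = ip n v u"
  by (simp add: ip_def mult.commute)

lemma ip_nonneg: "0 \<le> ip n u u"
  by (simp add: ip_def sum_nonneg)

lemma ip_eq_0_iff: "ip n u u = 0 \<longleftrightarrow> (\<forall>c<n. u c = 0)"
  by (auto simp: ip_def sum_nonneg_eq_0_iff)

lemma ip_scale: "ip n (\<lambda>c. a * u c) v = a * ip n u v" "ip n u (\<lambda>c. a * v c) = a * ip n u v"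
  by (simp_all add: ip_def sum_distrib_left ac_simps)

lemma ip_sum: "ip n (\<lambda>c. \<Sum>i\<in>I. u i c) w = (\<Sum>i\<in>I. ip n (u i) w)" "ip n w (\<lambda>c. \<Sum>i\<in>I. u i c) = (\<Sum>i\<in>I. ip n w (u i))"
  by (simp_all add: ip_def sum_distrib_left sum_distrib_right) (subst sum.swap, rule refl)+

lemma ip_cong: "(\<And>c. c < n \<Longrightarrow> u c = u' c) \<Longrightarrow> (\<And>c. c < n \<Longrightarrow> v c = v' c) \<Longrightarrow> ip n u v = ip n u' v'"
  by (simp add: ip_def)

lemma ip_square: "ip n u u = (\<Sum>c<n. (u c)\<^sup>2)"
  by (simp add: ip_def power2_eq_square)

lemma Cauchy_Schwarz_ip: "(ip n u v)\<^sup>2 \<le> ip n u u * ip n v v"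
  using Cauchy_Schwarz_ineq_sum[of u v "{..<n}"] by (simp add: ip_def power2_eq_square)

lemma ip_pos_iff: "0 < ip n u u \<longleftrightarrow> ip n u u \<noteq> 0"
  using ip_nonneg[of n u] by (auto simp: less_le)

lemma ip_normalize:
  assumes "ip n u u \<noteq> 0"
  shows "ip n (\<lambda>c. 1 / sqrt (ip n u u) * u c) (\<lambda>c. 1 / sqrt (ip n u u) * u c) = 1"
proof -
  define s where "s = sqrt (ip n u u)"
  have s: "s * s = ip n u u" "s \<noteq> 0" using assms ip_nonneg[of n u] by (simp_all add: s_def)
  have "ip n (\<lambda>c. 1 / s * u c) (\<lambda>c. 1 / s * u c) = 1 / s * (1 / s * (s * s))"
    unfolding ip_scale s(1) ..
  also have "\<dots> = 1" using s(2) by simp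
  finally show ?thesis by (simp only: s_def)
qed

text \<open>The matrix whose rows are the given vectors, padded with zero rows, is singular.\<close>

lemma exists_unit_orthogonal:
  assumes "j < n"
  shows "\<exists>u. ip n u u = 1 \<and> (\<forall>a<j. ip n (w a) u = 0)"
proof -
  define A :: "real mat" where "A = mat n n (\<lambda>(i, c). if i < j then w i c else 0)"
  have A: "A \<in> carrier_mat n n" by (simp add: A_def)
  have "transpose_mat A *\<^sub>v unit_vec n j = 0\<^sub>v n"
    using assms by (intro eq_vecI) (auto simp: A_def)
  moreover have "unit_vec n j \<noteq> (0\<^sub>v n :: real vec)" using assms by simp
  ultimately have "det (transpose_mat A) = 0"
    using A by (subst det_0_iff_vec_prod_zero_field[of _ n]) (auto intro!: exI[of _ "unit_vec n j"])
  then have "det A = 0" using A by (simp add: det_transpose)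
  then obtain v where v: "v \<in> carrier_vec n" "v \<noteq> 0\<^sub>v n" "A *\<^sub>v v = 0\<^sub>v n"
    using det_0_iff_vec_prod_zero_field[OF A] by blast
  define z where "z = (\<lambda>c. v $ c)"
  have orth: "ip n (w a) z = 0" if "a < j" for a
  proof -
    have "(A *\<^sub>v v) $ a = 0" using v that assms by simp
    then show ?thesis using that assms v(1)
      by (simp add: A_def scalar_prod_def ip_def z_def lessThan_atLeast0 cong: sum.cong_simp)
  qed
  have nz: "ip n z z \<noteq> 0"
  proof
    assume "ip n z z = 0"
    then have "v = 0\<^sub>v n" using v(1) by (intro eq_vecI) (auto simp: ip_eq_0_iff z_def)
    then show False using v(2) by simp
  qed
  let ?u = "\<lambda>c. 1 / sqrt (ip n z z) * z c"
  have "ip n ?u ?u = 1" by (rule ip_normalize[OF nz])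
  moreover have "\<forall>a<j. ip n (w a) ?u = 0" unfolding ip_scale using orth by simp
  ultimately show ?thesis by blast
qed

lemma orthonormal_extend:
  assumes U: "orthonormal_rows r n U" and "r + j < n"
  shows "\<exists>u. orthonormal_rows (Suc r) n (U(r := u)) \<and> (\<forall>a<j. ip n (w a) u = 0)"
proof -
  obtain u where u: "ip n u u = 1" "\<forall>a<r + j. ip n (if a < r then U a else w (a - r)) u = 0"
    using exists_unit_orthogonal[OF assms(2), of "\<lambda>a. if a < r then U a else w (a - r)"] by blast
  have 1: "ip n (U a) u = 0" if "a < r" for a using u(2)[rule_format, of a] that by simp
  have sw: "ip n u (U a) = 0" if "a < r" for a using 1[OF that] by (simp only: ip_commute[of n u "U a"])
  have 2: "ip n (w a) u = 0" if "a < j" for a using u(2)[rule_format, of "r + a"] that by simp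
  have "orthonormal_rows (Suc r) n (U(r := u))"
    using U u(1) 1 sw by (auto simp: orthonormal_rows_def less_Suc_eq)
  then show ?thesis using 2 by blast
qed

lemma orthonormal_completion:
  assumes U: "orthonormal_rows r n U" and "r \<le> n"
  shows "\<exists>U'. orthonormal_rows n n U' \<and> (\<forall>i<r. U' i = U i)"
proof -
  have "\<exists>U'. orthonormal_rows (r + t) n U' \<and> (\<forall>i<r. U' i = U i)" if "r + t \<le> n" for t
    using that
  proof (induction t)
    case 0
    then show ?case using U by auto
  next
    case (Suc t)
    then obtain U' where U': "orthonormal_rows (r + t) n U'" "\<forall>i<r. U' i = U i" by auto
    obtain u where "orthonormal_rows (Suc (r + t)) n (U'(r + t := u))"
      using orthonormal_extend[OF U'(1), of 0 undefined] Suc.prems by auto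
    then have "orthonormal_rows (r + Suc t) n (U'(r + t := u))" by (simp only: add_Suc_right)
    moreover have "\<forall>i<r. (U'(r + t := u)) i = U i" using U'(2) by auto
    ultimately show ?case by blast
  qed
  from this[of "n - r"] show ?thesis using assms(2) by simp
qed

text \<open>The first \<open>n - j\<close> members of the basis are chosen in the orthogonal complement of the \<open>j\<close> given vectors.\<close>

lemma orthonormal_basis_avoiding:
  assumes "j \<le> n"
  shows "\<exists>U. orthonormal_rows n n U \<and> (\<forall>i<n - j. \<forall>a<j. ip n (w a) (U i) = 0)"
proof -
  have "\<exists>U. orthonormal_rows t n U \<and> (\<forall>i<t. \<forall>a<j. ip n (w a) (U i) = 0)" if "t \<le> n - j" for t
    using that
  proof (induction t)
    case 0
    then show ?case by (auto simp: orthonormal_rows_def)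
  next
    case (Suc t)
    then obtain U where U: "orthonormal_rows t n U" "\<forall>i<t. \<forall>a<j. ip n (w a) (U i) = 0" by auto
    have "t + j < n" using Suc.prems assms by linarith
    from orthonormal_extend[OF U(1) this, of w]
    obtain u where "orthonormal_rows (Suc t) n (U(t := u))" "\<forall>a<j. ip n (w a) u = 0" by blast
    moreover have "\<forall>i<Suc t. \<forall>a<j. ip n (w a) ((U(t := u)) i) = 0"
      using U(2) calculation by (auto simp: less_Suc_eq)
    ultimately show ?case by blast
  qed
  from this[of "n - j"] obtain U where U: "orthonormal_rows (n - j) n U" "\<forall>i<n - j. \<forall>a<j. ip n (w a) (U i) = 0" by auto
  obtain U' where "orthonormal_rows n n U'" "\<forall>i<n - j. U' i = U i"
    using orthonormal_completion[OF U(1)] by auto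
  then show ?thesis using U(2) by auto
qed

lemma orthonormal_columns:
  assumes U: "orthonormal_rows n n U" and "a < n" "b < n"
  shows "(\<Sum>i<n. U i a * U i b) = (if a = b then 1 else 0)"
proof -
  define M where "M = mat n n (\<lambda>(i, c). U i c)"
  have M: "M \<in> carrier_mat n n" "transpose_mat M \<in> carrier_mat n n" by (simp_all add: M_def)
  have "M * transpose_mat M = 1\<^sub>m n"
    using U by (intro eq_matI) (auto simp: M_def scalar_prod_def orthonormal_rows_def ip_def lessThan_atLeast0)
  then have "transpose_mat M * M = 1\<^sub>m n" by (rule mat_mult_left_right_inverse[OF M])
  then have "(transpose_mat M * M) $$ (a, b) = (1\<^sub>m n) $$ (a, b)" by simp
  then show ?thesis using assms(2,3) by (simp add: M_def scalar_prod_def lessThan_atLeast0)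
qed

lemma ip_expand:
  assumes U: "orthonormal_rows n n U"
  shows "ip n x y = (\<Sum>i<n. ip n (U i) x * ip n (U i) y)"
proof -
  have "(\<Sum>i<n. ip n (U i) x * ip n (U i) y) = (\<Sum>i<n. \<Sum>a<n. \<Sum>b<n. (U i a * U i b) * (x a * y b))"
    by (simp add: ip_def sum_product ac_simps)
  also have "\<dots> = (\<Sum>a<n. \<Sum>b<n. \<Sum>i<n. (U i a * U i b) * (x a * y b))"
    by (subst sum.swap, rule sum.cong, rule refl, subst sum.swap, rule refl)
  also have "\<dots> = (\<Sum>a<n. \<Sum>b<n. (if a = b then 1 else 0) * (x a * y b))"
    using orthonormal_columns[OF U] by (simp add: sum_distrib_right[symmetric])
  also have "\<dots> = (\<Sum>a<n. x a * y a)"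
    by (intro sum.cong refl) (simp add: if_distrib[of "\<lambda>z. z * _"] cong: if_cong)
  finally show ?thesis by (simp add: ip_def)
qed

lemma vec_expand:
  assumes U: "orthonormal_rows n n U" and "c < n"
  shows "x c = (\<Sum>i<n. ip n (U i) x * U i c)"
proof -
  have "(\<Sum>i<n. ip n (U i) x * U i c) = (\<Sum>i<n. \<Sum>a<n. (U i a * U i c) * x a)"
    by (simp only: ip_def sum_distrib_right) (intro sum.cong refl, simp add: ac_simps)
  also have "\<dots> = (\<Sum>a<n. \<Sum>i<n. (U i a * U i c) * x a)" by (rule sum.swap)
  also have "\<dots> = (\<Sum>a<n. (if a = c then 1 else 0) * x a)"
    using orthonormal_columns[OF U _ assms(2)] by (simp add: sum_distrib_right[symmetric])
  also have "\<dots> = x c" using assms(2) by (simp add: if_distrib[of "\<lambda>z. z * _"] cong: if_cong)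
  finally show ?thesis by simp
qed


lemma ip_self_adjoint:
  fixes S :: "nat \<Rightarrow> nat \<Rightarrow> real"
  assumes sym: "\<And>i j. i < n \<Longrightarrow> j < n \<Longrightarrow> S i j = S j i"
  shows "ip n x (\<lambda>r. ip n (S r) y) = ip n (\<lambda>r. ip n (S r) x) y"
proof -
  have "ip n x (\<lambda>r. ip n (S r) y) = (\<Sum>r<n. \<Sum>c<n. x r * S r c * y c)"
    by (simp add: ip_def sum_distrib_left mult.assoc)
  also have "\<dots> = (\<Sum>c<n. \<Sum>r<n. x r * S r c * y c)" by (rule sum.swap)
  also have "\<dots> = (\<Sum>c<n. \<Sum>r<n. S c r * x r * y c)"
    by (intro sum.cong refl) (simp add: sym mult.commute)
  finally show ?thesis by (simp add: ip_def sum_distrib_right)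
qed

text \<open>A complex eigenvalue exists. Symmetry forces its imaginary part to vanish, and then the real or the imaginary part
of the eigenvector is a real eigenvector.\<close>

lemma symmetric_eigenvector_exists:
  fixes S :: "nat \<Rightarrow> nat \<Rightarrow> real"
  assumes n: "0 < n" and sym: "\<And>i j. i < n \<Longrightarrow> j < n \<Longrightarrow> S i j = S j i"
  shows "\<exists>d u. ip n u u = 1 \<and> (\<forall>r<n. ip n (S r) u = d * u r)"
proof -
  define C :: "complex mat" where "C = mat n n (\<lambda>(i, j). complex_of_real (S i j))"
  have C: "C \<in> carrier_mat n n" by (simp add: C_def)
  obtain z where "eigenvalue C z" using spectrum_non_empty[OF C n] by (auto simp: spectrum_def)
  then obtain v where v: "v \<in> carrier_vec n" "v \<noteq> 0\<^sub>v n" "C *\<^sub>v v = z \<cdot>\<^sub>v v"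
    using C by (auto simp: eigenvalue_def eigenvector_def)
  define x y where "x c = Re (v $ c)" and "y c = Im (v $ c)" for c
  define a b where "a = Re z" and "b = Im z"
  have eq: "(\<Sum>c<n. complex_of_real (S r c) * v $ c) = z * v $ r" if "r < n" for r
  proof -
    have "(C *\<^sub>v v) $ r = z * v $ r" using v that by simp
    then show ?thesis using that v(1) by (simp add: C_def scalar_prod_def lessThan_atLeast0)
  qed
  have re: "ip n (S r) x = a * x r - b * y r" if "r < n" for r
    using arg_cong[OF eq[OF that], of Re] by (simp add: ip_def x_def y_def a_def b_def)
  have im: "ip n (S r) y = a * y r + b * x r" if "r < n" for r
    using arg_cong[OF eq[OF that], of Im] by (simp add: ip_def x_def y_def a_def b_def)
  have "ip n y (\<lambda>r. ip n (S r) x) = ip n x (\<lambda>r. ip n (S r) y)"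
    using ip_self_adjoint[of n S y x, OF sym] ip_commute[of n x "\<lambda>r. ip n (S r) y"] by simp
  moreover have "ip n y (\<lambda>r. ip n (S r) x) = ip n y (\<lambda>r. a * x r - b * y r)"
    by (intro ip_cong refl re)
  moreover have "ip n y (\<lambda>r. a * x r - b * y r) = a * ip n x y - b * ip n y y"
    by (simp add: ip_def right_diff_distrib sum_subtractf sum_distrib_left ac_simps)
  moreover have "ip n x (\<lambda>r. ip n (S r) y) = ip n x (\<lambda>r. a * y r + b * x r)"
    by (intro ip_cong refl im)
  moreover have "ip n x (\<lambda>r. a * y r + b * x r) = a * ip n x y + b * ip n x x"
    by (simp add: ip_def distrib_left sum.distrib sum_distrib_left ac_simps)
  ultimately have "b * (ip n x x + ip n y y) = 0" by (simp add: algebra_simps)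
  moreover have nz: "ip n x x \<noteq> 0 \<or> ip n y y \<noteq> 0"
  proof (rule ccontr)
    assume "\<not> ?thesis"
    then have "v = 0\<^sub>v n" using v(1)
      by (intro eq_vecI) (auto simp: ip_eq_0_iff x_def y_def complex_eq_iff)
    then show False using v(2) by simp
  qed
  then have "ip n x x + ip n y y \<noteq> 0" using ip_nonneg[of n x] ip_nonneg[of n y] by linarith
  ultimately have b: "b = 0" by simp
  obtain w where w: "ip n w w \<noteq> 0" "\<And>r. r < n \<Longrightarrow> ip n (S r) w = a * w r"
    using nz re im b by auto
  let ?u = "\<lambda>c. 1 / sqrt (ip n w w) * w c"
  have "ip n ?u ?u = 1" by (rule ip_normalize[OF w(1)])
  moreover have "\<forall>r<n. ip n (S r) ?u = a * ?u r" unfolding ip_scale using w by simp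
  ultimately show ?thesis by blast
qed

text \<open>An orthonormal system of eigenvectors is extended one by one: the complement of the system is invariant
under \<open>S\<close>, and the restriction of \<open>S\<close> to it, in an orthonormal basis, is a smaller symmetric matrix.\<close>

lemma spectral_theorem:
  fixes S :: "nat \<Rightarrow> nat \<Rightarrow> real"
  assumes sym: "\<And>i j. i < n \<Longrightarrow> j < n \<Longrightarrow> S i j = S j i"
  shows "\<exists>U d. orthonormal_rows n n U \<and> (\<forall>i<n. \<forall>r<n. ip n (S r) (U i) = d i * U i r)"
proof -
  have self_adjoint: "ip n x (\<lambda>r. ip n (S r) y) = ip n (\<lambda>r. ip n (S r) x) y" for x y
    by (rule ip_self_adjoint) (rule sym)
  have "\<exists>U d. orthonormal_rows t n U \<and> (\<forall>i<t. \<forall>r<n. ip n (S r) (U i) = d i * U i r)" if "t \<le> n" for t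
    using that
  proof (induction t)
    case 0
    then show ?case by (auto simp: orthonormal_rows_def)
  next
    case (Suc t)
    then obtain U d where U: "orthonormal_rows t n U" "\<forall>i<t. \<forall>r<n. ip n (S r) (U i) = d i * U i r" by auto
    obtain V where V: "orthonormal_rows n n V" "\<forall>i<t. V i = U i"
      using orthonormal_completion[OF U(1)] Suc.prems by auto
    let ?m = "n - t"
    have m: "0 < ?m" using Suc.prems by simp
    \<comment> \<open>the restriction of \<open>S\<close> to the orthogonal complement of the eigenvectors found so far\<close>
    define T where "T i j = ip n (V (t + i)) (\<lambda>r. ip n (S r) (V (t + j)))" for i j
    have "T i j = T j i" for i j unfolding T_def by (subst self_adjoint) (rule ip_commute)
    then obtain e w where w: "ip ?m w w = 1" "\<forall>r<?m. ip ?m (T r) w = e * w r"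
      using symmetric_eigenvector_exists[OF m, of T] by blast
    define u where "u c = (\<Sum>j<?m. w j * V (t + j) c)" for c
    have Vu: "ip n (V i) u = (if i < t then 0 else w (i - t))" if "i < n" for i
    proof -
      have "ip n (V i) u = (\<Sum>j<?m. w j * ip n (V i) (V (t + j)))"
        unfolding u_def by (simp add: ip_sum ip_scale)
      also have "\<dots> = (\<Sum>j<?m. if i = t + j then w j else 0)"
        using V(1) that by (intro sum.cong refl) (auto simp: orthonormal_rows_def)
      also have "\<dots> = (if i < t then 0 else w (i - t))"
      proof (cases "i < t")
        case False
        then have "(\<Sum>j<?m. if i = t + j then w j else 0) = (\<Sum>j<?m. if j = i - t then w j else 0)"
          by (intro sum.cong refl) auto
        then show ?thesis using False that by simp
      qed simp
      finally show ?thesis .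
    qed
    have Su: "ip n (V i) (\<lambda>r. ip n (S r) u) = e * ip n (V i) u" if "i < n" for i
    proof (cases "i < t")
      case True
      have "ip n (V i) (\<lambda>r. ip n (S r) u) = ip n (\<lambda>r. ip n (S r) (V i)) u" by (rule self_adjoint)
      also have "\<dots> = ip n (\<lambda>r. d i * V i r) u"
        using U(2) V(2) True by (intro ip_cong) auto
      also have "\<dots> = d i * ip n (V i) u" by (rule ip_scale)
      finally show ?thesis using Vu[OF that] True by simp
    next
      case False
      have "ip n (V i) (\<lambda>r. ip n (S r) u) = (\<Sum>j<?m. w j * ip n (V i) (\<lambda>r. ip n (S r) (V (t + j))))"
        unfolding u_def by (simp add: ip_sum ip_scale)
      also have "\<dots> = ip ?m (T (i - t)) w"
        unfolding T_def using False by (subst ip_def) (simp add: mult.commute)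
      also have "\<dots> = e * w (i - t)" using w(2) that False by simp
      finally show ?thesis using Vu[OF that] False by simp
    qed
    have eig: "ip n (S r) u = e * u r" if "r < n" for r
    proof -
      have "ip n (S r) u = (\<Sum>i<n. ip n (V i) (\<lambda>r. ip n (S r) u) * V i r)"
        by (rule vec_expand[OF V(1) that])
      also have "\<dots> = e * (\<Sum>i<n. ip n (V i) u * V i r)"
        by (simp add: Su sum_distrib_left mult.assoc)
      also have "(\<Sum>i<n. ip n (V i) u * V i r) = u r" by (rule vec_expand[OF V(1) that, symmetric])
      finally show ?thesis .
    qed
    have "ip n u u = (\<Sum>i<n. ip n (V i) u * ip n (V i) u)" by (rule ip_expand[OF V(1)])
    also have "\<dots> = (\<Sum>i\<in>{t..<n}. w (i - t) * w (i - t))"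
      by (rule sum.mono_neutral_cong_right) (auto simp: Vu)
    also have "\<dots> = (\<Sum>j<?m. w j * w j)"
      by (rule sum.reindex_bij_witness[of _ "\<lambda>j. j + t" "\<lambda>i. i - t"]) (use Suc.prems in auto)
    also have "\<dots> = 1" using w(1) by (simp add: ip_def)
    finally have uu: "ip n u u = 1" .
    have "orthonormal_rows (Suc t) n (U(t := u))"
    proof -
      have "ip n (U i) u = 0 \<and> ip n u (U i) = 0" if "i < t" for i
        using Vu[of i] V(2) that Suc.prems ip_commute[of n u "U i"] by auto
      then show ?thesis using U(1) uu by (auto simp: orthonormal_rows_def less_Suc_eq)
    qed
    moreover have "\<forall>i<Suc t. \<forall>r<n. ip n (S r) ((U(t := u)) i) = (d(t := e)) i * (U(t := u)) i r"
      using U(2) eig by (auto simp: less_Suc_eq)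
    ultimately show ?case by blast
  qed
  then show ?thesis by blast
qed

lemma spectral_theorem_sorted:
  fixes S :: "nat \<Rightarrow> nat \<Rightarrow> real"
  assumes sym: "\<And>i j. i < n \<Longrightarrow> j < n \<Longrightarrow> S i j = S j i"
  shows "\<exists>U d. orthonormal_rows n n U \<and> (\<forall>i<n. \<forall>r<n. ip n (S r) (U i) = d i * U i r) \<and>
     (\<forall>i j. i \<le> j \<longrightarrow> j < n \<longrightarrow> d j \<le> d i)"
proof -
  obtain U d where U: "orthonormal_rows n n U" "\<forall>i<n. \<forall>r<n. ip n (S r) (U i) = d i * U i r"
    using spectral_theorem[of n S] sym by blast
  define xs where "xs = sort_key (\<lambda>i. - d i) [0..<n]"
  have xs: "length xs = n" "distinct xs" "set xs = {..<n}" by (auto simp: xs_def)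
  then have lt: "xs ! i < n" if "i < n" for i using that nth_mem[of i xs] by auto
  have "sorted (map (\<lambda>i. - d i) xs)" by (simp add: xs_def)
  then have "d (xs ! j) \<le> d (xs ! i)" if "i \<le> j" "j < n" for i j
    using that xs(1) by (auto simp: sorted_iff_nth_mono)
  moreover have "orthonormal_rows n n (\<lambda>i. U (xs ! i))"
    using U(1) xs lt by (auto simp: orthonormal_rows_def nth_eq_iff_index_eq)
  ultimately show ?thesis using U(2) lt
    by (intro exI[of _ "\<lambda>i. U (xs ! i)"] exI[of _ "\<lambda>i. d (xs ! i)"]) auto
qed

section \<open>The pseudoinverse of a wide Gaussian matrix\<close>

lemma nn_integral_gauss_union:
  assumes "finite I" "finite J" "I \<inter> J = {}" "f \<in> borel_measurable (Pi\<^sub>M (I \<union> J) (\<lambda>_. borel))"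
  shows "(\<integral>\<^sup>+g. f g \<partial>gauss (I \<union> J)) = (\<integral>\<^sup>+x. \<integral>\<^sup>+y. f (merge I J (x, y)) \<partial>gauss J \<partial>gauss I)"
  unfolding gauss_def using assms sets_gauss[of "I \<union> J"]
  by (intro std_normals.product_nn_integral_fold) (auto simp: gauss_def cong: measurable_cong_sets)

lemma gauss_orthogonal_rows:
  fixes n l :: nat
  assumes U: "orthonormal_rows n n U" and f: "f \<in> borel_measurable (Pi\<^sub>M ({..<n} \<times> {..<l}) (\<lambda>_. borel))"
  shows "(\<integral>\<^sup>+G. f (\<lambda>(i, c)\<in>{..<n} \<times> {..<l}. \<Sum>a<n. U i a * G (a, c)) \<partial>gauss ({..<n} \<times> {..<l}))
     = (\<integral>\<^sup>+G. f G \<partial>gauss ({..<n} \<times> {..<l}))"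
proof -
  define O' where "O' = (\<lambda>(i, c) (a, c'). if c = (c' :: nat) then U i a else 0)"
  have sum: "(\<Sum>z\<in>{..<n} \<times> {..<l}. O' (i, c) z * h z) = (\<Sum>a<n. U i a * h (a, c))" if "c < l" for i c and h :: "nat \<times> nat \<Rightarrow> real"
  proof -
    have "(\<Sum>z\<in>{..<n} \<times> {..<l}. O' (i, c) z * h z) = (\<Sum>a<n. \<Sum>c'<l. O' (i, c) (a, c') * h (a, c'))"
      by (simp add: sum.cartesian_product split_beta)
    also have "\<dots> = (\<Sum>a<n. \<Sum>c'<l. if c' = c then U i a * h (a, c) else 0)"
      by (intro sum.cong refl) (auto simp: O'_def)
    finally show ?thesis using that by simp
  qed
  have "orthonormal_on ({..<n} \<times> {..<l}) O'"
    unfolding orthonormal_on_def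
  proof (intro ballI)
    fix z z' assume zz: "z \<in> {..<n} \<times> {..<l}" "z' \<in> {..<n} \<times> {..<l}"
    obtain i c j c' where z: "z = (i, c)" "z' = (j, c')" by fastforce
    have "(\<Sum>x\<in>{..<n} \<times> {..<l}. O' z x * O' z' x) = (\<Sum>a<n. U i a * O' (j, c') (a, c))"
      unfolding z(1) by (subst sum) (use zz z in auto)
    also have "\<dots> = (if c = c' then ip n (U i) (U j) else 0)" by (simp add: O'_def ip_def)
    finally show "(\<Sum>x\<in>{..<n} \<times> {..<l}. O' z x * O' z' x) = (if z = z' then 1 else 0)"
      using U zz z by (auto simp: orthonormal_rows_def)
  qed
  from gauss_orthogonal[OF _ this f]
  have "(\<integral>\<^sup>+G. f (\<lambda>z\<in>{..<n} \<times> {..<l}. \<Sum>x\<in>{..<n} \<times> {..<l}. O' z x * G x) \<partial>gauss ({..<n} \<times> {..<l}))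
     = (\<integral>\<^sup>+G. f G \<partial>gauss ({..<n} \<times> {..<l}))" by simp
  moreover have "(\<lambda>z\<in>{..<n} \<times> {..<l}. \<Sum>x\<in>{..<n} \<times> {..<l}. O' z x * G x)
      = (\<lambda>(i, c)\<in>{..<n} \<times> {..<l}. \<Sum>a<n. U i a * G (a, c))" for G
    by (auto simp: fun_eq_iff restrict_def sum)
  ultimately show ?thesis by simp
qed

text \<open>The vector \<open>G\<^sup>T y\<close>, for the first \<open>k\<close> rows of \<open>G\<close>.\<close>

definition row_comb :: "nat \<Rightarrow> (nat \<Rightarrow> real) \<Rightarrow> (nat \<times> nat \<Rightarrow> real) \<Rightarrow> nat \<Rightarrow> real" where
  "row_comb k y G c = (\<Sum>i<k. y i * G (i, c))"

abbreviation vnorm :: "nat \<Rightarrow> (nat \<Rightarrow> real) \<Rightarrow> real" where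
  "vnorm n x \<equiv> sqrt (ip n x x)"

definition int_vec :: "int list \<Rightarrow> nat \<Rightarrow> real" where
  "int_vec zs i = (if i < length zs then of_int (zs ! i) else 0)"

text \<open>For independent rows this is the length of \<open>G\<^sup>\<dagger> x\<close>, in its dual form: the supremum of
\<open>|\<langle>x, y\<rangle>| / |G\<^sup>T y|\<close> over all \<open>y\<close>. The restriction to a countable set of \<open>y\<close> makes it visibly
measurable in \<open>x\<close> and \<open>G\<close>, and the extended value \<open>\<infinity>\<close> takes care of dependent rows.\<close>

definition pinv_norm :: "nat \<Rightarrow> nat \<Rightarrow> (nat \<Rightarrow> real) \<Rightarrow> (nat \<times> nat \<Rightarrow> real) \<Rightarrow> ennreal" where
  "pinv_norm k l x G =
     (SUP zs. ennreal \<bar>ip k x (int_vec zs)\<bar> / ennreal (vnorm l (row_comb k (int_vec zs) G)))"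

lemma borel_measurable_pinv_norm:
  assumes "\<And>i. i < k \<Longrightarrow> (\<lambda>\<omega>. x \<omega> i) \<in> borel_measurable M"
    and "\<And>i c. i < k \<Longrightarrow> c < l \<Longrightarrow> (\<lambda>\<omega>. G \<omega> (i, c)) \<in> borel_measurable M"
  shows "(\<lambda>\<omega>. pinv_norm k l (x \<omega>) (G \<omega>)) \<in> borel_measurable M"
  unfolding pinv_norm_def ip_def row_comb_def
  by (intro borel_measurable_SUP borel_measurable_divide_ennreal measurable_compose[OF _ measurable_ennreal]
      borel_measurable_sum borel_measurable_times borel_measurable_abs measurable_const
      measurable_compose[OF _ borel_measurable_sqrt] assms) auto

lemma ennreal_divide_le_iff:
  assumes "0 \<le> a" "0 \<le> b" "0 \<le> B"
  shows "ennreal a / ennreal b \<le> ennreal B \<longleftrightarrow> a \<le> B * b"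
proof (cases "b = 0")
  case True
  then show ?thesis using assms by (cases "a = 0") (auto simp: ennreal_divide_zero top_unique)
next
  case False
  then show ?thesis using assms by (simp add: divide_ennreal ennreal_le_iff pos_divide_le_eq)
qed

lemma pinv_norm_leI:
  assumes "0 \<le> B" "\<And>y. \<bar>ip k x y\<bar> \<le> B * vnorm l (row_comb k y G)"
  shows "pinv_norm k l x G \<le> ennreal B"
  unfolding pinv_norm_def
  by (intro SUP_least) (simp add: ennreal_divide_le_iff assms ip_nonneg)

lemma row_comb_scale: "row_comb k (\<lambda>i. a * y i) G = (\<lambda>c. a * row_comb k y G c)"
  by (auto simp: row_comb_def sum_distrib_left ac_simps)

lemma vnorm_scale: "vnorm n (\<lambda>c. a * u c) = \<bar>a\<bar> * vnorm n u"
  unfolding ip_scale by (simp add: real_sqrt_mult mult.assoc[symmetric])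

text \<open>Integer vectors suffice in the supremum: the quotient does not change under scaling, and
  multiples of integer vectors are dense.\<close>

lemma pinv_normD:
  assumes le: "pinv_norm k l x G \<le> ennreal B" and B: "0 \<le> B"
  shows "\<bar>ip k x y\<bar> \<le> B * vnorm l (row_comb k y G)"
proof -
  define z where "z N = (\<lambda>i. if i < k then of_int \<lfloor>real (Suc N) * y i\<rfloor> else 0 :: real)" for N
  define y' where "y' N = (\<lambda>i. 1 / real (Suc N) * z N i)" for N
  have int: "\<bar>ip k x (z N)\<bar> \<le> B * vnorm l (row_comb k (z N) G)" for N
  proof -
    have zs: "int_vec (map (\<lambda>i. \<lfloor>real (Suc N) * y i\<rfloor>) [0..<k]) = z N"
      by (auto simp: int_vec_def z_def fun_eq_iff)
    have "ennreal \<bar>ip k x (z N)\<bar> / ennreal (vnorm l (row_comb k (z N) G)) \<le> pinv_norm k l x G"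
      unfolding pinv_norm_def zs[symmetric] by (intro SUP_upper) simp
    also note le
    finally show ?thesis using B by (simp add: ennreal_divide_le_iff ip_nonneg)
  qed
  have scaled: "\<bar>ip k x (y' N)\<bar> \<le> B * vnorm l (row_comb k (y' N) G)" for N
  proof -
    have "\<bar>ip k x (y' N)\<bar> = \<bar>1 / real (Suc N)\<bar> * \<bar>ip k x (z N)\<bar>"
      unfolding y'_def ip_scale by (rule abs_mult)
    also have "\<dots> \<le> \<bar>1 / real (Suc N)\<bar> * (B * vnorm l (row_comb k (z N) G))"
      by (rule mult_left_mono[OF int]) simp
    also have "\<dots> = B * vnorm l (row_comb k (y' N) G)"
      unfolding y'_def row_comb_scale vnorm_scale by simp
    finally show ?thesis .
  qed
  have lim: "(\<lambda>N. y' N i) \<longlonglongrightarrow> y i" if "i < k" for i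
  proof (rule LIMSEQ_I)
    fix e :: real assume "0 < e"
    then obtain N0 where N0: "1 / real (Suc N0) < e" using nat_approx_posE by blast
    have "norm (y' N i - y i) < e" if "N0 \<le> N" for N
    proof -
      let ?t = "real (Suc N)"
      have "?t * y i - 1 < of_int \<lfloor>?t * y i\<rfloor>" "of_int \<lfloor>?t * y i\<rfloor> \<le> ?t * y i" by linarith+
      then have "\<bar>of_int \<lfloor>?t * y i\<rfloor> - ?t * y i\<bar> \<le> 1" by linarith
      moreover have "y' N i - y i = (of_int \<lfloor>?t * y i\<rfloor> - ?t * y i) / ?t"
        using \<open>i < k\<close> by (simp add: y'_def z_def field_simps)
      ultimately have "\<bar>y' N i - y i\<bar> \<le> 1 / ?t" by (simp add: divide_right_mono)
      also have "\<dots> \<le> 1 / real (Suc N0)" using that by (intro divide_left_mono) auto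
      finally show ?thesis using N0 by simp
    qed
    then show "\<exists>N0. \<forall>N\<ge>N0. norm (y' N i - y i) < e" by blast
  qed
  have "(\<lambda>N. \<bar>ip k x (y' N)\<bar>) \<longlonglongrightarrow> \<bar>ip k x y\<bar>"
    unfolding ip_def by (intro tendsto_rabs tendsto_sum tendsto_mult tendsto_const lim) simp
  moreover have "(\<lambda>N. B * vnorm l (row_comb k (y' N) G)) \<longlonglongrightarrow> B * vnorm l (row_comb k y G)"
    unfolding ip_def row_comb_def
    by (intro tendsto_mult tendsto_real_sqrt tendsto_sum tendsto_const lim) simp_all
  ultimately show ?thesis using scaled by (intro LIMSEQ_le) auto
qed

text \<open>Fix all rows but the first. The first row has \<open>p + 1\<close> independent standard Gaussian components along
orthonormal directions perpendicular to the others, and \<open>|G\<^sup>T y|\<close> is at least \<open>|y\<^sub>0|\<close> times the length of this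
component vector. So the quantity is bounded by a negative moment in dimension \<open>p + 1\<close>.\<close>

lemma pinv_norm_moment_first_unit:
  assumes k: "0 < k" and p: "0 < p" and l: "l = k + p"
  shows "(\<integral>\<^sup>+G. pinv_norm k l (\<lambda>i. if i = 0 then 1 else 0) G ^ p \<partial>gauss ({..<k} \<times> {..<l}))
      \<le> ennreal (inv_chi_moment p)"
proof -
  define I J :: "(nat \<times> nat) set" where "I = {1..<k} \<times> {..<l}" and "J = {0} \<times> {..<l}"
  have IJ: "{..<k} \<times> {..<l} = I \<union> J" "finite I" "finite J" "I \<inter> J = {}"
    using k by (auto simp: I_def J_def)
  define e0 where "e0 = (\<lambda>i::nat. if i = 0 then 1 else 0 :: real)"
  have ip_e0: "ip k e0 y = y 0" for y
    using k by (simp add: ip_def e0_def if_distrib[of "\<lambda>z. z * _"] cong: if_cong)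
  have meas: "(\<lambda>G. pinv_norm k l e0 G) \<in> borel_measurable (Pi\<^sub>M (I \<union> J) (\<lambda>_. borel))"
    unfolding IJ(1)[symmetric] by (rule borel_measurable_pinv_norm) auto
  have "(\<integral>\<^sup>+G. pinv_norm k l e0 G ^ p \<partial>gauss (I \<union> J))
     = (\<integral>\<^sup>+x. \<integral>\<^sup>+y. pinv_norm k l e0 (merge I J (x, y)) ^ p \<partial>gauss J \<partial>gauss I)"
    using IJ meas by (intro nn_integral_gauss_union) auto
  also have "\<dots> \<le> (\<integral>\<^sup>+x. ennreal (inv_chi_moment p) \<partial>gauss I)"
  proof (rule nn_integral_mono)
    fix x :: "nat \<times> nat \<Rightarrow> real"
    obtain U where U: "orthonormal_rows l l U"
      and perp: "\<forall>i<l - (k - 1). \<forall>a<k - 1. ip l (\<lambda>c. x (Suc a, c)) (U i) = 0"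
    proof -
      have "k - 1 \<le> l" using l by simp
      from orthonormal_basis_avoiding[OF this, of "\<lambda>a c. x (Suc a, c)"] that show ?thesis by blast
    qed
    define O' where "O' = (\<lambda>(z::nat, i) (z'::nat, c). U i c)"
    define h where "h g = inverse (ennreal (sqrt (\<Sum>z\<in>{0} \<times> {..<p + 1}. (g z)\<^sup>2))) ^ p" for g :: "nat \<times> nat \<Rightarrow> real"
    have sub: "{0} \<times> {..<p + 1} \<subseteq> J" using k l by (auto simp: J_def)
    have comp: "(\<lambda>g. g z) \<in> borel_measurable (Pi\<^sub>M J (\<lambda>_. borel :: real measure))" if "z \<in> {0} \<times> {..<p + 1}" for z
      using that sub by auto
    have hm: "h \<in> borel_measurable (Pi\<^sub>M J (\<lambda>_. borel))"
      unfolding h_def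
      by (intro borel_measurable_power_ennreal borel_measurable_inverse_ennreal
          measurable_compose[OF _ measurable_ennreal] measurable_compose[OF _ borel_measurable_sqrt]
          borel_measurable_sum borel_measurable_power comp)
    have sum0: "(\<Sum>z\<in>{0} \<times> {..<q}. f z) = (\<Sum>c<q. f (0, c))" for f :: "nat \<times> nat \<Rightarrow> real" and q
    proof -
      have "(\<Sum>z\<in>{0} \<times> {..<q}. f z) = (\<Sum>a\<in>{0}. \<Sum>c<q. f (a, c))"
        by (simp only: sum.cartesian_product case_prod_eta)
      then show ?thesis by simp
    qed
    then have sumJ: "(\<Sum>z\<in>J. f z) = (\<Sum>c<l. f (0, c))" for f :: "nat \<times> nat \<Rightarrow> real"
      unfolding J_def .
    have O': "orthonormal_on J O'"
      using U unfolding orthonormal_on_def sumJ by (auto simp: J_def O'_def orthonormal_rows_def ip_def)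
    have "(\<integral>\<^sup>+y. pinv_norm k l e0 (merge I J (x, y)) ^ p \<partial>gauss J)
        \<le> (\<integral>\<^sup>+y. h (\<lambda>z\<in>J. \<Sum>z'\<in>J. O' z z' * y z') \<partial>gauss J)"
    proof (rule nn_integral_mono)
      fix y
      let ?G = "merge I J (x, y)"
      define s where "s = (\<Sum>i<p + 1. (ip l (U i) (\<lambda>c. y (0, c)))\<^sup>2)"
      have s0: "0 \<le> s" by (simp add: s_def sum_nonneg)
      have hs: "h (\<lambda>z\<in>J. \<Sum>z'\<in>J. O' z z' * y z') = inverse (ennreal (sqrt s)) ^ p"
      proof -
        have "(\<Sum>z\<in>{0} \<times> {..<p + 1}. ((\<lambda>z\<in>J. \<Sum>z'\<in>J. O' z z' * y z') z)\<^sup>2) = s"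
          unfolding s_def sumJ sum0 using sub
          by (intro sum.cong refl) (auto simp: O'_def ip_def)
        then show ?thesis by (simp only: h_def)
      qed
      have "pinv_norm k l e0 ?G \<le> inverse (ennreal (sqrt s))"
      proof (cases "s = 0")
        case False
        then have spos: "0 < s" using s0 by simp
        have "pinv_norm k l e0 ?G \<le> ennreal (1 / sqrt s)"
        proof (rule pinv_norm_leI)
          fix w
          have rc: "ip l (U i) (row_comb k w ?G) = w 0 * ip l (U i) (\<lambda>c. y (0, c))" if "i < p + 1" for i
          proof -
            have "ip l (U i) (row_comb k w ?G) = (\<Sum>a<k. w a * ip l (U i) (\<lambda>c. ?G (a, c)))"
              unfolding row_comb_def[abs_def] ip_sum ip_scale ..
            also have "\<dots> = (\<Sum>a<k. if a = 0 then w 0 * ip l (U i) (\<lambda>c. y (0, c)) else 0)"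
            proof (intro sum.cong refl)
              fix a assume a: "a \<in> {..<k}"
              show "w a * ip l (U i) (\<lambda>c. ?G (a, c)) = (if a = 0 then w 0 * ip l (U i) (\<lambda>c. y (0, c)) else 0)"
              proof (cases "a = 0")
                case True
                have "ip l (U i) (\<lambda>c. ?G (0, c)) = ip l (U i) (\<lambda>c. y (0, c))"
                  by (intro ip_cong) (auto simp: merge_def I_def J_def)
                then show ?thesis using True by simp
              next
                case False
                then obtain a' where a': "a = Suc a'" "a' < k - 1" using a by (cases a) auto
                have "ip l (U i) (\<lambda>c. ?G (a, c)) = ip l (U i) (\<lambda>c. x (Suc a', c))"
                  using a a' by (intro ip_cong) (auto simp: merge_def I_def J_def)
                also have "\<dots> = ip l (\<lambda>c. x (Suc a', c)) (U i)" by (rule ip_commute)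
                also have "\<dots> = 0" using perp that a' k l by auto
                finally show ?thesis using False by simp
              qed
            qed
            finally show ?thesis using k by simp
          qed
          have "(w 0)\<^sup>2 * s = (\<Sum>i<p + 1. (ip l (U i) (row_comb k w ?G))\<^sup>2)"
            unfolding s_def sum_distrib_left by (intro sum.cong refl) (simp add: rc power_mult_distrib)
          also have "\<dots> \<le> (\<Sum>i<l. (ip l (U i) (row_comb k w ?G))\<^sup>2)"
            using k l by (intro sum_mono2) auto
          also have "\<dots> = ip l (row_comb k w ?G) (row_comb k w ?G)"
            by (subst ip_expand[OF U]) (simp add: power2_eq_square)
          finally have "sqrt ((w 0)\<^sup>2 * s) \<le> vnorm l (row_comb k w ?G)" by simp
          then have "\<bar>w 0\<bar> * sqrt s \<le> vnorm l (row_comb k w ?G)" by (simp add: real_sqrt_mult)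
          then show "\<bar>ip k e0 w\<bar> \<le> 1 / sqrt s * vnorm l (row_comb k w ?G)"
            using spos by (simp add: ip_e0 field_simps)
        qed (use spos in simp)
        also have "ennreal (1 / sqrt s) = inverse (ennreal (sqrt s))"
          using spos by (simp add: inverse_ennreal divide_inverse)
        finally show ?thesis .
      qed simp
      then show "pinv_norm k l e0 ?G ^ p \<le> h (\<lambda>z\<in>J. \<Sum>z'\<in>J. O' z z' * y z')"
        unfolding hs by (rule power_mono_ennreal)
    qed
    also have "\<dots> = (\<integral>\<^sup>+y. h y \<partial>gauss J)" by (rule gauss_orthogonal[OF IJ(3) O' hm])
    also have "\<dots> \<le> ennreal (inv_chi_moment p)"
      unfolding h_def by (rule gauss_inverse_moment[OF IJ(3) sub _ p]) (simp add: card_cartesian_product)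
    finally show "(\<integral>\<^sup>+y. pinv_norm k l e0 (merge I J (x, y)) ^ p \<partial>gauss J) \<le> ennreal (inv_chi_moment p)" .
  qed
  also have "\<dots> = ennreal (inv_chi_moment p)" by (simp add: emeasure_gauss_space)
  finally show ?thesis unfolding IJ(1) e0_def .
qed

text \<open>An orthogonal transformation of the rows carries the direction of \<open>x\<close> to the first unit vector and
preserves the law of \<open>G\<close>.\<close>

lemma pinv_norm_moment:
  assumes k: "0 < k" and p: "0 < p" and l: "l = k + p"
  shows "(\<integral>\<^sup>+G. pinv_norm k l x G ^ p \<partial>gauss ({..<k} \<times> {..<l})) \<le> ennreal (vnorm k x ^ p * inv_chi_moment p)"
proof (cases "ip k x x = 0")
  case True
  have "pinv_norm k l x G \<le> ennreal 0" for G
  proof (rule pinv_norm_leI)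
    fix y
    have "ip k x y = 0" using True[unfolded ip_eq_0_iff] by (simp add: ip_def)
    then show "\<bar>ip k x y\<bar> \<le> 0 * vnorm l (row_comb k y G)" by simp
  qed simp
  then have "pinv_norm k l x G = 0" for G by (simp add: le_zero_eq)
  then show ?thesis using p by (simp add: power_0_left)
next
  case False
  define u where "u = (\<lambda>c. 1 / vnorm k x * x c)"
  have uu: "ip k u u = 1" unfolding u_def by (rule ip_normalize[OF False])
  have xu: "x = (\<lambda>c. vnorm k x * u c)" using False by (auto simp: u_def fun_eq_iff)
  have "orthonormal_rows 1 k (\<lambda>_. u)" using uu by (simp add: orthonormal_rows_def)
  then obtain U where U: "orthonormal_rows k k U" "U 0 = u"
    using orthonormal_completion[of 1 k "\<lambda>_. u"] k by auto
  define e0 where "e0 = (\<lambda>i::nat. if i = 0 then 1 else 0 :: real)"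
  have ip_e0: "ip k e0 y = y 0" for y
    using k by (simp add: ip_def e0_def if_distrib[of "\<lambda>z. z * _"] cong: if_cong)
  define T where "T G = (\<lambda>(i, c)\<in>{..<k} \<times> {..<l}. \<Sum>a<k. U i a * G (a, c))" for G :: "nat \<times> nat \<Rightarrow> real"
  have le: "pinv_norm k l x G \<le> ennreal (vnorm k x) * pinv_norm k l e0 (T G)" for G
  proof (cases "pinv_norm k l e0 (T G)" rule: ennreal_cases)
    case (real B)
    have "pinv_norm k l x G \<le> ennreal (vnorm k x * B)"
    proof (rule pinv_norm_leI)
      fix y
      define w where "w i = ip k (U i) y" for i
      have "row_comb k w (T G) c = row_comb k y G c" if "c < l" for c
      proof -
        have "row_comb k w (T G) c = (\<Sum>i<k. \<Sum>a<k. (w i * U i a) * G (a, c))"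
          using that by (simp add: row_comb_def T_def sum_distrib_left mult.assoc)
        also have "\<dots> = (\<Sum>a<k. \<Sum>i<k. (w i * U i a) * G (a, c))" by (rule sum.swap)
        also have "\<dots> = (\<Sum>a<k. y a * G (a, c))"
        proof (intro sum.cong refl)
          fix a assume "a \<in> {..<k}"
          then have "y a = (\<Sum>i<k. w i * U i a)" unfolding w_def by (intro vec_expand[OF U(1)]) simp
          then show "(\<Sum>i<k. (w i * U i a) * G (a, c)) = y a * G (a, c)" by (simp add: sum_distrib_right)
        qed
        finally show ?thesis by (simp add: row_comb_def)
      qed
      then have n: "vnorm l (row_comb k w (T G)) = vnorm l (row_comb k y G)"
        by (intro arg_cong[of _ _ sqrt] ip_cong) auto
      have "\<bar>ip k e0 w\<bar> \<le> B * vnorm l (row_comb k w (T G))"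
        using real by (intro pinv_normD) auto
      then have "\<bar>ip k u y\<bar> \<le> B * vnorm l (row_comb k y G)"
        by (simp add: ip_e0 w_def U(2) n)
      then have "vnorm k x * \<bar>ip k u y\<bar> \<le> vnorm k x * (B * vnorm l (row_comb k y G))"
        by (rule mult_left_mono) (simp add: ip_nonneg)
      moreover have "ip k x y = vnorm k x * ip k u y"
        by (subst xu) (rule ip_scale)
      ultimately show "\<bar>ip k x y\<bar> \<le> vnorm k x * B * vnorm l (row_comb k y G)"
        by (simp add: abs_mult ip_nonneg mult.assoc)
    qed (use real in \<open>simp add: ip_nonneg\<close>)
    then show ?thesis using real by (simp add: ennreal_mult ip_nonneg)
  next
    case top
    have "0 < ip k x x" using False by (simp add: ip_pos_iff)
    then show ?thesis using top by (simp add: ennreal_mult_top)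
  qed
  have em: "(\<lambda>G. pinv_norm k l e0 G) \<in> borel_measurable (Pi\<^sub>M ({..<k} \<times> {..<l}) (\<lambda>_. borel))"
    by (rule borel_measurable_pinv_norm) auto
  have Tm: "T \<in> measurable (Pi\<^sub>M ({..<k} \<times> {..<l}) (\<lambda>_. borel)) (Pi\<^sub>M ({..<k} \<times> {..<l}) (\<lambda>_. borel))"
    unfolding T_def by (rule measurable_restrict) (auto simp: split_beta)
  have "(\<integral>\<^sup>+G. pinv_norm k l x G ^ p \<partial>gauss ({..<k} \<times> {..<l}))
     \<le> (\<integral>\<^sup>+G. (ennreal (vnorm k x) * pinv_norm k l e0 (T G)) ^ p \<partial>gauss ({..<k} \<times> {..<l}))"
    by (intro nn_integral_mono power_mono_ennreal le)
  also have "\<dots> = (\<integral>\<^sup>+G. ennreal (vnorm k x ^ p) * pinv_norm k l e0 (T G) ^ p \<partial>gauss ({..<k} \<times> {..<l}))"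
    by (simp add: power_mult_distrib ennreal_power ip_nonneg)
  also have "\<dots> = ennreal (vnorm k x ^ p) * (\<integral>\<^sup>+G. pinv_norm k l e0 (T G) ^ p \<partial>gauss ({..<k} \<times> {..<l}))"
    using measurable_compose[OF Tm em] by (intro nn_integral_cmult) auto
  also have "(\<integral>\<^sup>+G. pinv_norm k l e0 (T G) ^ p \<partial>gauss ({..<k} \<times> {..<l}))
     = (\<integral>\<^sup>+G. pinv_norm k l e0 G ^ p \<partial>gauss ({..<k} \<times> {..<l}))"
    unfolding T_def using em by (intro gauss_orthogonal_rows[OF U(1)]) auto
  also have "ennreal (vnorm k x ^ p) * \<dots> \<le> ennreal (vnorm k x ^ p) * ennreal (inv_chi_moment p)"
    using pinv_norm_moment_first_unit[OF k p l] by (intro mult_left_mono) (auto simp: e0_def)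
  also have "\<dots> = ennreal (vnorm k x ^ p * inv_chi_moment p)"
    using inv_chi_moment_pos[of p] by (simp add: ennreal_mult ip_nonneg)
  finally show ?thesis .
qed

section \<open>The right inverse of a matrix with independent rows\<close>

lemma borel_measurable_det:
  assumes "\<And>\<omega>. A \<omega> \<in> carrier_mat n n"
    and "\<And>i j. i < n \<Longrightarrow> j < n \<Longrightarrow> (\<lambda>\<omega>. A \<omega> $$ (i, j) :: real) \<in> borel_measurable M"
  shows "(\<lambda>\<omega>. det (A \<omega>)) \<in> borel_measurable M"
proof -
  have "(\<lambda>\<omega>. det (A \<omega>)) = (\<lambda>\<omega>. \<Sum>q | q permutes {0..<n}. signof q * (\<Prod>i = 0..<n. A \<omega> $$ (i, q i)))"
    using det_def'[OF assms(1)] by (intro ext)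
  also have "\<dots> \<in> borel_measurable M"
  proof (intro borel_measurable_sum borel_measurable_times borel_measurable_prod measurable_const)
    fix q i assume "q \<in> {q. q permutes {0..<n}}" "i \<in> {0..<n}"
    then have "q i < n" "i < n" using permutes_in_image[of q "{0..<n}" i] by auto
    then show "(\<lambda>\<omega>. A \<omega> $$ (i, q i)) \<in> borel_measurable M" by (intro assms(2))
  qed simp
  finally show ?thesis .
qed

definition gram :: "nat \<Rightarrow> nat \<Rightarrow> (nat \<times> nat \<Rightarrow> real) \<Rightarrow> real mat" where
  "gram k l G = mat k k (\<lambda>(i, j). \<Sum>c<l. G (i, c) * G (j, c))"

text \<open>The right inverse \<open>G\<^sup>T (G G\<^sup>T)\<^sup>-\<^sup>1\<close> through the adjugate, so that its entries are visibly
  measurable functions of the entries of \<open>G\<close>; where \<open>G G\<^sup>T\<close> is singular it is zero.\<close>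

definition right_inv :: "nat \<Rightarrow> nat \<Rightarrow> (nat \<times> nat \<Rightarrow> real) \<Rightarrow> nat \<Rightarrow> nat \<Rightarrow> real" where
  "right_inv k l G c j = (\<Sum>i<k. G (i, c) * adj_mat (gram k l G) $$ (i, j)) / det (gram k l G)"

lemma gram_carrier [simp]: "gram k l G \<in> carrier_mat k k"
  by (simp add: gram_def)

lemma borel_measurable_right_inv:
  assumes G: "\<And>i c. i < k \<Longrightarrow> c < l \<Longrightarrow> (\<lambda>\<omega>. G \<omega> (i, c)) \<in> borel_measurable M"
    and "c < l" "j < k"
  shows "(\<lambda>\<omega>. right_inv k l (G \<omega>) c j) \<in> borel_measurable M"
proof -
  have gm: "(\<lambda>\<omega>. gram k l (G \<omega>) $$ (i, j)) \<in> borel_measurable M" if "i < k" "j < k" for i j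
    using that by (simp add: gram_def) (intro borel_measurable_sum borel_measurable_times G, auto)
  have "(\<lambda>\<omega>. det (mat_delete (gram k l (G \<omega>)) j i)) \<in> borel_measurable M" if "i < k" for i
  proof (rule borel_measurable_det[of _ "k - 1"])
    show "mat_delete (gram k l (G \<omega>)) j i \<in> carrier_mat (k - 1) (k - 1)" for \<omega>
      by (rule mat_delete_carrier) simp
    fix a b assume ab: "a < k - 1" "b < k - 1"
    have "mat_delete (gram k l (G \<omega>)) j i $$ (a, b)
        = gram k l (G \<omega>) $$ (if a < j then a else Suc a, if b < i then b else Suc b)" for \<omega>
      using ab by (simp add: mat_delete_def gram_def)
    then show "(\<lambda>\<omega>. mat_delete (gram k l (G \<omega>)) j i $$ (a, b)) \<in> borel_measurable M"
      using ab by (simp only:) (rule gm, auto)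
  qed
  then have "(\<lambda>\<omega>. adj_mat (gram k l (G \<omega>)) $$ (i, j)) \<in> borel_measurable M" if "i < k" for i
    using that assms(3) by (simp add: adj_mat_def cofactor_def carrier_matD[OF gram_carrier])
  moreover have "(\<lambda>\<omega>. det (gram k l (G \<omega>))) \<in> borel_measurable M"
    by (rule borel_measurable_det[of _ k]) (auto intro: gm)
  ultimately show ?thesis
    unfolding right_inv_def using G assms(2)
    by (intro borel_measurable_divide borel_measurable_sum borel_measurable_times) auto
qed

lemma right_inv_cong:
  assumes "\<And>i c. i < k \<Longrightarrow> c < l \<Longrightarrow> G (i, c) = G' (i, c)" "c < l"
  shows "right_inv k l G c j = right_inv k l G' c j"
proof -
  have "gram k l G = gram k l G'" using assms(1) by (auto simp: gram_def intro!: eq_matI)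
  then show ?thesis using assms by (simp add: right_inv_def)
qed

lemma gram_mult:
  assumes "i < k"
  shows "(\<Sum>a<k. gram k l G $$ (i, a) * z a) = (\<Sum>c<l. G (i, c) * row_comb k z G c)"
proof -
  have "(\<Sum>a<k. gram k l G $$ (i, a) * z a) = (\<Sum>a<k. \<Sum>c<l. G (i, c) * (z a * G (a, c)))"
    using assms by (intro sum.cong refl) (simp add: gram_def sum_distrib_left ac_simps)
  also have "\<dots> = (\<Sum>c<l. \<Sum>a<k. G (i, c) * (z a * G (a, c)))" by (rule sum.swap)
  finally show ?thesis by (simp add: row_comb_def sum_distrib_left)
qed

lemma ip_gram: "ip k y (\<lambda>i. \<Sum>a<k. gram k l G $$ (i, a) * z a) = ip l (row_comb k y G) (row_comb k z G)"
proof -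
  have "ip k y (\<lambda>i. \<Sum>a<k. gram k l G $$ (i, a) * z a) = (\<Sum>i<k. \<Sum>c<l. (y i * G (i, c)) * row_comb k z G c)"
    unfolding ip_def by (intro sum.cong refl) (simp add: gram_mult sum_distrib_left mult.assoc)
  also have "\<dots> = (\<Sum>c<l. \<Sum>i<k. (y i * G (i, c)) * row_comb k z G c)" by (rule sum.swap)
  finally show ?thesis by (simp add: ip_def row_comb_def sum_distrib_right)
qed

lemma det_gram_nonzero:
  assumes nondeg: "\<And>y. (\<forall>c<l. row_comb k y G c = 0) \<Longrightarrow> \<forall>i<k. y i = 0"
  shows "det (gram k l G) \<noteq> 0"
proof
  assume "det (gram k l G) = 0"
  then obtain v where v: "v \<in> carrier_vec k" "v \<noteq> 0\<^sub>v k" "gram k l G *\<^sub>v v = 0\<^sub>v k"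
    using det_0_iff_vec_prod_zero_field[OF gram_carrier] by blast
  define y where "y i = v $ i" for i
  have "(\<Sum>a<k. gram k l G $$ (i, a) * y a) = 0" if "i < k" for i
  proof -
    have "(gram k l G *\<^sub>v v) $ i = 0" using v that by simp
    then show ?thesis using v(1) that carrier_matD[OF gram_carrier[of k l G]]
      by (simp add: scalar_prod_def y_def lessThan_atLeast0)
  qed
  then have "ip k y (\<lambda>i. \<Sum>a<k. gram k l G $$ (i, a) * y a) = 0" by (simp add: ip_def)
  then have "ip l (row_comb k y G) (row_comb k y G) = 0" by (simp add: ip_gram)
  then have "\<forall>i<k. y i = 0" by (intro nondeg) (simp add: ip_eq_0_iff)
  then have "v = 0\<^sub>v k" using v(1) by (intro eq_vecI) (auto simp: y_def)
  then show False using v(2) by simp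
qed

text \<open>The vector \<open>z\<close> is \<open>(G G\<^sup>T)\<^sup>-\<^sup>1 x\<close>, so that \<open>F x = G\<^sup>T z\<close>.\<close>

lemma right_inv_solution:
  assumes det: "det (gram k l G) \<noteq> 0"
  shows "\<exists>z. (\<forall>c. (\<Sum>j<k. right_inv k l G c j * x j) = row_comb k z G c)
     \<and> (\<forall>i<k. (\<Sum>a<k. gram k l G $$ (i, a) * z a) = x i)"
proof -
  let ?M = "gram k l G" and ?A = "adj_mat (gram k l G)"
  define z where "z i = (\<Sum>j<k. ?A $$ (i, j) * x j) / det ?M" for i
  have "(\<Sum>j<k. right_inv k l G c j * x j) = row_comb k z G c" for c
  proof -
    have "(\<Sum>j<k. right_inv k l G c j * x j) = (\<Sum>j<k. \<Sum>i<k. G (i, c) * (?A $$ (i, j) * x j) / det ?M)"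
      by (simp add: right_inv_def sum_divide_distrib sum_distrib_right mult.assoc)
    also have "\<dots> = (\<Sum>i<k. \<Sum>j<k. G (i, c) * (?A $$ (i, j) * x j) / det ?M)" by (rule sum.swap)
    also have "\<dots> = row_comb k z G c"
      unfolding row_comb_def z_def by (intro sum.cong refl) (simp add: sum_distrib_left sum_divide_distrib mult.commute)
    finally show ?thesis .
  qed
  moreover have "(\<Sum>a<k. ?M $$ (i, a) * z a) = x i" if i: "i < k" for i
  proof -
    have A: "?A \<in> carrier_mat k k" "?M * ?A = det ?M \<cdot>\<^sub>m 1\<^sub>m k" using adj_mat[OF gram_carrier] by auto
    have MA: "(\<Sum>a<k. ?M $$ (i, a) * ?A $$ (a, j)) = (if i = j then det ?M else 0)" if "j < k" for j
    proof -
      have "(?M * ?A) $$ (i, j) = (if i = j then det ?M else 0)" using A(2) i that by simp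
      then show ?thesis using A(1) i that carrier_matD[OF gram_carrier[of k l G]]
        by (simp add: scalar_prod_def lessThan_atLeast0)
    qed
    have "(\<Sum>a<k. ?M $$ (i, a) * z a) = (\<Sum>a<k. \<Sum>j<k. ?M $$ (i, a) * ?A $$ (a, j) * x j) / det ?M"
      by (simp add: z_def sum_distrib_left sum_divide_distrib mult.assoc)
    also have "(\<Sum>a<k. \<Sum>j<k. ?M $$ (i, a) * ?A $$ (a, j) * x j) = (\<Sum>j<k. (\<Sum>a<k. ?M $$ (i, a) * ?A $$ (a, j)) * x j)"
      by (subst sum.swap) (simp add: sum_distrib_right)
    also have "\<dots> = (\<Sum>j<k. if j = i then det ?M * x i else 0)"
      by (intro sum.cong refl) (auto simp: MA)
    finally show ?thesis using i det by simp
  qed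
  ultimately show ?thesis by blast
qed

text \<open>With \<open>F x = G\<^sup>T z\<close> and \<open>G G\<^sup>T z = x\<close>, the square of \<open>|F x|\<close> is \<open>\<langle>x, z\<rangle> \<le> B * |F x|\<close>.\<close>

lemma right_inv_norm_le:
  assumes det: "det (gram k l G) \<noteq> 0" and B: "0 \<le> B"
    and le: "\<And>y. \<bar>ip k x y\<bar> \<le> B * vnorm l (row_comb k y G)"
  shows "vnorm l (\<lambda>c. \<Sum>j<k. right_inv k l G c j * x j) \<le> B"
proof -
  obtain z where z: "\<And>c. (\<Sum>j<k. right_inv k l G c j * x j) = row_comb k z G c"
    "\<And>i. i < k \<Longrightarrow> (\<Sum>a<k. gram k l G $$ (i, a) * z a) = x i"
    using right_inv_solution[OF det] by blast
  define N where "N = vnorm l (row_comb k z G)"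
  have N0: "0 \<le> N" by (simp add: N_def ip_nonneg)
  have "N * N = ip l (row_comb k z G) (row_comb k z G)" by (simp add: N_def ip_nonneg)
  also have "\<dots> = ip k z (\<lambda>i. \<Sum>a<k. gram k l G $$ (i, a) * z a)" by (rule ip_gram[symmetric])
  also have "\<dots> = ip k z x" by (intro ip_cong refl z(2))
  also have "\<dots> = ip k x z" by (rule ip_commute)
  also have "\<dots> \<le> B * N" using le[of z] by (simp add: N_def)
  finally have "N * N \<le> B * N" .
  then have "N \<le> B" using N0 B by (cases "N = 0") auto
  then show ?thesis by (simp add: z(1) N_def)
qed

lemma right_inv_mult:
  assumes det: "det (gram k l G) \<noteq> 0" and ij: "i < k" "j < k"
  shows "(\<Sum>c<l. G (i, c) * right_inv k l G c j) = (if i = j then 1 else 0)"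
proof -
  obtain z where z: "\<And>c. (\<Sum>a<k. right_inv k l G c a * (if a = j then 1 else 0)) = row_comb k z G c"
    "\<And>i. i < k \<Longrightarrow> (\<Sum>a<k. gram k l G $$ (i, a) * z a) = (if i = j then 1 else 0)"
    using right_inv_solution[OF det, of "\<lambda>a. if a = j then 1 else 0"] by blast
  have "right_inv k l G c j = row_comb k z G c" for c
    using z(1)[of c] ij by (simp add: if_distrib[of "\<lambda>t. _ * t"] cong: if_cong)
  then have "(\<Sum>c<l. G (i, c) * right_inv k l G c j) = (\<Sum>a<k. gram k l G $$ (i, a) * z a)"
    using gram_mult[OF ij(1), of l G z] by simp
  then show ?thesis using z(2) ij by simp
qed

lemma Bernoulli_square:
  fixes z :: real
  assumes "0 \<le> z" "2 \<le> p"
  shows "real p * (z\<^sup>2 - 1) \<le> 2 * (z ^ p - 1)"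
  using assms(2)
proof (induction p rule: dec_induct)
  case base
  then show ?case by simp
next
  case (step q)
  have "0 \<le> (z - 1)\<^sup>2 * (real q * z + (real q - 1))" using assms(1) step by (intro mult_nonneg_nonneg add_nonneg_nonneg) auto
  moreover have "z * (real q * (z\<^sup>2 - 1) + 2) \<le> z * (2 * z ^ q)"
    using step.IH assms(1) by (intro mult_left_mono) auto
  ultimately show ?case by (simp add: power2_eq_square algebra_simps)
qed

text \<open>The power mean inequality between the exponents \<open>2\<close> and \<open>p\<close>, from the termwise tangent inequality
\<open>Bernoulli_square\<close>.\<close>

lemma sum_squares_le_of_sum_powers:
  fixes a :: "nat \<Rightarrow> real"
  assumes a: "\<And>j. j < k \<Longrightarrow> 0 \<le> a j" and c: "0 < c" and p: "2 \<le> p"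
    and le: "(\<Sum>j<k. a j ^ p) \<le> real k * c ^ p"
  shows "(\<Sum>j<k. (a j)\<^sup>2) \<le> real k * c\<^sup>2"
proof -
  have "real p * ((\<Sum>j<k. (a j)\<^sup>2) / c\<^sup>2 - real k) = (\<Sum>j<k. real p * ((a j / c)\<^sup>2 - 1))"
    by (simp add: sum_distrib_left[symmetric] sum_subtractf sum_divide_distrib power_divide)
  also have "\<dots> \<le> (\<Sum>j<k. 2 * ((a j / c) ^ p - 1))"
    using a c p by (intro sum_mono Bernoulli_square) auto
  also have "\<dots> = 2 * ((\<Sum>j<k. a j ^ p) / c ^ p - real k)"
    unfolding sum_distrib_left[symmetric] sum_subtractf sum_divide_distrib power_divide by simp
  also have "\<dots> \<le> 0" using le c by (simp add: pos_divide_le_eq)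
  finally have "(\<Sum>j<k. (a j)\<^sup>2) / c\<^sup>2 - real k \<le> 0" using p by (simp add: mult_le_0_iff)
  then show ?thesis using c by (simp add: pos_divide_le_eq)
qed

text \<open>By rotation invariance \<open>\<langle>x, y\<rangle>\<close> has the law of \<open>|y|\<close> times one standard normal variable.\<close>

lemma nn_integral_gauss_ip_power:
  assumes k: "0 < k" and p: "0 < p"
  shows "(\<integral>\<^sup>+x. ennreal (\<bar>ip k x y\<bar> ^ p) \<partial>gauss {..<k}) = ennreal (vnorm k y ^ p / inv_chi_moment p)"
proof (cases "ip k y y = 0")
  case True
  have "ip k x y = 0" for x using True[unfolded ip_eq_0_iff] by (simp add: ip_def)
  then show ?thesis using True p by (simp add: power_0_left)
next
  case False
  define u where "u = (\<lambda>c. 1 / vnorm k y * y c)"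
  have uu: "ip k u u = 1" unfolding u_def by (rule ip_normalize[OF False])
  have yu: "y = (\<lambda>c. vnorm k y * u c)" using False by (auto simp: u_def fun_eq_iff)
  have "orthonormal_rows 1 k (\<lambda>_. u)" using uu by (simp add: orthonormal_rows_def)
  then obtain U where U: "orthonormal_rows k k U" "U 0 = u"
    using orthonormal_completion[of 1 k "\<lambda>_. u"] k by auto
  have "orthonormal_on {..<k} U" using U(1) by (auto simp: orthonormal_on_def orthonormal_rows_def ip_def)
  then have "(\<integral>\<^sup>+x. ennreal (\<bar>(\<lambda>i\<in>{..<k}. \<Sum>c\<in>{..<k}. U i c * x c) 0\<bar> ^ p) \<partial>gauss {..<k})
     = (\<integral>\<^sup>+x. ennreal (\<bar>x 0\<bar> ^ p) \<partial>gauss {..<k})"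
    using k by (intro gauss_orthogonal[where f="\<lambda>x. ennreal (\<bar>x 0\<bar> ^ p)"]) auto
  also have "\<dots> = (\<integral>\<^sup>+x. (\<Prod>i\<in>{..<k}. if i = 0 then ennreal (\<bar>x i\<bar> ^ p) else 1) \<partial>gauss {..<k})"
    using k by (intro nn_integral_cong) simp
  also have "\<dots> = (\<Prod>i\<in>{..<k}. \<integral>\<^sup>+t. (if i = 0 then ennreal (\<bar>t\<bar> ^ p) else 1) \<partial>std_normal)"
    by (intro nn_integral_gauss_prod) auto
  also have "\<dots> = (\<Prod>i\<in>{..<k}. if i = 0 then ennreal (1 / inv_chi_moment p) else 1)"
    using std_normal.emeasure_space_1 by (intro prod.cong refl) (simp add: nn_integral_std_normal_abs_power)
  also have "\<dots> = ennreal (1 / inv_chi_moment p)" using k by simp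
  finally have 1: "(\<integral>\<^sup>+x. ennreal (\<bar>ip k u x\<bar> ^ p) \<partial>gauss {..<k}) = ennreal (1 / inv_chi_moment p)"
    using k by (simp add: U(2) ip_def)
  have "(\<integral>\<^sup>+x. ennreal (\<bar>ip k x y\<bar> ^ p) \<partial>gauss {..<k})
     = (\<integral>\<^sup>+x. ennreal (vnorm k y ^ p) * ennreal (\<bar>ip k u x\<bar> ^ p) \<partial>gauss {..<k})"
  proof (rule nn_integral_cong)
    fix x
    have "ip k x y = vnorm k y * ip k u x"
      by (subst yu) (simp only: ip_scale ip_commute[of k x u])
    then show "ennreal (\<bar>ip k x y\<bar> ^ p) = ennreal (vnorm k y ^ p) * ennreal (\<bar>ip k u x\<bar> ^ p)"
      by (simp add: abs_mult power_mult_distrib ennreal_mult ip_nonneg)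
  qed
  also have "\<dots> = ennreal (vnorm k y ^ p) * ennreal (1 / inv_chi_moment p)"
  proof (subst nn_integral_cmult)
    have [measurable]: "(\<lambda>x. ip k u x) \<in> borel_measurable (Pi\<^sub>M {..<k} (\<lambda>_. borel))" unfolding ip_def by measurable
    show "(\<lambda>x. ennreal (\<bar>ip k u x\<bar> ^ p)) \<in> borel_measurable (gauss {..<k})" by measurable
  qed (simp only: 1)
  finally show ?thesis using inv_chi_moment_pos[of p]
    by (simp add: ennreal_mult[symmetric] ip_nonneg)
qed

section \<open>Events on which the right inverse is small\<close>

lemma Markov_complement:
  assumes f: "f \<in> borel_measurable M" and le: "(\<integral>\<^sup>+x. f x \<partial>M) \<le> ennreal (b * \<delta>)" and b: "0 < b"
  shows "emeasure M {x \<in> space M. \<not> f x \<le> ennreal b} \<le> ennreal \<delta>"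
proof -
  have "emeasure M {x \<in> space M. \<not> f x \<le> ennreal b} \<le> emeasure M {x \<in> space M. 1 \<le> ennreal (1 / b) * f x}"
  proof (rule emeasure_mono)
    show "{x \<in> space M. \<not> f x \<le> ennreal b} \<subseteq> {x \<in> space M. 1 \<le> ennreal (1 / b) * f x}"
    proof safe
      fix x assume "\<not> f x \<le> ennreal b"
      then have "ennreal (1 / b) * ennreal b \<le> ennreal (1 / b) * f x" by (intro mult_left_mono) auto
      then show "1 \<le> ennreal (1 / b) * f x" using b by (simp add: ennreal_mult'[symmetric])
    qed
    show "{x \<in> space M. 1 \<le> ennreal (1 / b) * f x} \<in> sets M" using f by measurable
  qed
  also have "\<dots> \<le> ennreal (1 / b) * (\<integral>\<^sup>+x. f x \<partial>M)"
  proof -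
    have "(\<lambda>x. f x * indicator (space M) x) \<in> borel_measurable M" using f by measurable
    from nn_integral_Markov_inequality[OF this sets.top, of "ennreal (1 / b)"]
    have "emeasure M {x \<in> space M. 1 \<le> ennreal (1 / b) * f x} \<le> ennreal (1 / b) * (\<integral>\<^sup>+x. f x * indicator (space M) x \<partial>M)" .
    also have "(\<integral>\<^sup>+x. f x * indicator (space M) x \<partial>M) = (\<integral>\<^sup>+x. f x \<partial>M)"
      by (intro nn_integral_cong) simp
    finally show ?thesis .
  qed
  also have "\<dots> \<le> ennreal (1 / b) * ennreal (b * \<delta>)" by (rule mult_left_mono[OF le]) simp
  also have "\<dots> = ennreal \<delta>" using b by (simp add: ennreal_mult'[symmetric])
  finally show ?thesis .
qed

lemma pinv_norm_cong:
  assumes "\<And>i c. i < k \<Longrightarrow> c < l \<Longrightarrow> G (i, c) = G' (i, c)"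
  shows "pinv_norm k l x G = pinv_norm k l x G'"
proof -
  have "vnorm l (row_comb k y G) = vnorm l (row_comb k y G')" for y
    using assms by (intro arg_cong[of _ _ sqrt] ip_cong) (auto simp: row_comb_def)
  then show ?thesis by (simp add: pinv_norm_def)
qed

lemma split_rows:
  fixes k n l :: nat
  assumes "k \<le> n"
  shows "{..<n} \<times> {..<l} = {..<k} \<times> {..<l} \<union> {k..<n} \<times> {..<l::nat}" "({..<k} \<times> {..<l}) \<inter> ({k..<n} \<times> {..<l}) = {}"
  using assms by auto

lemma nn_integral_gauss_first_rows:
  fixes k n l :: nat
  assumes kn: "k \<le> n" and f: "f \<in> borel_measurable (Pi\<^sub>M ({..<n} \<times> {..<l::nat}) (\<lambda>_. borel))"
    and f': "f' \<in> borel_measurable (Pi\<^sub>M ({..<k} \<times> {..<l}) (\<lambda>_. borel))"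
    and eq: "\<And>G G'. (\<And>i c. i < k \<Longrightarrow> c < l \<Longrightarrow> G (i, c) = G' (i, c)) \<Longrightarrow> f G = f' G'"
  shows "(\<integral>\<^sup>+G. f G \<partial>gauss ({..<n} \<times> {..<l})) = (\<integral>\<^sup>+G. f' G \<partial>gauss ({..<k} \<times> {..<l}))"
proof -
  let ?I = "{..<k} \<times> {..<l}" and ?J = "{k..<n} \<times> {..<l}"
  have "(\<integral>\<^sup>+G. f G \<partial>gauss ({..<n} \<times> {..<l})) = (\<integral>\<^sup>+x. \<integral>\<^sup>+y. f (merge ?I ?J (x, y)) \<partial>gauss ?J \<partial>gauss ?I)"
    using f split_rows(2)[OF kn, of l] unfolding split_rows(1)[OF kn] by (intro nn_integral_gauss_union) auto
  also have "\<dots> = (\<integral>\<^sup>+x. \<integral>\<^sup>+y. f' x \<partial>gauss ?J \<partial>gauss ?I)"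
    by (intro nn_integral_cong eq) (auto simp: merge_def)
  finally show ?thesis by (simp add: emeasure_gauss_space)
qed

definition unit_fun :: "nat \<Rightarrow> nat \<Rightarrow> real" where
  "unit_fun j i = (if i = j then 1 else 0)"

lemma ip_unit_fun: "j < k \<Longrightarrow> ip k (unit_fun j) y = y j" "j < k \<Longrightarrow> ip k y (unit_fun j) = y j"
  by (simp_all add: ip_def unit_fun_def if_distrib[of "\<lambda>z. z * _"] if_distrib[of "\<lambda>z. _ * z"] cong: if_cong)

text \<open>The \<open>j\<close>-th summand is the \<open>p\<close>-th power of the length of column \<open>j\<close> of the right inverse, so the event
controls its Frobenius norm.\<close>

definition trace_event :: "nat \<Rightarrow> nat \<Rightarrow> nat \<Rightarrow> nat \<Rightarrow> (nat \<times> nat \<Rightarrow> real) set" where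
  "trace_event n k l p = {G \<in> space (gauss ({..<n} \<times> {..<l})).
     (\<Sum>j<k. pinv_norm k l (unit_fun j) G ^ p) \<le> ennreal (real k * sqrt (3.2 * (real p * ln (real p))) ^ p)}"

definition avg_pinv_norm :: "nat \<Rightarrow> nat \<Rightarrow> nat \<Rightarrow> (nat \<times> nat \<Rightarrow> real) \<Rightarrow> ennreal" where
  "avg_pinv_norm k l p G = (\<integral>\<^sup>+x. pinv_norm k l x G ^ p \<partial>gauss {..<k})"

text \<open>The average over Gaussian \<open>x\<close> of the \<open>p\<close>-th power of \<open>|G\<^sup>\<dagger> x|\<close> controls the operator norm of the
right inverse: it is at least the contribution of the worst single direction.\<close>

definition norm_event :: "nat \<Rightarrow> nat \<Rightarrow> nat \<Rightarrow> nat \<Rightarrow> (nat \<times> nat \<Rightarrow> real) set" where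
  "norm_event n k l p = {G \<in> space (gauss ({..<n} \<times> {..<l})).
     avg_pinv_norm k l p G \<le> ennreal (sqrt (7.4 * real l) ^ p / inv_chi_moment p)}"

lemma borel_measurable_pinv_norm_gauss:
  assumes "k \<le> n"
  shows "pinv_norm k l x \<in> borel_measurable (Pi\<^sub>M ({..<n} \<times> {..<l}) (\<lambda>_. borel))"
  using assms by (intro borel_measurable_pinv_norm) auto

lemma borel_measurable_avg_pinv_norm:
  assumes "k \<le> n"
  shows "avg_pinv_norm k l p \<in> borel_measurable (Pi\<^sub>M ({..<n} \<times> {..<l}) (\<lambda>_. borel))"
proof -
  interpret P: prob_space "gauss {..<k} :: (nat \<Rightarrow> real) measure" by (rule prob_space_gauss)
  let ?N = "Pi\<^sub>M ({..<n} \<times> {..<l}) (\<lambda>_. borel) \<Otimes>\<^sub>M gauss {..<k}"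
  have "(\<lambda>z. snd z i) \<in> borel_measurable ?N" if "i < k" for i
    using that by (intro measurable_compose[OF measurable_snd]) (simp cong: measurable_cong_sets)
  moreover have "(\<lambda>z. fst z (i, c)) \<in> borel_measurable ?N" if "i < k" "c < l" for i c
    using that assms by (intro measurable_compose[OF measurable_fst]) auto
  ultimately have "(\<lambda>z. pinv_norm k l (snd z) (fst z)) \<in> borel_measurable ?N"
    by (intro borel_measurable_pinv_norm)
  then have "(\<lambda>(G, x). pinv_norm k l x G ^ p) \<in> borel_measurable ?N" by (simp add: split_beta')
  then show ?thesis unfolding avg_pinv_norm_def[abs_def] by (rule P.borel_measurable_nn_integral)
qed

lemma inv_chi_moment_le_power:
  assumes p: "2 \<le> p"
  shows "inv_chi_moment p \<le> sqrt (3.2 * (real p * ln (real p))) ^ p / real p ^ p"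
proof -
  have "sqrt (real p) ^ p * sqrt (real p) ^ p = real p ^ p"
    by (simp add: power_mult_distrib[symmetric])
  moreover have "(inv_chi_moment p * sqrt (real p) ^ p) * sqrt (real p) ^ p \<le> sqrt (3.2 * ln (real p)) ^ p * sqrt (real p) ^ p"
    by (rule mult_right_mono[OF inv_chi_moment_le[OF p]]) simp
  moreover have "sqrt (3.2 * ln (real p)) ^ p * sqrt (real p) ^ p = sqrt (3.2 * (real p * ln (real p))) ^ p"
    by (simp only: power_mult_distrib[symmetric] real_sqrt_mult[symmetric] ac_simps)
  ultimately have "inv_chi_moment p * real p ^ p \<le> sqrt (3.2 * (real p * ln (real p))) ^ p" by (simp only: mult.assoc)
  moreover have "0 < real p ^ p" using p by simp
  ultimately show ?thesis by (simp only: pos_le_divide_eq)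
qed

lemma trace_event_prob:
  assumes k: "0 < k" "k \<le> n" and p: "2 \<le> p" and l: "l = k + p"
  shows "emeasure (gauss ({..<n} \<times> {..<l})) (space (gauss ({..<n} \<times> {..<l})) - trace_event n k l p) \<le> ennreal (1 / real p ^ p)"
proof -
  let ?\<gamma> = "gauss ({..<n} \<times> {..<l})"
  define c where "c = sqrt (3.2 * (real p * ln (real p)))"
  have c: "0 < c" using p by (simp add: c_def)
  note m = borel_measurable_pinv_norm_gauss[OF k(2), of l]
  have one: "(\<integral>\<^sup>+G. pinv_norm k l (unit_fun j) G ^ p \<partial>?\<gamma>) \<le> ennreal (inv_chi_moment p)" if "j < k" for j
  proof -
    have "(\<integral>\<^sup>+G. pinv_norm k l (unit_fun j) G ^ p \<partial>?\<gamma>)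
        = (\<integral>\<^sup>+G. pinv_norm k l (unit_fun j) G ^ p \<partial>gauss ({..<k} \<times> {..<l}))"
      using m borel_measurable_pinv_norm_gauss[OF order_refl, of k l]
      by (intro nn_integral_gauss_first_rows[OF k(2)]) (auto intro!: arg_cong[of _ _ "\<lambda>z. z ^ p"] pinv_norm_cong)
    also have "\<dots> \<le> ennreal (vnorm k (unit_fun j) ^ p * inv_chi_moment p)"
      using k p by (intro pinv_norm_moment l) auto
    also have "vnorm k (unit_fun j) = 1" using that by (simp add: ip_unit_fun) (simp add: unit_fun_def)
    finally show ?thesis by simp
  qed
  have "(\<integral>\<^sup>+G. (\<Sum>j<k. pinv_norm k l (unit_fun j) G ^ p) \<partial>?\<gamma>) = (\<Sum>j<k. \<integral>\<^sup>+G. pinv_norm k l (unit_fun j) G ^ p \<partial>?\<gamma>)"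
    using m by (intro nn_integral_sum) auto
  also have "\<dots> \<le> (\<Sum>j<k. ennreal (inv_chi_moment p))" by (intro sum_mono one) auto
  also have "\<dots> = ennreal (real k * inv_chi_moment p)"
    using inv_chi_moment_pos[of p] by (simp add: ennreal_mult' ennreal_of_nat_eq_real_of_nat)
  also have "\<dots> \<le> ennreal ((real k * c ^ p) * (1 / real p ^ p))"
  proof (rule ennreal_leI)
    have "real k * inv_chi_moment p \<le> real k * (c ^ p / real p ^ p)"
      unfolding c_def by (rule mult_left_mono[OF inv_chi_moment_le_power[OF p]]) simp
    then show "real k * inv_chi_moment p \<le> (real k * c ^ p) * (1 / real p ^ p)" by simp
  qed
  finally have "emeasure ?\<gamma> {G \<in> space ?\<gamma>. \<not> (\<Sum>j<k. pinv_norm k l (unit_fun j) G ^ p) \<le> ennreal (real k * c ^ p)} \<le> ennreal (1 / real p ^ p)"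
    using m k c by (intro Markov_complement) auto
  also have "{G \<in> space ?\<gamma>. \<not> (\<Sum>j<k. pinv_norm k l (unit_fun j) G ^ p) \<le> ennreal (real k * c ^ p)} = space ?\<gamma> - trace_event n k l p"
    by (auto simp: trace_event_def c_def)
  finally show ?thesis .
qed

text \<open>Exchanging the averages over \<open>x\<close> and \<open>G\<close>, the mean of the average is at most the product of the \<open>p\<close>-th moment
of \<open>|x|\<close> and the negative moment. The threshold is chosen such that Markov's inequality
gives \<open>1 / p ^ p\<close>.\<close>

lemma norm_event_prob:
  assumes k: "0 < k" "k \<le> n" and p: "2 \<le> p" and l: "l = k + p"
  shows "emeasure (gauss ({..<n} \<times> {..<l})) (space (gauss ({..<n} \<times> {..<l})) - norm_event n k l p) \<le> ennreal (1 / real p ^ p)"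
proof -
  let ?\<gamma> = "gauss ({..<n} \<times> {..<l})" and ?k = "gauss {..<k} :: (nat \<Rightarrow> real) measure"
  define \<kappa> where "\<kappa> = inv_chi_moment p"
  have \<kappa>: "0 < \<kappa>" by (simp add: \<kappa>_def inv_chi_moment_pos)
  define t where "t = sqrt (7.4 * real l)"
  have t: "0 < t" using l k by (simp add: t_def)
  interpret A: prob_space ?\<gamma> by (rule prob_space_gauss)
  interpret B: prob_space ?k by (rule prob_space_gauss)
  interpret P: pair_sigma_finite ?k ?\<gamma> ..
  note m = borel_measurable_pinv_norm_gauss[OF k(2), of l]
  have one: "(\<integral>\<^sup>+G. pinv_norm k l x G ^ p \<partial>?\<gamma>) \<le> ennreal (vnorm k x ^ p) * ennreal \<kappa>" for x
  proof -
    have "(\<integral>\<^sup>+G. pinv_norm k l x G ^ p \<partial>?\<gamma>) = (\<integral>\<^sup>+G. pinv_norm k l x G ^ p \<partial>gauss ({..<k} \<times> {..<l}))"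
      using m borel_measurable_pinv_norm_gauss[OF order_refl, of k l]
      by (intro nn_integral_gauss_first_rows[OF k(2)]) (auto intro!: arg_cong[of _ _ "\<lambda>z. z ^ p"] pinv_norm_cong)
    also have "\<dots> \<le> ennreal (vnorm k x ^ p * inv_chi_moment p)"
      using k p by (intro pinv_norm_moment l) auto
    finally show ?thesis using \<kappa> by (simp add: \<kappa>_def ennreal_mult ip_nonneg)
  qed
  have jm: "(\<lambda>(x, G). pinv_norm k l x G ^ p) \<in> borel_measurable (?k \<Otimes>\<^sub>M ?\<gamma>)"
  proof -
    have "(\<lambda>z. fst z i) \<in> borel_measurable (?k \<Otimes>\<^sub>M ?\<gamma>)" if "i < k" for i
      using that by (intro measurable_compose[OF measurable_fst]) (simp cong: measurable_cong_sets)
    moreover have "(\<lambda>z. snd z (i, c)) \<in> borel_measurable (?k \<Otimes>\<^sub>M ?\<gamma>)" if "i < k" "c < l" for i c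
      using that k by (intro measurable_compose[OF measurable_snd]) (simp cong: measurable_cong_sets)
    ultimately have "(\<lambda>z. pinv_norm k l (fst z) (snd z)) \<in> borel_measurable (?k \<Otimes>\<^sub>M ?\<gamma>)"
      by (intro borel_measurable_pinv_norm)
    then show ?thesis by (simp add: split_beta')
  qed
  have nm: "(\<lambda>x. ennreal (vnorm k x ^ p)) \<in> borel_measurable ?k"
    unfolding ip_def by measurable
  have "(\<integral>\<^sup>+G. avg_pinv_norm k l p G \<partial>?\<gamma>) = (\<integral>\<^sup>+x. \<integral>\<^sup>+G. pinv_norm k l x G ^ p \<partial>?\<gamma> \<partial>?k)"
    unfolding avg_pinv_norm_def by (rule P.Fubini'[OF jm])
  also have "\<dots> \<le> (\<integral>\<^sup>+x. ennreal (vnorm k x ^ p) * ennreal \<kappa> \<partial>?k)" by (intro nn_integral_mono one)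
  also have "\<dots> = (\<integral>\<^sup>+x. ennreal (vnorm k x ^ p) \<partial>?k) * ennreal \<kappa>" by (rule nn_integral_multc[OF nm])
  also have "\<dots> \<le> ennreal (sqrt (real l) ^ p) * ennreal \<kappa>"
    using gauss_norm_moment[of "{..<k}" p] k p l by (intro mult_right_mono) (simp_all add: ip_square)
  also have "\<dots> = ennreal (sqrt (real l) ^ p * \<kappa>)" using \<kappa> by (simp add: ennreal_mult)
  also have "\<dots> \<le> ennreal ((t ^ p / \<kappa>) * (1 / real p ^ p))"
  proof (rule ennreal_leI)
    have "sqrt (real l) ^ p * (\<kappa>\<^sup>2 * real p ^ p) \<le> sqrt (real l) ^ p * sqrt 7.4 ^ p"
      using inv_chi_moment_square_le[OF p] by (intro mult_left_mono) (auto simp: \<kappa>_def)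
    also have "\<dots> = t ^ p" unfolding t_def by (simp only: power_mult_distrib[symmetric] real_sqrt_mult[symmetric] mult.commute)
    finally show "sqrt (real l) ^ p * \<kappa> \<le> (t ^ p / \<kappa>) * (1 / real p ^ p)"
      using \<kappa> p by (simp add: pos_le_divide_eq power2_eq_square ac_simps)
  qed
  finally have "emeasure ?\<gamma> {G \<in> space ?\<gamma>. \<not> avg_pinv_norm k l p G \<le> ennreal (t ^ p / \<kappa>)} \<le> ennreal (1 / real p ^ p)"
    using borel_measurable_avg_pinv_norm[OF k(2), of l p] t \<kappa> by (intro Markov_complement) auto
  also have "{G \<in> space ?\<gamma>. \<not> avg_pinv_norm k l p G \<le> ennreal (t ^ p / \<kappa>)} = space ?\<gamma> - norm_event n k l p"
    by (auto simp: norm_event_def t_def \<kappa>_def)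
  finally show ?thesis .
qed

lemma trace_event_bound:
  assumes p: "2 \<le> p" and G: "G \<in> trace_event n k l p"
  shows "\<exists>a. (\<forall>j<k. 0 \<le> a j \<and> pinv_norm k l (unit_fun j) G = ennreal (a j)) \<and>
     (\<Sum>j<k. (a j)\<^sup>2) \<le> real k * (3.2 * (real p * ln (real p)))"
proof -
  define c where "c = sqrt (3.2 * (real p * ln (real p)))"
  have c: "0 < c" using p by (simp add: c_def)
  have le: "(\<Sum>j<k. pinv_norm k l (unit_fun j) G ^ p) \<le> ennreal (real k * c ^ p)"
    using G by (simp add: trace_event_def c_def)
  define a where "a j = enn2real (pinv_norm k l (unit_fun j) G)" for j
  have a: "pinv_norm k l (unit_fun j) G = ennreal (a j)" if "j < k" for j
  proof -
    have "pinv_norm k l (unit_fun j) G ^ p \<le> (\<Sum>j<k. pinv_norm k l (unit_fun j) G ^ p)"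
      using that by (intro member_le_sum) auto
    then have "pinv_norm k l (unit_fun j) G ^ p < \<infinity>"
      using le by (metis ennreal_less_top infinity_ennreal_def le_less_trans)
    then have "pinv_norm k l (unit_fun j) G < \<infinity>"
      using p by (simp add: power_less_top_ennreal)
    then show ?thesis by (simp add: a_def)
  qed
  have a0: "0 \<le> a j" for j by (simp add: a_def)
  have "ennreal (\<Sum>j<k. a j ^ p) = (\<Sum>j<k. pinv_norm k l (unit_fun j) G ^ p)"
    using a a0 by (simp add: sum_ennreal[symmetric] ennreal_power del: sum_ennreal)
  then have "ennreal (\<Sum>j<k. a j ^ p) \<le> ennreal (real k * c ^ p)" using le by (simp only:)
  then have "(\<Sum>j<k. a j ^ p) \<le> real k * c ^ p" using c by (subst (asm) ennreal_le_iff) auto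
  then have "(\<Sum>j<k. (a j)\<^sup>2) \<le> real k * c\<^sup>2"
    using a0 c p by (intro sum_squares_le_of_sum_powers) auto
  moreover have "c\<^sup>2 = 3.2 * (real p * ln (real p))" using p by (simp add: c_def)
  ultimately show ?thesis using a a0 by (intro exI[of _ a]) auto
qed

lemma trace_event_nondegenerate:
  assumes p: "2 \<le> p" and G: "G \<in> trace_event n k l p" and y: "\<forall>c<l. row_comb k y G c = 0"
  shows "\<forall>i<k. y i = 0"
proof (intro allI impI)
  fix i assume i: "i < k"
  obtain a where "0 \<le> a" "pinv_norm k l (unit_fun i) G = ennreal a"
    using trace_event_bound[OF p G] i by blast
  then have "\<bar>ip k (unit_fun i) y\<bar> \<le> a * vnorm l (row_comb k y G)" by (intro pinv_normD) auto
  moreover have "ip l (row_comb k y G) (row_comb k y G) = 0" using y by (simp add: ip_eq_0_iff)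
  ultimately show "y i = 0" using i by (simp add: ip_unit_fun)
qed

text \<open>For fixed \<open>y\<close>, each \<open>|G\<^sup>\<dagger> x|\<close> is at least \<open>|\<langle>x, y\<rangle>| / |G\<^sup>T y|\<close>. The average of the \<open>p\<close>-th power of
this lower bound is explicit.\<close>

lemma norm_event_bound:
  assumes k: "0 < k" and p: "2 \<le> p" and G: "G \<in> norm_event n k l p"
    and nondeg: "\<And>y. (\<forall>c<l. row_comb k y G c = 0) \<Longrightarrow> \<forall>i<k. y i = 0"
  shows "vnorm k y \<le> sqrt (7.4 * real l) * vnorm l (row_comb k y G)"
proof -
  define t \<kappa> w where "t = sqrt (7.4 * real l)" and "\<kappa> = inv_chi_moment p" and "w = vnorm l (row_comb k y G)"
  have \<kappa>: "0 < \<kappa>" by (simp add: \<kappa>_def inv_chi_moment_pos)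
  have tw: "0 \<le> t" "0 \<le> w" by (simp_all add: t_def w_def ip_nonneg)
  show ?thesis
  proof (cases "w = 0")
    case True
    then have "\<forall>i<k. y i = 0" by (intro nondeg) (simp add: w_def ip_eq_0_iff)
    then have "ip k y y = 0" by (simp add: ip_eq_0_iff)
    then show ?thesis using tw by (simp add: t_def w_def)
  next
    case False
    then have w: "0 < w" using tw by simp
    have upper: "ennreal (\<bar>ip k x y\<bar> / w) \<le> pinv_norm k l x G" for x
    proof (cases "pinv_norm k l x G" rule: ennreal_cases)
      case (real B)
      then have "\<bar>ip k x y\<bar> \<le> B * w" unfolding w_def by (intro pinv_normD) auto
      then show ?thesis using real w by (simp add: ennreal_le_iff pos_divide_le_eq)
    qed simp
    have m: "(\<lambda>x. ennreal (\<bar>ip k x y\<bar> ^ p)) \<in> borel_measurable (gauss {..<k})"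
      unfolding ip_def by measurable
    have "ennreal (1 / w ^ p) * ennreal (vnorm k y ^ p / \<kappa>) = (\<integral>\<^sup>+x. ennreal (1 / w ^ p) * ennreal (\<bar>ip k x y\<bar> ^ p) \<partial>gauss {..<k})"
      unfolding \<kappa>_def using k p by (subst nn_integral_cmult[OF m]) (simp add: nn_integral_gauss_ip_power)
    also have "\<dots> = (\<integral>\<^sup>+x. ennreal (\<bar>ip k x y\<bar> / w) ^ p \<partial>gauss {..<k})"
      using w by (intro nn_integral_cong) (simp add: ennreal_power ennreal_mult'[symmetric] power_divide)
    also have "\<dots> \<le> avg_pinv_norm k l p G"
      unfolding avg_pinv_norm_def by (intro nn_integral_mono power_mono_ennreal upper)
    also have "\<dots> \<le> ennreal (t ^ p / \<kappa>)" using G by (simp add: norm_event_def t_def \<kappa>_def)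
    finally have "1 / w ^ p * (vnorm k y ^ p / \<kappa>) \<le> t ^ p / \<kappa>"
      using w \<kappa> tw by (simp add: ennreal_mult'[symmetric] ennreal_le_iff del: ennreal_le_iff2)
    then have "vnorm k y ^ p \<le> (t * w) ^ p"
      using w \<kappa> by (simp add: divide_simps power_mult_distrib mult.commute)
    then have "vnorm k y \<le> t * w"
      using tw p by (subst (asm) power_mono_iff) (auto simp: ip_nonneg)
    then show ?thesis by (simp only: t_def w_def)
  qed
qed

section \<open>An exponential average over random directions\<close>

definition right_inv_app :: "nat \<Rightarrow> nat \<Rightarrow> (nat \<times> nat \<Rightarrow> real) \<Rightarrow> (nat \<Rightarrow> real) \<Rightarrow> nat \<Rightarrow> real" where
  "right_inv_app k l G h c = (\<Sum>j<k. right_inv k l G c j * h j)"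

text \<open>For \<open>i \<ge> k\<close> this is entry \<open>i\<close> of \<open>H F h\<close>, where \<open>H\<close> is formed by the rows of \<open>G\<close> beyond the first \<open>k\<close>.\<close>

definition tail_app :: "nat \<Rightarrow> nat \<Rightarrow> (nat \<times> nat \<Rightarrow> real) \<Rightarrow> (nat \<Rightarrow> real) \<Rightarrow> nat \<Rightarrow> real" where
  "tail_app k l G h i = (\<Sum>c<l. G (i, c) * right_inv_app k l G h c)"

text \<open>The logarithm of the density, with respect to the law of the rows \<open>k, \<dots>, n - 1\<close> of \<open>G\<close>, of
  their translate by \<open>\<tau> (S g) (F h)\<^sup>T\<close>, where \<open>S = diag s\<close> and \<open>F\<close> is the right inverse of the
  first \<open>k\<close> rows.\<close>

definition tilt :: "nat \<Rightarrow> nat \<Rightarrow> nat \<Rightarrow> (nat \<Rightarrow> real) \<Rightarrow> real \<Rightarrow> (nat \<times> nat \<Rightarrow> real) \<Rightarrow> (nat \<Rightarrow> real) \<Rightarrow> (nat \<Rightarrow> real) \<Rightarrow> real" where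
  "tilt n k l s \<tau> G g h = \<tau> * (\<Sum>i\<in>{k..<n}. s i * g i * tail_app k l G h i)
     - \<tau>\<^sup>2 / 2 * (\<Sum>i\<in>{k..<n}. (s i * g i)\<^sup>2) * (\<Sum>c<l. (right_inv_app k l G h c)\<^sup>2)"

definition tilt_mean :: "nat \<Rightarrow> nat \<Rightarrow> nat \<Rightarrow> (nat \<Rightarrow> real) \<Rightarrow> real \<Rightarrow> (nat \<times> nat \<Rightarrow> real) \<Rightarrow> ennreal" where
  "tilt_mean n k l s \<tau> G =
     (\<integral>\<^sup>+g. \<integral>\<^sup>+h. ennreal (exp (tilt n k l s \<tau> G g h)) \<partial>gauss {..<k} \<partial>gauss {k..<n})"

lemma borel_measurable_tilt:
  assumes G: "\<And>i c. i < n \<Longrightarrow> c < l \<Longrightarrow> (\<lambda>\<omega>. G \<omega> (i, c)) \<in> borel_measurable M" and kn: "k \<le> n"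
    and g: "\<And>i. i \<in> {k..<n} \<Longrightarrow> (\<lambda>\<omega>. g \<omega> i) \<in> borel_measurable M"
    and h: "\<And>j. j < k \<Longrightarrow> (\<lambda>\<omega>. h \<omega> j) \<in> borel_measurable M"
  shows "(\<lambda>\<omega>. ennreal (exp (tilt n k l s \<tau> (G \<omega>) (g \<omega>) (h \<omega>)))) \<in> borel_measurable M"
proof -
  have F: "(\<lambda>\<omega>. right_inv_app k l (G \<omega>) (h \<omega>) c) \<in> borel_measurable M" if "c < l" for c
    unfolding right_inv_app_def
    using that kn by (intro borel_measurable_sum borel_measurable_times borel_measurable_right_inv G h) auto
  have T: "(\<lambda>\<omega>. tail_app k l (G \<omega>) (h \<omega>) i) \<in> borel_measurable M" if "i < n" for i
    unfolding tail_app_def using that by (intro borel_measurable_sum borel_measurable_times F G) auto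
  have "(\<lambda>\<omega>. tilt n k l s \<tau> (G \<omega>) (g \<omega>) (h \<omega>)) \<in> borel_measurable M"
    unfolding tilt_def
    by (intro borel_measurable_diff borel_measurable_sum borel_measurable_times borel_measurable_power
        measurable_const F T g) auto
  then show ?thesis by measurable
qed

lemma coordinate_measurable_gauss:
  assumes "X \<in> measurable M (gauss I)" "i \<in> I"
  shows "(\<lambda>\<omega>. X \<omega> i) \<in> borel_measurable M"
  using measurable_compose[OF assms(1), of "\<lambda>g. g i" borel] assms(2) by (simp cong: measurable_cong_sets)

lemma borel_measurable_tilt_mean:
  assumes kn: "k \<le> n"
  shows "tilt_mean n k l s \<tau> \<in> borel_measurable (gauss ({..<n} \<times> {..<l}))"
proof -
  let ?\<gamma> = "gauss ({..<n} \<times> {..<l}) :: (nat \<times> nat \<Rightarrow> real) measure"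
  let ?g = "gauss {k..<n} :: (nat \<Rightarrow> real) measure" and ?h = "gauss {..<k} :: (nat \<Rightarrow> real) measure"
  interpret g: prob_space ?g by (rule prob_space_gauss)
  interpret h: prob_space ?h by (rule prob_space_gauss)
  have "(\<lambda>z. ennreal (exp (tilt n k l s \<tau> (fst (fst z)) (snd (fst z)) (snd z)))) \<in> borel_measurable ((?\<gamma> \<Otimes>\<^sub>M ?g) \<Otimes>\<^sub>M ?h)"
    by (intro borel_measurable_tilt[OF _ kn] coordinate_measurable_gauss) measurable
  then have "(\<lambda>y. \<integral>\<^sup>+h. ennreal (exp (tilt n k l s \<tau> (fst y) (snd y) h)) \<partial>?h) \<in> borel_measurable (?\<gamma> \<Otimes>\<^sub>M ?g)"
    by (intro h.borel_measurable_nn_integral) (simp add: split_beta')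
  then show ?thesis
    unfolding tilt_mean_def[abs_def] by (intro g.borel_measurable_nn_integral) (simp add: split_beta')
qed

text \<open>For fixed first \<open>k\<close> rows the linear term is a Gaussian variable in the remaining rows, and the quadratic term is
half its variance.\<close>

lemma nn_integral_tilt:
  assumes kn: "k \<le> n"
  shows "(\<integral>\<^sup>+G. ennreal (exp (tilt n k l s \<tau> G g h)) \<partial>gauss ({..<n} \<times> {..<l})) = 1"
proof -
  let ?I = "{..<k} \<times> {..<l}" and ?J = "{k..<n} \<times> {..<l}"
  have "(\<integral>\<^sup>+G. ennreal (exp (tilt n k l s \<tau> G g h)) \<partial>gauss ({..<n} \<times> {..<l}))
     = (\<integral>\<^sup>+x. \<integral>\<^sup>+y. ennreal (exp (tilt n k l s \<tau> (merge ?I ?J (x, y)) g h)) \<partial>gauss ?J \<partial>gauss ?I)"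
  proof -
    have "(\<lambda>G. ennreal (exp (tilt n k l s \<tau> G g h))) \<in> borel_measurable (Pi\<^sub>M ({..<n} \<times> {..<l}) (\<lambda>_. borel))"
      by (intro borel_measurable_tilt[OF _ kn] measurable_const) auto
    then show ?thesis using split_rows(2)[OF kn, of l] unfolding split_rows(1)[OF kn]
      by (intro nn_integral_gauss_union) auto
  qed
  also have "\<dots> = (\<integral>\<^sup>+x. 1 \<partial>gauss ?I)"
  proof (rule nn_integral_cong)
    fix x :: "nat \<times> nat \<Rightarrow> real"
    define f where "f c = right_inv_app k l x h c" for c
    define b where "b = (\<lambda>(i, c). \<tau> * (s i * g i) * f c)"
    define q where "q = \<tau>\<^sup>2 / 2 * (\<Sum>i\<in>{k..<n}. (s i * g i)\<^sup>2) * (\<Sum>c<l. (f c)\<^sup>2)"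
    have f: "right_inv_app k l (merge ?I ?J (x, y)) h c = f c" if "c < l" for y c
      unfolding right_inv_app_def f_def using that
      by (intro sum.cong refl arg_cong2[of _ _ _ _ "(*)"] right_inv_cong) (auto simp: merge_def)
    have t: "tail_app k l (merge ?I ?J (x, y)) h i = (\<Sum>c<l. y (i, c) * f c)" if "i \<in> {k..<n}" for y i
      unfolding tail_app_def
    proof (intro sum.cong refl)
      fix c assume "c \<in> {..<l}"
      then have c: "c < l" by simp
      then have "merge ?I ?J (x, y) (i, c) = y (i, c)" using that by (simp add: merge_def)
      then show "merge ?I ?J (x, y) (i, c) * right_inv_app k l (merge ?I ?J (x, y)) h c = y (i, c) * f c"
        by (simp only: f[OF c])
    qed
    have e: "tilt n k l s \<tau> (merge ?I ?J (x, y)) g h = (\<Sum>z\<in>?J. b z * y z) - q" for y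
    proof -
      have "\<tau> * (\<Sum>i\<in>{k..<n}. s i * g i * tail_app k l (merge ?I ?J (x, y)) h i)
          = (\<Sum>i\<in>{k..<n}. \<Sum>c<l. b (i, c) * y (i, c))"
        unfolding sum_distrib_left
        by (intro sum.cong refl) (simp add: t b_def sum_distrib_left ac_simps)
      also have "\<dots> = (\<Sum>z\<in>?J. b z * y z)"
        by (simp add: sum.cartesian_product split_beta)
      finally show ?thesis unfolding tilt_def q_def using f by simp
    qed
    have "(\<Sum>z\<in>?J. (b z)\<^sup>2) = (\<Sum>i\<in>{k..<n}. \<Sum>c<l. (b (i, c))\<^sup>2)"
      by (simp add: sum.cartesian_product split_beta)
    also have "\<dots> = (\<Sum>i\<in>{k..<n}. \<Sum>c<l. \<tau>\<^sup>2 * ((s i * g i)\<^sup>2 * (f c)\<^sup>2))"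
      by (simp add: b_def power_mult_distrib mult.assoc)
    also have "\<dots> = 2 * q"
      by (simp add: q_def sum_distrib_left[symmetric] sum_product[symmetric] sum_distrib_right[symmetric])
    finally have bq: "(\<Sum>z\<in>?J. (b z)\<^sup>2) / 2 = q" by simp
    have "(\<integral>\<^sup>+y. ennreal (exp (tilt n k l s \<tau> (merge ?I ?J (x, y)) g h)) \<partial>gauss ?J)
       = (\<integral>\<^sup>+y. ennreal (exp (- q)) * ennreal (exp (\<Sum>z\<in>?J. b z * y z)) \<partial>gauss ?J)"
      unfolding e by (intro nn_integral_cong) (simp add: ennreal_mult'[symmetric] exp_add[symmetric])
    also have "\<dots> = ennreal (exp (- q)) * ennreal (exp ((\<Sum>z\<in>?J. (b z)\<^sup>2) / 2))"
      by (subst nn_integral_cmult, measurable) (simp add: nn_integral_gauss_exp_linear)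
    also have "\<dots> = 1" unfolding bq by (simp add: ennreal_mult'[symmetric] exp_add[symmetric])
    finally show "(\<integral>\<^sup>+y. ennreal (exp (tilt n k l s \<tau> (merge ?I ?J (x, y)) g h)) \<partial>gauss ?J) = 1" .
  qed
  also have "\<dots> = 1" by (simp add: emeasure_gauss_space)
  finally show ?thesis .
qed

lemma nn_integral_tilt_mean:
  assumes kn: "k \<le> n"
  shows "(\<integral>\<^sup>+G. tilt_mean n k l s \<tau> G \<partial>gauss ({..<n} \<times> {..<l})) = 1"
proof -
  let ?\<gamma> = "gauss ({..<n} \<times> {..<l}) :: (nat \<times> nat \<Rightarrow> real) measure"
  let ?g = "gauss {k..<n} :: (nat \<Rightarrow> real) measure" and ?h = "gauss {..<k} :: (nat \<Rightarrow> real) measure"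
  interpret \<gamma>: prob_space ?\<gamma> by (rule prob_space_gauss)
  interpret g: prob_space ?g by (rule prob_space_gauss)
  interpret h: prob_space ?h by (rule prob_space_gauss)
  interpret P: pair_sigma_finite ?g ?\<gamma> ..
  interpret Q: pair_sigma_finite ?h ?\<gamma> ..
  have m1: "(\<lambda>(g, G). \<integral>\<^sup>+h. ennreal (exp (tilt n k l s \<tau> G g h)) \<partial>?h) \<in> borel_measurable (?g \<Otimes>\<^sub>M ?\<gamma>)"
  proof -
    have "(\<lambda>z. ennreal (exp (tilt n k l s \<tau> (snd (fst z)) (fst (fst z)) (snd z)))) \<in> borel_measurable ((?g \<Otimes>\<^sub>M ?\<gamma>) \<Otimes>\<^sub>M ?h)"
      by (intro borel_measurable_tilt[OF _ kn] coordinate_measurable_gauss) measurable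
    then have "(\<lambda>y. \<integral>\<^sup>+h. ennreal (exp (tilt n k l s \<tau> (snd y) (fst y) h)) \<partial>?h) \<in> borel_measurable (?g \<Otimes>\<^sub>M ?\<gamma>)"
      by (intro h.borel_measurable_nn_integral) (simp add: split_beta')
    then show ?thesis by (simp add: split_beta')
  qed
  have m2: "(\<lambda>(h, G). ennreal (exp (tilt n k l s \<tau> G g h))) \<in> borel_measurable (?h \<Otimes>\<^sub>M ?\<gamma>)" for g
  proof -
    have "(\<lambda>z. ennreal (exp (tilt n k l s \<tau> (snd z) g (fst z)))) \<in> borel_measurable (?h \<Otimes>\<^sub>M ?\<gamma>)"
      by (intro borel_measurable_tilt[OF _ kn] coordinate_measurable_gauss measurable_const) measurable
    then show ?thesis by (simp add: split_beta')
  qed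
  have "(\<integral>\<^sup>+G. tilt_mean n k l s \<tau> G \<partial>?\<gamma>) = (\<integral>\<^sup>+g. \<integral>\<^sup>+G. \<integral>\<^sup>+h. ennreal (exp (tilt n k l s \<tau> G g h)) \<partial>?h \<partial>?\<gamma> \<partial>?g)"
    unfolding tilt_mean_def by (rule P.Fubini'[OF m1])
  also have "\<dots> = (\<integral>\<^sup>+g. \<integral>\<^sup>+h. \<integral>\<^sup>+G. ennreal (exp (tilt n k l s \<tau> G g h)) \<partial>?\<gamma> \<partial>?h \<partial>?g)"
    by (intro nn_integral_cong Q.Fubini'[OF m2])
  also have "\<dots> = 1" by (simp add: nn_integral_tilt[OF kn] emeasure_gauss_space)
  finally show ?thesis .
qed

text \<open>The Gibbs variational inequality, applied to \<open>h\<close> translated by \<open>w\<close> and then to \<open>g\<close> translated by \<open>u\<close>.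
The Frobenius norms of \<open>F\<close> and \<open>S\<close> enter as the fluctuation of \<open>F h\<close> and \<open>S g\<close> about their means.\<close>

lemma tilt_mean_lower_bound:
  fixes s u w :: "nat \<Rightarrow> real"
  shows "ennreal (exp (\<tau> * (\<Sum>i\<in>{k..<n}. s i * u i * tail_app k l G w i)
       - \<tau>\<^sup>2 / 2 * ((\<Sum>i\<in>{k..<n}. (s i * u i)\<^sup>2) + (\<Sum>i\<in>{k..<n}. (s i)\<^sup>2))
           * ((\<Sum>c<l. (right_inv_app k l G w c)\<^sup>2) + (\<Sum>c<l. \<Sum>j<k. (right_inv k l G c j)\<^sup>2))
       - (\<Sum>i\<in>{k..<n}. (u i)\<^sup>2) / 2 - (\<Sum>j<k. (w j)\<^sup>2) / 2))
     \<le> tilt_mean n k l s \<tau> G"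
proof -
  define R where "R = (\<Sum>c<l. (right_inv_app k l G w c)\<^sup>2) + (\<Sum>c<l. \<Sum>j<k. (right_inv k l G c j)\<^sup>2)"
  have R0: "0 \<le> R" by (simp add: R_def sum_nonneg)
  define W where "W = (\<Sum>j<k. (w j)\<^sup>2) / 2"
  define b where "b i = \<tau> * s i * tail_app k l G w i" for i
  define S where "S r i = (if i = r then s r else 0)" for r i :: nat
  have S: "(\<Sum>i\<in>{k..<n}. S r i * v i) = s r * v r" if "r \<in> {k..<n}" for r v
    using that by (simp add: S_def if_distrib[of "\<lambda>z. z * _"] cong: if_cong)
  have S2: "(\<Sum>i\<in>{k..<n}. (S r i)\<^sup>2) = (s r)\<^sup>2" if "r \<in> {k..<n}" for r
    using that by (simp add: S_def if_distrib[of "\<lambda>z. z\<^sup>2"] cong: if_cong)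
  have inner: "ennreal (exp ((\<Sum>i\<in>{k..<n}. b i * g i) - \<tau>\<^sup>2 / 2 * R * (\<Sum>r\<in>{k..<n}. (\<Sum>i\<in>{k..<n}. S r i * g i)\<^sup>2)) * exp (- W))
      \<le> (\<integral>\<^sup>+h. ennreal (exp (tilt n k l s \<tau> G g h)) \<partial>gauss {..<k})" for g
  proof -
    define A where "A = (\<Sum>i\<in>{k..<n}. (s i * g i)\<^sup>2)"
    have A0: "0 \<le> A" by (simp add: A_def sum_nonneg)
    define D where "D i j = (\<Sum>c<l. G (i, c) * right_inv k l G c j)" for i j
    define d where "d j = (\<Sum>i\<in>{k..<n}. \<tau> * (s i * g i) * D i j)" for j
    have lin: "(\<Sum>j<k. d j * h j) = \<tau> * (\<Sum>i\<in>{k..<n}. s i * g i * tail_app k l G h i)" for h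
    proof -
      have "tail_app k l G h i = (\<Sum>j<k. D i j * h j)" for i
      proof -
        have "tail_app k l G h i = (\<Sum>c<l. \<Sum>j<k. G (i, c) * right_inv k l G c j * h j)"
          by (simp add: tail_app_def right_inv_app_def sum_distrib_left mult.assoc)
        also have "\<dots> = (\<Sum>j<k. \<Sum>c<l. G (i, c) * right_inv k l G c j * h j)" by (rule sum.swap)
        finally show ?thesis by (simp add: D_def sum_distrib_right)
      qed
      then have "\<tau> * (\<Sum>i\<in>{k..<n}. s i * g i * tail_app k l G h i)
          = (\<Sum>i\<in>{k..<n}. \<Sum>j<k. \<tau> * (s i * g i) * D i j * h j)"
        by (simp add: sum_distrib_left mult.assoc)
      also have "\<dots> = (\<Sum>j<k. \<Sum>i\<in>{k..<n}. \<tau> * (s i * g i) * D i j * h j)"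
        by (rule sum.swap)
      finally show ?thesis by (simp add: d_def sum_distrib_right)
    qed
    have "ennreal (exp ((\<Sum>j<k. d j * w j) - \<tau>\<^sup>2 / 2 * A
          * ((\<Sum>c<l. (\<Sum>j<k. right_inv k l G c j * w j)\<^sup>2) + (\<Sum>c<l. \<Sum>j<k. (right_inv k l G c j)\<^sup>2)) - (\<Sum>j<k. (w j)\<^sup>2) / 2))
      \<le> (\<integral>\<^sup>+h. ennreal (exp ((\<Sum>j<k. d j * h j) - \<tau>\<^sup>2 / 2 * A * (\<Sum>c<l. (\<Sum>j<k. right_inv k l G c j * h j)\<^sup>2))) \<partial>gauss {..<k})"
      using A0 by (intro gauss_gibbs_lower_bound) auto
    also have "(\<Sum>c<l. (\<Sum>j<k. right_inv k l G c j * w j)\<^sup>2) + (\<Sum>c<l. \<Sum>j<k. (right_inv k l G c j)\<^sup>2) = R"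
      by (simp add: R_def right_inv_app_def)
    also have "(\<Sum>j<k. d j * w j) - \<tau>\<^sup>2 / 2 * A * R - (\<Sum>j<k. (w j)\<^sup>2) / 2
       = (\<Sum>i\<in>{k..<n}. b i * g i) - \<tau>\<^sup>2 / 2 * R * (\<Sum>r\<in>{k..<n}. (\<Sum>i\<in>{k..<n}. S r i * g i)\<^sup>2) + - W"
    proof -
      have "(\<Sum>j<k. d j * w j) = (\<Sum>i\<in>{k..<n}. b i * g i)"
        unfolding lin b_def by (simp add: sum_distrib_left ac_simps)
      moreover have "(\<Sum>r\<in>{k..<n}. (\<Sum>i\<in>{k..<n}. S r i * g i)\<^sup>2) = A"
        unfolding A_def by (intro sum.cong refl) (simp only: S)
      ultimately show ?thesis by (simp add: W_def)
    qed
    finally show ?thesis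
      unfolding lin by (simp only: exp_add tilt_def A_def right_inv_app_def)
  qed
  have "ennreal (exp (- W)) * ennreal (exp ((\<Sum>i\<in>{k..<n}. b i * u i)
      - \<tau>\<^sup>2 / 2 * R * ((\<Sum>r\<in>{k..<n}. (\<Sum>i\<in>{k..<n}. S r i * u i)\<^sup>2) + (\<Sum>r\<in>{k..<n}. \<Sum>i\<in>{k..<n}. (S r i)\<^sup>2)) - (\<Sum>i\<in>{k..<n}. (u i)\<^sup>2) / 2))
    \<le> ennreal (exp (- W)) * (\<integral>\<^sup>+g. ennreal (exp ((\<Sum>i\<in>{k..<n}. b i * g i) - \<tau>\<^sup>2 / 2 * R * (\<Sum>r\<in>{k..<n}. (\<Sum>i\<in>{k..<n}. S r i * g i)\<^sup>2))) \<partial>gauss {k..<n})"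
    using R0 by (intro mult_left_mono gauss_gibbs_lower_bound) auto
  also have "\<dots> = (\<integral>\<^sup>+g. ennreal (exp ((\<Sum>i\<in>{k..<n}. b i * g i) - \<tau>\<^sup>2 / 2 * R * (\<Sum>r\<in>{k..<n}. (\<Sum>i\<in>{k..<n}. S r i * g i)\<^sup>2)) * exp (- W)) \<partial>gauss {k..<n})"
    by (subst nn_integral_cmult[symmetric], measurable) (simp add: ennreal_mult' mult.commute)
  also have "\<dots> \<le> tilt_mean n k l s \<tau> G"
    unfolding tilt_mean_def by (intro nn_integral_mono inner)
  finally have "ennreal (exp (- W + ((\<Sum>i\<in>{k..<n}. b i * u i)
      - \<tau>\<^sup>2 / 2 * R * ((\<Sum>r\<in>{k..<n}. (\<Sum>i\<in>{k..<n}. S r i * u i)\<^sup>2) + (\<Sum>r\<in>{k..<n}. \<Sum>i\<in>{k..<n}. (S r i)\<^sup>2)) - (\<Sum>i\<in>{k..<n}. (u i)\<^sup>2) / 2)))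
    \<le> tilt_mean n k l s \<tau> G"
    by (simp only: exp_add ennreal_mult' exp_ge_zero)
  moreover have "(\<Sum>r\<in>{k..<n}. (\<Sum>i\<in>{k..<n}. S r i * u i)\<^sup>2) = (\<Sum>i\<in>{k..<n}. (s i * u i)\<^sup>2)"
    by (intro sum.cong refl) (simp only: S)
  moreover have "(\<Sum>r\<in>{k..<n}. \<Sum>i\<in>{k..<n}. (S r i)\<^sup>2) = (\<Sum>i\<in>{k..<n}. (s i)\<^sup>2)"
    by (intro sum.cong refl) (simp only: S2)
  moreover have "(\<Sum>i\<in>{k..<n}. b i * u i) = \<tau> * (\<Sum>i\<in>{k..<n}. s i * u i * tail_app k l G w i)"
    unfolding b_def by (simp add: sum_distrib_left ac_simps)
  ultimately show ?thesis unfolding R_def[symmetric] W_def[symmetric]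
    by (simp only:) (simp add: algebra_simps)
qed

section \<open>The bilinear tail of a Gaussian sketch\<close>

text \<open>The free parameters of the exponential bound are the lengths \<open>a\<close>, \<open>b\<close> of the two translations
and the tilt \<open>t\<close>. The stated values make the bound equal to \<open>3 y (F + 2 \<sigma> x)\<close>, where \<open>x\<close> and \<open>y\<close> stand for
the square roots of \<open>p ln p\<close> and of \<open>l\<close>.\<close>

lemma optimal_tilt:
  fixes F \<sigma> x y q :: real
  assumes pos: "0 < F" "0 < \<sigma>" "0 < x" "0 < y"
    and a: "a\<^sup>2 = 2 * F * x / \<sigma>" "0 < a" and b: "b\<^sup>2 = 2 * x\<^sup>2" "0 < b"
    and t: "t\<^sup>2 * ((a\<^sup>2 * \<sigma>\<^sup>2 + F\<^sup>2) * (18 * y\<^sup>2 * x\<^sup>2)) = a\<^sup>2 + 4 * x\<^sup>2" "0 < t"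
    and q: "0 \<le> q"
    and le: "t * (a * b * q) - t\<^sup>2 / 2 * ((a\<^sup>2 * \<sigma>\<^sup>2 + F\<^sup>2) * (18 * y\<^sup>2 * x\<^sup>2)) - a\<^sup>2 / 2 - b\<^sup>2 / 2 \<le> x\<^sup>2"
  shows "q \<le> 3 * y * (F + 2 * \<sigma> * x)"
proof (rule power2_le_imp_le)
  define X Y where "X = (a\<^sup>2 * \<sigma>\<^sup>2 + F\<^sup>2) * (18 * y\<^sup>2 * x\<^sup>2)" and "Y = a\<^sup>2 + 4 * x\<^sup>2"
  have XY: "X * Y = (3 * y * (F + 2 * \<sigma> * x))\<^sup>2 * (a\<^sup>2 * b\<^sup>2)"
    unfolding X_def Y_def a(1) b(1) using pos by (simp add: divide_simps) (simp add: power2_eq_square algebra_simps)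
  have "t * (a * b * q) \<le> Y"
  proof -
    have "t\<^sup>2 / 2 * X = Y / 2" using t(1) by (simp add: X_def Y_def)
    then have "t * (a * b * q) - Y / 2 - a\<^sup>2 / 2 - x\<^sup>2 \<le> x\<^sup>2"
      using le b(1) by (simp add: X_def[symmetric])
    then show ?thesis by (simp add: Y_def field_simps)
  qed
  then have "(t * (a * b * q))\<^sup>2 \<le> Y\<^sup>2" using q t a b by (intro power_mono) auto
  also have "Y\<^sup>2 = t\<^sup>2 * (X * Y)"
  proof -
    have "t\<^sup>2 * X = Y" using t(1) by (simp only: X_def Y_def)
    then show ?thesis by (simp only: power2_eq_square[of Y] mult.assoc[symmetric])
  qed
  finally have "(t\<^sup>2 * (a\<^sup>2 * b\<^sup>2)) * q\<^sup>2 \<le> (t\<^sup>2 * (a\<^sup>2 * b\<^sup>2)) * (3 * y * (F + 2 * \<sigma> * x))\<^sup>2"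
    unfolding XY by (simp add: power_mult_distrib ac_simps)
  moreover have "0 < t\<^sup>2 * (a\<^sup>2 * b\<^sup>2)" using t(2) a(2) b(2) by (intro mult_pos_pos zero_less_power)
  ultimately show "q\<^sup>2 \<le> (3 * y * (F + 2 * \<sigma> * x))\<^sup>2" by (simp only: mult_le_cancel_left_pos)
qed (use pos in simp)

text \<open>The translation \<open>w\<close> points in the direction of \<open>v\<close> and \<open>u\<close> in the direction of \<open>S H F v\<close>, so that the linear term
of the exponent becomes \<open>t a b |S H F v| / |v|\<close>. The two events on \<open>F\<close> contribute \<open>7.4\<close> and \<open>3.2\<close> to the
quadratic term; with \<open>b\<^sup>2 = 2 L\<close> they add up to \<open>18 = 7.4 * 2 + 3.2\<close>.\<close>

lemma tail_bound:
  fixes s :: "nat \<Rightarrow> real"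
  assumes k: "0 < k" and p: "2 \<le> p" and l: "l = k + p"
    and s: "\<And>i. i \<in> {k..<n} \<Longrightarrow> 0 \<le> s i \<and> s i \<le> \<sigma>"
    and F: "F\<^sup>2 = (\<Sum>i\<in>{k..<n}. (s i)\<^sup>2)" "0 < F" and \<sigma>: "0 < \<sigma>"
    and L: "L = real p * ln (real p)"
    and a: "a\<^sup>2 = 2 * F * sqrt L / \<sigma>" "0 < a" and b: "b\<^sup>2 = 2 * L" "0 < b"
    and t: "t\<^sup>2 * ((a\<^sup>2 * \<sigma>\<^sup>2 + F\<^sup>2) * (18 * real l * L)) = a\<^sup>2 + 4 * L" "0 < t"
    and G1: "G \<in> trace_event n k l p" and G2: "G \<in> norm_event n k l p"
    and G3: "tilt_mean n k l s t G \<le> ennreal (real p ^ p)"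
  shows "sqrt (\<Sum>i\<in>{k..<n}. (s i * tail_app k l G v i)\<^sup>2)
    \<le> 3 * sqrt (real l) * (F + 2 * \<sigma> * sqrt L) * vnorm k v"
proof -
  have L0: "0 < L" using p by (simp add: L)
  have l0: "0 < real l" using k l by simp
  have nondeg: "\<forall>i<k. y i = 0" if "\<forall>c<l. row_comb k y G c = 0" for y
    by (rule trace_event_nondegenerate[OF p G1 that])
  have det: "det (gram k l G) \<noteq> 0" by (rule det_gram_nonzero) (rule nondeg)
  have F_norm: "(\<Sum>c<l. (right_inv_app k l G w c)\<^sup>2) \<le> 7.4 * real l * ip k w w" for w
  proof -
    have "vnorm l (right_inv_app k l G w) \<le> sqrt (7.4 * real l) * vnorm k w"
      unfolding right_inv_app_def
    proof (rule right_inv_norm_le[OF det])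
      fix y
      have "\<bar>ip k w y\<bar> \<le> vnorm k w * vnorm k y"
        using Cauchy_Schwarz_ip[of k w y] by (metis real_sqrt_abs real_sqrt_le_mono real_sqrt_mult)
      also have "\<dots> \<le> vnorm k w * (sqrt (7.4 * real l) * vnorm l (row_comb k y G))"
        by (intro mult_left_mono norm_event_bound[OF k p G2 nondeg]) (auto simp: ip_nonneg)
      finally show "\<bar>ip k w y\<bar> \<le> sqrt (7.4 * real l) * vnorm k w * vnorm l (row_comb k y G)"
        by (simp only: ac_simps)
    qed (simp add: ip_nonneg)
    then have "sqrt (ip l (right_inv_app k l G w) (right_inv_app k l G w)) \<le> sqrt (7.4 * real l * ip k w w)"
      by (simp only: real_sqrt_mult)
    then show ?thesis by (simp only: real_sqrt_le_iff ip_square)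
  qed
  have F_frob: "(\<Sum>c<l. \<Sum>j<k. (right_inv k l G c j)\<^sup>2) \<le> 3.2 * real l * L"
  proof -
    obtain e where e: "\<And>j. j < k \<Longrightarrow> 0 \<le> e j \<and> pinv_norm k l (unit_fun j) G = ennreal (e j)"
      and sum_e: "(\<Sum>j<k. (e j)\<^sup>2) \<le> real k * (3.2 * (real p * ln (real p)))"
      using trace_event_bound[OF p G1] by blast
    have col: "(\<Sum>c<l. (right_inv k l G c j)\<^sup>2) \<le> (e j)\<^sup>2" if j: "j < k" for j
    proof -
      have "vnorm l (\<lambda>c. \<Sum>i<k. right_inv k l G c i * unit_fun j i) \<le> e j"
        using e[OF j] by (intro right_inv_norm_le[OF det] pinv_normD) auto
      moreover have "(\<Sum>i<k. right_inv k l G c i * unit_fun j i) = right_inv k l G c j" for c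
        using j by (simp add: ip_unit_fun(2)[of j k, unfolded ip_def])
      ultimately have "sqrt (\<Sum>c<l. (right_inv k l G c j)\<^sup>2) \<le> e j" by (simp add: ip_square)
      then show ?thesis by (rule sqrt_le_D)
    qed
    have "(\<Sum>c<l. \<Sum>j<k. (right_inv k l G c j)\<^sup>2) = (\<Sum>j<k. \<Sum>c<l. (right_inv k l G c j)\<^sup>2)" by (rule sum.swap)
    also have "\<dots> \<le> (\<Sum>j<k. (e j)\<^sup>2)" by (intro sum_mono col) simp
    also have "\<dots> \<le> real k * (3.2 * L)" using sum_e by (simp add: L)
    also have "\<dots> \<le> real l * (3.2 * L)" using l L0 by (intro mult_right_mono) auto
    finally show ?thesis by (simp only: ac_simps)
  qed
  define N where "N = vnorm k v"
  define q where "q = sqrt (\<Sum>i\<in>{k..<n}. (s i * tail_app k l G v i)\<^sup>2)"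
  have q0: "0 \<le> q" by (simp add: q_def sum_nonneg)
  have q2: "(\<Sum>i\<in>{k..<n}. (s i * tail_app k l G v i)\<^sup>2) = q\<^sup>2" by (simp add: q_def sum_nonneg)
  have N0: "0 \<le> N" by (simp add: N_def ip_nonneg)
  have N2: "ip k v v = N\<^sup>2" by (simp add: N_def ip_nonneg)
  have scale: "right_inv_app k l G (\<lambda>j. r * v j) c = r * right_inv_app k l G v c"
      "tail_app k l G (\<lambda>j. r * v j) i = r * tail_app k l G v i" for r c i
    by (simp_all add: tail_app_def right_inv_app_def sum_distrib_left ac_simps)
  show ?thesis
  proof (cases "N = 0 \<or> q = 0")
    case True
    have "q = 0"
    proof (cases "N = 0")
      case True
      then have "\<forall>j<k. v j = 0" by (simp add: N_def ip_eq_0_iff)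
      then have "tail_app k l G v i = 0" for i by (simp add: tail_app_def right_inv_app_def)
      then show ?thesis by (simp add: q_def)
    qed (use True in simp)
    then show ?thesis using F \<sigma> L0 l0 N0 by (simp add: q_def[symmetric] N_def[symmetric])
  next
    case False
    then have Np: "0 < N" and qp: "0 < q" using N0 q0 by auto
    define w where "w j = b / N * v j" for j
    define u where "u i = a / q * (s i * tail_app k l G v i)" for i
    have ww: "ip k w w = b\<^sup>2" unfolding w_def ip_scale N2 using Np by (simp add: power2_eq_square)
    have uu: "(\<Sum>i\<in>{k..<n}. (u i)\<^sup>2) = a\<^sup>2"
      unfolding u_def power_mult_distrib[of "a / q"] sum_distrib_left[symmetric] q2
      using qp by (simp add: power_divide)
    have su: "(\<Sum>i\<in>{k..<n}. (s i * u i)\<^sup>2) \<le> a\<^sup>2 * \<sigma>\<^sup>2"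
    proof -
      have "(\<Sum>i\<in>{k..<n}. (s i * u i)\<^sup>2) \<le> (\<Sum>i\<in>{k..<n}. \<sigma>\<^sup>2 * (u i)\<^sup>2)"
        using s by (intro sum_mono) (auto simp: power_mult_distrib intro!: mult_right_mono power_mono)
      then show ?thesis by (simp add: sum_distrib_left[symmetric] uu mult.commute)
    qed
    have lin: "(\<Sum>i\<in>{k..<n}. s i * u i * tail_app k l G w i) = a * b * (q / N)"
    proof -
      have "(\<Sum>i\<in>{k..<n}. s i * u i * tail_app k l G w i) = (\<Sum>i\<in>{k..<n}. a * b / (q * N) * (s i * tail_app k l G v i)\<^sup>2)"
        unfolding w_def[abs_def] scale u_def
        by (intro sum.cong refl) (simp add: power2_eq_square ac_simps)
      also have "\<dots> = a * b / (q * N) * q\<^sup>2" by (simp only: sum_distrib_left[symmetric] q2)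
      finally show ?thesis using qp by (simp add: power2_eq_square)
    qed
    define E where "E = t * (\<Sum>i\<in>{k..<n}. s i * u i * tail_app k l G w i)
       - t\<^sup>2 / 2 * ((\<Sum>i\<in>{k..<n}. (s i * u i)\<^sup>2) + (\<Sum>i\<in>{k..<n}. (s i)\<^sup>2))
           * ((\<Sum>c<l. (right_inv_app k l G w c)\<^sup>2) + (\<Sum>c<l. \<Sum>j<k. (right_inv k l G c j)\<^sup>2))
       - (\<Sum>i\<in>{k..<n}. (u i)\<^sup>2) / 2 - (\<Sum>j<k. (w j)\<^sup>2) / 2"
    have "ennreal (exp E) \<le> tilt_mean n k l s t G" unfolding E_def by (rule tilt_mean_lower_bound)
    also note G3
    also have "real p ^ p = exp L" using p by (simp add: L exp_of_nat_mult)
    finally have "E \<le> L" by (simp add: ennreal_le_iff)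
    moreover have "t * (a * b * (q / N)) - t\<^sup>2 / 2 * ((a\<^sup>2 * \<sigma>\<^sup>2 + F\<^sup>2) * (18 * real l * L)) - a\<^sup>2 / 2 - b\<^sup>2 / 2 \<le> E"
    proof -
      have "(\<Sum>c<l. (right_inv_app k l G w c)\<^sup>2) + (\<Sum>c<l. \<Sum>j<k. (right_inv k l G c j)\<^sup>2)
          \<le> 7.4 * real l * b\<^sup>2 + 3.2 * real l * L"
        using F_norm[of w] F_frob unfolding ww by (rule add_mono)
      also have "\<dots> = 18 * real l * L" by (simp add: b)
      finally have "((\<Sum>i\<in>{k..<n}. (s i * u i)\<^sup>2) + F\<^sup>2) * ((\<Sum>c<l. (right_inv_app k l G w c)\<^sup>2) + (\<Sum>c<l. \<Sum>j<k. (right_inv k l G c j)\<^sup>2))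
          \<le> (a\<^sup>2 * \<sigma>\<^sup>2 + F\<^sup>2) * (18 * real l * L)"
        using su by (intro mult_mono add_mono) (auto intro!: add_nonneg_nonneg sum_nonneg)
      then have "t\<^sup>2 / 2 * (((\<Sum>i\<in>{k..<n}. (s i * u i)\<^sup>2) + F\<^sup>2) * ((\<Sum>c<l. (right_inv_app k l G w c)\<^sup>2) + (\<Sum>c<l. \<Sum>j<k. (right_inv k l G c j)\<^sup>2)))
          \<le> t\<^sup>2 / 2 * ((a\<^sup>2 * \<sigma>\<^sup>2 + F\<^sup>2) * (18 * real l * L))"
        by (rule mult_left_mono) simp
      moreover have "(\<Sum>j<k. (w j)\<^sup>2) = b\<^sup>2" using ww by (simp only: ip_square)
      ultimately show ?thesis unfolding E_def lin uu F(1)[symmetric] by (simp only: mult.assoc)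
    qed
    ultimately have le: "t * (a * b * (q / N)) - t\<^sup>2 / 2 * ((a\<^sup>2 * \<sigma>\<^sup>2 + F\<^sup>2) * (18 * real l * L)) - a\<^sup>2 / 2 - b\<^sup>2 / 2 \<le> L"
      by (rule order_trans[rotated])
    have xs: "(sqrt L)\<^sup>2 = L" "(sqrt (real l))\<^sup>2 = real l" using L0 by simp_all
    have "0 < sqrt L" "0 < sqrt (real l)" "0 \<le> q / N" using L0 l0 q0 N0 by simp_all
    with optimal_tilt[of F \<sigma> "sqrt L" "sqrt (real l)" a b t "q / N", unfolded xs] le F(2) \<sigma> a b t
    have "q / N \<le> 3 * sqrt (real l) * (F + 2 * \<sigma> * sqrt L)" by blast
    then show ?thesis using Np by (simp add: q_def[symmetric] N_def[symmetric] pos_divide_le_eq)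
  qed
qed

text \<open>The matrix \<open>F\<close> is a right inverse of the first \<open>k\<close> rows, and the bounded map is \<open>S H F\<close>. The
translation length \<open>a\<close> balances the Frobenius norm of \<open>S\<close> against the bound \<open>\<sigma>\<close> of its entries.\<close>

theorem gaussian_sketch:
  fixes s :: "nat \<Rightarrow> real"
  assumes k: "0 < k" "k < n" and p: "2 \<le> p" and l: "l = k + p"
    and s: "\<And>i. i \<in> {k..<n} \<Longrightarrow> 0 \<le> s i \<and> s i \<le> \<sigma>"
  shows "\<exists>\<G>\<in>sets (gauss ({..<n} \<times> {..<l})).
    emeasure (gauss ({..<n} \<times> {..<l})) (space (gauss ({..<n} \<times> {..<l})) - \<G>) \<le> ennreal (3 / real p ^ p) \<and>
    (\<forall>G\<in>\<G>. \<exists>F. (\<forall>i<k. \<forall>j<k. (\<Sum>c<l. G (i, c) * F c j) = (if i = j then 1 else 0)) \<and>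
      (\<forall>v. sqrt (\<Sum>i\<in>{k..<n}. (s i * (\<Sum>c<l. G (i, c) * (\<Sum>j<k. F c j * v j)))\<^sup>2)
        \<le> (3 * sqrt (real l) * sqrt (\<Sum>i\<in>{k..<n}. (s i)\<^sup>2) + 6 * sqrt (real l * real p * ln (real p)) * \<sigma>) * vnorm k v))"
proof -
  have kn: "k \<le> n" using k by simp
  let ?\<gamma> = "gauss ({..<n} \<times> {..<l}) :: (nat \<times> nat \<Rightarrow> real) measure"
  define L where "L = real p * ln (real p)"
  have L0: "0 < L" using p by (simp add: L_def)
  have l0: "0 < real l" using k l by simp
  define F where "F = sqrt (\<Sum>i\<in>{k..<n}. (s i)\<^sup>2)"
  have F2: "F\<^sup>2 = (\<Sum>i\<in>{k..<n}. (s i)\<^sup>2)" and F0: "0 \<le> F" by (simp_all add: F_def sum_nonneg)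
  define a where "a = sqrt (2 * F * sqrt L / \<sigma>)"
  define b where "b = sqrt (2 * L)"
  define t where "t = sqrt ((a\<^sup>2 + 4 * L) / ((a\<^sup>2 * \<sigma>\<^sup>2 + F\<^sup>2) * (18 * real l * L)))"
  define Z where "Z = {G \<in> space ?\<gamma>. tilt_mean n k l s t G \<le> ennreal (real p ^ p)}"
  have Zm: "tilt_mean n k l s t \<in> borel_measurable ?\<gamma>" by (rule borel_measurable_tilt_mean[OF kn])
  have sets: "trace_event n k l p \<in> sets ?\<gamma>" "norm_event n k l p \<in> sets ?\<gamma>" "Z \<in> sets ?\<gamma>"
  proof -
    have [measurable]: "pinv_norm k l x \<in> borel_measurable ?\<gamma>" for x
      using borel_measurable_pinv_norm_gauss[OF kn, of l x] by (simp cong: measurable_cong_sets)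
    have [measurable]: "avg_pinv_norm k l p \<in> borel_measurable ?\<gamma>"
      using borel_measurable_avg_pinv_norm[OF kn, of l p] by (simp cong: measurable_cong_sets)
    note [measurable] = Zm
    show "trace_event n k l p \<in> sets ?\<gamma>" unfolding trace_event_def by measurable
    show "norm_event n k l p \<in> sets ?\<gamma>" unfolding norm_event_def by measurable
    show "Z \<in> sets ?\<gamma>" unfolding Z_def by measurable
  qed
  have "emeasure ?\<gamma> {G \<in> space ?\<gamma>. \<not> tilt_mean n k l s t G \<le> ennreal (real p ^ p)} \<le> ennreal (1 / real p ^ p)"
    using p by (intro Markov_complement Zm) (auto simp: nn_integral_tilt_mean[OF kn])
  also have "{G \<in> space ?\<gamma>. \<not> tilt_mean n k l s t G \<le> ennreal (real p ^ p)} = space ?\<gamma> - Z"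
    by (auto simp: Z_def)
  finally have Zp: "emeasure ?\<gamma> (space ?\<gamma> - Z) \<le> ennreal (1 / real p ^ p)" .
  define \<G> where "\<G> = trace_event n k l p \<inter> norm_event n k l p \<inter> Z"
  have "emeasure ?\<gamma> (space ?\<gamma> - \<G>) \<le> emeasure ?\<gamma> ((space ?\<gamma> - trace_event n k l p) \<union> (space ?\<gamma> - norm_event n k l p) \<union> (space ?\<gamma> - Z))"
    using sets by (intro emeasure_mono sets.Un sets.compl_sets) (auto simp: \<G>_def)
  also have "\<dots> \<le> emeasure ?\<gamma> ((space ?\<gamma> - trace_event n k l p) \<union> (space ?\<gamma> - norm_event n k l p)) + emeasure ?\<gamma> (space ?\<gamma> - Z)"
    using sets by (intro emeasure_subadditive sets.Un sets.compl_sets)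
  also have "\<dots> \<le> (emeasure ?\<gamma> (space ?\<gamma> - trace_event n k l p) + emeasure ?\<gamma> (space ?\<gamma> - norm_event n k l p)) + emeasure ?\<gamma> (space ?\<gamma> - Z)"
    using sets by (intro add_right_mono emeasure_subadditive sets.compl_sets)
  also have "\<dots> \<le> (ennreal (1 / real p ^ p) + ennreal (1 / real p ^ p)) + ennreal (1 / real p ^ p)"
    by (intro add_mono Zp trace_event_prob norm_event_prob k(1) kn p l)
  also have "\<dots> = ennreal (3 / real p ^ p)"
    by (simp add: ennreal_plus[symmetric] add_divide_distrib[symmetric] del: ennreal_plus)
  finally have prob: "emeasure ?\<gamma> (space ?\<gamma> - \<G>) \<le> ennreal (3 / real p ^ p)" .
  have "\<exists>F'. (\<forall>i<k. \<forall>j<k. (\<Sum>c<l. G (i, c) * F' c j) = (if i = j then 1 else 0)) \<and>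
      (\<forall>v. sqrt (\<Sum>i\<in>{k..<n}. (s i * (\<Sum>c<l. G (i, c) * (\<Sum>j<k. F' c j * v j)))\<^sup>2)
        \<le> (3 * sqrt (real l) * F + 6 * sqrt (real l * real p * ln (real p)) * \<sigma>) * vnorm k v)" if G: "G \<in> \<G>" for G
  proof (intro exI[of _ "right_inv k l G"] conjI allI impI)
    have G1: "G \<in> trace_event n k l p" and G2: "G \<in> norm_event n k l p" and G3: "tilt_mean n k l s t G \<le> ennreal (real p ^ p)"
      using G by (auto simp: \<G>_def Z_def)
    have det: "det (gram k l G) \<noteq> 0"
      by (rule det_gram_nonzero) (rule trace_event_nondegenerate[OF p G1])
    show "(\<Sum>c<l. G (i, c) * right_inv k l G c j) = (if i = j then 1 else 0)" if "i < k" "j < k" for i j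
      by (rule right_inv_mult[OF det that])
    fix v
    have "sqrt (\<Sum>i\<in>{k..<n}. (s i * tail_app k l G v i)\<^sup>2)
      \<le> (3 * sqrt (real l) * F + 6 * sqrt (real l * real p * ln (real p)) * \<sigma>) * vnorm k v"
    \<comment> \<open>All \<open>s i\<close> vanish in the first case, for which the scales \<open>a\<close> and \<open>t\<close> are meaningless.\<close>
    proof (cases "F = 0")
      case True
      then have "(\<Sum>i\<in>{k..<n}. (s i)\<^sup>2) = 0" using F2 by simp
      then have z: "\<forall>i\<in>{k..<n}. s i = 0" by (simp add: sum_nonneg_eq_0_iff)
      have "0 \<le> \<sigma>" using s[of k] k by auto
      then show ?thesis using z \<open>F = 0\<close> p by (simp add: ip_nonneg)
    next
      case False
      then have Fp: "0 < F" using F0 by simp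
      then have "0 < (\<Sum>i\<in>{k..<n}. (s i)\<^sup>2)" using F2 by (metis zero_less_power)
      then obtain i where i: "i \<in> {k..<n}" "s i \<noteq> 0"
        by (metis (no_types, lifting) less_irrefl power_zero_numeral sum.neutral)
      then have \<sigma>: "0 < \<sigma>" using s[OF i(1)] by linarith
      have a2: "a\<^sup>2 = 2 * F * sqrt L / \<sigma>" "0 < a" using Fp \<sigma> L0 by (simp_all add: a_def)
      have b2: "b\<^sup>2 = 2 * L" "0 < b" using L0 by (simp_all add: b_def)
      have X: "0 < (a\<^sup>2 * \<sigma>\<^sup>2 + F\<^sup>2) * (18 * real l * L)"
        using Fp l0 L0 by (intro mult_pos_pos add_nonneg_pos) auto
      have Y: "0 < a\<^sup>2 + 4 * L" using L0 by (intro add_nonneg_pos) auto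
      have "(sqrt (y / x))\<^sup>2 * x = y \<and> 0 < sqrt (y / x)" if "0 < x" "0 < y" for x y :: real
        using that by simp
      from this[OF X Y] have t2: "t\<^sup>2 * ((a\<^sup>2 * \<sigma>\<^sup>2 + F\<^sup>2) * (18 * real l * L)) = a\<^sup>2 + 4 * L" "0 < t"
        unfolding t_def[symmetric] by blast+
      have "sqrt (\<Sum>i\<in>{k..<n}. (s i * tail_app k l G v i)\<^sup>2) \<le> 3 * sqrt (real l) * (F + 2 * \<sigma> * sqrt L) * vnorm k v"
        by (rule tail_bound[OF k(1) p l s F2 Fp \<sigma> L_def a2 b2 t2 G1 G2 G3])
      also have "3 * sqrt (real l) * (F + 2 * \<sigma> * sqrt L) = 3 * sqrt (real l) * F + 6 * sqrt (real l * real p * ln (real p)) * \<sigma>"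
        by (simp add: L_def real_sqrt_mult algebra_simps)
      finally show ?thesis .
    qed
    then show "sqrt (\<Sum>i\<in>{k..<n}. (s i * (\<Sum>c<l. G (i, c) * (\<Sum>j<k. right_inv k l G c j * v j)))\<^sup>2)
        \<le> (3 * sqrt (real l) * F + 6 * sqrt (real l * real p * ln (real p)) * \<sigma>) * vnorm k v"
      by (simp only: tail_app_def right_inv_app_def)
  qed
  moreover have "\<G> \<in> sets ?\<gamma>" using sets by (auto simp: \<G>_def)
  ultimately show ?thesis using prob unfolding F_def by blast
qed

section \<open>Norms, singular values and pseudoinverses\<close>

lemma scalar_prod_ip:
  fixes u v :: "real vec"
  assumes "v \<in> carrier_vec n"
  shows "scalar_prod u v = ip n (\<lambda>i. u $ i) (\<lambda>i. v $ i)"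
  using assms by (simp add: scalar_prod_def ip_def lessThan_atLeast0)

lemma vec_norm2_vnorm: "v \<in> carrier_vec n \<Longrightarrow> vec_norm2 v = vnorm n (\<lambda>i. v $ i)"
  by (simp add: vec_norm2_def scalar_prod_ip)

lemma vec_norm2_L2: "v \<in> carrier_vec n \<Longrightarrow> vec_norm2 v = L2_set (\<lambda>i. v $ i) {..<n}"
  by (simp add: vec_norm2_vnorm ip_square L2_set_def)

lemma scalar_prod_self_nonneg: "0 \<le> scalar_prod v (v :: real vec)"
  by (simp add: scalar_prod_def sum_nonneg)

lemma vec_norm2_nonneg: "0 \<le> vec_norm2 v"
  by (simp add: vec_norm2_def scalar_prod_self_nonneg)

lemma vec_norm2_square: "(vec_norm2 v)\<^sup>2 = scalar_prod v v"
  by (simp add: vec_norm2_def scalar_prod_self_nonneg)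

lemma vec_norm2_triangle:
  assumes "u \<in> carrier_vec n" "v \<in> carrier_vec n"
  shows "vec_norm2 (u + v) \<le> vec_norm2 u + vec_norm2 v"
proof -
  have "vec_norm2 (u + v) = L2_set (\<lambda>i. u $ i + v $ i) {..<n}"
    unfolding vec_norm2_L2[OF add_carrier_vec[OF assms]] using assms by (intro L2_set_cong) auto
  then show ?thesis using L2_set_triangle_ineq[of "\<lambda>i. u $ i" "\<lambda>i. v $ i" "{..<n}"] assms
    by (simp add: vec_norm2_L2)
qed

lemma vec_norm2_smult: "vec_norm2 (a \<cdot>\<^sub>v v) = \<bar>a\<bar> * vec_norm2 v"
proof -
  have "scalar_prod (a \<cdot>\<^sub>v v) (a \<cdot>\<^sub>v v) = a\<^sup>2 * scalar_prod v v"
    by (simp add: power2_eq_square)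
  then show ?thesis by (simp add: vec_norm2_def real_sqrt_mult)
qed

lemma vec_norm2_0_iff: "v \<in> carrier_vec n \<Longrightarrow> vec_norm2 v = 0 \<longleftrightarrow> v = 0\<^sub>v n"
  by (auto simp: vec_norm2_vnorm ip_eq_0_iff intro!: eq_vecI)

lemma Cauchy_Schwarz_vec:
  fixes u v :: "real vec"
  assumes "u \<in> carrier_vec n" "v \<in> carrier_vec n"
  shows "scalar_prod u v \<le> vec_norm2 u * vec_norm2 v"
proof -
  have "scalar_prod u v \<le> sqrt ((ip n (\<lambda>i. u $ i) (\<lambda>i. v $ i))\<^sup>2)"
    using assms by (simp add: scalar_prod_ip)
  also have "\<dots> \<le> sqrt (ip n (\<lambda>i. u $ i) (\<lambda>i. u $ i) * ip n (\<lambda>i. v $ i) (\<lambda>i. v $ i))"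
    by (intro real_sqrt_le_mono Cauchy_Schwarz_ip)
  finally show ?thesis using assms by (simp add: vec_norm2_vnorm real_sqrt_mult)
qed

lemma adjoint_vec:
  fixes A :: "real mat"
  assumes "A \<in> carrier_mat m n" "x \<in> carrier_vec n" "y \<in> carrier_vec m"
  shows "scalar_prod (A *\<^sub>v x) y = scalar_prod x (transpose_mat A *\<^sub>v y)"
proof -
  have "scalar_prod (A *\<^sub>v x) y = scalar_prod y (A *\<^sub>v x)"
    using assms by (intro comm_scalar_prod) auto
  also have "\<dots> = scalar_prod (transpose_mat A *\<^sub>v y) x"
    by (rule transpose_vec_mult_scalar[OF assms, symmetric])
  also have "\<dots> = scalar_prod x (transpose_mat A *\<^sub>v y)"
    using assms by (intro comm_scalar_prod) auto
  finally show ?thesis .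
qed

lemma vec_norm2_mult_bounded:
  fixes A :: "real mat"
  assumes A: "A \<in> carrier_mat m n"
  shows "\<exists>C\<ge>0. \<forall>v\<in>carrier_vec n. vec_norm2 (A *\<^sub>v v) \<le> C * vec_norm2 v"
proof -
  define C where "C = sqrt (\<Sum>r<m. (vec_norm2 (row A r))\<^sup>2)"
  have "vec_norm2 (A *\<^sub>v v) \<le> C * vec_norm2 v" if v: "v \<in> carrier_vec n" for v
  proof -
    have "scalar_prod (A *\<^sub>v v) (A *\<^sub>v v) = (\<Sum>r<m. (scalar_prod (row A r) v)\<^sup>2)"
      using A v by (simp add: scalar_prod_def[of "A *\<^sub>v v"] lessThan_atLeast0 power2_eq_square)
    also have "\<dots> \<le> (\<Sum>r<m. (vec_norm2 (row A r))\<^sup>2 * (vec_norm2 v)\<^sup>2)"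
    proof (rule sum_mono)
      fix r assume "r \<in> {..<m}"
      then have r: "row A r \<in> carrier_vec n" using A by (auto intro: row_carrier_vec)
      show "(scalar_prod (row A r) v)\<^sup>2 \<le> (vec_norm2 (row A r))\<^sup>2 * (vec_norm2 v)\<^sup>2"
        unfolding vec_norm2_square using Cauchy_Schwarz_ip[of n] r v by (simp add: scalar_prod_ip)
    qed
    finally have "sqrt (scalar_prod (A *\<^sub>v v) (A *\<^sub>v v)) \<le> sqrt ((\<Sum>r<m. (vec_norm2 (row A r))\<^sup>2) * (vec_norm2 v)\<^sup>2)"
      by (simp add: sum_distrib_right)
    then show ?thesis by (simp add: C_def vec_norm2_def[of "A *\<^sub>v v"] real_sqrt_mult vec_norm2_nonneg)
  qed
  moreover have "0 \<le> C" by (simp add: C_def sum_nonneg)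
  ultimately show ?thesis by blast
qed

lemma vec_norm2_0 [simp]: "vec_norm2 (0\<^sub>v n) = 0"
  by (simp add: vec_norm2_def)

lemma mat_norm2_bdd:
  assumes A: "A \<in> carrier_mat m n"
  shows "bdd_above ((\<lambda>v. vec_norm2 (A *\<^sub>v v)) ` {v \<in> carrier_vec (dim_col A). vec_norm2 v \<le> 1})"
proof -
  obtain C where C: "0 \<le> C" "\<forall>v\<in>carrier_vec n. vec_norm2 (A *\<^sub>v v) \<le> C * vec_norm2 v"
    using vec_norm2_mult_bounded[OF A] by blast
  have "vec_norm2 (A *\<^sub>v v) \<le> C" if "v \<in> carrier_vec n" "vec_norm2 v \<le> 1" for v
    using C that mult_left_mono[of "vec_norm2 v" 1 C] by force
  then show ?thesis using A by (intro bdd_aboveI[of _ C]) auto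
qed

lemma mat_norm2_nonneg: "0 \<le> mat_norm2 A"
proof -
  have A: "A \<in> carrier_mat (dim_row A) (dim_col A)" by simp
  have "A *\<^sub>v 0\<^sub>v (dim_col A) = 0\<^sub>v (dim_row A)" by auto
  then have "vec_norm2 (A *\<^sub>v 0\<^sub>v (dim_col A)) = 0" by simp
  moreover have "vec_norm2 (A *\<^sub>v 0\<^sub>v (dim_col A)) \<le> mat_norm2 A"
    unfolding mat_norm2_def by (intro cSUP_upper mat_norm2_bdd[OF A]) auto
  ultimately show ?thesis by simp
qed

lemma vec_norm2_mult_le:
  assumes A: "A \<in> carrier_mat m n" and v: "v \<in> carrier_vec n"
  shows "vec_norm2 (A *\<^sub>v v) \<le> mat_norm2 A * vec_norm2 v"
proof (cases "vec_norm2 v = 0")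
  case True
  then have "v = 0\<^sub>v n" using v by (simp add: vec_norm2_0_iff)
  moreover have "A *\<^sub>v 0\<^sub>v n = 0\<^sub>v m" using A by auto
  ultimately show ?thesis by simp
next
  case False
  then have pos: "0 < vec_norm2 v" using vec_norm2_nonneg[of v] by linarith
  let ?u = "(1 / vec_norm2 v) \<cdot>\<^sub>v v"
  have "vec_norm2 ?u = 1" using pos by (simp add: vec_norm2_smult)
  then have "vec_norm2 (A *\<^sub>v ?u) \<le> mat_norm2 A"
    unfolding mat_norm2_def using A v by (intro cSUP_upper mat_norm2_bdd[OF A]) auto
  moreover have "A *\<^sub>v ?u = (1 / vec_norm2 v) \<cdot>\<^sub>v (A *\<^sub>v v)"
    by (rule mult_mat_vec[OF A v])
  ultimately show ?thesis using pos by (simp add: vec_norm2_smult pos_divide_le_eq)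
qed

lemma mat_norm2_leI:
  assumes A: "A \<in> carrier_mat m n" and c: "0 \<le> c"
    and le: "\<And>v. v \<in> carrier_vec n \<Longrightarrow> vec_norm2 (A *\<^sub>v v) \<le> c * vec_norm2 v"
  shows "mat_norm2 A \<le> c"
  unfolding mat_norm2_def
proof (rule cSUP_least)
  have "0\<^sub>v (dim_col A) \<in> {v \<in> carrier_vec (dim_col A). vec_norm2 v \<le> 1}" by simp
  then show "{v \<in> carrier_vec (dim_col A). vec_norm2 v \<le> 1} \<noteq> {}" by blast
  fix v assume "v \<in> {v \<in> carrier_vec (dim_col A). vec_norm2 v \<le> 1}"
  then have v: "v \<in> carrier_vec n" "vec_norm2 v \<le> 1" using A by auto
  show "vec_norm2 (A *\<^sub>v v) \<le> c"
    using le[OF v(1)] mult_left_mono[OF v(2) c] by simp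
qed

text \<open>The reason is \<open>|A v|\<^sup>2 = \<langle>v, A\<^sup>T (A v)\<rangle> \<le> c |v| |A v|\<close>.\<close>

lemma adjoint_norm_le:
  fixes A :: "real mat"
  assumes A: "A \<in> carrier_mat m n" and v: "v \<in> carrier_vec n" and c: "0 \<le> c"
    and le: "\<And>y. y \<in> carrier_vec m \<Longrightarrow> vec_norm2 (transpose_mat A *\<^sub>v y) \<le> c * vec_norm2 y"
  shows "vec_norm2 (A *\<^sub>v v) \<le> c * vec_norm2 v"
proof -
  let ?N = "vec_norm2 (A *\<^sub>v v)"
  have Av: "A *\<^sub>v v \<in> carrier_vec m" using A v by simp
  have "?N * ?N = scalar_prod (A *\<^sub>v v) (A *\<^sub>v v)"
    using vec_norm2_square[of "A *\<^sub>v v"] by (simp add: power2_eq_square)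
  also have "\<dots> = scalar_prod v (transpose_mat A *\<^sub>v (A *\<^sub>v v))" by (rule adjoint_vec[OF A v Av])
  also have "\<dots> \<le> vec_norm2 v * vec_norm2 (transpose_mat A *\<^sub>v (A *\<^sub>v v))"
    using A v by (intro Cauchy_Schwarz_vec[of _ n]) auto
  also have "\<dots> \<le> vec_norm2 v * (c * ?N)"
    by (intro mult_left_mono le Av vec_norm2_nonneg)
  finally have "?N * ?N \<le> (c * vec_norm2 v) * ?N" by (simp add: ac_simps)
  then show ?thesis using vec_norm2_nonneg[of "A *\<^sub>v v"] c vec_norm2_nonneg[of v]
    by (cases "?N = 0") auto
qed

lemma orthonormal_cols_norm:
  assumes Q: "Q \<in> carrier_mat m l" "orthonormal_cols Q" and v: "v \<in> carrier_vec l"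
  shows "vec_norm2 (Q *\<^sub>v v) = vec_norm2 v"
proof -
  have "scalar_prod (Q *\<^sub>v v) (Q *\<^sub>v v) = scalar_prod v (transpose_mat Q *\<^sub>v (Q *\<^sub>v v))"
    using Q v by (intro adjoint_vec) auto
  also have "transpose_mat Q *\<^sub>v (Q *\<^sub>v v) = (transpose_mat Q * Q) *\<^sub>v v"
    using Q v by (intro assoc_mult_mat_vec[symmetric]) auto
  also have "\<dots> = v" using Q v by (auto simp: orthonormal_cols_def)
  finally show ?thesis by (simp add: vec_norm2_def)
qed

lemma orthonormal_cols_adjoint_norm_le:
  assumes Q: "Q \<in> carrier_mat m l" "orthonormal_cols Q" and v: "v \<in> carrier_vec m"
  shows "vec_norm2 (transpose_mat Q *\<^sub>v v) \<le> vec_norm2 v"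
  using adjoint_norm_le[of "transpose_mat Q" l m v 1] Q v orthonormal_cols_norm[OF Q] by simp

text \<open>The singular values are read off from the characteristic polynomial, which the spectral decomposition of \<open>A\<^sup>T A\<close>
splits into linear factors; the eigenvalues of \<open>A\<^sup>T A\<close> are already listed in decreasing order.\<close>

lemma gram_spectral_decomposition:
  fixes A :: "real mat"
  assumes A: "A \<in> carrier_mat m n"
  shows "\<exists>P d. P \<in> carrier_mat n n \<and> transpose_mat P * P = 1\<^sub>m n \<and> P * transpose_mat P = 1\<^sub>m n \<and>
    transpose_mat A * A = P * mat_diag n d * transpose_mat P \<and>
    (\<forall>i<n. 0 \<le> d i) \<and> (\<forall>i j. i \<le> j \<longrightarrow> j < n \<longrightarrow> d j \<le> d i) \<and>
    sing_vals A = map (\<lambda>i. sqrt (d i)) [0..<n]"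
proof -
  define T where "T = transpose_mat A * A"
  have T: "T \<in> carrier_mat n n" using A by (simp add: T_def)
  have tT: "transpose_mat T = T" unfolding T_def using A by (simp add: transpose_mult[of _ n m _ n])
  have T_sym: "T $$ (i, j) = T $$ (j, i)" if "i < n" "j < n" for i j
    using arg_cong[OF tT, of "\<lambda>M. M $$ (i, j)"] that T by simp
  have "\<exists>U d. orthonormal_rows n n U \<and> (\<forall>i<n. \<forall>r<n. ip n (\<lambda>c. T $$ (r, c)) (U i) = d i * U i r) \<and>
     (\<forall>i j. i \<le> j \<longrightarrow> j < n \<longrightarrow> d j \<le> d i)"
    by (rule spectral_theorem_sorted[of n "\<lambda>r c. T $$ (r, c)"]) (rule T_sym)
  then obtain U d where U: "orthonormal_rows n n U" and eig: "\<forall>i<n. \<forall>r<n. ip n (\<lambda>c. T $$ (r, c)) (U i) = d i * U i r"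
    and dec: "\<forall>i j. i \<le> j \<longrightarrow> j < n \<longrightarrow> d j \<le> d i"
    by (elim exE conjE) (rule that)
  define P where "P = mat n n (\<lambda>(r, i). U i r)"
  have P: "P \<in> carrier_mat n n" "transpose_mat P \<in> carrier_mat n n" by (simp_all add: P_def)
  have PP: "transpose_mat P * P = 1\<^sub>m n"
    using U by (intro eq_matI) (auto simp: P_def scalar_prod_def orthonormal_rows_def ip_def lessThan_atLeast0)
  have PP': "P * transpose_mat P = 1\<^sub>m n" by (rule mat_mult_left_right_inverse[OF P(2,1) PP])
  have D: "mat_diag n d \<in> carrier_mat n n" by simp
  have TP: "T * P = P * mat_diag n d"
  proof (rule eq_matI)
    fix r i assume "r < dim_row (P * mat_diag n d)" "i < dim_col (P * mat_diag n d)"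
    then have ri: "r < n" "i < n" using P by (auto simp: mat_diag_def)
    have "(T * P) $$ (r, i) = ip n (\<lambda>c. T $$ (r, c)) (U i)"
      using ri T by (simp add: P_def scalar_prod_def ip_def lessThan_atLeast0)
    also have "\<dots> = d i * U i r" using eig ri by blast
    also have "\<dots> = (P * mat_diag n d) $$ (r, i)"
      unfolding mat_diag_mult_right[OF P(1)] using ri by (simp add: P_def)
    finally show "(T * P) $$ (r, i) = (P * mat_diag n d) $$ (r, i)" .
  qed (use T P in \<open>auto simp: mat_diag_def\<close>)
  have TD: "T = P * mat_diag n d * transpose_mat P"
  proof -
    have "T = T * (P * transpose_mat P)" using T PP' by simp
    also have "\<dots> = T * P * transpose_mat P" using T P by (simp add: assoc_mult_mat)
    finally show ?thesis by (simp add: TP)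
  qed
  have d0: "0 \<le> d i" if i: "i < n" for i
  proof -
    have c: "col P i \<in> carrier_vec n" using P i by auto
    have "T *\<^sub>v col P i = d i \<cdot>\<^sub>v col P i"
      using eig i T by (intro eq_vecI) (auto simp: P_def scalar_prod_def ip_def lessThan_atLeast0)
    then have "scalar_prod (col P i) (T *\<^sub>v col P i) = d i * scalar_prod (col P i) (col P i)"
      using c by simp
    also have "scalar_prod (col P i) (col P i) = 1"
      using U i by (simp add: P_def scalar_prod_def orthonormal_rows_def ip_def lessThan_atLeast0)
    finally have "d i = scalar_prod (col P i) (transpose_mat A *\<^sub>v (A *\<^sub>v col P i))"
      using A c by (simp add: T_def)
    also have "\<dots> = scalar_prod (A *\<^sub>v col P i) (A *\<^sub>v col P i)"
      using A c by (intro adjoint_vec[symmetric]) auto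
    finally show ?thesis by (simp add: scalar_prod_self_nonneg)
  qed
  have "char_poly T = char_poly (mat_diag n d)"
    by (rule char_poly_similar, rule similar_matI[of _ _ P "transpose_mat P" n]) (use T P PP PP' TD in auto)
  also have "\<dots> = (\<Prod>a\<leftarrow>diag_mat (mat_diag n d). [:- a, 1:])"
    by (rule char_poly_upper_triangular[OF D]) (auto simp: mat_diag_def)
  also have "diag_mat (mat_diag n d) = map d [0..<n]"
    by (auto simp: diag_mat_def mat_diag_def)
  finally have cp: "char_poly T = (\<Prod>a\<leftarrow>map d [0..<n]. [:- a, 1:])" .
  have "proots (\<Prod>a\<leftarrow>xs. [:- a, 1:]) = mset xs" for xs :: "real list"
  proof (induction xs)
    case (Cons a xs)
    have "(\<Prod>a\<leftarrow>xs. [:- a, 1:]) \<noteq> (0 :: real poly)" by (auto simp: prod_list_zero_iff)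
    then show ?case using Cons by (simp add: proots_mult del: mult_pCons_left)
  qed simp
  then have "image_mset sqrt (proots (char_poly T)) = mset (map (\<lambda>i. sqrt (d i)) [0..<n])"
    by (simp only: cp) (simp add: image_mset.compositionality comp_def)
  then have "sing_vals A = rev (sort (map (\<lambda>i. sqrt (d i)) [0..<n]))"
    by (simp only: sing_vals_def T_def[symmetric] sorted_list_of_multiset_mset)
  also have "sort (map (\<lambda>i. sqrt (d i)) [0..<n]) = rev (map (\<lambda>i. sqrt (d i)) [0..<n])"
  proof (rule properties_for_sort)
    show "sorted (rev (map (\<lambda>i. sqrt (d i)) [0..<n]))"
      unfolding sorted_rev_iff_nth_mono using dec by auto
  qed simp
  finally have "sing_vals A = map (\<lambda>i. sqrt (d i)) [0..<n]" by simp
  then show ?thesis using P PP PP' TD d0 dec unfolding T_def by blast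
qed

lemma is_pinv_unique:
  assumes X: "is_pinv A X" and Y: "is_pinv A Y"
  shows "X = Y"
proof -
  define m n where "m = dim_row A" and "n = dim_col A"
  have A: "A \<in> carrier_mat m n" by (simp add: m_def n_def)
  have cX: "X \<in> carrier_mat n m" and cY: "Y \<in> carrier_mat n m" using X Y by (auto simp: is_pinv_def m_def n_def)
  have carriers: "A * X \<in> carrier_mat m m" "A * Y \<in> carrier_mat m m" "X * A \<in> carrier_mat n n" "Y * A \<in> carrier_mat n n"
    using A cX cY by auto
  have AX: "A * X = A * Y"
  proof -
    have "A * X = (A * Y * A) * X" using Y by (simp add: is_pinv_def)
    also have "\<dots> = (A * Y) * (A * X)" by (rule assoc_mult_mat[OF carriers(2) A cX])
    also have "\<dots> = transpose_mat (A * Y) * transpose_mat (A * X)" using X Y by (simp add: is_pinv_def)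
    also have "\<dots> = transpose_mat ((A * X) * (A * Y))" by (rule transpose_mult[OF carriers(1,2), symmetric])
    also have "(A * X) * (A * Y) = (A * X * A) * Y" by (rule assoc_mult_mat[OF carriers(1) A cY, symmetric])
    also have "\<dots> = A * Y" using X by (simp add: is_pinv_def)
    also have "transpose_mat (A * Y) = A * Y" using Y by (simp add: is_pinv_def)
    finally show ?thesis .
  qed
  have XA: "X * A = Y * A"
  proof -
    have "X * A = X * (A * Y * A)" using Y by (simp add: is_pinv_def)
    also have "A * Y * A = A * (Y * A)" by (rule assoc_mult_mat[OF A cY A])
    also have "X * (A * (Y * A)) = (X * A) * (Y * A)" by (rule assoc_mult_mat[OF cX A carriers(4), symmetric])
    also have "\<dots> = transpose_mat (X * A) * transpose_mat (Y * A)" using X Y by (simp add: is_pinv_def)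
    also have "\<dots> = transpose_mat ((Y * A) * (X * A))" by (rule transpose_mult[OF carriers(4,3), symmetric])
    also have "(Y * A) * (X * A) = Y * (A * (X * A))" by (rule assoc_mult_mat[OF cY A carriers(3)])
    also have "A * (X * A) = A * X * A" by (rule assoc_mult_mat[OF A cX A, symmetric])
    also have "\<dots> = A" using X by (simp add: is_pinv_def)
    also have "transpose_mat (Y * A) = Y * A" using Y by (simp add: is_pinv_def)
    finally show ?thesis .
  qed
  have "X = X * A * X" using X by (simp add: is_pinv_def)
  also have "\<dots> = X * (A * X)" by (rule assoc_mult_mat[OF cX A cX])
  also have "\<dots> = X * (A * Y)" by (simp only: AX)
  also have "\<dots> = X * A * Y" by (rule assoc_mult_mat[OF cX A cY, symmetric])
  also have "\<dots> = Y * A * Y" by (simp only: XA)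
  also have "\<dots> = Y" using Y by (simp add: is_pinv_def)
  finally show ?thesis .
qed

text \<open>With \<open>A\<^sup>T A = P D P\<^sup>T\<close>, the pseudoinverse is \<open>P D\<^sup>\<dagger> P\<^sup>T A\<^sup>T\<close>. The equation \<open>A X A = A\<close> holds because
\<open>A\<close> annihilates the eigenvectors of \<open>A\<^sup>T A\<close> with eigenvalue zero.\<close>

lemma pinv_is_pinv:
  fixes A :: "real mat"
  shows "is_pinv A (pinv A)"
proof -
  define m n where "m = dim_row A" and "n = dim_col A"
  have A: "A \<in> carrier_mat m n" and tA: "transpose_mat A \<in> carrier_mat n m" by (simp_all add: m_def n_def)
  obtain P d where P: "P \<in> carrier_mat n n" and PP: "transpose_mat P * P = 1\<^sub>m n" "P * transpose_mat P = 1\<^sub>m n"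
    and T: "transpose_mat A * A = P * mat_diag n d * transpose_mat P"
    using gram_spectral_decomposition[OF A] by blast
  define e where "e i = (if d i = 0 then 0 else 1 / d i)" for i
  define E where "E = mat_diag n e"
  define D where "D = mat_diag n d"
  have tP: "transpose_mat P \<in> carrier_mat n n" using P by simp
  have DE: "D \<in> carrier_mat n n" "E \<in> carrier_mat n n" by (simp_all add: D_def E_def)
  have tDE: "transpose_mat D = D" "transpose_mat E = E" by (auto simp: D_def E_def mat_diag_def intro!: eq_matI)
  have EDE: "E * D * E = E" "E * D = mat_diag n (\<lambda>i. if d i = 0 then 0 else 1)"
  proof -
    have "(\<lambda>i. e i * d i) = (\<lambda>i. if d i = 0 then 0 else 1)" "(\<lambda>i. e i * d i * e i) = e"
      by (auto simp: e_def)
    then show "E * D * E = E" "E * D = mat_diag n (\<lambda>i. if d i = 0 then 0 else 1)"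
      unfolding D_def E_def mat_diag_diag by (auto intro: arg_cong[of _ _ "mat_diag n"])
  qed
  define X where "X = P * E * transpose_mat P * transpose_mat A"
  have X: "X \<in> carrier_mat n m" using P tP DE tA by (auto simp: X_def)
  note cs = P tP DE A tA
  have XA: "X * A = P * (E * D) * transpose_mat P"
  proof -
    have "X * A = P * E * transpose_mat P * (transpose_mat A * A)"
      unfolding X_def by (rule assoc_mult_mat) (use cs in auto)
    also have "\<dots> = P * E * (transpose_mat P * (P * D * transpose_mat P))"
      unfolding T D_def[symmetric] by (rule assoc_mult_mat[of _ n n _ n _ n]) (use cs in auto)
    also have "transpose_mat P * (P * D * transpose_mat P) = (transpose_mat P * P) * (D * transpose_mat P)"
      using cs by (simp add: assoc_mult_mat[of _ n n _ n _ n])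
    also have "\<dots> = D * transpose_mat P" using cs PP by simp
    finally show ?thesis using cs by (simp add: assoc_mult_mat[of _ n n _ n _ n])
  qed
  have AX: "A * X = A * (P * E * transpose_mat P) * transpose_mat A"
    unfolding X_def by (rule assoc_mult_mat[symmetric]) (use cs in auto)
  have tXA: "transpose_mat (X * A) = X * A"
  proof -
    have "transpose_mat (E * D) = E * D"
      unfolding EDE(2) by (auto simp: mat_diag_def intro!: eq_matI)
    then show ?thesis unfolding XA using cs
      by (simp add: transpose_mult[of _ n n _ n] assoc_mult_mat[of _ n n _ n _ n])
  qed
  have tAX: "transpose_mat (A * X) = A * X"
  proof -
    have "transpose_mat (P * E * transpose_mat P) = P * E * transpose_mat P"
      using cs tDE by (simp add: transpose_mult[of _ n n _ n] assoc_mult_mat[of _ n n _ n _ n])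
    then have "transpose_mat (A * X) = transpose_mat (transpose_mat A) * (transpose_mat (P * E * transpose_mat P) * transpose_mat A)"
      unfolding AX using cs by (simp add: transpose_mult[of _ m n _ m] transpose_mult[of _ m n _ n])
    then show ?thesis unfolding AX using cs \<open>transpose_mat (P * E * transpose_mat P) = _\<close>
      by (simp only: transpose_transpose) (rule assoc_mult_mat[symmetric, of _ m n _ n _ m], auto)
  qed
  have XAX: "X * A * X = X"
  proof -
    have "X * A * X = P * (E * D) * transpose_mat P * (P * (E * (transpose_mat P * transpose_mat A)))"
      unfolding XA using cs by (simp add: X_def assoc_mult_mat[of _ n n _ n _ n] assoc_mult_mat[of _ n n _ n _ m])
    also have "\<dots> = P * (E * D * (transpose_mat P * P * (E * (transpose_mat P * transpose_mat A))))"
      using cs by (simp add: assoc_mult_mat[of _ n n _ n _ n] assoc_mult_mat[of _ n n _ n _ m])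
    also have "\<dots> = P * (E * D * E * (transpose_mat P * transpose_mat A))"
      using cs PP by (simp add: assoc_mult_mat[of _ n n _ n _ n] assoc_mult_mat[of _ n n _ n _ m])
    also have "\<dots> = X"
      using cs EDE(1) by (simp add: X_def assoc_mult_mat[of _ n n _ n _ n] assoc_mult_mat[of _ n n _ n _ m])
    finally show ?thesis .
  qed
  have AXA: "A * X * A = A"
  proof -
    have zero: "A * P * mat_diag n (\<lambda>i. if d i = 0 then 0 else 1) = A * P"
    proof (rule eq_matI)
      fix r i assume "r < dim_row (A * P)" "i < dim_col (A * P)"
      then have ri: "r < m" "i < n" using A P by auto
      have ap: "A * P \<in> carrier_mat m n" using cs by simp
      have "(A * P) $$ (r, i) = 0" if "d i = 0"
      proof -
        have c: "col P i \<in> carrier_vec n" using P ri by auto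
        have "transpose_mat A * A * P = P * D"
        proof -
          have "transpose_mat A * A * P = P * D * (transpose_mat P * P)"
            unfolding T D_def[symmetric] using cs by (simp add: assoc_mult_mat[of _ n n _ n _ n])
          then show ?thesis using cs PP by simp
        qed
        then have "(transpose_mat A * A * P) *\<^sub>v unit_vec n i = (P * D) *\<^sub>v unit_vec n i" by simp
        moreover have "D *\<^sub>v unit_vec n i = 0\<^sub>v n"
          using that ri by (intro eq_vecI) (auto simp: D_def mat_diag_def)
        moreover have "P *\<^sub>v 0\<^sub>v n = 0\<^sub>v n" using P by auto
        ultimately have "transpose_mat A *\<^sub>v (A *\<^sub>v (P *\<^sub>v unit_vec n i)) = 0\<^sub>v n"
          using cs ri by (simp add: assoc_mult_mat_vec[of _ n n _ n] assoc_mult_mat_vec[of _ n m _ n])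
        then have "scalar_prod (A *\<^sub>v (P *\<^sub>v unit_vec n i)) (A *\<^sub>v (P *\<^sub>v unit_vec n i)) = 0"
          using cs by (subst adjoint_vec[OF A]) auto
        then have "vec_norm2 (A *\<^sub>v (P *\<^sub>v unit_vec n i)) = 0" by (simp add: vec_norm2_def)
        then have "A *\<^sub>v (P *\<^sub>v unit_vec n i) = 0\<^sub>v m"
          using cs by (subst (asm) vec_norm2_0_iff[of _ m]) auto
        then have "((A * P) *\<^sub>v unit_vec n i) $ r = 0" using cs ri by simp
        moreover have "P *\<^sub>v unit_vec n i = col P i"
          using cs ri by (intro eq_vecI) auto
        ultimately show ?thesis using cs ri by simp
      qed
      then show "(A * P * mat_diag n (\<lambda>i. if d i = 0 then 0 else 1)) $$ (r, i) = (A * P) $$ (r, i)"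
        unfolding mat_diag_mult_right[OF ap] using ri by auto
    qed (use cs in \<open>auto simp: mat_diag_def\<close>)
    have "A * X * A = A * (X * A)" by (rule assoc_mult_mat[OF A X A])
    also have "\<dots> = A * P * (E * D) * transpose_mat P"
      unfolding XA using cs by (simp add: assoc_mult_mat[of _ n n _ n _ n] assoc_mult_mat[of _ m n _ n _ n])
    also have "\<dots> = A * P * transpose_mat P" unfolding EDE(2) zero ..
    also have "\<dots> = A * (P * transpose_mat P)" by (rule assoc_mult_mat[OF A P tP])
    also have "\<dots> = A" using PP A by simp
    finally show ?thesis .
  qed
  have ex: "is_pinv A X"
    using X AXA XAX tAX tXA by (simp add: is_pinv_def m_def n_def)
  show ?thesis unfolding pinv_def by (rule theI[of "is_pinv A", OF ex]) (rule is_pinv_unique[OF _ ex])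
qed

section \<open>Interpolation at DEIM indices\<close>

lemma first_cols_carrier:
  assumes "A \<in> carrier_mat m n" "k \<le> n"
  shows "first_cols k A \<in> carrier_mat m k"
  using assms by (auto simp: first_cols_def)

lemma first_cols_index:
  assumes "A \<in> carrier_mat m n" "k \<le> n" "i < m" "j < k"
  shows "first_cols k A $$ (i, j) = A $$ (i, j)"
  using assms by (auto simp: first_cols_def mat_of_cols_index)

lemma select_rows_carrier: "A \<in> carrier_mat m n \<Longrightarrow> select_rows A q \<in> carrier_mat (length q) n"
  by (auto simp: select_rows_def)

lemma select_rows_index:
  assumes "A \<in> carrier_mat m n" "i < length q" "q ! i < m" "j < n"
  shows "select_rows A q $$ (i, j) = A $$ (q ! i, j)"
  using assms by (auto simp: select_rows_def mat_of_rows_index)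

text \<open>As long as the columns chosen so far are independent at the chosen indices, the selected square block is
invertible and the residual is the column minus its interpolant from the earlier columns.\<close>

lemma deim_residual_properties:
  fixes X :: "real mat"
  assumes X: "X \<in> carrier_mat N k" and j: "j < k" and q: "\<And>i. i < j \<Longrightarrow> q ! i < N" and len: "length q = k"
    and inj: "\<And>c. (\<forall>i<j. (\<Sum>a<j. c a * X $$ (q ! i, a)) = 0) \<Longrightarrow> \<forall>a<j. c a = 0"
  shows "\<exists>c. (\<forall>i<N. deim_residual X q j $ i = X $$ (i, j) - (\<Sum>a<j. c a * X $$ (i, a)))
      \<and> (\<forall>i<j. deim_residual X q j $ (q ! i) = 0)"
proof (cases "j = 0")
  case True
  then show ?thesis using X j by (auto simp: deim_residual_def)
next
  case False
  define q' X' where "q' = take j q" and "X' = first_cols j X"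
  have X': "X' \<in> carrier_mat N j" using X j by (simp add: X'_def first_cols_carrier)
  have X'i: "X' $$ (i, a) = X $$ (i, a)" if "i < N" "a < j" for i a
    unfolding X'_def using X j that by (intro first_cols_index) auto
  have q': "length q' = j" "\<And>i. i < j \<Longrightarrow> q' ! i = q ! i" using j len by (auto simp: q'_def)
  define S where "S = select_rows X' q'"
  have S: "S \<in> carrier_mat j j" using select_rows_carrier[OF X', of q'] q'(1) by (simp add: S_def)
  have Si: "S $$ (i, a) = X $$ (q ! i, a)" if "i < j" "a < j" for i a
    unfolding S_def using X' q' q that X'i by (subst select_rows_index[OF X']) auto
  have "det S \<noteq> 0"
  proof
    assume "det S = 0"
    then obtain v where v: "v \<in> carrier_vec j" "v \<noteq> 0\<^sub>v j" "S *\<^sub>v v = 0\<^sub>v j"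
      using det_0_iff_vec_prod_zero_field[OF S] by blast
    have "(\<Sum>a<j. v $ a * X $$ (q ! i, a)) = 0" if i: "i < j" for i
    proof -
      have "(S *\<^sub>v v) $ i = 0" using v i by simp
      then show ?thesis using S v(1) i
        by (simp add: scalar_prod_def Si lessThan_atLeast0 mult.commute)
    qed
    then have "\<forall>a<j. v $ a = 0" by - (rule inj[of "\<lambda>a. v $ a"], intro allI impI)
    then have "v = 0\<^sub>v j" using v(1) by (intro eq_vecI) auto
    then show False using v(2) by simp
  qed
  then have "S \<in> Units (ring_mat TYPE(real) j ())" by (rule det_non_zero_imp_unit[OF S])
  then obtain B where B: "mat_inverse S = Some B" using mat_inverse(1)[OF S, of "()"] by (cases "mat_inverse S") auto
  then have SB: "S * B = 1\<^sub>m j" "B \<in> carrier_mat j j" using mat_inverse(2)[OF S] by auto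
  define b where "b = vec j (\<lambda>i. col X j $ (q' ! i))"
  define c where "c = B *\<^sub>v b"
  have b: "b \<in> carrier_vec j" and c: "c \<in> carrier_vec j" using SB by (auto simp: b_def c_def)
  have Sc: "S *\<^sub>v c = b"
  proof -
    have "S *\<^sub>v c = (S * B) *\<^sub>v b" unfolding c_def by (rule assoc_mult_mat_vec[OF S SB(2) b, symmetric])
    then show ?thesis by (simp only: SB(1) one_mult_mat_vec[OF b])
  qed
  have res: "deim_residual X q j = col X j - X' *\<^sub>v c"
    using False B by (simp add: deim_residual_def Let_def q'_def[symmetric] X'_def[symmetric] S_def[symmetric] c_def b_def)
  have val: "deim_residual X q j $ i = X $$ (i, j) - (\<Sum>a<j. c $ a * X $$ (i, a))" if i: "i < N" for i
    unfolding res using X X' c i j by (simp add: scalar_prod_def X'i lessThan_atLeast0 mult.commute)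
  moreover have "deim_residual X q j $ (q ! i) = 0" if i: "i < j" for i
  proof -
    have "(S *\<^sub>v c) $ i = X $$ (q ! i, j)"
      unfolding Sc b_def using i q' X j q[OF i] by simp
    then have "(\<Sum>a<j. c $ a * X $$ (q ! i, a)) = X $$ (q ! i, j)"
      using S c i by (simp add: scalar_prod_def Si lessThan_atLeast0 mult.commute)
    then show ?thesis using val[OF q[OF i]] by simp
  qed
  ultimately show ?thesis by (intro exI[of _ "\<lambda>a. c $ a"]) auto
qed

text \<open>Both facts are proved together by induction. A residual with largest entry zero vanishes, which contradicts the
independence of the columns. Conversely, a nonzero pivot extends the triangular structure of the selected
rows: the residual vanishes at the earlier indices but not at the new one.\<close>

lemma deim_independent:
  fixes X :: "real mat"
  assumes X: "X \<in> carrier_mat N k"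
    and inj: "\<And>c. (\<forall>i<N. (\<Sum>a<k. c a * X $$ (i, a)) = 0) \<Longrightarrow> \<forall>a<k. c a = 0"
    and q: "is_deim X q" and J: "J \<le> k"
  shows "(\<forall>i<J. (\<Sum>a<J. c a * X $$ (q ! i, a)) = 0) \<Longrightarrow> \<forall>a<J. c a = 0"
    and "j < J \<Longrightarrow> deim_residual X q j $ (q ! j) \<noteq> 0"
proof -
  have len: "length q = k" and lt: "\<And>j. j < k \<Longrightarrow> q ! j < N"
    and mx: "\<And>j i. j < k \<Longrightarrow> i < N \<Longrightarrow> \<bar>deim_residual X q j $ i\<bar> \<le> \<bar>deim_residual X q j $ (q ! j)\<bar>"
    using q X by (auto simp: is_deim_def)
  have H: "(\<forall>c. (\<forall>i<J. (\<Sum>a<J. c a * X $$ (q ! i, a)) = 0) \<longrightarrow> (\<forall>a<J. c a = 0))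
      \<and> (\<forall>j<J. deim_residual X q j $ (q ! j) \<noteq> 0)" using J
  proof (induction J)
    case 0
    then show ?case by simp
  next
    case (Suc J)
    have Jk: "J < k" using Suc.prems by simp
    note H = Suc.IH[OF less_imp_le[OF Jk]]
    have IH: "\<And>c. (\<forall>i<J. (\<Sum>a<J. c a * X $$ (q ! i, a)) = 0) \<Longrightarrow> \<forall>a<J. c a = 0"
      by (rule conjunct1[OF H, THEN spec, THEN mp])
    note IH2 = conjunct2[OF H]
    obtain d where d: "\<And>i. i < N \<Longrightarrow> deim_residual X q J $ i = X $$ (i, J) - (\<Sum>a<J. d a * X $$ (i, a))"
      and z: "\<And>i. i < J \<Longrightarrow> deim_residual X q J $ (q ! i) = 0"
      using deim_residual_properties[OF X Jk lt[OF less_trans[OF _ Jk]] len IH] by blast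
    have nz: "deim_residual X q J $ (q ! J) \<noteq> 0"
    proof
      assume "deim_residual X q J $ (q ! J) = 0"
      then have r0: "deim_residual X q J $ i = 0" if "i < N" for i using mx[OF Jk that] by simp
      define e where "e a = (if a = J then 1 else if a < J then - d a else 0)" for a
      have "(\<Sum>a<k. e a * X $$ (i, a)) = 0" if i: "i < N" for i
      proof -
        have "(\<Sum>a<k. e a * X $$ (i, a)) = (\<Sum>a<Suc J. e a * X $$ (i, a))"
          by (rule sum.mono_neutral_right) (use Jk in \<open>auto simp: e_def\<close>)
        also have "\<dots> = X $$ (i, J) - (\<Sum>a<J. d a * X $$ (i, a))"
          by (simp add: e_def sum_negf)
        finally show ?thesis using d[OF i] r0[OF i] by simp
      qed
      then have "\<forall>a<k. e a = 0" by - (rule inj[of e], intro allI impI)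
      then have "e J = 0" using Jk by blast
      then show False by (simp add: e_def)
    qed
    have new: "\<forall>a<Suc J. c a = 0" if c: "\<forall>i<Suc J. (\<Sum>a<Suc J. c a * X $$ (q ! i, a)) = 0" for c
    proof -
      have eq: "(\<Sum>a<Suc J. c a * X $$ (i, a)) = (\<Sum>a<J. (c a + c J * d a) * X $$ (i, a)) + c J * deim_residual X q J $ i" if "i < N" for i
      proof -
        have "X $$ (i, J) = deim_residual X q J $ i + (\<Sum>a<J. d a * X $$ (i, a))" using d[OF that] by simp
        then show ?thesis by (simp only: sum.lessThan_Suc distrib_left distrib_right sum.distrib sum_distrib_left ac_simps)
      qed
      have low: "(\<Sum>a<J. (c a + c J * d a) * X $$ (q ! i, a)) = 0" if i: "i < J" for i
      proof -
        have "q ! i < N" using lt i Jk by simp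
        moreover have "(\<Sum>a<Suc J. c a * X $$ (q ! i, a)) = 0" using c i by (simp only: less_SucI)
        ultimately show ?thesis using eq z[OF i] by (simp only: mult_zero_right add_0_right)
      qed
      have 0: "\<forall>a<J. c a + c J * d a = 0"
        by (rule IH[of "\<lambda>a. c a + c J * d a"]) (use low in blast)
      then have "(\<Sum>a<J. (c a + c J * d a) * X $$ (q ! J, a)) = 0" by simp
      then have "c J * deim_residual X q J $ (q ! J) = 0"
        using c[rule_format, of J] eq[OF lt[OF Jk]] by simp
      then have "c J = 0" using nz by simp
      then show ?thesis using 0 by (auto simp: less_Suc_eq)
    qed
    have diag: "deim_residual X q j $ (q ! j) \<noteq> 0" if "j < Suc J" for j
    proof (cases "j = J")
      case False
      then show ?thesis using that IH2[rule_format, of j] by simp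
    qed (use nz in simp)
    show ?case by (rule conjI, rule allI, rule impI, rule new, assumption, rule allI, rule impI, rule diag, assumption)
  qed
  show "(\<forall>i<J. (\<Sum>a<J. c a * X $$ (q ! i, a)) = 0) \<Longrightarrow> \<forall>a<J. c a = 0"
    by (rule conjunct1[OF H, THEN spec, THEN mp])
  show "j < J \<Longrightarrow> deim_residual X q j $ (q ! j) \<noteq> 0"
    by (rule conjunct2[OF H, THEN spec, THEN mp])
qed

text \<open>The sum of \<open>2 ^ (J - 1 - i) * |f i|\<close> over \<open>i < J\<close>.\<close>

fun growth :: "(nat \<Rightarrow> real) \<Rightarrow> nat \<Rightarrow> real" where
  "growth f 0 = 0"
| "growth f (Suc J) = 2 * growth f J + \<bar>f J\<bar>"

lemma growth_nonneg: "0 \<le> growth f J"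
  by (induction J) auto

text \<open>The Cauchy-Schwarz inequality, since \<open>(4 ^ J - 1) / 3\<close> is the sum of the squares of the weights.\<close>

lemma growth_square_le: "(growth f J)\<^sup>2 \<le> (4 ^ J - 1) / 3 * (\<Sum>i<J. (f i)\<^sup>2)"
proof (induction J)
  case 0
  then show ?case by simp
next
  case (Suc J)
  define g t D V where "g = growth f J" and "t = \<bar>f J\<bar>" and "D = ((4::real) ^ J - 1) / 3" and "V = (\<Sum>i<J. (f i)\<^sup>2)"
  have IH: "g\<^sup>2 \<le> D * V" using Suc.IH by (simp add: g_def D_def V_def)
  have g0: "0 \<le> g" and t0: "0 \<le> t" and V0: "0 \<le> V" by (simp_all add: g_def t_def V_def growth_nonneg sum_nonneg)
  have D0: "0 \<le> D" by (simp add: D_def)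
  have "4 * g * t \<le> 4 * D * t\<^sup>2 + V"
  proof (cases "D = 0")
    case True
    then have "g = 0" using IH by simp
    then show ?thesis using V0 True by simp
  next
    case False
    then have Dp: "0 < D" using D0 by simp
    have "0 \<le> (2 * D * t - g)\<^sup>2" by simp
    then have "D * (4 * g * t) \<le> 4 * D\<^sup>2 * t\<^sup>2 + g\<^sup>2" by (simp add: power2_eq_square algebra_simps)
    also have "\<dots> \<le> 4 * D\<^sup>2 * t\<^sup>2 + D * V" using IH by simp
    also have "\<dots> = D * (4 * D * t\<^sup>2 + V)" by (simp add: power2_eq_square algebra_simps)
    finally show ?thesis using Dp by (simp only: mult_le_cancel_left_pos)
  qed
  then have "(2 * g + t)\<^sup>2 \<le> (4 * D + 1) * (V + t\<^sup>2)"
    using IH by (simp add: power2_eq_square algebra_simps)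
  moreover have "4 * D + 1 = (4 ^ Suc J - 1) / 3" by (simp add: D_def field_simps)
  ultimately show ?case by (simp add: g_def t_def V_def)
qed

text \<open>To interpolate at one more index, a multiple of the residual of the new column is added to the interpolant.
The residual is largest at the new index, so the correction is nowhere larger than the defect there, which is at
most the new datum plus the bound for the previous interpolant.\<close>

lemma deim_interpolation:
  fixes X :: "real mat"
  assumes X: "X \<in> carrier_mat N k"
    and inj: "\<And>c. (\<forall>i<N. (\<Sum>a<k. c a * X $$ (i, a)) = 0) \<Longrightarrow> \<forall>a<k. c a = 0"
    and q: "is_deim X q" and J: "J \<le> k"
  shows "\<exists>c. (\<forall>i<J. v (q ! i) = (\<Sum>a<J. c a * X $$ (q ! i, a)))
      \<and> (\<forall>i<N. \<bar>\<Sum>a<J. c a * X $$ (i, a)\<bar> \<le> growth (\<lambda>i. v (q ! i)) J)"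
  using J
proof (induction J)
  case 0
  then show ?case by simp
next
  case (Suc J)
  have len: "length q = k" and lt: "\<And>j. j < k \<Longrightarrow> q ! j < N"
    and mx: "\<And>j i. j < k \<Longrightarrow> i < N \<Longrightarrow> \<bar>deim_residual X q j $ i\<bar> \<le> \<bar>deim_residual X q j $ (q ! j)\<bar>"
    using q X by (auto simp: is_deim_def)
  define r where "r i = deim_residual X q J $ i" for i
  have Jk: "J < k" using Suc.prems by simp
  obtain c where c: "\<And>i. i < J \<Longrightarrow> v (q ! i) = (\<Sum>a<J. c a * X $$ (q ! i, a))"
    and bd: "\<And>i. i < N \<Longrightarrow> \<bar>\<Sum>a<J. c a * X $$ (i, a)\<bar> \<le> growth (\<lambda>i. v (q ! i)) J"
    using Suc by auto
  obtain d where d: "\<And>i. i < N \<Longrightarrow> r i = X $$ (i, J) - (\<Sum>a<J. d a * X $$ (i, a))"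
    and z: "\<And>i. i < J \<Longrightarrow> r (q ! i) = 0"
    using deim_residual_properties[OF X Jk lt[OF less_trans[OF _ Jk]] len deim_independent(1)[OF X inj q less_imp_le[OF Jk]]]
    unfolding r_def by blast
  have nz: "r (q ! J) \<noteq> 0" unfolding r_def by (rule deim_independent(2)[OF X inj q Suc.prems]) auto
  define s where "s = (v (q ! J) - (\<Sum>a<J. c a * X $$ (q ! J, a))) / r (q ! J)"
  define e where "e a = (if a = J then s else c a - s * d a)" for a
  have eq: "(\<Sum>a<Suc J. e a * X $$ (i, a)) = (\<Sum>a<J. c a * X $$ (i, a)) + s * r i" if "i < N" for i
  proof -
    have "X $$ (i, J) = r i + (\<Sum>a<J. d a * X $$ (i, a))" using d[OF that] by simp
    moreover have "(\<Sum>a<J. e a * X $$ (i, a)) = (\<Sum>a<J. c a * X $$ (i, a)) - s * (\<Sum>a<J. d a * X $$ (i, a))"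
      by (simp add: e_def left_diff_distrib sum_subtractf sum_distrib_left mult.assoc)
    ultimately show ?thesis by (simp add: e_def distrib_left)
  qed
  have interp: "v (q ! i) = (\<Sum>a<Suc J. e a * X $$ (q ! i, a))" if "i < Suc J" for i
  proof (cases "i = J")
    case True
    then show ?thesis unfolding eq[OF lt[OF Jk, folded True]] using nz by (simp add: True s_def)
  next
    case False
    then have "i < J" using that by simp
    then show ?thesis using eq[OF lt[of i]] c z Jk by simp
  qed
  have "\<bar>\<Sum>a<Suc J. e a * X $$ (i, a)\<bar> \<le> growth (\<lambda>i. v (q ! i)) (Suc J)" if i: "i < N" for i
  proof -
    have "\<bar>r i\<bar> \<le> \<bar>r (q ! J)\<bar>" unfolding r_def by (rule mx[OF Jk i])
    then have "\<bar>s * r i\<bar> \<le> \<bar>s\<bar> * \<bar>r (q ! J)\<bar>" by (simp add: abs_mult mult_left_mono)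
    also have "\<dots> = \<bar>v (q ! J) - (\<Sum>a<J. c a * X $$ (q ! J, a))\<bar>" using nz by (simp add: s_def abs_mult)
    also have "\<dots> \<le> \<bar>v (q ! J)\<bar> + growth (\<lambda>i. v (q ! i)) J" using bd[OF lt[OF Jk]] by linarith
    finally show ?thesis unfolding eq[OF i] using bd[OF i] by simp
  qed
  then show ?case using interp by (intro exI[of _ e] conjI allI impI) simp_all
qed

text \<open>Since \<open>w\<close> vanishes at the indices, \<open>w = w' - i\<close> where \<open>i\<close> is the interpolant of \<open>w'\<close>, of size at most
\<open>growth\<close> of the data. Only entries of \<open>w'\<close> off the indices and the interpolant contribute to \<open>|w|\<close>; the two are balanced
by a weighted binomial inequality.\<close>

theorem deim_error_bound:
  fixes X :: "real mat"
  assumes X: "X \<in> carrier_mat N k" and k: "0 < k" "k < N"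
    and inj: "\<And>c. c \<in> carrier_vec k \<Longrightarrow> X *\<^sub>v c = 0\<^sub>v N \<Longrightarrow> c = 0\<^sub>v k"
    and q: "is_deim X q"
    and w: "w = X *\<^sub>v c + w'" "c \<in> carrier_vec k" "w' \<in> carrier_vec N"
    and zero: "\<And>j. j < k \<Longrightarrow> w $ (q ! j) = 0"
  shows "vec_norm2 w \<le> sqrt (real N * real k / 3) * 2 ^ k * vec_norm2 w'"
proof -
  have inj': "\<forall>a<k. c a = 0" if c: "\<forall>i<N. (\<Sum>a<k. c a * X $$ (i, a)) = 0" for c
  proof -
    have "X *\<^sub>v vec k c = 0\<^sub>v N"
      using c X by (intro eq_vecI) (auto simp: scalar_prod_def lessThan_atLeast0 mult.commute)
    then have "vec k c = 0\<^sub>v k" by (intro inj) auto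
    then show ?thesis by (metis index_vec index_zero_vec(1))
  qed
  have lt: "\<And>j. j < k \<Longrightarrow> q ! j < N" using q X by (auto simp: is_deim_def)
  have len: "length q = k" using q X by (auto simp: is_deim_def)
  have wN: "w \<in> carrier_vec N" using w X by simp
  obtain e where e: "\<And>i. i < k \<Longrightarrow> w' $ (q ! i) = (\<Sum>a<k. e a * X $$ (q ! i, a))"
    and bd: "\<And>i. i < N \<Longrightarrow> \<bar>\<Sum>a<k. e a * X $$ (i, a)\<bar> \<le> growth (\<lambda>i. w' $ (q ! i)) k"
    using deim_interpolation[OF X inj' q order_refl, of "\<lambda>i. w' $ i"] by blast
  have wi: "w $ i = (\<Sum>a<k. c $ a * X $$ (i, a)) + w' $ i" if "i < N" for i
    using that X w by (simp add: scalar_prod_def lessThan_atLeast0 mult.commute)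
  have "\<forall>a<k. c $ a + e a = 0"
  proof (rule deim_independent(1)[OF X inj' q order_refl])
    show "\<forall>i<k. (\<Sum>a<k. (c $ a + e a) * X $$ (q ! i, a)) = 0"
      using zero wi[OF lt] e by (simp add: distrib_right sum.distrib)
  qed
  then have we: "w $ i = w' $ i - (\<Sum>a<k. e a * X $$ (i, a))" if "i < N" for i
    using wi[OF that] by (simp add: eq_neg_iff_add_eq_0[symmetric] sum_negf)
  define g where "g = growth (\<lambda>i. w' $ (q ! i)) k"
  define D where "D = ((4::real) ^ k - 1) / 3"
  have "(4::real) ^ 1 \<le> 4 ^ k" using k by (intro power_increasing) auto
  then have D1: "1 \<le> D" by (simp add: D_def)
  define Q where "Q = (\<lambda>j. q ! j) ` {..<k}"
  have QN: "Q \<subseteq> {..<N}" using lt by (auto simp: Q_def)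
  have injq: "inj_on (\<lambda>j. q ! j) {..<k}"
  proof -
    have ne: "q ! i \<noteq> q ! j" if "i < j" "j < k" for i j
    proof
      assume eq: "q ! i = q ! j"
      have "\<And>i. i < j \<Longrightarrow> q ! i < N" using lt that by auto
      from deim_residual_properties[OF X that(2) this len deim_independent(1)[OF X inj' q less_imp_le[OF that(2)]]]
      have "deim_residual X q j $ (q ! i) = 0" using that(1) by blast
      then show False using deim_independent(2)[OF X inj' q order_refl that(2)] eq by simp
    qed
    show ?thesis by (rule inj_onI) (metis ne lessThan_iff linorder_neqE_nat)
  qed
  define VQ where "VQ = (\<Sum>i\<in>Q. (w' $ i)\<^sup>2)"
  define VO where "VO = (\<Sum>i\<in>{..<N} - Q. (w' $ i)\<^sup>2)"
  have VQ: "VQ = (\<Sum>j<k. (w' $ (q ! j))\<^sup>2)" unfolding VQ_def Q_def using injq by (simp add: sum.reindex)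
  have Vsum: "scalar_prod w' w' = VO + VQ"
    using QN w(3) by (simp add: VO_def VQ_def sum.subset_diff[of Q "{..<N}"] scalar_prod_ip[of w' N] ip_square)
  have g2: "g\<^sup>2 \<le> D * VQ" unfolding g_def D_def VQ by (rule growth_square_le)
  have V0: "0 \<le> VQ" "0 \<le> VO" by (simp_all add: VQ_def VO_def sum_nonneg)
  define N' where "N' = real N - 1"
  have N': "1 \<le> N'" using k by (simp add: N'_def)
  have cardO: "real (card ({..<N} - Q)) \<le> N'"
  proof -
    have "card Q = k" unfolding Q_def using injq by (simp add: card_image)
    then have "card ({..<N} - Q) = N - k" using QN by (simp add: card_Diff_subset finite_subset[OF QN])
    then show ?thesis using k by (simp add: N'_def)
  qed
  have ND: "0 < N' * D" using N' D1 by simp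
  \<comment> \<open>The weight \<open>N' * D\<close> makes the coefficients of both parts of \<open>|w'|\<^sup>2\<close> equal to \<open>1 + N' * D\<close> after summation over at most \<open>N'\<close> entries.\<close>
  have point: "(w $ i)\<^sup>2 \<le> (1 + N' * D) * (w' $ i)\<^sup>2 + (1 + 1 / (N' * D)) * (D * VQ)" if i: "i < N" for i
  proof -
    define x where "x = \<bar>w' $ i\<bar>"
    have "\<bar>w $ i\<bar> \<le> x + g" using we[OF i] bd[OF i] by (simp add: x_def g_def)
    then have "(w $ i)\<^sup>2 \<le> (x + g)\<^sup>2" using abs_le_square_iff[of "w $ i" "x + g"] by force
    also have "\<dots> \<le> (1 + N' * D) * x\<^sup>2 + (1 + 1 / (N' * D)) * g\<^sup>2"
    proof -
      have "(E * x - g)\<^sup>2 / E = E * x\<^sup>2 - 2 * x * g + g\<^sup>2 / E" if "0 < E" for E :: real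
        using that by (simp add: power2_eq_square field_simps)
      moreover have "0 \<le> (N' * D * x - g)\<^sup>2 / (N' * D)" using ND by simp
      ultimately have "0 \<le> N' * D * x\<^sup>2 - 2 * x * g + g\<^sup>2 / (N' * D)" using ND by (simp only:)
      moreover have "(x + g)\<^sup>2 = x\<^sup>2 + 2 * x * g + g\<^sup>2" by (simp add: power2_eq_square algebra_simps)
      moreover have "(1 + N' * D) * x\<^sup>2 + (1 + 1 / (N' * D)) * g\<^sup>2 = N' * D * x\<^sup>2 + g\<^sup>2 / (N' * D) + (x\<^sup>2 + g\<^sup>2)"
        by (simp add: distrib_right)
      ultimately show ?thesis by linarith
    qed
    also have "\<dots> \<le> (1 + N' * D) * x\<^sup>2 + (1 + 1 / (N' * D)) * (D * VQ)"
      by (rule add_left_mono, rule mult_left_mono[OF g2]) (use ND in \<open>simp add: add_nonneg_nonneg\<close>)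
    finally show ?thesis by (simp add: x_def)
  qed
  have "scalar_prod w w = (\<Sum>i\<in>{..<N} - Q. (w $ i)\<^sup>2)"
  proof -
    have "(\<Sum>i\<in>Q. (w $ i)\<^sup>2) = 0" by (rule sum.neutral) (use zero in \<open>auto simp: Q_def\<close>)
    then show ?thesis using QN wN by (simp add: sum.subset_diff[of Q "{..<N}"] scalar_prod_ip[of w N] ip_square)
  qed
  also have "\<dots> \<le> (\<Sum>i\<in>{..<N} - Q. (1 + N' * D) * (w' $ i)\<^sup>2 + (1 + 1 / (N' * D)) * (D * VQ))"
    by (intro sum_mono point) auto
  also have "\<dots> = (1 + N' * D) * VO + real (card ({..<N} - Q)) * ((1 + 1 / (N' * D)) * (D * VQ))"
    by (simp add: sum.distrib sum_distrib_left[symmetric] VO_def)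
  also have "\<dots> \<le> (1 + N' * D) * VO + N' * ((1 + 1 / (N' * D)) * (D * VQ))"
    using cardO V0 D1 ND by (intro add_left_mono mult_right_mono mult_nonneg_nonneg add_nonneg_nonneg) simp_all
  also have "\<dots> = (1 + N' * D) * scalar_prod w' w'"
    using ND N' D1 by (simp add: Vsum field_simps)
  also have "\<dots> \<le> (real N * real k / 3 * 4 ^ k) * scalar_prod w' w'"
  proof (rule mult_right_mono[OF _ scalar_prod_self_nonneg])
    have "1 + N' * D = real N * 4 ^ k / 3 - (real N + 4 ^ k - 4) / 3"
      by (simp add: N'_def D_def field_simps)
    also have "\<dots> \<le> real N * 4 ^ k / 3" using \<open>(4::real) ^ 1 \<le> 4 ^ k\<close> by simp
    also have "\<dots> \<le> real N * real k / 3 * 4 ^ k" using k by (simp add: field_simps)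
    finally show "1 + N' * D \<le> real N * real k / 3 * 4 ^ k" .
  qed
  finally have "sqrt (scalar_prod w w) \<le> sqrt ((real N * real k / 3 * 4 ^ k) * scalar_prod w' w')" by simp
  also have "\<dots> = sqrt (real N * real k / 3) * sqrt (4 ^ k) * vec_norm2 w'"
    by (simp only: real_sqrt_mult vec_norm2_def)
  also have "sqrt ((4::real) ^ k) = 2 ^ k" by (simp add: real_sqrt_power)
  finally show ?thesis by (simp add: vec_norm2_def)
qed

section \<open>Generalized singular values\<close>

text \<open>Repeated columns are excluded first, because linear independence of the set of columns does not see repetitions.\<close>

lemma full_column_rank_kernel:
  assumes B: "B \<in> carrier_mat d n" and rank: "full_column_rank B"
    and x: "x \<in> carrier_vec n" and zero: "B *\<^sub>v x = 0\<^sub>v d"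
  shows "x = 0\<^sub>v n"
proof (rule ccontr)
  assume nz: "x \<noteq> 0\<^sub>v n"
  interpret vec_space "TYPE(real)" d .
  have rk: "rank B = n" using rank B by (simp add: full_column_rank_def)
  have dist: "distinct (cols B)"
  proof (rule ccontr)
    assume nd: "\<not> distinct (cols B)"
    obtain S where S: "maximal S (\<lambda>T. T \<subseteq> set (cols B) \<and> lin_indpt T)"
      using maximal_exists[of "(\<lambda>T. T \<subseteq> set (cols B) \<and> lin_indpt T)" "card (set (cols B))" "{}"]
      by (meson List.finite_set card_mono empty_iff empty_subsetI finite_lin_indpt2 finite_subset rev_finite_subset)
    then have "S \<subseteq> set (cols B)" by (simp add: maximal_def)
    then have "card S \<le> card (set (cols B))" by (simp add: card_mono)
    also have "\<dots> < length (cols B)"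
      using nd card_distinct[of "cols B"] card_length[of "cols B"] by linarith
    finally have "card S < n" using B by simp
    then show False using rank_card_indpt[OF B S] rk by simp
  qed
  show False
    using lin_depI[OF B x nz zero dist] full_rank_lin_indpt[OF B rk dist] by blast
qed

lemma rect_diag_carrier [simp]: "rect_diag r c f \<in> carrier_mat r c"
  by (simp add: rect_diag_def)

lemma rect_diag_mult_vec:
  assumes "y \<in> carrier_vec c" "i < r"
  shows "(rect_diag r c f *\<^sub>v y) $ i = (if i < c then f (i + 1) * y $ i else 0)"
proof -
  have "(rect_diag r c f *\<^sub>v y) $ i = (\<Sum>j = 0..<c. (if i = j then f (i + 1) else 0) * y $ j)"
    using assms by (simp add: rect_diag_def scalar_prod_def)
  also have "\<dots> = (\<Sum>j = 0..<c. if j = i then f (i + 1) * y $ i else 0)"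
    by (rule sum.cong) auto
  finally show ?thesis by simp
qed

lemma vec_norm2_square_sum: "v \<in> carrier_vec n \<Longrightarrow> (vec_norm2 v)\<^sup>2 = (\<Sum>i<n. (v $ i)\<^sup>2)"
  by (simp add: vec_norm2_square scalar_prod_ip[of v n] ip_square)

lemma rect_diag_norm:
  assumes y: "y \<in> carrier_vec c" and f: "\<And>i. i < c \<Longrightarrow> r \<le> i \<Longrightarrow> f (i + 1) = 0"
  shows "(vec_norm2 (rect_diag r c f *\<^sub>v y))\<^sup>2 = (\<Sum>i<c. (f (i + 1) * y $ i)\<^sup>2)"
proof -
  have D: "rect_diag r c f *\<^sub>v y \<in> carrier_vec r" by (rule mult_mat_vec_carrier[OF rect_diag_carrier y])
  have "(vec_norm2 (rect_diag r c f *\<^sub>v y))\<^sup>2 = (\<Sum>i<r. if i < c then (f (i + 1) * y $ i)\<^sup>2 else 0)"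
    unfolding vec_norm2_square_sum[OF D] by (rule sum.cong) (simp_all add: rect_diag_mult_vec[OF y])
  also have "\<dots> = (\<Sum>i\<in>{..<r} \<inter> {..<c}. (f (i + 1) * y $ i)\<^sup>2)"
    by (simp add: sum.If_cases lessThan_def)
  also have "\<dots> = (\<Sum>i<c. (f (i + 1) * y $ i)\<^sup>2)"
    by (rule sum.mono_neutral_left) (use f not_less in auto)
  finally show ?thesis .
qed

lemma gsvd_factor_norm:
  assumes U: "real_orthogonal r U" and Y: "Y \<in> carrier_mat n n"
    and A: "A = U * rect_diag r n f * transpose_mat Y"
    and f: "\<And>i. i < n \<Longrightarrow> r \<le> i \<Longrightarrow> f (i + 1) = 0" and x: "x \<in> carrier_vec n"
  shows "(vec_norm2 (A *\<^sub>v x))\<^sup>2 = (\<Sum>i<n. (f (i + 1) * (transpose_mat Y *\<^sub>v x) $ i)\<^sup>2)"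
proof -
  have U': "U \<in> carrier_mat r r" "orthonormal_cols U" using U by (auto simp: real_orthogonal_def)
  have y: "transpose_mat Y *\<^sub>v x \<in> carrier_vec n" using Y x by simp
  have D: "rect_diag r n f *\<^sub>v (transpose_mat Y *\<^sub>v x) \<in> carrier_vec r"
    by (rule mult_mat_vec_carrier[OF rect_diag_carrier y])
  have "A *\<^sub>v x = (U * rect_diag r n f) *\<^sub>v (transpose_mat Y *\<^sub>v x)"
    unfolding A using Y x by (intro assoc_mult_mat_vec[OF mult_carrier_mat[OF U'(1) rect_diag_carrier]]) auto
  also have "\<dots> = U *\<^sub>v (rect_diag r n f *\<^sub>v (transpose_mat Y *\<^sub>v x))"
    by (rule assoc_mult_mat_vec[OF U'(1) rect_diag_carrier y])
  finally show ?thesis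
    using rect_diag_norm[where r = r and f = f, OF y] f by (simp add: orthonormal_cols_norm[OF U' D])
qed

lemma gsvd_diagonal:
  assumes A: "A \<in> carrier_mat m n" and g: "is_gsvd A B U V Y \<gamma> \<beta>"
  shows gsvd_carrier: "Y \<in> carrier_mat n n"
    and gsvd_nonneg: "i < n \<Longrightarrow> 0 \<le> \<gamma> (i + 1)"
    and gsvd_unit: "i < n \<Longrightarrow> (\<gamma> (i + 1))\<^sup>2 + (\<beta> (i + 1))\<^sup>2 = 1"
    and gsvd_antimono: "i \<le> j \<Longrightarrow> j < n \<Longrightarrow> \<gamma> (j + 1) / \<beta> (j + 1) \<le> \<gamma> (i + 1) / \<beta> (i + 1)"
proof -
  have *: "Y \<in> carrier_mat n n" "\<forall>i\<in>{1..n}. 0 \<le> \<gamma> i \<and> 0 \<le> \<beta> i \<and> (\<gamma> i)\<^sup>2 + (\<beta> i)\<^sup>2 = 1"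
    "\<forall>i\<in>{1..n}. \<forall>j\<in>{1..n}. i \<le> j \<longrightarrow> \<gamma> j / \<beta> j \<le> \<gamma> i / \<beta> i"
    using g unfolding is_gsvd_def Let_def carrier_matD(2)[OF A] by - (elim conjE, assumption)+
  show "Y \<in> carrier_mat n n" by (rule *(1))
  show "i < n \<Longrightarrow> 0 \<le> \<gamma> (i + 1)" using *(2) by simp
  show "i < n \<Longrightarrow> (\<gamma> (i + 1))\<^sup>2 + (\<beta> (i + 1))\<^sup>2 = 1" using *(2) by simp
  show "i \<le> j \<Longrightarrow> j < n \<Longrightarrow> \<gamma> (j + 1) / \<beta> (j + 1) \<le> \<gamma> (i + 1) / \<beta> (i + 1)" using *(3) by simp
qed

lemma gsvd_norms:
  assumes A: "A \<in> carrier_mat m n" and B: "B \<in> carrier_mat d n" and nd: "n \<le> d"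
    and g: "is_gsvd A B U V Y \<gamma> \<beta>" and x: "x \<in> carrier_vec n"
  shows "(vec_norm2 (A *\<^sub>v x))\<^sup>2 = (\<Sum>i<n. (\<gamma> (i + 1) * (transpose_mat Y *\<^sub>v x) $ i)\<^sup>2)"
    and "(vec_norm2 (B *\<^sub>v x))\<^sup>2 = (\<Sum>i<n. (\<beta> (i + 1) * (transpose_mat Y *\<^sub>v x) $ i)\<^sup>2)"
proof -
  have *: "real_orthogonal m U" "real_orthogonal d V" "Y \<in> carrier_mat n n"
    "A = U * rect_diag m n \<gamma> * transpose_mat Y" "B = V * rect_diag d n \<beta> * transpose_mat Y"
    and z: "\<forall>i\<in>{1..n}. m < i \<longrightarrow> \<gamma> i = 0"
    using g A B by (auto simp: is_gsvd_def Let_def)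
  show "(vec_norm2 (A *\<^sub>v x))\<^sup>2 = (\<Sum>i<n. (\<gamma> (i + 1) * (transpose_mat Y *\<^sub>v x) $ i)\<^sup>2)"
    by (rule gsvd_factor_norm[OF *(1,3,4) _ x]) (use z in auto)
  show "(vec_norm2 (B *\<^sub>v x))\<^sup>2 = (\<Sum>i<n. (\<beta> (i + 1) * (transpose_mat Y *\<^sub>v x) $ i)\<^sup>2)"
    by (rule gsvd_factor_norm[OF *(2,3,5) _ x]) (use nd in auto)
qed

text \<open>In other words, \<open>Y Y\<^sup>T = A\<^sup>T A + B\<^sup>T B\<close>.\<close>

lemma gsvd_pythagoras:
  assumes A: "A \<in> carrier_mat m n" and B: "B \<in> carrier_mat d n" and nd: "n \<le> d"
    and g: "is_gsvd A B U V Y \<gamma> \<beta>" and x: "x \<in> carrier_vec n"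
  shows "(vec_norm2 (transpose_mat Y *\<^sub>v x))\<^sup>2 = (vec_norm2 (A *\<^sub>v x))\<^sup>2 + (vec_norm2 (B *\<^sub>v x))\<^sup>2"
proof -
  note Y = gsvd_carrier[OF A g] and one = gsvd_unit[OF A g]
  have y: "transpose_mat Y *\<^sub>v x \<in> carrier_vec n" using Y x by simp
  have "(\<Sum>i<n. ((transpose_mat Y *\<^sub>v x) $ i)\<^sup>2)
      = (\<Sum>i<n. ((\<gamma> (i + 1))\<^sup>2 + (\<beta> (i + 1))\<^sup>2) * ((transpose_mat Y *\<^sub>v x) $ i)\<^sup>2)"
    using one by simp
  then show ?thesis
    unfolding gsvd_norms[OF A B nd g x] vec_norm2_square_sum[OF y]
    by (simp only: distrib_right sum.distrib power_mult_distrib)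
qed

lemma gsvd_inverse:
  assumes A: "A \<in> carrier_mat m n" and g: "is_gsvd A B U V Y \<gamma> \<beta>"
  shows "\<exists>Z. Z \<in> carrier_mat n n \<and> Z * Y = 1\<^sub>m n \<and> transpose_mat Y * transpose_mat Z = 1\<^sub>m n"
proof -
  have Y: "Y \<in> carrier_mat n n" "invertible_mat Y" using g A by (auto simp: is_gsvd_def Let_def)
  then obtain Z where Z: "inverts_mat Y Z" "inverts_mat Z Y" by (auto simp: invertible_mat_def)
  have eq: "Y * Z = 1\<^sub>m n" "Z * Y = 1\<^sub>m (dim_row Z)" using Z Y by (auto simp: inverts_mat_def)
  have "dim_col Z = n" using arg_cong[OF eq(1), of dim_col] by simp
  moreover have "dim_row Z = n" using arg_cong[OF eq(2), of dim_col] Y by simp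
  ultimately have Zc: "Z \<in> carrier_mat n n" by blast
  have "transpose_mat Y * transpose_mat Z = transpose_mat (Z * Y)"
    using transpose_mult[OF Zc Y(1)] by simp
  then show ?thesis using Zc eq \<open>dim_row Z = n\<close> by (intro exI[of _ Z]) simp
qed

lemma gsvd_beta_pos:
  assumes A: "A \<in> carrier_mat m n" and B: "B \<in> carrier_mat d n" and nd: "n \<le> d"
    and g: "is_gsvd A B U V Y \<gamma> \<beta>" and rank: "full_column_rank B" and j: "j \<in> {1..n}"
  shows "0 < \<beta> j"
proof (rule ccontr)
  assume "\<not> 0 < \<beta> j"
  moreover have "0 \<le> \<beta> j" using g A j by (auto simp: is_gsvd_def Let_def)
  ultimately have b0: "\<beta> j = 0" by simp
  obtain Z where Z: "Z \<in> carrier_mat n n" "transpose_mat Y * transpose_mat Z = 1\<^sub>m n"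
    using gsvd_inverse[OF A g] by blast
  have Y: "Y \<in> carrier_mat n n" using g A by (auto simp: is_gsvd_def Let_def)
  define x where "x = transpose_mat Z *\<^sub>v unit_vec n (j - 1)"
  have x: "x \<in> carrier_vec n" using Z by (simp add: x_def)
  have "transpose_mat Y *\<^sub>v x = (transpose_mat Y * transpose_mat Z) *\<^sub>v unit_vec n (j - 1)"
    unfolding x_def using Y Z(1) by (intro assoc_mult_mat_vec[symmetric, of _ n n _ n]) auto
  then have yx: "transpose_mat Y *\<^sub>v x = unit_vec n (j - 1)" by (simp add: Z(2))
  have "(vec_norm2 (B *\<^sub>v x))\<^sup>2 = 0"
    unfolding gsvd_norms(2)[OF A B nd g x] yx using b0 j
    by (intro sum.neutral) (auto simp: unit_vec_def)
  then have "B *\<^sub>v x = 0\<^sub>v d" using vec_norm2_0_iff[of "B *\<^sub>v x" d] B x by simp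
  then have "x = 0\<^sub>v n" by (rule full_column_rank_kernel[OF B rank x])
  moreover have zeroY: "transpose_mat Y *\<^sub>v 0\<^sub>v n = 0\<^sub>v n" using Y by (intro eq_vecI) auto
  ultimately have "unit_vec n (j - 1) = (0\<^sub>v n :: real vec)" using yx zeroY by simp
  then have "unit_vec n (j - 1) $ (j - 1) = (0\<^sub>v n :: real vec) $ (j - 1)" by simp
  moreover have "j - 1 < n" using j by auto
  ultimately show False by simp
qed

lemma gsvd_factor_norm_le:
  assumes A: "A \<in> carrier_mat m n" and B: "B \<in> carrier_mat d n" and nd: "n \<le> d"
    and g: "is_gsvd A B U V Y \<gamma> \<beta>" and x: "x \<in> carrier_vec n" and a: "0 \<le> a"
    and le: "vec_norm2 (A *\<^sub>v x) \<le> a * vec_norm2 x"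
  shows "vec_norm2 (transpose_mat Y *\<^sub>v x) \<le> (a + mat_norm2 B) * vec_norm2 x"
proof -
  let ?a = "a * vec_norm2 x" and ?b = "mat_norm2 B * vec_norm2 x"
  have ab: "0 \<le> ?a" "0 \<le> ?b" using a by (simp_all add: mat_norm2_nonneg vec_norm2_nonneg)
  have "(vec_norm2 (transpose_mat Y *\<^sub>v x))\<^sup>2 \<le> ?a\<^sup>2 + ?b\<^sup>2"
    unfolding gsvd_pythagoras[OF A B nd g x]
    by (intro add_mono power_mono le vec_norm2_mult_le[OF B x] vec_norm2_nonneg)
  also have "\<dots> \<le> (?a + ?b)\<^sup>2" using mult_nonneg_nonneg[OF ab] unfolding power2_sum by linarith
  finally have "vec_norm2 (transpose_mat Y *\<^sub>v x) \<le> ?a + ?b"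
    by (rule power2_le_imp_le[OF _ add_nonneg_nonneg[OF ab]])
  then show ?thesis by (simp only: distrib_right)
qed

text \<open>Choose a unit vector \<open>x\<close> such that \<open>Y\<^sup>T x\<close> vanishes in the first \<open>k\<close> coordinates and \<open>Y'\<^sup>T x\<close> in
all coordinates after the first \<open>k + 1\<close>; these are \<open>n - 1\<close> linear conditions. For this \<open>x\<close>,
\<open>|A x| / |B x|\<close> is at most the ratio of the first pair and \<open>|A' x| / |B x|\<close> is at least that of the second pair.\<close>

lemma gsvd_ratio_mono:
  assumes A: "A \<in> carrier_mat m n" and A': "A' \<in> carrier_mat l n" and B: "B \<in> carrier_mat d n"
    and nd: "n \<le> d" and kn: "k < n" and rank: "full_column_rank B"
    and g: "is_gsvd A B U V Y \<gamma> \<beta>" and g': "is_gsvd A' B U' V' Y' \<gamma>' \<beta>'"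
    and le: "\<And>x. x \<in> carrier_vec n \<Longrightarrow> vec_norm2 (A' *\<^sub>v x) \<le> vec_norm2 (A *\<^sub>v x)"
  shows "\<gamma>' (k + 1) / \<beta>' (k + 1) \<le> \<gamma> (k + 1) / \<beta> (k + 1)"
proof -
  define \<rho> \<rho>' where "\<rho> = \<gamma> (k + 1) / \<beta> (k + 1)" and "\<rho>' = \<gamma>' (k + 1) / \<beta>' (k + 1)"
  have Y: "Y \<in> carrier_mat n n" and Y': "Y' \<in> carrier_mat n n" using gsvd_carrier[OF A g] gsvd_carrier[OF A' g'] .
  define w where "w a = (\<lambda>i. if a < k then Y $$ (i, a) else Y' $$ (i, a + 1))" for a
  obtain u where u: "ip n u u = 1" "\<forall>a<n - 1. ip n (w a) u = 0"
    using exists_unit_orthogonal[of "n - 1" n w] kn by auto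
  define x where "x = vec n u"
  have x: "x \<in> carrier_vec n" by (simp add: x_def)
  define y y' where "y = transpose_mat Y *\<^sub>v x" and "y' = transpose_mat Y' *\<^sub>v x"
  have yi: "y $ a = ip n (\<lambda>i. Y $$ (i, a)) u" and yi': "y' $ a = ip n (\<lambda>i. Y' $$ (i, a)) u" if "a < n" for a
    unfolding y_def y'_def x_def using that Y Y'
    by (simp_all add: scalar_prod_def ip_def lessThan_atLeast0)
  have low: "y $ a = 0" if "a < k" for a
    using u(2)[rule_format, of a] that kn yi[of a] by (simp add: w_def)
  have high: "y' $ a = 0" if "k < a" "a < n" for a
  proof -
    have "ip n (w (a - 1)) u = 0" using u(2) that by simp
    moreover have "w (a - 1) = (\<lambda>i. Y' $$ (i, a))" using that by (auto simp: w_def fun_eq_iff)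
    ultimately show ?thesis using yi'[of a] that by simp
  qed
  have bp: "0 < \<beta> (i + 1)" "0 < \<beta>' (i + 1)" if "i < n" for i
    using gsvd_beta_pos[OF A B nd g rank] gsvd_beta_pos[OF A' B nd g' rank] that by auto
  have gn: "0 \<le> \<gamma> (i + 1)" "0 \<le> \<gamma>' (i + 1)" if "i < n" for i
    using gsvd_nonneg[OF A g that] gsvd_nonneg[OF A' g' that] .
  have dec: "\<gamma> (i + 1) / \<beta> (i + 1) \<le> \<rho>" if "k \<le> i" "i < n" for i
    unfolding \<rho>_def by (rule gsvd_antimono[OF A g that])
  have dec': "\<rho>' \<le> \<gamma>' (i + 1) / \<beta>' (i + 1)" if "i \<le> k" for i
    unfolding \<rho>'_def by (rule gsvd_antimono[OF A' g' that kn])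
  have r0: "0 \<le> \<rho>" "0 \<le> \<rho>'" using bp[OF kn] gn[OF kn] by (auto simp: \<rho>_def \<rho>'_def)
  have 1: "(vec_norm2 (A *\<^sub>v x))\<^sup>2 \<le> \<rho>\<^sup>2 * (vec_norm2 (B *\<^sub>v x))\<^sup>2"
    unfolding gsvd_norms[OF A B nd g x] y_def[symmetric] sum_distrib_left
  proof (rule sum_mono)
    fix i assume "i \<in> {..<n}"
    then have i: "i < n" by simp
    show "(\<gamma> (i + 1) * y $ i)\<^sup>2 \<le> \<rho>\<^sup>2 * (\<beta> (i + 1) * y $ i)\<^sup>2"
    proof (cases "i < k")
      case False
      then have "\<gamma> (i + 1) \<le> \<rho> * \<beta> (i + 1)" using dec[of i] i bp(1)[OF i] by (simp add: pos_divide_le_eq)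
      then have "(\<gamma> (i + 1))\<^sup>2 \<le> (\<rho> * \<beta> (i + 1))\<^sup>2" using gn[OF i] by (intro power_mono)
      then show ?thesis using mult_right_mono[of "(\<gamma> (i + 1))\<^sup>2" "(\<rho> * \<beta> (i + 1))\<^sup>2" "(y $ i)\<^sup>2"]
        by (simp add: power_mult_distrib mult.assoc)
    qed (simp add: low)
  qed
  have 2: "\<rho>'\<^sup>2 * (vec_norm2 (B *\<^sub>v x))\<^sup>2 \<le> (vec_norm2 (A' *\<^sub>v x))\<^sup>2"
    unfolding gsvd_norms[OF A' B nd g' x] y'_def[symmetric] sum_distrib_left
  proof (rule sum_mono)
    fix i assume "i \<in> {..<n}"
    then have i: "i < n" by simp
    show "\<rho>'\<^sup>2 * (\<beta>' (i + 1) * y' $ i)\<^sup>2 \<le> (\<gamma>' (i + 1) * y' $ i)\<^sup>2"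
    proof (cases "k < i")
      case False
      then have "\<rho>' * \<beta>' (i + 1) \<le> \<gamma>' (i + 1)" using dec'[of i] bp(2)[OF i] by (simp add: pos_le_divide_eq)
      then have "(\<rho>' * \<beta>' (i + 1))\<^sup>2 \<le> (\<gamma>' (i + 1))\<^sup>2" using r0 bp(2)[OF i] by (intro power_mono) auto
      then show ?thesis using mult_right_mono[of "(\<rho>' * \<beta>' (i + 1))\<^sup>2" "(\<gamma>' (i + 1))\<^sup>2" "(y' $ i)\<^sup>2"]
        by (simp add: power_mult_distrib mult.assoc)
    qed (simp add: high i)
  qed
  have 3: "(vec_norm2 (A' *\<^sub>v x))\<^sup>2 \<le> (vec_norm2 (A *\<^sub>v x))\<^sup>2"
    by (intro power_mono le x vec_norm2_nonneg)
  have "B *\<^sub>v x \<noteq> 0\<^sub>v d"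
  proof
    assume "B *\<^sub>v x = 0\<^sub>v d"
    then have "x = 0\<^sub>v n" by (rule full_column_rank_kernel[OF B rank x])
    then have "u i = 0" if "i < n" for i using that unfolding x_def by (metis index_vec index_zero_vec(1))
    then show False using u(1) by (simp add: ip_def)
  qed
  then have "0 < (vec_norm2 (B *\<^sub>v x))\<^sup>2" using vec_norm2_0_iff[of "B *\<^sub>v x" d] B x by simp
  moreover have "\<rho>'\<^sup>2 * (vec_norm2 (B *\<^sub>v x))\<^sup>2 \<le> \<rho>\<^sup>2 * (vec_norm2 (B *\<^sub>v x))\<^sup>2"
    using 1 2 3 by linarith
  ultimately have "\<rho>'\<^sup>2 \<le> \<rho>\<^sup>2" by simp
  then show ?thesis using r0 by (fold \<rho>_def \<rho>'_def) (rule power2_le_imp_le)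
qed

lemma gsvd_gamma_le_ratio:
  assumes A: "A \<in> carrier_mat m n" and B: "B \<in> carrier_mat d n" and nd: "n \<le> d"
    and g: "is_gsvd A B U V Y \<gamma> \<beta>" and rank: "full_column_rank B"
    and i: "k \<le> i" "i < n"
  shows "0 \<le> \<gamma> (i + 1)" "\<gamma> (i + 1) \<le> \<gamma> (k + 1) / \<beta> (k + 1)"
proof -
  have b: "0 < \<beta> (i + 1)" using gsvd_beta_pos[OF A B nd g rank] i by auto
  have *: "0 \<le> \<gamma> (i + 1)" "(\<gamma> (i + 1))\<^sup>2 + (\<beta> (i + 1))\<^sup>2 = 1"
    and dec: "\<gamma> (i + 1) / \<beta> (i + 1) \<le> \<gamma> (k + 1) / \<beta> (k + 1)"
    using gsvd_nonneg[OF A g i(2)] gsvd_unit[OF A g i(2)] gsvd_antimono[OF A g i] .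
  show "0 \<le> \<gamma> (i + 1)" by (rule *(1))
  have "(\<beta> (i + 1))\<^sup>2 \<le> 1\<^sup>2" using *(2) zero_le_power2[of "\<gamma> (i + 1)"] unfolding power_one by linarith
  then have "\<beta> (i + 1) \<le> 1" by (rule power2_le_imp_le) simp
  then have "\<gamma> (i + 1) * \<beta> (i + 1) \<le> \<gamma> (i + 1)" using *(1) mult_left_mono by fastforce
  then have "\<gamma> (i + 1) \<le> \<gamma> (i + 1) / \<beta> (i + 1)" using b by (simp add: pos_le_divide_eq)
  then show "\<gamma> (i + 1) \<le> \<gamma> (k + 1) / \<beta> (k + 1)" using dec by simp
qed

section \<open>The deterministic error of a CUR approximation\<close>

lemma vec_norm2_minus_commute:
  assumes "u \<in> carrier_vec n" "v \<in> carrier_vec n"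
  shows "vec_norm2 (u - v) = vec_norm2 (v - u)"
proof -
  have "(vec_norm2 (u - v))\<^sup>2 = (vec_norm2 (v - u))\<^sup>2"
    using assms by (simp add: vec_norm2_square_sum[of _ n] power2_commute)
  then show ?thesis by (rule power2_eq_imp_eq) (rule vec_norm2_nonneg)+
qed

text \<open>For an orthogonal projection \<open>S\<close> the residual \<open>v - S v\<close> is orthogonal to \<open>S v\<close>.\<close>

lemma projection_residual:
  fixes S :: "real mat"
  assumes S: "S \<in> carrier_mat n n" "transpose_mat S = S" "S * S = S" and v: "v \<in> carrier_vec n"
  shows "scalar_prod (v - S *\<^sub>v v) (v - S *\<^sub>v v) = scalar_prod v (v - S *\<^sub>v v)"
    and "vec_norm2 (S *\<^sub>v v) \<le> vec_norm2 v" and "vec_norm2 (v - S *\<^sub>v v) \<le> vec_norm2 v"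
proof -
  have Sv: "S *\<^sub>v v \<in> carrier_vec n" using S v by simp
  have SSv: "S *\<^sub>v (S *\<^sub>v v) = S *\<^sub>v v" using assoc_mult_mat_vec[OF S(1) S(1) v] S(3) by simp
  have a: "scalar_prod (S *\<^sub>v v) (S *\<^sub>v v) = scalar_prod v (S *\<^sub>v v)"
    using adjoint_vec[OF S(1) v Sv] by (simp only: S(2) SSv)
  have comm: "scalar_prod (S *\<^sub>v v) v = scalar_prod v (S *\<^sub>v v)" by (rule comm_scalar_prod[OF Sv v])
  have d: "scalar_prod v (v - S *\<^sub>v v) = scalar_prod v v - scalar_prod v (S *\<^sub>v v)"
    by (rule scalar_prod_minus_distrib[OF v v Sv])
  have "scalar_prod (v - S *\<^sub>v v) (v - S *\<^sub>v v)
      = scalar_prod v (v - S *\<^sub>v v) - scalar_prod (S *\<^sub>v v) (v - S *\<^sub>v v)"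
    by (rule minus_scalar_prod_distrib[OF v Sv]) (use v Sv in simp)
  also have "scalar_prod (S *\<^sub>v v) (v - S *\<^sub>v v) = 0"
    using scalar_prod_minus_distrib[OF Sv v Sv] a comm by simp
  finally show res: "scalar_prod (v - S *\<^sub>v v) (v - S *\<^sub>v v) = scalar_prod v (v - S *\<^sub>v v)" by simp
  show "vec_norm2 (S *\<^sub>v v) \<le> vec_norm2 v"
    unfolding vec_norm2_def using res d a scalar_prod_self_nonneg[of "v - S *\<^sub>v v"] by simp
  show "vec_norm2 (v - S *\<^sub>v v) \<le> vec_norm2 v"
    unfolding vec_norm2_def using res d a scalar_prod_self_nonneg[of "S *\<^sub>v v"] by simp
qed

lemma pinv_projections:
  fixes C :: "real mat"
  assumes C: "C \<in> carrier_mat m r"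
  shows "pinv C \<in> carrier_mat r m"
    and "transpose_mat (C * pinv C) = C * pinv C" "(C * pinv C) * (C * pinv C) = C * pinv C"
    and "transpose_mat (pinv C * C) = pinv C * C" "(pinv C * C) * (pinv C * C) = pinv C * C"
    and "C * pinv C * C = C"
proof -
  have X: "pinv C \<in> carrier_mat r m" and 1: "C * pinv C * C = C"
    and s: "transpose_mat (C * pinv C) = C * pinv C" "transpose_mat (pinv C * C) = pinv C * C"
    using pinv_is_pinv[of C] C by (auto simp: is_pinv_def)
  show "pinv C \<in> carrier_mat r m" "C * pinv C * C = C"
    "transpose_mat (C * pinv C) = C * pinv C" "transpose_mat (pinv C * C) = pinv C * C" by fact+
  have "(C * pinv C) * (C * pinv C) = (C * pinv C * C) * pinv C"
    by (rule assoc_mult_mat[symmetric, of _ m m _ r _ m]) (use C X in auto)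
  then show "(C * pinv C) * (C * pinv C) = C * pinv C" by (simp only: 1)
  have "(pinv C * C) * (pinv C * C) = pinv C * (C * (pinv C * C))"
    by (rule assoc_mult_mat[of _ r m _ r _ r]) (use C X in auto)
  also have "C * (pinv C * C) = C * pinv C * C"
    by (rule assoc_mult_mat[symmetric, of _ m r _ m _ r]) (use C X in auto)
  finally show "(pinv C * C) * (pinv C * C) = pinv C * C" by (simp only: 1)
qed

lemma first_cols_split:
  fixes X :: "real mat"
  assumes X: "X \<in> carrier_mat N r" and k: "k \<le> r" and g: "g \<in> carrier_vec r"
  shows "X *\<^sub>v g = first_cols k X *\<^sub>v vec k (\<lambda>i. g $ i) + X *\<^sub>v vec r (\<lambda>i. if i < k then 0 else g $ i)"
proof (rule eq_vecI)
  let ?F = "first_cols k X"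
  have F: "?F \<in> carrier_mat N k" by (rule first_cols_carrier[OF X k])
  show "dim_vec (X *\<^sub>v g) = dim_vec (?F *\<^sub>v vec k (\<lambda>i. g $ i) + X *\<^sub>v vec r (\<lambda>i. if i < k then 0 else g $ i))"
    using X by simp
  fix i assume "i < dim_vec (?F *\<^sub>v vec k (\<lambda>i. g $ i) + X *\<^sub>v vec r (\<lambda>i. if i < k then 0 else g $ i))"
  then have i: "i < N" using X by simp
  have "(\<Sum>j<r. X $$ (i, j) * g $ j)
      = (\<Sum>j<r. if j < k then X $$ (i, j) * g $ j else 0) + (\<Sum>j<r. X $$ (i, j) * (if j < k then 0 else g $ j))"
    unfolding sum.distrib[symmetric] by (rule sum.cong) auto
  also have "(\<Sum>j<r. if j < k then X $$ (i, j) * g $ j else 0) = (\<Sum>j<k. X $$ (i, j) * g $ j)"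
    by (rule sum.mono_neutral_cong_right) (use k in auto)
  finally have eq: "(\<Sum>j<r. X $$ (i, j) * g $ j)
      = (\<Sum>j<k. X $$ (i, j) * g $ j) + (\<Sum>j<r. X $$ (i, j) * (if j < k then 0 else g $ j))" .
  have 1: "(X *\<^sub>v g) $ i = (\<Sum>j<r. X $$ (i, j) * g $ j)"
    using X g i by (simp add: scalar_prod_def lessThan_atLeast0)
  have 2: "(?F *\<^sub>v vec k (\<lambda>i. g $ i)) $ i = (\<Sum>j<k. X $$ (i, j) * g $ j)"
    using F i by (simp add: scalar_prod_def lessThan_atLeast0 first_cols_index[OF X k])
  have 3: "(X *\<^sub>v vec r (\<lambda>i. if i < k then 0 else g $ i)) $ i = (\<Sum>j<r. X $$ (i, j) * (if j < k then 0 else g $ j))"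
    using X i by (simp add: scalar_prod_def lessThan_atLeast0)
  show "(X *\<^sub>v g) $ i = (?F *\<^sub>v vec k (\<lambda>i. g $ i) + X *\<^sub>v vec r (\<lambda>i. if i < k then 0 else g $ i)) $ i"
    using i X 1 2 3 eq by simp
qed

lemma first_cols_injective:
  fixes X :: "real mat"
  assumes X: "X \<in> carrier_mat N r" and k: "k \<le> r"
    and inj: "\<And>g. g \<in> carrier_vec r \<Longrightarrow> X *\<^sub>v g = 0\<^sub>v N \<Longrightarrow> g = 0\<^sub>v r"
    and c: "c \<in> carrier_vec k" and zero: "first_cols k X *\<^sub>v c = 0\<^sub>v N"
  shows "c = 0\<^sub>v k"
proof -
  define g where "g = vec r (\<lambda>i. if i < k then c $ i else 0)"
  have g: "g \<in> carrier_vec r" by (simp add: g_def)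
  have 1: "vec k (\<lambda>i. g $ i) = c" using c k by (intro eq_vecI) (auto simp: g_def)
  have 2: "vec r (\<lambda>i. if i < k then 0 else g $ i) = 0\<^sub>v r" by (intro eq_vecI) (auto simp: g_def)
  have 3: "X *\<^sub>v 0\<^sub>v r = 0\<^sub>v N" using X by (intro eq_vecI) auto
  have "X *\<^sub>v g = 0\<^sub>v N" unfolding first_cols_split[OF X k g] 1 2 3 zero by simp
  then have "g = 0\<^sub>v r" by (rule inj[OF g])
  then have gz: "g $ i = 0" if "i < r" for i using that by simp
  have "c $ i = 0" if "i < k" for i using gz[of i] that k by (simp add: g_def)
  then show ?thesis using c by (intro eq_vecI) auto
qed

lemma rect_diag_tail_norm:
  assumes y: "y \<in> carrier_vec c" and \<rho>: "0 \<le> \<rho>"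
    and f: "\<And>i. k \<le> i \<Longrightarrow> i < r \<Longrightarrow> i < c \<Longrightarrow> 0 \<le> f (i + 1) \<and> f (i + 1) \<le> \<rho>"
  shows "vec_norm2 (vec r (\<lambda>i. if i < k then 0 else (rect_diag r c f *\<^sub>v y) $ i)) \<le> \<rho> * vec_norm2 y"
proof (rule power2_le_imp_le)
  let ?t = "vec r (\<lambda>i. if i < k then 0 else (rect_diag r c f *\<^sub>v y) $ i)"
  have t: "?t \<in> carrier_vec r" by simp
  have "(vec_norm2 ?t)\<^sup>2 = (\<Sum>i<r. (?t $ i)\<^sup>2)" by (rule vec_norm2_square_sum[OF t])
  also have "\<dots> \<le> (\<Sum>i<r. if i < c then (\<rho> * y $ i)\<^sup>2 else 0)"
  proof (rule sum_mono)
    fix i assume "i \<in> {..<r}"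
    then have i: "i < r" by simp
    show "(?t $ i)\<^sup>2 \<le> (if i < c then (\<rho> * y $ i)\<^sup>2 else 0)"
    proof (cases "k \<le> i \<and> i < c")
      case True
      then have "(f (i + 1))\<^sup>2 \<le> \<rho>\<^sup>2" using f[of i] i by (intro power_mono) auto
      then have "(f (i + 1))\<^sup>2 * (y $ i)\<^sup>2 \<le> \<rho>\<^sup>2 * (y $ i)\<^sup>2" by (rule mult_right_mono) simp
      then show ?thesis using True i by (simp add: rect_diag_mult_vec[OF y] power_mult_distrib)
    next
      case False
      then show ?thesis using i by (auto simp: rect_diag_mult_vec[OF y])
    qed
  qed
  also have "\<dots> = (\<Sum>i\<in>{..<r} \<inter> {..<c}. (\<rho> * y $ i)\<^sup>2)" by (simp add: sum.If_cases lessThan_def)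
  also have "\<dots> \<le> (\<Sum>i<c. (\<rho> * y $ i)\<^sup>2)" by (rule sum_mono2) auto
  also have "\<dots> = (\<rho> * vec_norm2 y)\<^sup>2"
    by (simp add: power_mult_distrib vec_norm2_square_sum[OF y] sum_distrib_left)
  finally show "(vec_norm2 ?t)\<^sup>2 \<le> (\<rho> * vec_norm2 y)\<^sup>2" .
qed (simp add: \<rho> vec_norm2_nonneg)

text \<open>The first \<open>k\<close> columns of \<open>X\<close> are the ones on which the indices were selected; the other columns enter only through the
diagonal entries beyond \<open>k\<close>, which are at most \<open>\<rho>\<close>.\<close>

lemma deim_diagonal_bound:
  fixes X :: "real mat"
  assumes X: "X \<in> carrier_mat N r" and k: "0 < k" "k \<le> r" "k < N"
    and inj: "\<And>g. g \<in> carrier_vec r \<Longrightarrow> X *\<^sub>v g = 0\<^sub>v N \<Longrightarrow> g = 0\<^sub>v r"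
    and q: "is_deim (first_cols k X) q"
    and y: "y \<in> carrier_vec c" and e: "e \<in> carrier_vec N"
    and w: "w = X *\<^sub>v (rect_diag r c f *\<^sub>v y) + e" and zero: "\<And>j. j < k \<Longrightarrow> w $ (q ! j) = 0"
    and \<rho>: "0 \<le> \<rho>" and f: "\<And>i. k \<le> i \<Longrightarrow> i < r \<Longrightarrow> i < c \<Longrightarrow> 0 \<le> f (i + 1) \<and> f (i + 1) \<le> \<rho>"
    and S: "0 \<le> S" and le: "\<And>g. g \<in> carrier_vec r \<Longrightarrow> vec_norm2 (X *\<^sub>v g) \<le> S * vec_norm2 g"
  shows "vec_norm2 w \<le> sqrt (real N * real k / 3) * 2 ^ k * (S * (\<rho> * vec_norm2 y) + vec_norm2 e)"
proof -
  let ?g = "rect_diag r c f *\<^sub>v y"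
  have g: "?g \<in> carrier_vec r" by (rule mult_mat_vec_carrier[OF rect_diag_carrier y])
  define t where "t = vec r (\<lambda>i. if i < k then 0 else ?g $ i)"
  have t: "t \<in> carrier_vec r" by (simp add: t_def)
  have F: "first_cols k X \<in> carrier_mat N k" by (rule first_cols_carrier[OF X k(2)])
  have Xt: "X *\<^sub>v t \<in> carrier_vec N" using X t by simp
  have "w = (first_cols k X *\<^sub>v vec k (\<lambda>i. ?g $ i) + X *\<^sub>v t) + e"
    unfolding w t_def by (subst first_cols_split[OF X k(2) g]) (rule refl)
  also have "\<dots> = first_cols k X *\<^sub>v vec k (\<lambda>i. ?g $ i) + (X *\<^sub>v t + e)"
    using F Xt e by (intro assoc_add_vec[of _ N]) auto
  finally have "vec_norm2 w \<le> sqrt (real N * real k / 3) * 2 ^ k * vec_norm2 (X *\<^sub>v t + e)"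
    using F Xt e
    by (intro deim_error_bound[OF F k(1,3) first_cols_injective[OF X k(2) inj] q _ _ _ zero]) auto
  also have "\<dots> \<le> sqrt (real N * real k / 3) * 2 ^ k * (S * (\<rho> * vec_norm2 y) + vec_norm2 e)"
  proof (rule mult_left_mono)
    have "vec_norm2 (X *\<^sub>v t + e) \<le> vec_norm2 (X *\<^sub>v t) + vec_norm2 e"
      by (rule vec_norm2_triangle[OF Xt e])
    moreover have "vec_norm2 (X *\<^sub>v t) \<le> S * vec_norm2 t" by (rule le[OF t])
    moreover have "S * vec_norm2 t \<le> S * (\<rho> * vec_norm2 y)"
    proof (rule mult_left_mono[OF _ S])
      show "vec_norm2 t \<le> \<rho> * vec_norm2 y"
        unfolding t_def by (rule rect_diag_tail_norm[OF y \<rho>]) (rule f)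
    qed
    ultimately show "vec_norm2 (X *\<^sub>v t + e) \<le> S * (\<rho> * vec_norm2 y) + vec_norm2 e" by linarith
  qed simp
  finally show ?thesis .
qed

lemma select_rows_zero:
  assumes A: "A \<in> carrier_mat m n" and j: "j < length s" "s ! j < m"
    and zero: "select_rows A s *\<^sub>v z = 0\<^sub>v (length s)"
  shows "(A *\<^sub>v z) $ (s ! j) = 0"
proof -
  have "(select_rows A s *\<^sub>v z) $ j = scalar_prod (row A (s ! j)) z"
    using A j by (simp add: select_rows_def)
  then show ?thesis using A j zero by simp
qed

lemma select_cols_zero:
  assumes A: "A \<in> carrier_mat m n" and j: "j < length q" "q ! j < n"
    and zero: "transpose_mat (select_cols A q) *\<^sub>v w = 0\<^sub>v (length q)"
  shows "(transpose_mat A *\<^sub>v w) $ (q ! j) = 0"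
proof -
  have "(transpose_mat (select_cols A q) *\<^sub>v w) $ j = scalar_prod (col A (q ! j)) w"
    using A j by (simp add: select_cols_def)
  then show ?thesis using A j zero by simp
qed

text \<open>The two estimates \<open>row_bound\<close> and \<open>col_bound\<close> apply \<open>deim_diagonal_bound\<close> to
\<open>A = (Q W) \<Gamma> Y\<^sup>T + E\<close> and to its transpose, where \<open>E = A - Q Q\<^sup>T A\<close>.\<close>

theorem gcur_error_bound:
  fixes A B :: "real mat"
  assumes A: "A \<in> carrier_mat m n" and B: "B \<in> carrier_mat d n" and nm: "n \<le> m" and nd: "n \<le> d"
    and rank: "full_column_rank B" and k: "0 < k" "k < n" "k \<le> l"
    and Q: "Q \<in> carrier_mat m l" "orthonormal_cols Q"
    and g: "is_gsvd A B U\<^sub>0 V\<^sub>0 Y\<^sub>0 \<gamma> \<beta>" and g': "is_gsvd (transpose_mat Q * A) B W V Y \<gamma>' \<beta>'"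
    and q: "is_deim (first_cols k Y) q" and s: "is_deim (first_cols k (Q * W)) s"
    and \<theta>: "0 \<le> \<theta>" and proj: "\<And>x. x \<in> carrier_vec n \<Longrightarrow>
      vec_norm2 (A *\<^sub>v x - Q *\<^sub>v (transpose_mat Q *\<^sub>v (A *\<^sub>v x))) \<le> \<theta> * vec_norm2 x"
  shows "mat_norm2 (cur_approx A q s - A)
    \<le> \<eta> m n k * (\<theta> + (mat_norm2 A + mat_norm2 B) * (\<gamma> (k + 1) / \<beta> (k + 1)))"
proof -
  define A' where "A' = transpose_mat Q * A"
  have A': "A' \<in> carrier_mat l n" using Q A by (simp add: A'_def)
  note g'' = g'[folded A'_def]
  have A'x: "A' *\<^sub>v x = transpose_mat Q *\<^sub>v (A *\<^sub>v x)" if "x \<in> carrier_vec n" for x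
    unfolding A'_def using Q A that by (intro assoc_mult_mat_vec[of _ l m _ n]) auto
  have A'le: "vec_norm2 (A' *\<^sub>v x) \<le> vec_norm2 (A *\<^sub>v x)" if "x \<in> carrier_vec n" for x
    unfolding A'x[OF that] using A that by (intro orthonormal_cols_adjoint_norm_le[OF Q]) auto
  define \<rho> S where "\<rho> = \<gamma> (k + 1) / \<beta> (k + 1)" and "S = mat_norm2 A + mat_norm2 B"
  have S0: "0 \<le> S" by (simp add: S_def mat_norm2_nonneg)
  have small: "0 \<le> \<gamma>' (i + 1) \<and> \<gamma>' (i + 1) \<le> \<rho>" if "k \<le> i" "i < n" for i
    using gsvd_gamma_le_ratio[OF A' B nd g'' rank that] gsvd_ratio_mono[OF A A' B nd k(2) rank g g'' A'le]
    unfolding \<rho>_def by linarith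
  have \<rho>0: "0 \<le> \<rho>" using small[OF order_refl k(2)] by linarith
  have Y: "Y \<in> carrier_mat n n" by (rule gsvd_carrier[OF A' g''])
  have W: "W \<in> carrier_mat l l" "orthonormal_cols W" and A'eq: "A' = W * rect_diag l n \<gamma>' * transpose_mat Y"
  proof -
    have "real_orthogonal l W" "A' = W * rect_diag l n \<gamma>' * transpose_mat Y"
      using g'' unfolding is_gsvd_def Let_def carrier_matD[OF A'] by - (elim conjE, assumption)+
    then show "W \<in> carrier_mat l l" "orthonormal_cols W" "A' = W * rect_diag l n \<gamma>' * transpose_mat Y"
      by (simp_all only: real_orthogonal_def)
  qed
  define X where "X = Q * W"
  have X: "X \<in> carrier_mat m l" using Q W by (simp add: X_def)
  have Xo: "orthonormal_cols X"
  proof -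
    have "transpose_mat X * X = (transpose_mat W * transpose_mat Q) * (Q * W)"
      unfolding X_def by (simp only: transpose_mult[OF Q(1) W(1)])
    also have "\<dots> = transpose_mat W * (transpose_mat Q * (Q * W))"
      using Q W by (intro assoc_mult_mat[of _ l l _ m _ l]) auto
    also have "transpose_mat Q * (Q * W) = (transpose_mat Q * Q) * W"
      using Q W by (intro assoc_mult_mat[symmetric, of _ l m _ l _ l]) auto
    also have "(transpose_mat Q * Q) * W = W" using Q W by (simp add: orthonormal_cols_def)
    finally show ?thesis using W X by (simp add: orthonormal_cols_def)
  qed
  define E where "E = A - Q * A'"
  have E: "E \<in> carrier_mat m n" unfolding E_def using Q A' by (intro minus_carrier_mat mult_carrier_mat)
  have Ax: "Q *\<^sub>v (A' *\<^sub>v x) + E *\<^sub>v x = A *\<^sub>v x" and Ex: "vec_norm2 (E *\<^sub>v x) \<le> \<theta> * vec_norm2 x"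
    if x: "x \<in> carrier_vec n" for x
  proof -
    have "E *\<^sub>v x = A *\<^sub>v x - (Q * A') *\<^sub>v x"
      unfolding E_def using A Q A' x by (intro minus_mult_distrib_mat_vec) auto
    then have eq: "E *\<^sub>v x = A *\<^sub>v x - Q *\<^sub>v (A' *\<^sub>v x)" by (simp add: assoc_mult_mat_vec[OF Q(1) A' x])
    show "vec_norm2 (E *\<^sub>v x) \<le> \<theta> * vec_norm2 x" unfolding eq A'x[OF x] by (rule proj[OF x])
    show "Q *\<^sub>v (A' *\<^sub>v x) + E *\<^sub>v x = A *\<^sub>v x"
      unfolding eq using A Q A' x by (intro eq_vecI) auto
  qed
  have ETx: "vec_norm2 (transpose_mat E *\<^sub>v w) \<le> \<theta> * vec_norm2 w" if "w \<in> carrier_vec m" for w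
    using adjoint_norm_le[of "transpose_mat E" n m w \<theta>] E Ex that \<theta> by simp
  have YT: "vec_norm2 (transpose_mat Y *\<^sub>v x) \<le> S * vec_norm2 x" if x: "x \<in> carrier_vec n" for x
    unfolding S_def
  proof (rule gsvd_factor_norm_le[OF A' B nd g'' x mat_norm2_nonneg])
    show "vec_norm2 (A' *\<^sub>v x) \<le> mat_norm2 A * vec_norm2 x"
      using A'le[OF x] vec_norm2_mult_le[OF A x] by linarith
  qed
  have Yn: "vec_norm2 (Y *\<^sub>v y) \<le> S * vec_norm2 y" if "y \<in> carrier_vec n" for y
    by (rule adjoint_norm_le[OF Y that S0 YT])
  have Yinj: "y = 0\<^sub>v n" if y: "y \<in> carrier_vec n" and zero: "Y *\<^sub>v y = 0\<^sub>v n" for y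
  proof -
    obtain Z where Z: "Z \<in> carrier_mat n n" "Z * Y = 1\<^sub>m n" using gsvd_inverse[OF A' g''] by blast
    have "(Z * Y) *\<^sub>v y = Z *\<^sub>v (Y *\<^sub>v y)" by (rule assoc_mult_mat_vec[OF Z(1) Y y])
    also have "\<dots> = 0\<^sub>v n" unfolding zero using Z by (intro eq_vecI) auto
    finally show ?thesis using Z(2) y by simp
  qed
  have Xinj: "y = 0\<^sub>v l" if y: "y \<in> carrier_vec l" and zero: "X *\<^sub>v y = 0\<^sub>v m" for y
    using orthonormal_cols_norm[OF X Xo y] vec_norm2_0_iff[OF y] by (simp add: zero)
  define K c\<^sub>n c\<^sub>m where "K = \<theta> + S * \<rho>" and "c\<^sub>n = sqrt (real n * real k / 3) * 2 ^ k"
    and "c\<^sub>m = sqrt (real m * real k / 3) * 2 ^ k"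
  have K0: "0 \<le> K" and c0: "0 \<le> c\<^sub>n" "0 \<le> c\<^sub>m" using \<theta> S0 \<rho>0 by (simp_all add: K_def c\<^sub>n_def c\<^sub>m_def)
  have kl: "k \<le> n" "k < m" using k nm by simp_all

  have row_bound: "vec_norm2 (A *\<^sub>v z) \<le> c\<^sub>m * (K * vec_norm2 z)"
    if z: "z \<in> carrier_vec n" and zero: "\<And>j. j < k \<Longrightarrow> (A *\<^sub>v z) $ (s ! j) = 0" for z
  proof -
    let ?y = "transpose_mat Y *\<^sub>v z"
    have y: "?y \<in> carrier_vec n" using Y z by simp
    have D: "rect_diag l n \<gamma>' *\<^sub>v ?y \<in> carrier_vec l" by (rule mult_mat_vec_carrier[OF rect_diag_carrier y])
    have "A' *\<^sub>v z = (W * rect_diag l n \<gamma>') *\<^sub>v ?y"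
      unfolding A'eq using Y z by (intro assoc_mult_mat_vec[OF mult_carrier_mat[OF W(1) rect_diag_carrier]]) auto
    also have "\<dots> = W *\<^sub>v (rect_diag l n \<gamma>' *\<^sub>v ?y)" by (rule assoc_mult_mat_vec[OF W(1) rect_diag_carrier y])
    finally have "Q *\<^sub>v (A' *\<^sub>v z) = X *\<^sub>v (rect_diag l n \<gamma>' *\<^sub>v ?y)"
      unfolding X_def by (simp only: assoc_mult_mat_vec[OF Q(1) W(1) D])
    then have w: "A *\<^sub>v z = X *\<^sub>v (rect_diag l n \<gamma>' *\<^sub>v ?y) + E *\<^sub>v z" using Ax[OF z] by simp
    have Ez: "E *\<^sub>v z \<in> carrier_vec m" using E z by simp
    have "vec_norm2 (A *\<^sub>v z) \<le> c\<^sub>m * (1 * (\<rho> * vec_norm2 ?y) + vec_norm2 (E *\<^sub>v z))"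
      unfolding c\<^sub>m_def
    proof (rule deim_diagonal_bound[OF X k(1,3) kl(2) Xinj s[folded X_def] y Ez w zero \<rho>0])
      show "vec_norm2 (X *\<^sub>v g) \<le> 1 * vec_norm2 g" if "g \<in> carrier_vec l" for g
        using orthonormal_cols_norm[OF X Xo that] by simp
    qed (use small in simp_all)
    also have "\<dots> \<le> c\<^sub>m * (K * vec_norm2 z)"
    proof (rule mult_left_mono[OF _ c0(2)])
      have "\<rho> * vec_norm2 ?y \<le> \<rho> * (S * vec_norm2 z)" by (rule mult_left_mono[OF YT[OF z] \<rho>0])
      then show "1 * (\<rho> * vec_norm2 ?y) + vec_norm2 (E *\<^sub>v z) \<le> K * vec_norm2 z"
        using Ex[OF z] by (simp add: K_def algebra_simps)
    qed
    finally show ?thesis .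
  qed

  have col_bound: "vec_norm2 (transpose_mat A *\<^sub>v w) \<le> c\<^sub>n * (K * vec_norm2 w)"
    if w: "w \<in> carrier_vec m" and zero: "\<And>j. j < k \<Longrightarrow> (transpose_mat A *\<^sub>v w) $ (q ! j) = 0" for w
  proof -
    let ?y = "transpose_mat X *\<^sub>v w"
    have y: "?y \<in> carrier_vec l" using X w by simp
    have dT: "transpose_mat (rect_diag l n \<gamma>') = rect_diag n l \<gamma>'" by (rule eq_matI) (auto simp: rect_diag_def)
    have "Q * A' = X * (rect_diag l n \<gamma>' * transpose_mat Y)"
    proof -
      have "A' = W * (rect_diag l n \<gamma>' * transpose_mat Y)"
        unfolding A'eq using Y by (intro assoc_mult_mat[OF W(1) rect_diag_carrier]) auto
      then show ?thesis unfolding X_def using Y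
        by (simp only:) (rule assoc_mult_mat[symmetric, OF Q(1) W(1) mult_carrier_mat[OF rect_diag_carrier]], simp)
    qed
    moreover have "A = Q * A' + E" unfolding E_def using A Q A' by (intro eq_matI) auto
    ultimately have Aeq: "A = X * (rect_diag l n \<gamma>' * transpose_mat Y) + E" by simp
    have YTc: "transpose_mat Y \<in> carrier_mat n n" using Y by simp
    note DY = mult_carrier_mat[OF rect_diag_carrier YTc, of l "\<gamma>'"]
    have "transpose_mat A = transpose_mat (X * (rect_diag l n \<gamma>' * transpose_mat Y)) + transpose_mat E"
      by (subst Aeq) (rule transpose_add[OF mult_carrier_mat[OF X DY] E])
    also have "transpose_mat (X * (rect_diag l n \<gamma>' * transpose_mat Y)) = (Y * rect_diag n l \<gamma>') * transpose_mat X"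
    proof -
      have "transpose_mat (rect_diag l n \<gamma>' * transpose_mat Y) = Y * rect_diag n l \<gamma>'"
        using transpose_mult[OF rect_diag_carrier YTc, of l "\<gamma>'"] by (simp add: dT)
      then show ?thesis
        using transpose_mult[OF X DY] by simp
    qed
    finally have AT: "transpose_mat A = (Y * rect_diag n l \<gamma>') * transpose_mat X + transpose_mat E" .
    have "transpose_mat A *\<^sub>v w
        = ((Y * rect_diag n l \<gamma>') * transpose_mat X) *\<^sub>v w + transpose_mat E *\<^sub>v w"
      unfolding AT using X Y E w
      by (intro add_mult_distrib_mat_vec[of _ n m] mult_carrier_mat[OF mult_carrier_mat[OF Y rect_diag_carrier]]) auto
    also have "((Y * rect_diag n l \<gamma>') * transpose_mat X) *\<^sub>v w = (Y * rect_diag n l \<gamma>') *\<^sub>v ?y"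
      using X w by (intro assoc_mult_mat_vec[OF mult_carrier_mat[OF Y rect_diag_carrier]]) auto
    also have "\<dots> = Y *\<^sub>v (rect_diag n l \<gamma>' *\<^sub>v ?y)" by (rule assoc_mult_mat_vec[OF Y rect_diag_carrier y])
    finally have dec: "transpose_mat A *\<^sub>v w = Y *\<^sub>v (rect_diag n l \<gamma>' *\<^sub>v ?y) + transpose_mat E *\<^sub>v w" .
    have Ew: "transpose_mat E *\<^sub>v w \<in> carrier_vec n" using E w by simp
    have "vec_norm2 (transpose_mat A *\<^sub>v w)
        \<le> c\<^sub>n * (S * (\<rho> * vec_norm2 ?y) + vec_norm2 (transpose_mat E *\<^sub>v w))"
      unfolding c\<^sub>n_def
      by (rule deim_diagonal_bound[OF Y k(1) kl(1) k(2) Yinj q y Ew dec zero \<rho>0 _ S0 Yn])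
         (use small in simp_all)
    also have "\<dots> \<le> c\<^sub>n * (K * vec_norm2 w)"
    proof (rule mult_left_mono[OF _ c0(1)])
      have "S * (\<rho> * vec_norm2 ?y) \<le> S * (\<rho> * vec_norm2 w)"
        by (intro mult_left_mono orthonormal_cols_adjoint_norm_le[OF X Xo w] \<rho>0 S0)
      then show "S * (\<rho> * vec_norm2 ?y) + vec_norm2 (transpose_mat E *\<^sub>v w) \<le> K * vec_norm2 w"
        using ETx[OF w] by (simp add: K_def algebra_simps)
    qed
    finally show ?thesis .
  qed

  define C R where "C = select_cols A q" and "R = select_rows A s"
  have lq: "length q = k" "\<And>j. j < k \<Longrightarrow> q ! j < n"
    using q first_cols_carrier[OF Y kl(1)] by (auto simp: is_deim_def)
  have ls: "length s = k" "\<And>j. j < k \<Longrightarrow> s ! j < m"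
    using s[folded X_def] first_cols_carrier[OF X k(3)] by (auto simp: is_deim_def)
  have C: "C \<in> carrier_mat m k" using A lq(1) mat_of_cols_carrier(1)[of m "map (col A) q"] by (simp add: C_def select_cols_def)
  have R: "R \<in> carrier_mat k n" using select_rows_carrier[OF A, of s] ls by (simp add: R_def)
  note pC = pinv_projections[OF C] and pR = pinv_projections[OF R]
  show ?thesis
  proof (rule mat_norm2_leI)
    show "cur_approx A q s - A \<in> carrier_mat m n" by (rule minus_carrier_mat[OF A])
    show "0 \<le> \<eta> m n k * (\<theta> + (mat_norm2 A + mat_norm2 B) * (\<gamma> (k + 1) / \<beta> (k + 1)))"
      using K0 by (simp add: \<eta>_def K_def S_def \<rho>_def)
    fix v :: "real vec" assume v: "v \<in> carrier_vec n"
    define p z u w where "p = (pinv R * R) *\<^sub>v v" and "z = v - (pinv R * R) *\<^sub>v v"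
      and "u = A *\<^sub>v p" and "w = u - (C * pinv C) *\<^sub>v u"
    have PR: "pinv R * R \<in> carrier_mat n n" and PC: "C * pinv C \<in> carrier_mat m m" using C R pC pR by simp_all
    have p: "p \<in> carrier_vec n" and z: "z \<in> carrier_vec n" using PR v by (simp_all add: p_def z_def)
    have u: "u \<in> carrier_vec m" and w: "w \<in> carrier_vec m" using A p PC by (simp_all add: u_def w_def)
    have pv: "vec_norm2 p \<le> vec_norm2 v" and zv: "vec_norm2 z \<le> vec_norm2 v"
      using projection_residual(2,3)[OF PR pR(4,5) v] by (simp_all add: p_def z_def)
    have "R *\<^sub>v z = R *\<^sub>v v - R *\<^sub>v p"
      unfolding z_def p_def using PR v by (intro mult_minus_distrib_mat_vec[OF R]) auto
    also have "R *\<^sub>v p = (R * (pinv R * R)) *\<^sub>v v"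
      unfolding p_def by (rule assoc_mult_mat_vec[symmetric, OF R PR v])
    also have "R * (pinv R * R) = R * pinv R * R"
      by (rule assoc_mult_mat[symmetric, OF R pR(1) R])
    finally have Rz: "R *\<^sub>v z = 0\<^sub>v k" using R v by (simp add: pR(6))
    have Az: "vec_norm2 (A *\<^sub>v z) \<le> c\<^sub>m * (K * vec_norm2 v)"
    proof -
      have "(A *\<^sub>v z) $ (s ! j) = 0" if "j < k" for j
        using select_rows_zero[OF A, of j s z] Rz ls that by (simp add: R_def)
      from row_bound[OF z this] have "vec_norm2 (A *\<^sub>v z) \<le> c\<^sub>m * (K * vec_norm2 z)" .
      also have "\<dots> \<le> c\<^sub>m * (K * vec_norm2 v)" by (intro mult_left_mono zv K0 c0)
      finally show ?thesis .
    qed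
    have "transpose_mat C *\<^sub>v w = transpose_mat C *\<^sub>v u - transpose_mat C *\<^sub>v ((C * pinv C) *\<^sub>v u)"
      unfolding w_def using C PC u by (intro mult_minus_distrib_mat_vec[of _ k m]) auto
    also have "transpose_mat C *\<^sub>v ((C * pinv C) *\<^sub>v u) = (transpose_mat C * (C * pinv C)) *\<^sub>v u"
      using C by (intro assoc_mult_mat_vec[symmetric, OF _ PC u]) simp
    also have "transpose_mat C * (C * pinv C) = transpose_mat ((C * pinv C) * C)"
      unfolding transpose_mult[OF PC C] by (simp only: pC(2))
    finally have Cw: "transpose_mat C *\<^sub>v w = 0\<^sub>v k" using C u by (simp add: pC(6))
    \<comment> \<open>\<open>|w|\<^sup>2 = \<langle>A p, w\<rangle> = \<langle>p, A\<^sup>T w\<rangle>\<close>, so the estimate of \<open>A\<^sup>T w\<close> bounds \<open>w\<close>.\<close>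
    have wn: "vec_norm2 w \<le> c\<^sub>n * (K * vec_norm2 v)"
    proof (cases "vec_norm2 w = 0")
      case True
      then show ?thesis using c0 K0 by (simp add: vec_norm2_nonneg)
    next
      case False
      then have wp: "0 < vec_norm2 w" using vec_norm2_nonneg[of w] by linarith
      have "(transpose_mat A *\<^sub>v w) $ (q ! j) = 0" if "j < k" for j
        using select_cols_zero[OF A, of j q w] Cw lq that by (simp add: C_def)
      note cb = col_bound[OF w this]
      have Aw: "transpose_mat A *\<^sub>v w \<in> carrier_vec n" using A w by simp
      have "vec_norm2 w * vec_norm2 w = scalar_prod u w"
        using projection_residual(1)[OF PC pC(2,3) u] vec_norm2_square[of w]
        by (simp add: w_def power2_eq_square)
      also have "\<dots> = scalar_prod p (transpose_mat A *\<^sub>v w)" unfolding u_def by (rule adjoint_vec[OF A p w])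
      also have "\<dots> \<le> vec_norm2 p * vec_norm2 (transpose_mat A *\<^sub>v w)" by (rule Cauchy_Schwarz_vec[OF p Aw])
      also have "\<dots> \<le> vec_norm2 v * (c\<^sub>n * (K * vec_norm2 w))"
        by (intro mult_mono pv cb vec_norm2_nonneg)
      finally have "vec_norm2 w * vec_norm2 w \<le> (c\<^sub>n * (K * vec_norm2 v)) * vec_norm2 w"
        by (simp add: ac_simps)
      then show ?thesis using wp by (simp only: mult_le_cancel_right_pos)
    qed
    have Av: "A *\<^sub>v v = A *\<^sub>v z + u"
    proof -
      have "v = z + p" unfolding z_def p_def using PR v by (intro eq_vecI) auto
      then show ?thesis unfolding u_def using mult_add_distrib_mat_vec[OF A z p] by simp
    qed
    have cur: "cur_approx A q s *\<^sub>v v = (C * pinv C) *\<^sub>v u"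
    proof -
      have 1: "pinv C * A \<in> carrier_mat k n" "pinv C * A * pinv R \<in> carrier_mat k k"
        "C * (pinv C * A * pinv R) \<in> carrier_mat m k" using C R A pC(1) pR(1) by simp_all
      have Rv: "R *\<^sub>v v \<in> carrier_vec k" using R v by simp
      have pRv: "pinv R *\<^sub>v (R *\<^sub>v v) = p" unfolding p_def by (rule assoc_mult_mat_vec[symmetric, OF pR(1) R v])
      have "cur_approx A q s *\<^sub>v v = (C * (pinv C * A * pinv R)) *\<^sub>v (R *\<^sub>v v)"
        unfolding cur_approx_def Let_def C_def[symmetric] R_def[symmetric] by (rule assoc_mult_mat_vec[OF 1(3) R v])
      also have "\<dots> = C *\<^sub>v ((pinv C * A * pinv R) *\<^sub>v (R *\<^sub>v v))" by (rule assoc_mult_mat_vec[OF C 1(2) Rv])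
      also have "(pinv C * A * pinv R) *\<^sub>v (R *\<^sub>v v) = (pinv C * A) *\<^sub>v p"
        unfolding pRv[symmetric] by (rule assoc_mult_mat_vec[OF 1(1) pR(1) Rv])
      also have "\<dots> = pinv C *\<^sub>v u" unfolding u_def by (rule assoc_mult_mat_vec[OF pC(1) A p])
      also have "C *\<^sub>v (pinv C *\<^sub>v u) = (C * pinv C) *\<^sub>v u" by (rule assoc_mult_mat_vec[symmetric, OF C pC(1) u])
      finally show ?thesis .
    qed
    have "(cur_approx A q s - A) *\<^sub>v v = (C * pinv C) *\<^sub>v u - (A *\<^sub>v z + u)"
    proof -
      have "cur_approx A q s \<in> carrier_mat m n"
        unfolding cur_approx_def Let_def C_def[symmetric] R_def[symmetric]
        by (rule mult_carrier_mat[OF mult_carrier_mat[OF C mult_carrier_mat[OF mult_carrier_mat[OF pC(1) A] pR(1)]] R])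
      from minus_mult_distrib_mat_vec[OF this A v] show ?thesis by (simp only: cur Av)
    qed
    then have "vec_norm2 ((cur_approx A q s - A) *\<^sub>v v) = vec_norm2 ((A *\<^sub>v z + u) - (C * pinv C) *\<^sub>v u)"
      using vec_norm2_minus_commute[of "(C * pinv C) *\<^sub>v u" m "A *\<^sub>v z + u"] A z u PC by simp
    also have "(A *\<^sub>v z + u) - (C * pinv C) *\<^sub>v u = A *\<^sub>v z + w"
      unfolding w_def using A z u PC by (intro eq_vecI) auto
    also have "vec_norm2 (A *\<^sub>v z + w) \<le> vec_norm2 (A *\<^sub>v z) + vec_norm2 w"
      using A z w by (intro vec_norm2_triangle[of _ m]) auto
    also have "\<dots> \<le> c\<^sub>m * (K * vec_norm2 v) + c\<^sub>n * (K * vec_norm2 v)" using Az wn by linarith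
    also have "\<dots> = (\<eta> m n k * K) * vec_norm2 v" by (simp add: \<eta>_def c\<^sub>m_def c\<^sub>n_def algebra_simps)
    finally show "vec_norm2 ((cur_approx A q s - A) *\<^sub>v v)
        \<le> \<eta> m n k * (\<theta> + (mat_norm2 A + mat_norm2 B) * (\<gamma> (k + 1) / \<beta> (k + 1))) * vec_norm2 v"
      by (simp only: K_def S_def \<rho>_def)
  qed
qed

section \<open>The range finder\<close>

lemma mult_vec_index:
  assumes "A \<in> carrier_mat m n" "x \<in> carrier_vec n" "i < m"
  shows "(A *\<^sub>v x) $ i = (\<Sum>c<n. A $$ (i, c) * x $ c)"
  using assms by (simp add: scalar_prod_def lessThan_atLeast0)

lemma gram_norm:
  fixes A P :: "real mat"
  assumes A: "A \<in> carrier_mat m n" and P: "P \<in> carrier_mat n n"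
    and gram: "transpose_mat A * A = P * mat_diag n d * transpose_mat P" and y: "y \<in> carrier_vec n"
  shows "(vec_norm2 (A *\<^sub>v y))\<^sup>2 = (\<Sum>i<n. d i * ((transpose_mat P *\<^sub>v y) $ i)\<^sup>2)"
proof -
  let ?z = "transpose_mat P *\<^sub>v y"
  have z: "?z \<in> carrier_vec n" using P y by simp
  have D: "mat_diag n d \<in> carrier_mat n n" by (simp add: mat_diag_def)
  have Deq: "mat_diag n d = rect_diag n n (\<lambda>i. d (i - 1))"
    by (rule eq_matI) (auto simp: mat_diag_def rect_diag_def)
  have Dz: "mat_diag n d *\<^sub>v ?z \<in> carrier_vec n" by (rule mult_mat_vec_carrier[OF D z])
  have Ay: "A *\<^sub>v y \<in> carrier_vec m" using A y by simp
  have "(vec_norm2 (A *\<^sub>v y))\<^sup>2 = scalar_prod y (transpose_mat A *\<^sub>v (A *\<^sub>v y))"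
    unfolding vec_norm2_square by (rule adjoint_vec[OF A y Ay])
  also have "transpose_mat A *\<^sub>v (A *\<^sub>v y) = (transpose_mat A * A) *\<^sub>v y"
    by (rule assoc_mult_mat_vec[symmetric, OF _ A y]) (use A in simp)
  also have "\<dots> = (P * mat_diag n d) *\<^sub>v ?z"
    unfolding gram using P y by (intro assoc_mult_mat_vec[OF mult_carrier_mat[OF P D]]) auto
  also have "\<dots> = P *\<^sub>v (mat_diag n d *\<^sub>v ?z)" by (rule assoc_mult_mat_vec[OF P D z])
  also have "scalar_prod y (P *\<^sub>v (mat_diag n d *\<^sub>v ?z)) = scalar_prod (P *\<^sub>v (mat_diag n d *\<^sub>v ?z)) y"
    using P Dz y by (intro comm_scalar_prod[of _ n]) auto
  also have "\<dots> = scalar_prod (mat_diag n d *\<^sub>v ?z) ?z" by (rule adjoint_vec[OF P Dz y])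
  also have "\<dots> = (\<Sum>i<n. d i * (?z $ i)\<^sup>2)"
  proof -
    have "scalar_prod (mat_diag n d *\<^sub>v ?z) ?z = (\<Sum>i<n. (mat_diag n d *\<^sub>v ?z) $ i * ?z $ i)"
      unfolding scalar_prod_def lessThan_atLeast0 carrier_vecD[OF z] by (rule refl)
    also have "\<dots> = (\<Sum>i<n. d i * (?z $ i)\<^sup>2)"
      by (rule sum.cong) (simp_all add: Deq rect_diag_mult_vec[OF z] power2_eq_square)
    finally show ?thesis .
  qed
  finally show ?thesis .
qed

text \<open>Let \<open>\<xi> = P\<^sup>T x\<close> be the coordinates of \<open>x\<close> in the basis of right singular vectors, and \<open>\<xi>\<^sub>1\<close> the
first \<open>k\<close> of them. The vector \<open>y = x - \<Omega> F \<xi>\<^sub>1\<close> has no components along the first \<open>k\<close> singular vectors, and \<open>A \<Omega>\<close>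
lies in the range of \<open>Q\<close>. So the residual of \<open>A x\<close> is that of \<open>A y\<close>, and only the small
singular values act on \<open>y\<close>.\<close>

theorem range_finder_bound:
  fixes A P Q T Om :: "real mat"
  assumes A: "A \<in> carrier_mat m n" and Q: "Q \<in> carrier_mat m l" "orthonormal_cols Q"
    and T: "T \<in> carrier_mat l l" and Om: "Om \<in> carrier_mat n l" and QT: "A * Om = Q * T"
    and P: "P \<in> carrier_mat n n" "P * transpose_mat P = 1\<^sub>m n"
    and gram: "transpose_mat A * A = P * mat_diag n d * transpose_mat P" and d: "\<And>i. i < n \<Longrightarrow> 0 \<le> d i"
    and k: "k \<le> n" and \<sigma>: "0 \<le> \<sigma>" "\<And>i. i \<in> {k..<n} \<Longrightarrow> sqrt (d i) \<le> \<sigma>" and \<tau>: "0 \<le> \<tau>"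
    and G: "\<And>i c. i < n \<Longrightarrow> c < l \<Longrightarrow> G (i, c) = (\<Sum>a<n. P $$ (a, i) * Om $$ (a, c))"
    and F: "\<And>i j. i < k \<Longrightarrow> j < k \<Longrightarrow> (\<Sum>c<l. G (i, c) * F c j) = (if i = j then 1 else 0)"
    and tail: "\<And>v. sqrt (\<Sum>i\<in>{k..<n}. (sqrt (d i) * (\<Sum>c<l. G (i, c) * (\<Sum>j<k. F c j * v j)))\<^sup>2) \<le> \<tau> * vnorm k v"
    and x: "x \<in> carrier_vec n"
  shows "vec_norm2 (A *\<^sub>v x - Q *\<^sub>v (transpose_mat Q *\<^sub>v (A *\<^sub>v x))) \<le> (\<sigma> + \<tau>) * vec_norm2 x"
proof -
  define \<xi> where "\<xi> = transpose_mat P *\<^sub>v x"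
  define f where "f = vec l (\<lambda>c. \<Sum>j<k. F c j * \<xi> $ j)"
  define y where "y = x - Om *\<^sub>v f"
  have f: "f \<in> carrier_vec l" and \<xi>: "\<xi> \<in> carrier_vec n" using P x by (simp_all add: f_def \<xi>_def)
  have Of: "Om *\<^sub>v f \<in> carrier_vec n" using Om f by simp
  have y: "y \<in> carrier_vec n" using x Of by (simp add: y_def)
  have Ay: "A *\<^sub>v y \<in> carrier_vec m" using A y by simp
  have QQ: "transpose_mat Q * Q = 1\<^sub>m l" using Q by (simp add: orthonormal_cols_def)
  have Qt: "transpose_mat Q \<in> carrier_mat l m" using Q by simp
  \<comment> \<open>Subtracting a vector from the range of \<open>Q\<close> does not change the residual.\<close>
  have "vec_norm2 (A *\<^sub>v x - Q *\<^sub>v (transpose_mat Q *\<^sub>v (A *\<^sub>v x))) \<le> vec_norm2 (A *\<^sub>v y)"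
  proof -
    define h where "h = T *\<^sub>v f"
    have h: "h \<in> carrier_vec l" using T f by (simp add: h_def)
    have Qh: "Q *\<^sub>v h \<in> carrier_vec m" using Q h by simp
    have AOf: "A *\<^sub>v (Om *\<^sub>v f) = Q *\<^sub>v h"
      using assoc_mult_mat_vec[OF A Om f] assoc_mult_mat_vec[OF Q(1) T f] by (simp add: QT h_def)
    have "A *\<^sub>v y = A *\<^sub>v x - Q *\<^sub>v h"
      unfolding y_def using mult_minus_distrib_mat_vec[OF A x Of] by (simp add: AOf)
    then have Ax: "A *\<^sub>v x = A *\<^sub>v y + Q *\<^sub>v h" using A x Q Qh by (intro eq_vecI) auto
    have QtQh: "transpose_mat Q *\<^sub>v (Q *\<^sub>v h) = h"
      using assoc_mult_mat_vec[OF Qt Q(1) h] h by (simp add: QQ)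
    have QtAy: "transpose_mat Q *\<^sub>v (A *\<^sub>v y) \<in> carrier_vec l" by (rule mult_mat_vec_carrier[OF Qt Ay])
    have "Q *\<^sub>v (transpose_mat Q *\<^sub>v (A *\<^sub>v x)) = Q *\<^sub>v (transpose_mat Q *\<^sub>v (A *\<^sub>v y)) + Q *\<^sub>v h"
      unfolding Ax mult_add_distrib_mat_vec[OF Qt Ay Qh] QtQh by (rule mult_add_distrib_mat_vec[OF Q(1) QtAy h])
    then have "A *\<^sub>v x - Q *\<^sub>v (transpose_mat Q *\<^sub>v (A *\<^sub>v x)) = A *\<^sub>v y - Q *\<^sub>v (transpose_mat Q *\<^sub>v (A *\<^sub>v y))"
      unfolding Ax using Ay Qh Q QtAy by (intro eq_vecI) auto
    also have "Q *\<^sub>v (transpose_mat Q *\<^sub>v (A *\<^sub>v y)) = (Q * transpose_mat Q) *\<^sub>v (A *\<^sub>v y)"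
      by (rule assoc_mult_mat_vec[symmetric, OF Q(1) Qt Ay])
    also have "vec_norm2 (A *\<^sub>v y - (Q * transpose_mat Q) *\<^sub>v (A *\<^sub>v y)) \<le> vec_norm2 (A *\<^sub>v y)"
    proof (rule projection_residual(3)[OF _ _ _ Ay])
      show "Q * transpose_mat Q \<in> carrier_mat m m" by (rule mult_carrier_mat[OF Q(1) Qt])
      show "transpose_mat (Q * transpose_mat Q) = Q * transpose_mat Q"
        using transpose_mult[OF Q(1) Qt] by simp
      have "(Q * transpose_mat Q) * (Q * transpose_mat Q) = Q * (transpose_mat Q * (Q * transpose_mat Q))"
        by (rule assoc_mult_mat[OF Q(1) Qt mult_carrier_mat[OF Q(1) Qt]])
      also have "transpose_mat Q * (Q * transpose_mat Q) = (transpose_mat Q * Q) * transpose_mat Q"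
        by (rule assoc_mult_mat[symmetric, OF Qt Q(1) Qt])
      also have "\<dots> = transpose_mat Q" using Qt by (simp add: QQ)
      finally show "(Q * transpose_mat Q) * (Q * transpose_mat Q) = Q * transpose_mat Q" .
    qed
    finally show ?thesis .
  qed
  also have "vec_norm2 (A *\<^sub>v y) \<le> (\<sigma> + \<tau>) * vec_norm2 x"
  proof -
    define g where "g i = (\<Sum>c<l. G (i, c) * (\<Sum>j<k. F c j * \<xi> $ j))" for i
    have Pt: "transpose_mat P \<in> carrier_mat n n" using P by simp
    have \<zeta>: "(transpose_mat P *\<^sub>v y) $ i = \<xi> $ i - g i" if i: "i < n" for i
    proof -
      have "transpose_mat P *\<^sub>v y = \<xi> - transpose_mat P *\<^sub>v (Om *\<^sub>v f)"
        unfolding y_def \<xi>_def by (rule mult_minus_distrib_mat_vec[OF Pt x Of])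
      also have "transpose_mat P *\<^sub>v (Om *\<^sub>v f) = (transpose_mat P * Om) *\<^sub>v f"
        by (rule assoc_mult_mat_vec[symmetric, OF Pt Om f])
      finally have "(transpose_mat P *\<^sub>v y) $ i = \<xi> $ i - ((transpose_mat P * Om) *\<^sub>v f) $ i"
        using \<xi> P Om i by simp
      also have "((transpose_mat P * Om) *\<^sub>v f) $ i = (\<Sum>c<l. (transpose_mat P * Om) $$ (i, c) * f $ c)"
        by (rule mult_vec_index[OF mult_carrier_mat[OF Pt Om] f i])
      also have "\<dots> = g i"
        unfolding g_def
      proof (rule sum.cong[OF refl])
        fix c assume "c \<in> {..<l}"
        then have c: "c < l" by simp
        have "(transpose_mat P * Om) $$ (i, c) = G (i, c)"
          unfolding G[OF i c] using P Om i c by (simp add: scalar_prod_def lessThan_atLeast0)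
        then show "(transpose_mat P * Om) $$ (i, c) * f $ c = G (i, c) * (\<Sum>j<k. F c j * \<xi> $ j)"
          using c by (simp add: f_def)
      qed
      finally show ?thesis .
    qed
    have head: "g i = \<xi> $ i" if i: "i < k" for i
    proof -
      have "g i = (\<Sum>j<k. (\<Sum>c<l. G (i, c) * F c j) * \<xi> $ j)"
        unfolding g_def sum_distrib_left sum_distrib_right by (subst sum.swap) (simp add: mult.assoc)
      also have "\<dots> = (\<Sum>j<k. (if i = j then 1 else 0) * \<xi> $ j)"
        by (rule sum.cong) (simp_all add: F i)
      also have "\<dots> = (\<Sum>j<k. if j = i then \<xi> $ j else 0)" by (rule sum.cong) auto
      finally show ?thesis using i by simp
    qed
    have "(vec_norm2 (A *\<^sub>v y))\<^sup>2 = (\<Sum>i<n. d i * (\<xi> $ i - g i)\<^sup>2)"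
      unfolding gram_norm[OF A P(1) gram y] by (rule sum.cong) (simp_all add: \<zeta>)
    also have "\<dots> = (\<Sum>i\<in>{k..<n}. d i * (\<xi> $ i - g i)\<^sup>2)"
      by (rule sum.mono_neutral_right) (use head in auto)
    also have "\<dots> = (\<Sum>i\<in>{k..<n}. (sqrt (d i) * \<xi> $ i + - (sqrt (d i) * g i))\<^sup>2)"
      by (rule sum.cong) (simp_all add: d power_mult_distrib right_diff_distrib[symmetric])
    finally have "vec_norm2 (A *\<^sub>v y) = L2_set (\<lambda>i. sqrt (d i) * \<xi> $ i + - (sqrt (d i) * g i)) {k..<n}"
      unfolding L2_set_def by (metis real_sqrt_unique vec_norm2_nonneg)
    also have "\<dots> \<le> L2_set (\<lambda>i. sqrt (d i) * \<xi> $ i) {k..<n} + L2_set (\<lambda>i. - (sqrt (d i) * g i)) {k..<n}"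
      by (rule L2_set_triangle_ineq)
    also have "L2_set (\<lambda>i. - (sqrt (d i) * g i)) {k..<n} \<le> \<tau> * vnorm k (\<lambda>i. \<xi> $ i)"
      using tail[of "\<lambda>i. \<xi> $ i"] by (simp add: L2_set_def g_def)
    also have "vnorm k (\<lambda>i. \<xi> $ i) \<le> vec_norm2 \<xi>"
    proof -
      have "(\<Sum>i<k. (\<xi> $ i)\<^sup>2) \<le> (\<Sum>i<n. (\<xi> $ i)\<^sup>2)" by (rule sum_mono2) (use k in auto)
      then show ?thesis using vec_norm2_vnorm[OF \<xi>] by (simp add: ip_square)
    qed
    also have "L2_set (\<lambda>i. sqrt (d i) * \<xi> $ i) {k..<n} \<le> \<sigma> * vec_norm2 \<xi>"
    proof -
      have "L2_set (\<lambda>i. sqrt (d i) * \<xi> $ i) {k..<n} = L2_set (\<lambda>i. sqrt (d i) * \<bar>\<xi> $ i\<bar>) {k..<n}"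
        unfolding L2_set_def by (simp add: power_mult_distrib)
      also have "\<dots> \<le> L2_set (\<lambda>i. \<sigma> * \<bar>\<xi> $ i\<bar>) {k..<n}"
        by (rule L2_set_mono) (use \<sigma>(2) d in \<open>auto intro!: mult_right_mono\<close>)
      also have "\<dots> = \<sigma> * L2_set (\<lambda>i. \<bar>\<xi> $ i\<bar>) {k..<n}" by (rule L2_set_right_distrib[symmetric, OF \<sigma>(1)])
      also have "L2_set (\<lambda>i. \<bar>\<xi> $ i\<bar>) {k..<n} \<le> vec_norm2 \<xi>"
        unfolding vec_norm2_L2[OF \<xi>] L2_set_def
        by (simp, rule sum_mono2) auto
      finally show ?thesis using \<sigma>(1) by (simp add: mult_left_mono)
    qed
    finally show ?thesis
      using orthonormal_cols_norm[of "transpose_mat P" n n x] P x Pt \<tau>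
      by (simp add: orthonormal_cols_def \<xi>_def distrib_right mult_left_mono)
  qed
  finally show ?thesis .
qed

section \<open>The probabilistic error bound\<close>

text \<open>The entries of the test matrix have joint law \<open>gauss\<close>, which is invariant under the orthogonal map \<open>U\<close>.\<close>

lemma gaussian_matrix_rotated_event:
  fixes M :: "'w measure" and \<Omega> :: "'w \<Rightarrow> real mat" and n l :: nat
  assumes M: "prob_space M" and gm: "gaussian_matrix M n l \<Omega>" and nl: "0 < n" "0 < l"
    and U: "orthonormal_rows n n U" and \<G>: "\<G> \<in> sets (gauss ({..<n} \<times> {..<l}))"
  shows "\<exists>E\<in>sets M.
    emeasure M (space M - E) = emeasure (gauss ({..<n} \<times> {..<l})) (space (gauss ({..<n} \<times> {..<l})) - \<G>) \<and>
    (\<forall>\<omega>\<in>E. (\<lambda>(i, c)\<in>{..<n} \<times> {..<l}. \<Sum>a<n. U i a * \<Omega> \<omega> $$ (a, c)) \<in> \<G>)"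
proof -
  interpret prob_space M by (rule M)
  define I where "I = {..<n} \<times> {..<l}"
  define X where "X \<omega> = (\<lambda>z\<in>I. \<Omega> \<omega> $$ z)" for \<omega>
  define rot where "rot G = (\<lambda>(i, c)\<in>I. \<Sum>a<n. U i a * G (a, c))" for G :: "nat \<times> nat \<Rightarrow> real"
  have dist: "distributed M lborel (\<lambda>\<omega>. \<Omega> \<omega> $$ z) std_normal_density" if "z \<in> I" for z
    using gm that by (cases z) (auto simp: gaussian_matrix_def I_def)
  have rv: "random_variable borel (\<lambda>\<omega>. \<Omega> \<omega> $$ z)" if "z \<in> I" for z
    using distributed_measurable[OF dist[OF that]] by simp
  have law: "distr M borel (\<lambda>\<omega>. \<Omega> \<omega> $$ z) = std_normal" if "z \<in> I" for z
  proof -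
    have "distr M borel (\<lambda>\<omega>. \<Omega> \<omega> $$ z) = distr M lborel (\<lambda>\<omega>. \<Omega> \<omega> $$ z)" by (rule distr_cong) simp_all
    then show ?thesis using distributed_distr_eq_density[OF dist[OF that]] by simp
  qed
  have Ine: "I \<noteq> {}" using nl by (auto simp: I_def)
  have ind: "indep_vars (\<lambda>_. borel) (\<lambda>ij \<omega>. \<Omega> \<omega> $$ ij) I"
    using gm by (simp add: gaussian_matrix_def I_def)
  have "distr M (Pi\<^sub>M I (\<lambda>_. borel)) X = Pi\<^sub>M I (\<lambda>z. distr M borel (\<lambda>\<omega>. \<Omega> \<omega> $$ z))"
    using iffD1[OF indep_vars_iff_distr_eq_PiM'[OF Ine rv] ind] unfolding X_def .
  also have "\<dots> = gauss I" unfolding gauss_def by (rule PiM_cong[OF refl law])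
  finally have distr: "distr M (Pi\<^sub>M I (\<lambda>_. borel)) X = gauss I" .
  have Xm: "X \<in> measurable M (Pi\<^sub>M I (\<lambda>_. borel))" unfolding X_def by (rule measurable_restrict) (rule rv)
  have rotm: "rot \<in> measurable (Pi\<^sub>M I (\<lambda>_. borel)) (Pi\<^sub>M I (\<lambda>_. borel))"
    unfolding rot_def
  proof (rule measurable_restrict)
    fix z assume "z \<in> I"
    then obtain i c where z: "z = (i, c)" "i < n" "c < l" by (auto simp: I_def)
    have "(\<lambda>G. G (a, c)) \<in> borel_measurable (Pi\<^sub>M I (\<lambda>_. borel :: real measure))" if "a < n" for a
      by (rule measurable_component_singleton) (use that z in \<open>simp add: I_def\<close>)
    then show "(\<lambda>G. case z of (i, c) \<Rightarrow> \<Sum>a<n. U i a * G (a, c)) \<in> borel_measurable (Pi\<^sub>M I (\<lambda>_. borel))"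
      unfolding z prod.case by (intro borel_measurable_sum borel_measurable_times) auto
  qed
  define N where "N = space (gauss I) - \<G>"
  have \<G>': "\<G> \<in> sets (Pi\<^sub>M I (\<lambda>_. borel))" and N: "N \<in> sets (Pi\<^sub>M I (\<lambda>_. borel))"
    using \<G> sets.compl_sets[OF \<G>] by (simp_all add: N_def I_def[symmetric])
  have spc: "space (gauss I) = space (Pi\<^sub>M I (\<lambda>_. borel))" by (rule sets_eq_imp_space_eq) simp
  define E where "E = (\<lambda>\<omega>. rot (X \<omega>)) -` \<G> \<inter> space M"
  have rX: "(\<lambda>\<omega>. rot (X \<omega>)) \<in> measurable M (Pi\<^sub>M I (\<lambda>_. borel))" by (rule measurable_compose[OF Xm rotm])
  have E: "E \<in> sets M" unfolding E_def by (rule measurable_sets[OF rX \<G>'])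
  have compl: "space M - E = (\<lambda>\<omega>. rot (X \<omega>)) -` N \<inter> space M"
    unfolding E_def N_def spc using measurable_space[OF rX] by auto
  have "emeasure M (space M - E) = emeasure (distr M (Pi\<^sub>M I (\<lambda>_. borel)) (\<lambda>\<omega>. rot (X \<omega>))) N"
    unfolding compl by (rule emeasure_distr[symmetric, OF rX N])
  also have "distr M (Pi\<^sub>M I (\<lambda>_. borel)) (\<lambda>\<omega>. rot (X \<omega>))
      = distr (distr M (Pi\<^sub>M I (\<lambda>_. borel)) X) (Pi\<^sub>M I (\<lambda>_. borel)) rot"
    by (subst distr_distr[OF rotm Xm]) (simp add: comp_def)
  also have "\<dots> = distr (gauss I) (Pi\<^sub>M I (\<lambda>_. borel)) rot" by (simp only: distr)
  also have "emeasure \<dots> N = (\<integral>\<^sup>+G. indicator N (rot G) \<partial>gauss I)"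
  proof -
    have rotg: "rot \<in> measurable (gauss I) (Pi\<^sub>M I (\<lambda>_. borel))"
      using rotm by (simp cong: measurable_cong_sets)
    have "emeasure (distr (gauss I) (Pi\<^sub>M I (\<lambda>_. borel)) rot) N
        = (\<integral>\<^sup>+G. indicator N G \<partial>distr (gauss I) (Pi\<^sub>M I (\<lambda>_. borel)) rot)"
      using N by (intro nn_integral_indicator[symmetric]) simp
    also have "\<dots> = (\<integral>\<^sup>+G. indicator N (rot G) \<partial>gauss I)"
      by (rule nn_integral_distr[OF rotg]) (use N in simp)
    finally show ?thesis .
  qed
  also have "\<dots> = (\<integral>\<^sup>+G. indicator N G \<partial>gauss I)"
    using gauss_orthogonal_rows[OF U, of "indicator N" l] N unfolding rot_def I_def by simp
  also have "\<dots> = emeasure (gauss I) N" using N by (intro nn_integral_indicator) simp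
  finally have "emeasure M (space M - E) = emeasure (gauss I) (space (gauss I) - \<G>)" by (simp only: N_def)
  moreover have "(\<lambda>(i, c)\<in>I. \<Sum>a<n. U i a * \<Omega> \<omega> $$ (a, c)) \<in> \<G>" if "\<omega> \<in> E" for \<omega>
  proof -
    have "rot (X \<omega>) = (\<lambda>(i, c)\<in>I. \<Sum>a<n. U i a * \<Omega> \<omega> $$ (a, c))"
      unfolding rot_def X_def by (rule restrict_ext) (auto simp: I_def)
    then show ?thesis using that by (simp add: E_def)
  qed
  ultimately show ?thesis using E unfolding I_def by blast
qed

theorem theorem3p1:
  fixes A B :: "real mat" and m n d k p :: nat
    and M :: "'w measure" and \<Omega> Ahat Bhat :: "'w \<Rightarrow> real mat"
    and \<gamma> \<beta> :: "nat \<Rightarrow> real"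
  assumes "A \<in> carrier_mat m n" and "B \<in> carrier_mat d n"
    and "n \<le> m" and "n \<le> d"
    and "full_column_rank A" and "full_column_rank B"
    and "0 < k" and "0 < p" and "k < n" and "k + p \<le> m"
    and "prob_space M" and "gaussian_matrix M n (k + p) \<Omega>"
    and "\<And>\<omega>. \<omega> \<in> space M \<Longrightarrow> rand_gcur A B k p (\<Omega> \<omega>) (Ahat \<omega>) (Bhat \<omega>)"
    and "gen_sing_vals A B \<gamma> \<beta>"
    and "\<And>i j. 1 \<le> i \<Longrightarrow> i \<le> j \<Longrightarrow> j \<le> n \<Longrightarrow> 1 / \<beta> j \<le> 1 / \<beta> i"
  shows "\<exists>E\<in>sets M. measure M E \<ge> 1 - 3 * real p powr (- real p) \<and>
    (\<forall>\<omega>\<in>E. mat_norm2 (Ahat \<omega> - A) \<le>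
      \<eta> m n k * (\<Theta> A k p + (mat_norm2 A + mat_norm2 B) *
        (\<gamma> (k + 1) / \<beta> (k + 1) +
         \<Theta> A k p / \<beta> (k + 1) * mat_norm2 (pinv (A @\<^sub>r B)))))"
proof (cases "p = 1")
  case True
  \<comment> \<open>The required probability is \<open>1 - 3 < 0\<close>.\<close>
  have "(1::real) - 3 * real p powr (- real p) \<le> measure M {}" by (simp add: True)
  then show ?thesis by (intro bexI[of _ "{}"]) auto
next
  case False
  note A = assms(1) and B = assms(2) and nm = assms(3) and nd = assms(4) and rank = assms(6)
    and k0 = assms(7) and kn = assms(9) and M = assms(11) and gm = assms(12) and run = assms(13)
  interpret prob_space M by (rule M)
  have p2: "2 \<le> p" using assms(8) False by simp
  define l where "l = k + p"
  obtain U\<^sub>0 V\<^sub>0 Y\<^sub>0 where g: "is_gsvd A B U\<^sub>0 V\<^sub>0 Y\<^sub>0 \<gamma> \<beta>"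
    using assms(14) unfolding gen_sing_vals_def by (elim exE) (rule that)
  have "\<exists>P e. P \<in> carrier_mat n n \<and> transpose_mat P * P = 1\<^sub>m n \<and> P * transpose_mat P = 1\<^sub>m n \<and>
    transpose_mat A * A = P * mat_diag n e * transpose_mat P \<and>
    (\<forall>i<n. 0 \<le> e i) \<and> (\<forall>i j. i \<le> j \<longrightarrow> j < n \<longrightarrow> e j \<le> e i) \<and>
    sing_vals A = map (\<lambda>i. sqrt (e i)) [0..<n]"
    by (rule gram_spectral_decomposition[OF A])
  then obtain P e where P: "P \<in> carrier_mat n n" "transpose_mat P * P = 1\<^sub>m n" "P * transpose_mat P = 1\<^sub>m n"
    and gram: "transpose_mat A * A = P * mat_diag n e * transpose_mat P"
    and e0: "\<forall>i<n. 0 \<le> e i" and edec: "\<forall>i j. i \<le> j \<longrightarrow> j < n \<longrightarrow> e j \<le> e i"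
    and sv: "sing_vals A = map (\<lambda>i. sqrt (e i)) [0..<n]"
    by (elim exE conjE) (rule that)
  have sv': "sing_val A (i + 1) = sqrt (e i)" if "i < n" for i using that by (simp add: sing_val_def sv)
  define \<sigma> \<tau> where "\<sigma> = sqrt (e k)"
    and "\<tau> = 3 * sqrt (real l) * sqrt (\<Sum>i\<in>{k..<n}. (sqrt (e i))\<^sup>2) + 6 * sqrt (real l * real p * ln (real p)) * \<sigma>"
  have s: "0 \<le> sqrt (e i) \<and> sqrt (e i) \<le> \<sigma>" if "i \<in> {k..<n}" for i
    using that e0 edec by (simp add: \<sigma>_def)
  have \<sigma>0: "0 \<le> \<sigma>" using e0 kn by (simp add: \<sigma>_def)
  have \<tau>0: "0 \<le> \<tau>" unfolding \<tau>_def using \<sigma>0 p2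
    by (intro add_nonneg_nonneg mult_nonneg_nonneg real_sqrt_ge_zero sum_nonneg ln_ge_zero) auto
  have \<Theta>: "\<Theta> A k p = \<sigma> + \<tau>"
  proof -
    have "(\<Sum>j\<in>{k+1..n}. (sing_val A j)\<^sup>2) = (\<Sum>i\<in>{k..<n}. (sing_val A (i + 1))\<^sup>2)"
      by (rule sum.reindex_bij_witness[of _ "\<lambda>i. i + 1" "\<lambda>j. j - 1"]) auto
    also have "\<dots> = (\<Sum>i\<in>{k..<n}. (sqrt (e i))\<^sup>2)" by (rule sum.cong[OF refl]) (simp only: sv' atLeastLessThan_iff)
    finally show ?thesis
      using A kn by (simp only: \<Theta>_def \<tau>_def carrier_matD sv'[OF kn] \<sigma>_def l_def) (simp add: algebra_simps)
  qed
  define U where "U i a = P $$ (a, i)" for i a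
  have U: "orthonormal_rows n n U"
    unfolding orthonormal_rows_def
  proof (intro allI impI)
    fix i j assume ij: "i < n" "j < n"
    have "(transpose_mat P * P) $$ (i, j) = ip n (U i) (U j)"
      using P(1) ij by (simp add: scalar_prod_def ip_def U_def lessThan_atLeast0)
    then show "ip n (U i) (U j) = (if i = j then 1 else 0)" using ij by (simp add: P(2))
  qed
  let ?I = "{..<n} \<times> {..<l}"
  have "\<exists>\<G>\<in>sets (gauss ?I). emeasure (gauss ?I) (space (gauss ?I) - \<G>) \<le> ennreal (3 / real p ^ p) \<and>
    (\<forall>G\<in>\<G>. \<exists>F. (\<forall>i<k. \<forall>j<k. (\<Sum>c<l. G (i, c) * F c j) = (if i = j then 1 else 0)) \<and>
      (\<forall>v. sqrt (\<Sum>i\<in>{k..<n}. (sqrt (e i) * (\<Sum>c<l. G (i, c) * (\<Sum>j<k. F c j * v j)))\<^sup>2) \<le> \<tau> * vnorm k v))"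
    unfolding \<tau>_def by (rule gaussian_sketch[OF k0 kn p2 l_def s])
  then obtain \<G> where \<G>: "\<G> \<in> sets (gauss ?I)"
    "emeasure (gauss ?I) (space (gauss ?I) - \<G>) \<le> ennreal (3 / real p ^ p)"
    and sketch: "\<forall>G\<in>\<G>. \<exists>F. (\<forall>i<k. \<forall>j<k. (\<Sum>c<l. G (i, c) * F c j) = (if i = j then 1 else 0)) \<and>
      (\<forall>v. sqrt (\<Sum>i\<in>{k..<n}. (sqrt (e i) * (\<Sum>c<l. G (i, c) * (\<Sum>j<k. F c j * v j)))\<^sup>2) \<le> \<tau> * vnorm k v)"
    by (elim bexE conjE) (rule that)
  have nl: "0 < n" "0 < l" using kn k0 by (simp_all add: l_def)
  obtain E where E: "E \<in> sets M" "emeasure M (space M - E) = emeasure (gauss ?I) (space (gauss ?I) - \<G>)"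
    and EG: "\<forall>\<omega>\<in>E. (\<lambda>(i, c)\<in>?I. \<Sum>a<n. U i a * \<Omega> \<omega> $$ (a, c)) \<in> \<G>"
    using gaussian_matrix_rotated_event[OF M gm[folded l_def] nl U \<G>(1)]
    by (elim bexE conjE) (rule that)
  show ?thesis
  proof (intro bexI[OF _ E(1)] conjI ballI)
    have "ennreal (prob (space M - E)) \<le> ennreal (3 / real p ^ p)"
      using E(2) \<G>(2) by (simp add: emeasure_eq_measure)
    then have "prob (space M - E) \<le> 3 / real p ^ p" by simp
    moreover have "real p powr (- real p) = 1 / real p ^ p"
      using p2 by (simp add: powr_minus powr_realpow inverse_eq_divide)
    ultimately show "1 - 3 * real p powr (- real p) \<le> measure M E" using prob_compl[OF E(1)] by simp
  next
    fix \<omega> assume \<omega>: "\<omega> \<in> E"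
    then have sp: "\<omega> \<in> space M" using sets.sets_into_space[OF E(1)] by blast
    have Om: "\<Omega> \<omega> \<in> carrier_mat n l" using gm sp by (simp add: gaussian_matrix_def l_def)
    define G where "G = (\<lambda>(i, c)\<in>?I. \<Sum>a<n. U i a * \<Omega> \<omega> $$ (a, c))"
    have Gi: "G (i, c) = (\<Sum>a<n. P $$ (a, i) * \<Omega> \<omega> $$ (a, c))" if "i < n" "c < l" for i c
      using that by (simp add: G_def U_def)
    have "G \<in> \<G>" unfolding G_def by (rule EG[rule_format, OF \<omega>])
    from sketch[rule_format, OF this]
    obtain F where F: "\<forall>i<k. \<forall>j<k. (\<Sum>c<l. G (i, c) * F c j) = (if i = j then 1 else 0)"
      and tail: "\<forall>v. sqrt (\<Sum>i\<in>{k..<n}. (sqrt (e i) * (\<Sum>c<l. G (i, c) * (\<Sum>j<k. F c j * v j)))\<^sup>2) \<le> \<tau> * vnorm k v"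
      by (elim exE conjE) (rule that)
    obtain Q T W V Y \<gamma>' \<beta>' q s\<^sub>A s\<^sub>B where Q: "Q \<in> carrier_mat m l" "orthonormal_cols Q"
      and T: "T \<in> carrier_mat l l" and QT: "A * \<Omega> \<omega> = Q * T"
      and g': "is_gsvd (transpose_mat Q * A) B W V Y \<gamma>' \<beta>'"
      and q: "is_deim (first_cols k Y) q" and sA: "is_deim (first_cols k (Q * W)) s\<^sub>A"
      and Ahat: "Ahat \<omega> = cur_approx A q s\<^sub>A"
      using run[OF sp] unfolding rand_gcur_def carrier_matD(1)[OF A] l_def[symmetric]
      by (elim exE conjE) (rule that)
    have kl: "k \<le> l" by (simp add: l_def)
    have b: "0 < \<beta> (k + 1)" by (rule gsvd_beta_pos[OF A B nd g rank]) (use kn in simp)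
    have \<Theta>0: "0 \<le> \<Theta> A k p" using \<sigma>0 \<tau>0 by (simp add: \<Theta>)
    have proj: "vec_norm2 (A *\<^sub>v x - Q *\<^sub>v (transpose_mat Q *\<^sub>v (A *\<^sub>v x))) \<le> \<Theta> A k p * vec_norm2 x"
      if "x \<in> carrier_vec n" for x
      unfolding \<Theta>
      by (rule range_finder_bound[where F = F, OF A Q T Om QT P(1,3) gram _ less_imp_le[OF kn] \<sigma>0 _ \<tau>0 Gi _ _ that])
         (use e0 s F tail in blast)+
    have "mat_norm2 (Ahat \<omega> - A)
        \<le> \<eta> m n k * (\<Theta> A k p + (mat_norm2 A + mat_norm2 B) * (\<gamma> (k + 1) / \<beta> (k + 1)))"
      unfolding Ahat by (rule gcur_error_bound[OF A B nm nd rank k0 kn kl Q g g' q sA \<Theta>0 proj])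
    also have "\<dots> \<le> \<eta> m n k * (\<Theta> A k p + (mat_norm2 A + mat_norm2 B) *
        (\<gamma> (k + 1) / \<beta> (k + 1) + \<Theta> A k p / \<beta> (k + 1) * mat_norm2 (pinv (A @\<^sub>r B))))"
    proof (intro mult_left_mono add_left_mono)
      have "0 \<le> \<Theta> A k p / \<beta> (k + 1) * mat_norm2 (pinv (A @\<^sub>r B))"
        using \<Theta>0 b by (intro mult_nonneg_nonneg divide_nonneg_pos mat_norm2_nonneg)
      then show "\<gamma> (k + 1) / \<beta> (k + 1)
          \<le> \<gamma> (k + 1) / \<beta> (k + 1) + \<Theta> A k p / \<beta> (k + 1) * mat_norm2 (pinv (A @\<^sub>r B))" by simp
    qed (simp_all add: \<eta>_def mat_norm2_nonneg)
    finally show "mat_norm2 (Ahat \<omega> - A) \<le> \<eta> m n k * (\<Theta> A k p + (mat_norm2 A + mat_norm2 B) *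
        (\<gamma> (k + 1) / \<beta> (k + 1) + \<Theta> A k p / \<beta> (k + 1) * mat_norm2 (pinv (A @\<^sub>r B))))" .
  qed
qed

end
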